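(* Let $n\in\mathbb{N}$, let $Y$ be an infinite dimensional closed subspace of $\mathfrak{X}_{0,1}^n$ and $S:Y\to Y$ a non-zero strictly singular operator. Then $S$ has a non-trivial closed hyperinvariant subspace, i.e. there is a closed subspace $\{0\}\neq Z\subsetneq Y$ which is invariant under every bounded linear operator on $Y$ commuting with $S$.
   Context: $c_{00}$ is the space of finitely supported real sequences with unit vector basis $\{e_i\}_{i\in\mathbb{N}}$; $E<F$ for finite sets means $\max E<\min F$, and $f<g$ for vectors means $\operatorname{supp}f<\operatorname{supp}g$. Schreier families: $\mathcal{S}_0=\{\{m\}:m\in\mathbb{N}\}$, $\mathcal{S}_1=\{F\subset\mathbb{N}:\#F\leqslant\min F\}$, and $\mathcal{S}_{m+1}=\{F_1\cup\cdots\cup F_k: F_1<\cdots<F_k\in\mathcal{S}_m,\ k\leqslant\min F_1\}$. The space $\mathfrak{X}_{0,1}^n$ ($n\geqslant1$): For $G\subset c_{00}$, an $\alpha$-average in $G$ is a vector $\alpha\in G$ of the form $\alpha=\frac1\ell\sum_{q=1}^d f_q$ with $f_1<\cdots<f_d\in G$, $d\leqslant\ell$, $\ell\geqslant2$; its size is $s(\alpha)=\ell$ (an $\alpha$-average is considered together with such a representation). A sequence $\{\alpha_q\}_{q=1}^d$ of $\alpha$-averages is $\mathcal{S}_k$-admissible if $\alpha_1<\cdots<\alpha_d$ and $\{\min\operatorname{supp}\alpha_q:q=1,\ldots,d\}\in\mathcal{S}_k$; a (finite or infinite) sequence of $\alpha$-averages is very fast growing if $\alpha_1<\alpha_2<\cdots$,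 $s(\alpha_1)<s(\alpha_2)<\cdots$ and $s(\alpha_q)>\max\operatorname{supp}\alpha_{q-1}$ for $q>1$. Set $W_0=\{\pm e_i\}_{i\in\mathbb{N}}$ and $W_{m+1}=W_m\cup W^\alpha_{m+1}\cup W^S_{m+1}$, where $W^\alpha_{m+1}=\{\frac1\ell\sum_{q=1}^d f_q: f_1<\cdots<f_d\in W_m,\ \ell\geqslant2,\ \ell\geqslant d\}$ and $W^S_{m+1}=\{\sum_{q=1}^d\alpha_q:\{\alpha_q\}_{q=1}^d\subset W_m$ an $\mathcal{S}_n$-admissible and very fast growing sequence of $\alpha$-averages$\}$. Let $W=\bigcup_m W_m$, acting on $c_{00}$ by the usual duality, $\|x\|=\sup\{f(x):f\in W\}$, and $\mathfrak{X}_{0,1}^n$ the completion of $(c_{00},\|\cdot\|)$ (a real Banach space). A bounded operator is strictly singular if its restriction to any infinite dimensional subspace is not an isomorphism. *)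

theory Defs
  imports "HOL-Analysis.Analysis" "HOL-Analysis.Finite_Function_Topology"
begin

section \<open>Schreier families and finitely supported vectors\<close>

text \<open>
  Natural numbers start at 1 in the source, so index 0 is never used: \<open>c00\<close> consists of
  those finitely supported functions on \<^typ>\<open>nat\<close> that vanish at 0. The support of a vector is
  \<^const>\<open>Poly_Mapping.keys\<close> and the unit vectors are \<open>Poly_Mapping.single i 1\<close>.
  The norm which the library puts on \<^typ>\<open>nat \<Rightarrow>\<^sub>0 real\<close> (the \<open>\<ell>\<^sub>1\<close> norm) plays no role.
\<close>

definition c00 :: "(nat \<Rightarrow>\<^sub>0 real) set" where
  "c00 = {x. 0 \<notin> Poly_Mapping.keys x}"

text \<open>For nonempty finite sets this is \<open>Max E < Min F\<close>; it is only used for such sets.\<close>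

definition set_before :: "nat set \<Rightarrow> nat set \<Rightarrow> bool" where
  "set_before E F \<longleftrightarrow> (\<forall>i\<in>E. \<forall>j\<in>F. i < j)"

definition before :: "(nat \<Rightarrow>\<^sub>0 real) \<Rightarrow> (nat \<Rightarrow>\<^sub>0 real) \<Rightarrow> bool" where
  "before f g \<longleftrightarrow> set_before (Poly_Mapping.keys f) (Poly_Mapping.keys g)"

text \<open>Only nonempty sets are put into the families, so that minima make sense throughout.\<close>

fun schreier :: "nat \<Rightarrow> nat set set" where
  "schreier 0 = {{m} |m. 1 \<le> m}"
| "schreier (Suc 0) = {F. finite F \<and> F \<noteq> {} \<and> card F \<le> Min F}"
| "schreier (Suc (Suc m)) =
    {\<Union>(set Fs) |Fs. Fs \<noteq> [] \<and> set Fs \<subseteq> schreier (Suc m) \<and> sorted_wrt set_before Fs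
       \<and> length Fs \<le> Min (hd Fs)}"

section \<open>The norming set and the norm\<close>

text \<open>
  Pairs \<open>(\<alpha>, \<ell>)\<close> where \<open>\<alpha> = (f\<^sub>1 + \<dots> + f\<^sub>d) / \<ell>\<close> with \<open>f\<^sub>1 < \<dots> < f\<^sub>d\<close> in \<open>G\<close>. An average is
  carried together with its size \<open>\<ell>\<close>, which is not determined by the vector \<open>\<alpha>\<close>.
\<close>

definition averages :: "(nat \<Rightarrow>\<^sub>0 real) set \<Rightarrow> ((nat \<Rightarrow>\<^sub>0 real) \<times> nat) set" where
  "averages G = {((1 / real l) *\<^sub>R sum_list fs, l) |fs l.
     fs \<noteq> [] \<and> set fs \<subseteq> G \<and> sorted_wrt before fs \<and> length fs \<le> l \<and> 2 \<le> l}"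

definition alpha_averages :: "(nat \<Rightarrow>\<^sub>0 real) set \<Rightarrow> ((nat \<Rightarrow>\<^sub>0 real) \<times> nat) set" where
  "alpha_averages G = {(\<alpha>, l) \<in> averages G. \<alpha> \<in> G}"

definition admissible :: "nat \<Rightarrow> ((nat \<Rightarrow>\<^sub>0 real) \<times> nat) list \<Rightarrow> bool" where
  "admissible k as \<longleftrightarrow> sorted_wrt before (map fst as) \<and>
     (\<lambda>(\<alpha>, l). Min (Poly_Mapping.keys \<alpha>)) ` set as \<in> schreier k"

definition very_fast_growing :: "((nat \<Rightarrow>\<^sub>0 real) \<times> nat) list \<Rightarrow> bool" where
  "very_fast_growing as \<longleftrightarrow> sorted_wrt before (map fst as) \<and> sorted_wrt (<) (map snd as) \<and>
     (\<forall>q. 0 < q \<and> q < length as \<longrightarrow>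
        Max (Poly_Mapping.keys (fst (as ! (q - 1)))) < snd (as ! q))"

primrec norming_level :: "nat \<Rightarrow> nat \<Rightarrow> (nat \<Rightarrow>\<^sub>0 real) set" where
  "norming_level n 0 =
     {Poly_Mapping.single i 1 |i. 1 \<le> i} \<union> {- Poly_Mapping.single i 1 |i. 1 \<le> i}"
| "norming_level n (Suc m) = norming_level n m
     \<union> fst ` averages (norming_level n m)
     \<union> {sum_list (map fst as) |as. set as \<subseteq> alpha_averages (norming_level n m)
          \<and> admissible n as \<and> very_fast_growing as}"

definition norming_set :: "nat \<Rightarrow> (nat \<Rightarrow>\<^sub>0 real) set" where
  "norming_set n = (\<Union>m. norming_level n m)"

definition dual_pairing :: "(nat \<Rightarrow>\<^sub>0 real) \<Rightarrow> (nat \<Rightarrow>\<^sub>0 real) \<Rightarrow> real" where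
  "dual_pairing f x =
     (\<Sum>i\<in>Poly_Mapping.keys x. Poly_Mapping.lookup f i * Poly_Mapping.lookup x i)"

definition norm01 :: "nat \<Rightarrow> (nat \<Rightarrow>\<^sub>0 real) \<Rightarrow> real" where
  "norm01 n x = (SUP f\<in>norming_set n. dual_pairing f x)"

text \<open>
  \<open>X\<close> is (a realisation of) the completion of \<open>c00\<close> under \<open>norm01 n\<close>: it is the closure, inside
  some Banach space, of the image of \<open>c00\<close> under a linear isometry \<open>J\<close>. The completion is unique
  up to a linear isometry that respects \<open>J\<close>. As \<open>c00\<close> is a direct summand of
  \<^typ>\<open>nat \<Rightarrow>\<^sub>0 real\<close>, it is no restriction that \<open>J\<close> is linear on the whole type.
\<close>

definition is_X01 :: "nat \<Rightarrow> ((nat \<Rightarrow>\<^sub>0 real) \<Rightarrow> 'a::banach) \<Rightarrow> 'a set \<Rightarrow> bool" where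
  "is_X01 n J X \<longleftrightarrow> linear J \<and> (\<forall>x\<in>c00. norm (J x) = norm01 n x) \<and> X = closure (J ` c00)"

section \<open>Operators on subspaces\<close>

definition infinite_dim :: "'a::real_vector set \<Rightarrow> bool" where
  "infinite_dim V \<longleftrightarrow> \<not> (\<exists>B. finite B \<and> V \<subseteq> span B)"

text \<open>Values of \<open>T\<close> outside the subspace \<open>Y\<close> are irrelevant here and below.\<close>

definition bounded_operator_on :: "'a::real_normed_vector set \<Rightarrow> ('a \<Rightarrow> 'a) \<Rightarrow> bool" where
  "bounded_operator_on Y T \<longleftrightarrow> T ` Y \<subseteq> Y
     \<and> (\<forall>x\<in>Y. \<forall>y\<in>Y. T (x + y) = T x + T y)
     \<and> (\<forall>c. \<forall>x\<in>Y. T (c *\<^sub>R x) = c *\<^sub>R T x)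
     \<and> (\<exists>K. \<forall>x\<in>Y. norm (T x) \<le> K * norm x)"

text \<open>
  The restriction of an operator to \<open>V\<close> is an isomorphism (onto its range) if it is a
  homeomorphism from \<open>V\<close> onto its image.
\<close>

definition strictly_singular_on :: "'a::real_normed_vector set \<Rightarrow> ('a \<Rightarrow> 'a) \<Rightarrow> bool" where
  "strictly_singular_on Y S \<longleftrightarrow> bounded_operator_on Y S
     \<and> (\<forall>V. subspace V \<and> V \<subseteq> Y \<and> infinite_dim V \<longrightarrow> \<not> (\<exists>g. homeomorphism V (S ` V) S g))"

definition hyperinvariant_on :: "'a::real_normed_vector set \<Rightarrow> ('a \<Rightarrow> 'a) \<Rightarrow> 'a set \<Rightarrow> bool" where
  "hyperinvariant_on Y S Z \<longleftrightarrow>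
     (\<forall>T. bounded_operator_on Y T \<and> (\<forall>x\<in>Y. T (S x) = S (T x)) \<longrightarrow> T ` Z \<subseteq> Z)"

section \<open>The completion exists\<close>

lemma lookup_scaleR: "Poly_Mapping.lookup (c *\<^sub>R x) i = c * Poly_Mapping.lookup x i"
  for x :: "'b \<Rightarrow>\<^sub>0 real"
proof -
  have "finite {i. c * Poly_Mapping.lookup x i \<noteq> 0}"
    by (rule finite_subset[OF _ finite_lookup[of x]]) auto
  then show ?thesis
    by (simp add: scaleR_poly_mapping_def)
qed

lemma lookup_sum_list_before_le_1:
  assumes "sorted_wrt before fs" "\<And>f. f \<in> set fs \<Longrightarrow> \<bar>Poly_Mapping.lookup f i\<bar> \<le> 1"
  shows "\<bar>Poly_Mapping.lookup (sum_list fs) i\<bar> \<le> 1"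
  using assms
proof (induction fs)
  case (Cons f fs)
  show ?case
  proof (cases "i \<in> Poly_Mapping.keys f")
    case True
    have "Poly_Mapping.lookup g i = 0" if "g \<in> set fs" for g
      using Cons.prems(1) True that by (force simp: before_def set_before_def simp flip: not_in_keys_iff_lookup_eq_zero)
    then have "Poly_Mapping.lookup (sum_list fs) i = 0"
      by (induction fs) (auto simp: lookup_add)
    then show ?thesis
      using Cons.prems(2) by (simp add: lookup_add)
  next
    case False
    then show ?thesis
      using Cons by (simp add: lookup_add in_keys_iff)
  qed
qed simp

lemma averages_le_1:
  assumes "(\<alpha>, l) \<in> averages G" "\<And>f. f \<in> G \<Longrightarrow> \<bar>Poly_Mapping.lookup f i\<bar> \<le> 1"
  shows "\<bar>Poly_Mapping.lookup \<alpha> i\<bar> \<le> 1"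
proof -
  obtain fs where fs: "\<alpha> = (1 / real l) *\<^sub>R sum_list fs" "set fs \<subseteq> G" "sorted_wrt before fs" "2 \<le> l"
    using assms(1) by (auto simp: averages_def)
  have "\<bar>Poly_Mapping.lookup (sum_list fs) i\<bar> \<le> 1"
    using fs assms(2) by (intro lookup_sum_list_before_le_1) auto
  then show ?thesis
    using fs by (simp add: lookup_scaleR abs_mult divide_simps)
qed

lemma norming_level_le_1:
  "f \<in> norming_level n m \<Longrightarrow> \<bar>Poly_Mapping.lookup f i\<bar> \<le> 1"
proof (induction m arbitrary: f)
  case 0
  then show ?case by (auto simp: lookup_single when_def)
next
  case (Suc m)
  from Suc.prems consider "f \<in> norming_level n m" | l where "(f, l) \<in> averages (norming_level n m)"
    | as where "f = sum_list (map fst as)" "set as \<subseteq> alpha_averages (norming_level n m)"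
        "admissible n as"
    by force
  then show ?case
  proof cases
    case 3
    then show ?thesis
      using Suc.IH
      by (auto simp: admissible_def alpha_averages_def subset_iff split_beta
          intro!: lookup_sum_list_before_le_1)
  qed (use Suc.IH averages_le_1 in blast)+
qed

lemma norming_set_le_1: "f \<in> norming_set n \<Longrightarrow> \<bar>Poly_Mapping.lookup f i\<bar> \<le> 1"
  by (auto simp: norming_set_def norming_level_le_1)

lemma dual_pairing_bound:
  "f \<in> norming_set n \<Longrightarrow> \<bar>dual_pairing f x\<bar> \<le> (\<Sum>i\<in>Poly_Mapping.keys x. \<bar>Poly_Mapping.lookup x i\<bar>)"
  unfolding dual_pairing_def
  by (rule order_trans[OF sum_abs])
     (auto intro!: sum_mono simp: abs_mult norming_set_le_1 mult_left_le_one_le)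

lemma sum_list_uminus: "sum_list (map uminus fs) = - sum_list fs"
  for fs :: "'b::ab_group_add list"
  by (induction fs) auto

lemma averages_uminus:
  assumes "(\<alpha>, l) \<in> averages G" "\<And>f. f \<in> G \<Longrightarrow> - f \<in> G"
  shows "(- \<alpha>, l) \<in> averages G"
proof -
  obtain fs where fs: "\<alpha> = (1 / real l) *\<^sub>R sum_list fs" "fs \<noteq> []" "set fs \<subseteq> G"
      "sorted_wrt before fs" "length fs \<le> l" "2 \<le> l"
    using assms(1) by (auto simp: averages_def)
  have "sorted_wrt before (map uminus fs)"
    using fs(4) by (simp add: sorted_wrt_map before_def[abs_def])
  moreover have "set (map uminus fs) \<subseteq> G"
    using fs(3) assms(2) by auto
  ultimately show ?thesis
    unfolding averages_def using fs
    by (auto simp: sum_list_uminus intro!: exI[of _ "map uminus fs"])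
qed

lemma norming_level_uminus: "f \<in> norming_level n m \<Longrightarrow> - f \<in> norming_level n m"
proof (induction m arbitrary: f)
  case (Suc m)
  from Suc.prems consider "f \<in> norming_level n m" | l where "(f, l) \<in> averages (norming_level n m)"
    | as where "f = sum_list (map fst as)" "set as \<subseteq> alpha_averages (norming_level n m)"
        "admissible n as" "very_fast_growing as"
    by force
  then show ?case
  proof cases
    case 2
    then have "(- f, l) \<in> averages (norming_level n m)"
      by (rule averages_uminus) (rule Suc.IH)
    then show ?thesis by force
  next
    case 3
    define bs where "bs = map (\<lambda>(\<alpha>, l). (- \<alpha>, l)) as"
    have "map fst bs = map uminus (map fst as)"
      by (auto simp: bs_def)
    then have "- f = sum_list (map fst bs)"
      using 3(1) by (simp only: sum_list_uminus)
    moreover have "set bs \<subseteq> alpha_averages (norming_level n m)"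
      using 3(2) Suc.IH by (auto simp: bs_def alpha_averages_def intro!: averages_uminus)
    moreover have "admissible n bs"
      using 3(3)
      by (auto simp: bs_def admissible_def sorted_wrt_map before_def[abs_def] case_prod_unfold image_image)
    moreover have "very_fast_growing bs"
      using 3(4)
      by (auto simp: bs_def very_fast_growing_def sorted_wrt_map before_def[abs_def] case_prod_unfold)
    ultimately show ?thesis by auto
  qed (use Suc.IH in simp)
qed auto

lemma norming_set_uminus: "f \<in> norming_set n \<Longrightarrow> - f \<in> norming_set n"
  unfolding norming_set_def using norming_level_uminus by blast

lemma norming_set_nonempty: "norming_set n \<noteq> {}"
proof -
  have "Poly_Mapping.single 1 1 \<in> norming_level n 0" by auto
  then show ?thesis unfolding norming_set_def by blast
qed

lemma norm_poly_mapping_eq: "norm g = (\<Sum>i\<in>Poly_Mapping.keys g. \<bar>Poly_Mapping.lookup g i\<bar>)"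
  for g :: "'b \<Rightarrow>\<^sub>0 real"
  by (simp add: norm_poly_mapping_def dist_poly_mapping_def)

lemma dual_pairing_superset:
  "finite A \<Longrightarrow> Poly_Mapping.keys x \<subseteq> A \<Longrightarrow>
     dual_pairing f x = (\<Sum>i\<in>A. Poly_Mapping.lookup f i * Poly_Mapping.lookup x i)"
  unfolding dual_pairing_def by (intro sum.mono_neutral_left) (auto simp: in_keys_iff)

lemma keys_scaleR_subset: "Poly_Mapping.keys (c *\<^sub>R x) \<subseteq> Poly_Mapping.keys x"
  for x :: "'b \<Rightarrow>\<^sub>0 real"
  by (auto simp: in_keys_iff lookup_scaleR)

lemma dual_pairing_add: "dual_pairing f (x + y) = dual_pairing f x + dual_pairing f y"
  using Poly_Mapping.keys_add[of x y]
  by (simp add: dual_pairing_superset[of "Poly_Mapping.keys x \<union> Poly_Mapping.keys y"]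
      lookup_add distrib_left sum.distrib)

lemma dual_pairing_scaleR: "dual_pairing f (c *\<^sub>R x) = c * dual_pairing f x"
  using keys_scaleR_subset[of c x]
  by (simp add: dual_pairing_superset[of "Poly_Mapping.keys x"]
      lookup_scaleR sum_distrib_left ac_simps)

lemma abs_dual_pairing_le_norm01:
  assumes "f \<in> norming_set n"
  shows "\<bar>dual_pairing f x\<bar> \<le> norm01 n x"
proof -
  have "bdd_above ((\<lambda>f. dual_pairing f x) ` norming_set n)"
    using dual_pairing_bound[of _ n x] by (intro bdd_aboveI2) (auto dest: abs_le_D1)
  then have up: "dual_pairing f x \<le> norm01 n x" if "f \<in> norming_set n" for f
    unfolding norm01_def using that by (rule cSUP_upper2) simp
  have "dual_pairing (- f) x = - dual_pairing f x"
    by (simp add: dual_pairing_def sum_negf)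
  then show ?thesis
    using up[OF assms] up[OF norming_set_uminus[OF assms]] by (simp add: abs_le_iff)
qed

text \<open>
  Evaluation at the functionals in the norming set embeds \<open>c00\<close> isometrically into the dual
  of the finitely supported functions on that set, taken with the \<open>\<ell>\<^sub>1\<close> norm.
\<close>

proposition X01_exists:
  "\<exists>(J :: (nat \<Rightarrow>\<^sub>0 real) \<Rightarrow> ((nat \<Rightarrow>\<^sub>0 real) \<Rightarrow>\<^sub>0 real) \<Rightarrow>\<^sub>L real) X. is_X01 n J X"
proof -
  let ?e = "\<lambda>f x. if f \<in> norming_set n then dual_pairing f x else 0"
  have e: "\<bar>?e f x\<bar> \<le> norm01 n x" for f x
  proof -
    obtain f' where f': "f' \<in> norming_set n"
      using norming_set_nonempty by blast
    show ?thesis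
      using abs_dual_pairing_le_norm01[of f n x] abs_dual_pairing_le_norm01[OF f', of x] by auto
  qed
  define L where "L x g = (\<Sum>f\<in>Poly_Mapping.keys g. Poly_Mapping.lookup g f * ?e f x)" for x g
  have L_superset: "L x g = (\<Sum>f\<in>A. Poly_Mapping.lookup g f * ?e f x)"
    if "finite A" "Poly_Mapping.keys g \<subseteq> A" for A x g
    unfolding L_def using that by (intro sum.mono_neutral_left) (auto simp: in_keys_iff)
  have L_bound: "norm (L x g) \<le> norm01 n x * norm g" for x g
  proof -
    have "\<bar>L x g\<bar> \<le> (\<Sum>f\<in>Poly_Mapping.keys g. \<bar>Poly_Mapping.lookup g f\<bar> * norm01 n x)"
      unfolding L_def
      by (rule order_trans[OF sum_abs], rule sum_mono, unfold abs_mult,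
          rule mult_left_mono[OF e abs_ge_zero])
    then show ?thesis
      by (simp add: norm_poly_mapping_eq sum_distrib_left mult.commute)
  qed
  have "bounded_linear (L x)" for x
  proof (rule bounded_linear_intro)
    fix g h :: "(nat \<Rightarrow>\<^sub>0 real) \<Rightarrow>\<^sub>0 real" and c
    show "L x (g + h) = L x g + L x h"
      using Poly_Mapping.keys_add[of g h]
      by (simp add: L_superset[of "Poly_Mapping.keys g \<union> Poly_Mapping.keys h"]
          lookup_add distrib_right sum.distrib)
    show "L x (c *\<^sub>R g) = c *\<^sub>R L x g"
      using keys_scaleR_subset[of c g]
      by (simp add: L_superset[of "Poly_Mapping.keys g"] lookup_scaleR sum_distrib_left ac_simps)
    show "norm (L x g) \<le> norm g * norm01 n x"
      using L_bound[of x g] by (simp add: mult.commute)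
  qed
  then have J: "blinfun_apply (Blinfun (L x)) = L x" for x
    by (rule bounded_linear_Blinfun_apply)
  have "linear (\<lambda>x. Blinfun (L x))"
  proof (intro linearI blinfun_eqI)
    fix x y g and c :: real
    show "blinfun_apply (Blinfun (L (x + y))) g = blinfun_apply (Blinfun (L x) + Blinfun (L y)) g"
      unfolding plus_blinfun.rep_eq J L_def
      by (auto simp: dual_pairing_add distrib_left simp flip: sum.distrib intro!: sum.cong)
    show "blinfun_apply (Blinfun (L (c *\<^sub>R x))) g = blinfun_apply (c *\<^sub>R Blinfun (L x)) g"
      unfolding scaleR_blinfun.rep_eq J L_def
      by (auto simp: dual_pairing_scaleR sum_distrib_left intro!: sum.cong)
  qed
  moreover have "norm (Blinfun (L x)) = norm01 n x" for x
  proof (rule antisym)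
    have "0 \<le> norm01 n x"
      using e[of 0 x] by linarith
    then show "norm (Blinfun (L x)) \<le> norm01 n x"
      by (rule norm_blinfun_bound) (use L_bound J in simp)
    show "norm01 n x \<le> norm (Blinfun (L x))"
      unfolding norm01_def
    proof (rule cSUP_least[OF norming_set_nonempty])
      fix f assume "f \<in> norming_set n"
      then have "L x (Poly_Mapping.single f 1) = dual_pairing f x"
        by (simp add: L_def)
      moreover have "norm (Poly_Mapping.single f (1::real)) = 1"
        by (simp add: norm_poly_mapping_eq)
      ultimately show "dual_pairing f x \<le> norm (Blinfun (L x))"
        using norm_blinfun[of "Blinfun (L x)" "Poly_Mapping.single f 1"] by (simp add: J)
    qed
  qed
  ultimately show ?thesis
    unfolding is_X01_def by blast
qed

end

theory Submission
  imports Defs "HOL-Library.Diagonal_Subsequence"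
begin

text \<open>
  The main point is that \<open>S\<^sup>n\<^sup>+\<^sup>1\<close> is compact. Otherwise a sliding hump yields bounded vectors \<open>z\<^sub>k\<close> in \<open>Y\<close>
  such that all \<open>S\<^sup>j z\<^sub>k\<close> with \<open>j \<le> n + 1\<close> are small perturbations of successive blocks, while \<open>S\<^sup>n\<^sup>+\<^sup>1 z\<^sub>k\<close> does
  not tend to zero. Call a block sequence null of order \<open>k\<close> if sums of very fast growing \<open>S\<^sub>k\<close>-admissible
  averages of large sizes are eventually small on it. Going from \<open>z\<close> to \<open>S\<^sup>n\<^sup>+\<^sup>1 z\<close>, either \<open>S z\<close> is not
  null of order 0, or some \<open>x = S\<^sup>j z\<close> is null of an order \<open>k < n\<close> while \<open>S x\<close> is not null of order \<open>k + 1\<close>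
  (or, for \<open>k = n - 1\<close>, merely does not tend to zero). Averaging over long windows raises \<open>k\<close> by one, and for
  \<open>k = n - 1\<close> sums over long windows are still bounded while their images are not null of order 0.
  Hence there always is a bounded \<open>x\<close> such that \<open>S x\<close> is not null of order 0. Then \<open>S\<close> is an
  isomorphism on the span of suitable special convex combinations \<open>w\<^sub>i\<close> of the \<open>x\<^sub>k\<close>: by induction on the
  complexity of a functional \<open>f\<close> in the norming set, \<open>f (\<Sum> d\<^sub>i w\<^sub>i)\<close> is dominated by
  \<open>g (\<Sum> d\<^sub>i S w\<^sub>i)\<close> for some \<open>g\<close> in the norming set, up to a summable error. This contradicts strict singularity.

  If \<open>S\<^sup>n\<^sup>+\<^sup>1 = 0\<close>, the kernel of \<open>S\<close> is hyperinvariant. Otherwise let \<open>K = S\<^sup>n\<^sup>+\<^sup>1\<close>. Without hyperinvariant subspaces,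
  Lomonosov's argument gives \<open>T\<close> in the commutant of \<open>S\<close> and \<open>x \<noteq> 0\<close> with \<open>T K x = x\<close>. Since the scalars are real, \<open>K\<close> need
  not have an eigenvector in the finite dimensional space \<open>ker (T K - 1)\<close>; but \<open>r (K) x = 0\<close> for some real polynomial
  \<open>r\<close> with \<open>r (0) \<noteq> 0\<close>. The kernel of \<open>r (K)\<close> is hyperinvariant, hence equal to \<open>Y\<close>, so \<open>K\<close> is invertible and
  \<open>Y\<close> is finite dimensional.
\<close>

section \<open>Schreier families\<close>

text \<open>The obstacle in the domination step is that \<open>f\<close> is built by alternating
  averages and sums to unbounded depth, so an error made at every level would add up. Hence each
  combination \<open>w i\<close> carries a fixed budget \<open>e i\<close>, and a functional whose
  range meets only one of these combinations may spend only a quarter of it. Among the parts of an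
  average, at most one reaches the last combination in the range from the left, and the others that
  meet it are confined to it. As the size is at least 2, only 5/8 of the budget is used there. The
  sum formed next pays for its own losses out of the remaining 3/8, so the induction closes with
  unchanged constants. The substitute for \<open>f\<close> must also be very fast growing and
  admissible. It is therefore kept inside the range of \<open>f\<close>, averages keep their sizes,
  and newly inserted averages have sizes at most the right end of their block. Blocks are spaced so
  that the end of one is at most half the start of the next; this leaves room for two numbers of
  colours, so that two admissible families can be joined at the cost of one discarded block.\<close>

abbreviation supp :: "('b \<Rightarrow>\<^sub>0 real) \<Rightarrow> 'b set" where
  "supp \<equiv> Poly_Mapping.keys"

definition restr :: "nat set \<Rightarrow> (nat \<Rightarrow>\<^sub>0 real) \<Rightarrow> (nat \<Rightarrow>\<^sub>0 real)" where
  "restr A f = (\<Sum>i\<in>supp f \<inter> A. Poly_Mapping.single i (Poly_Mapping.lookup f i))"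

lemma lookup_restr: "Poly_Mapping.lookup (restr A f) i = (if i \<in> A then Poly_Mapping.lookup f i else 0)"
  by (auto simp: restr_def lookup_sum lookup_single when_def sum.delta' in_keys_iff)

lemma supp_restr: "supp (restr A f) = supp f \<inter> A"
  by (auto simp: in_keys_iff lookup_restr split: if_splits)

lemma restr_add: "restr A (f + g) = restr A f + restr A g"
  by (auto intro!: poly_mapping_eqI simp: lookup_restr lookup_add)

lemma restr_scaleR: "restr A (c *\<^sub>R f) = c *\<^sub>R restr A f"
  by (auto intro!: poly_mapping_eqI simp: lookup_restr lookup_scaleR)

lemma restr_zero [simp]: "restr A 0 = 0"
  by (auto intro!: poly_mapping_eqI simp: lookup_restr)

lemma restr_sum: "restr A (\<Sum>i\<in>I. f i) = (\<Sum>i\<in>I. restr A (f i))"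
  by (induction I rule: infinite_finite_induct) (auto simp: restr_add)

lemma restr_single: "restr A (Poly_Mapping.single i c) = (if i \<in> A then Poly_Mapping.single i c else 0)"
  by (auto intro!: poly_mapping_eqI simp: lookup_restr lookup_single when_def)

lemma restr_uminus: "restr A (- f) = - restr A f"
  by (auto intro!: poly_mapping_eqI simp: lookup_restr)

lemma restr_id: "supp f \<subseteq> A \<Longrightarrow> restr A f = f"
  by (auto intro!: poly_mapping_eqI simp: lookup_restr in_keys_iff)

lemma supp_scaleR: "c \<noteq> 0 \<Longrightarrow> supp (c *\<^sub>R x) = supp x" for x :: "'b \<Rightarrow>\<^sub>0 real"
  by (auto simp: in_keys_iff lookup_scaleR)

lemma before_iff: "before f g \<longleftrightarrow> (\<forall>i\<in>supp f. \<forall>j\<in>supp g. i < j)"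
  by (simp add: before_def set_before_def)

lemma before_zero [simp]: "before 0 g" "before f 0"
  by (auto simp: before_iff)

lemma schreier_nonempty_finite: "F \<in> schreier k \<Longrightarrow> finite F \<and> F \<noteq> {}"
proof (induction k arbitrary: F rule: schreier.induct)
  case (3 m)
  then obtain Fs where Fs: "F = \<Union>(set Fs)" "Fs \<noteq> []" "set Fs \<subseteq> schreier (Suc m)" by auto
  then show ?case
    using 3(1) by (metis List.finite_set Union_empty_conv finite_Union hd_in_set subset_iff)
qed auto

text \<open>The families of the statement omit the empty set. Adding it makes them hereditary, so
  that empty colour classes and families of vanishing averages need no separate treatment.\<close>

definition schreier0 :: "nat \<Rightarrow> nat set set" where
  "schreier0 k = insert {} (schreier k)"

lemma schreier0_finite: "F \<in> schreier0 k \<Longrightarrow> finite F"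
  using schreier_nonempty_finite by (auto simp: schreier0_def)

lemma schreier0_0: "F \<in> schreier0 0 \<longleftrightarrow> F = {} \<or> (\<exists>m\<ge>1. F = {m})"
  by (auto simp: schreier0_def)

definition block_coloring :: "(nat set \<Rightarrow> bool) \<Rightarrow> nat set \<Rightarrow> (nat \<Rightarrow> nat) \<Rightarrow> nat \<Rightarrow> bool" where
  "block_coloring P F c N \<longleftrightarrow> finite F \<and> (\<forall>x\<in>F. \<forall>y\<in>F. x \<le> y \<longrightarrow> c x \<le> c y) \<and>
     (\<forall>x\<in>F. c x < N \<and> N \<le> x) \<and> (\<forall>j. P {x\<in>F. c x = j})"

lemma schreier_1_iff:
  "F \<in> schreier0 (Suc 0) \<longleftrightarrow> (\<exists>c N. block_coloring (\<lambda>G. G \<in> schreier0 0) F c N)"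
proof
  assume F: "F \<in> schreier0 (Suc 0)"
  show "\<exists>c N. block_coloring (\<lambda>G. G \<in> schreier0 0) F c N"
  proof (cases "F = {}")
    case True
    then have "block_coloring (\<lambda>G. G \<in> schreier0 0) F (\<lambda>_. 0) 0"
      by (simp add: block_coloring_def schreier0_def)
    then show ?thesis by blast
  next
    case False
    then have fin: "finite F" and card: "card F \<le> Min F"
      using F by (auto simp: schreier0_def)
    define c where "c x = card {y\<in>F. y < x}" for x
    have c_less: "c x < c y" if "x \<in> F" "y \<in> F" "x < y" for x y
      unfolding c_def using fin that by (intro psubset_card_mono) auto
    have c_card: "c x < card F" if "x \<in> F" for x
      unfolding c_def using fin that by (intro psubset_card_mono) auto
    have "{x\<in>F. c x = j} \<in> schreier0 0" for j
    proof (cases "\<exists>x\<in>F. c x = j")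
      case True
      then obtain x where x: "x \<in> F" "c x = j" by blast
      have "{x\<in>F. c x = j} = {x}"
        using x c_less by (auto simp: set_eq_iff) (metis nat_neq_iff)
      moreover have "1 \<le> x" using card c_card[OF x(1)] Min_le[OF fin x(1)] by linarith
      ultimately show ?thesis by (auto simp: schreier0_0)
    next
      case False
      then have "{x\<in>F. c x = j} = {}" by auto
      then show ?thesis by (simp add: schreier0_0)
    qed
    moreover have "\<forall>x\<in>F. \<forall>y\<in>F. x \<le> y \<longrightarrow> c x \<le> c y"
      using c_less by (metis le_neq_implies_less order.refl order_less_imp_le)
    ultimately have "block_coloring (\<lambda>G. G \<in> schreier0 0) F c (card F)"
      using fin card c_card by (auto simp: block_coloring_def intro: order_trans)
    then show ?thesis by blast
  qed
next
  assume "\<exists>c N. block_coloring (\<lambda>G. G \<in> schreier0 0) F c N"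
  then obtain c N where c: "block_coloring (\<lambda>G. G \<in> schreier0 0) F c N" by blast
  show "F \<in> schreier0 (Suc 0)"
  proof (cases "F = {}")
    case False
    have "inj_on c F"
    proof (rule inj_onI)
      fix x y assume xy: "x \<in> F" "y \<in> F" "c x = c y"
      have "{z\<in>F. c z = c x} \<in> schreier0 0" using c by (auto simp: block_coloring_def)
      then obtain m where "{z\<in>F. c z = c x} = {m}" using xy by (auto simp: schreier0_0)
      then show "x = y" using xy by (metis (mono_tags, lifting) mem_Collect_eq singletonD)
    qed
    then have "card F \<le> card {..<N}"
      using c by (intro card_inj_on_le[of c]) (auto simp: block_coloring_def)
    moreover have "N \<le> Min F" using c False by (auto simp: block_coloring_def)
    ultimately show ?thesis using c False by (auto simp: schreier0_def block_coloring_def)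
  qed (auto simp: schreier0_def)
qed

lemma schreier_Suc_Suc_iff:
  "F \<in> schreier0 (Suc (Suc k)) \<longleftrightarrow> (\<exists>c N. block_coloring (\<lambda>G. G \<in> schreier0 (Suc k)) F c N)"
proof
  assume F: "F \<in> schreier0 (Suc (Suc k))"
  show "\<exists>c N. block_coloring (\<lambda>G. G \<in> schreier0 (Suc k)) F c N"
  proof (cases "F = {}")
    case True
    then have "block_coloring (\<lambda>G. G \<in> schreier0 (Suc k)) F (\<lambda>_. 0) 0"
      by (simp add: block_coloring_def schreier0_def del: schreier.simps)
    then show ?thesis by blast
  next
    case False
    then have "F \<in> schreier (Suc (Suc k))" using F by (simp only: schreier0_def) blast
    then obtain Fs where Fs: "F = \<Union>(set Fs)" "Fs \<noteq> []" "set Fs \<subseteq> schreier (Suc k)"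
        "sorted_wrt set_before Fs" "length Fs \<le> Min (hd Fs)"
      by (simp only: schreier.simps) blast
    define c where "c x = (LEAST j. j < length Fs \<and> x \<in> Fs ! j)" for x
    have nth: "finite (Fs ! j) \<and> Fs ! j \<noteq> {}" if "j < length Fs" for j
      using Fs(3) that nth_mem schreier_nonempty_finite by blast
    have bef: "x < y" if "i < j" "j < length Fs" "x \<in> Fs ! i" "y \<in> Fs ! j" for i j x y
      using Fs(4) that unfolding sorted_wrt_iff_nth_less set_before_def by blast
    have c: "c x < length Fs \<and> x \<in> Fs ! c x" if x: "x \<in> F" for x
    proof -
      obtain A where "A \<in> set Fs" "x \<in> A" using x Fs(1) by blast
      then obtain j where "j < length Fs \<and> x \<in> Fs ! j" by (auto simp: in_set_conv_nth)
      then show ?thesis unfolding c_def by (rule LeastI)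
    qed
    have c_eq: "c x = j" if "x \<in> Fs ! j" "j < length Fs" for x j
    proof -
      have "x \<in> F" using that Fs(1) by auto
      then show ?thesis using c bef that by (metis less_irrefl nat_neq_iff)
    qed
    have mono: "c x \<le> c y" if "x \<in> F" "y \<in> F" "x \<le> y" for x y
      using c[OF that(1)] c[OF that(2)] bef[of "c y" "c x" y x] that(3) by force
    have le: "length Fs \<le> x" if "x \<in> F" for x
    proof -
      have hd: "hd Fs = Fs ! 0" using Fs(2) by (simp add: hd_conv_nth)
      have M: "Min (Fs ! 0) \<in> Fs ! 0" using nth[of 0] Fs(2) by simp
      have "Min (Fs ! 0) \<le> x"
      proof (cases "c x = 0")
        case True
        then show ?thesis using c[OF that] nth[of 0] by auto
      next
        case False
        then show ?thesis using bef[of 0 "c x" _ x] c[OF that] M by fastforce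
      qed
      then show ?thesis using Fs(5) hd by simp
    qed
    have fib: "{x\<in>F. c x = j} \<in> schreier0 (Suc k)" for j
    proof (cases "j < length Fs")
      case True
      then have "{x\<in>F. c x = j} = Fs ! j" using c c_eq Fs(1) by auto
      moreover have "Fs ! j \<in> schreier (Suc k)" using True Fs(3) nth_mem by blast
      ultimately show ?thesis unfolding schreier0_def by simp
    next
      case False
      then have "{x\<in>F. c x = j} = {}" using c by auto
      then show ?thesis unfolding schreier0_def by (simp only: insert_iff) simp
    qed
    have "finite F" using F schreier0_finite by blast
    then have "block_coloring (\<lambda>G. G \<in> schreier0 (Suc k)) F c (length Fs)"
      unfolding block_coloring_def using mono le fib c by blast
    then show ?thesis by blast
  qed
next
  assume "\<exists>c N. block_coloring (\<lambda>G. G \<in> schreier0 (Suc k)) F c N"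
  then obtain c N where c: "block_coloring (\<lambda>G. G \<in> schreier0 (Suc k)) F c N" by blast
  show "F \<in> schreier0 (Suc (Suc k))"
  proof (cases "F = {}")
    case False
    define A where "A j = {x\<in>F. c x = j}" for j
    define Fs where "Fs = map A (filter (\<lambda>j. A j \<noteq> {}) [0..<N])"
    have setFs: "set Fs = {A j |j. j < N \<and> A j \<noteq> {}}" by (auto simp: Fs_def)
    have U: "\<Union>(set Fs) = F"
    proof
      show "F \<subseteq> \<Union>(set Fs)"
      proof
        fix x assume x: "x \<in> F"
        then have "x \<in> A (c x)" by (simp add: A_def)
        moreover have "c x < N" using c x by (simp add: block_coloring_def)
        ultimately show "x \<in> \<Union>(set Fs)" unfolding setFs by blast
      qed
    qed (auto simp: setFs A_def)
    have ne: "Fs \<noteq> []" using U False by auto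
    have sub: "set Fs \<subseteq> schreier (Suc k)"
      using c unfolding setFs A_def schreier0_def block_coloring_def by blast
    have "sorted_wrt set_before Fs"
      unfolding Fs_def sorted_wrt_map
    proof (rule sorted_wrt_filter, rule sorted_wrt_mono_rel[of _ "(<)"])
      fix i j :: nat assume "i < j"
      then show "set_before (A i) (A j)"
        using c unfolding set_before_def A_def block_coloring_def by (auto simp: not_le[symmetric])
    qed auto
    moreover have "length Fs \<le> Min (hd Fs)"
    proof -
      have "hd Fs \<in> set Fs" using ne by simp
      then have "Min (hd Fs) \<in> F"
        using U sub schreier_nonempty_finite by (metis Min_in Union_iff subset_iff)
      then have "N \<le> Min (hd Fs)" using c by (auto simp: block_coloring_def)
      moreover have "length Fs \<le> N"
        unfolding Fs_def using length_filter_le[of _ "[0..<N]"] by simp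
      ultimately show ?thesis by simp
    qed
    ultimately show ?thesis
      using U ne sub unfolding schreier0_def schreier.simps(3) by blast
  qed (simp add: schreier0_def)
qed

text \<open>Order 1 and the higher orders become one recursion, the form in which the Schreier
  structure is used below.\<close>

lemma schreier0_Suc:
  "F \<in> schreier0 (Suc k) \<longleftrightarrow> (\<exists>c N. block_coloring (\<lambda>G. G \<in> schreier0 k) F c N)"
  by (cases k) (simp_all only: schreier_1_iff schreier_Suc_Suc_iff)

lemma schreier0_ge_1: "F \<in> schreier0 k \<Longrightarrow> x \<in> F \<Longrightarrow> 1 \<le> x"
proof (cases k)
  case 0
  then show "F \<in> schreier0 k \<Longrightarrow> x \<in> F \<Longrightarrow> 1 \<le> x" by (auto simp: schreier0_0)
next
  case (Suc k')
  assume "F \<in> schreier0 k" "x \<in> F"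
  then obtain c N where "block_coloring (\<lambda>G. G \<in> schreier0 k') F c N"
    unfolding Suc schreier0_Suc by blast
  then have "c x < N \<and> N \<le> x" using \<open>x \<in> F\<close> unfolding block_coloring_def by blast
  then show "1 \<le> x" by linarith
qed

lemma schreier0_empty [simp]: "{} \<in> schreier0 k"
  by (simp add: schreier0_def)

text \<open>Heredity and spreading in one statement: \<open>h\<close> embeds \<open>G\<close>
  increasingly into \<open>F\<close> and moves points to the left. Composing a colouring of
  \<open>F\<close> with \<open>h\<close> colours \<open>G\<close>, and the lower bound
  \<open>N\<close> holds at \<open>g\<close> because it holds at \<open>h g\<close>.\<close>

lemma schreier0_spread:
  assumes "F \<in> schreier0 k" "finite G" "\<And>g. g \<in> G \<Longrightarrow> h g \<in> F \<and> h g \<le> g"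
    "\<And>g g'. g \<in> G \<Longrightarrow> g' \<in> G \<Longrightarrow> g < g' \<Longrightarrow> h g < h g'"
  shows "G \<in> schreier0 k"
  using assms
proof (induction k arbitrary: F G)
  case 0
  show ?case
  proof (cases "G = {}")
    case False
    then obtain g where g: "g \<in> G" by blast
    obtain m where m: "1 \<le> m" "F = {m}" using 0(1) 0(3)[OF g] by (auto simp: schreier0_0)
    have "G = {g}"
    proof (rule ccontr)
      assume "G \<noteq> {g}"
      then obtain g' where "g' \<in> G" "g' \<noteq> g" using g by blast
      then show False using 0(3)[OF g] 0(3)[of g'] 0(4)[of g g'] 0(4)[of g' g] g m by (auto simp: neq_iff)
    qed
    moreover have "1 \<le> g" using 0(3)[OF g] m by auto
    ultimately show ?thesis by (auto simp: schreier0_0)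
  qed simp
next
  case (Suc k)
  obtain c N where c: "block_coloring (\<lambda>G. G \<in> schreier0 k) F c N"
    using Suc.prems(1) schreier0_Suc by blast
  have "{g\<in>G. c (h g) = j} \<in> schreier0 k" for j
  proof (rule Suc.IH)
    show "{x\<in>F. c x = j} \<in> schreier0 k" using c by (auto simp: block_coloring_def)
  qed (use Suc.prems in auto)
  moreover have "c (h x) \<le> c (h y)" if "x \<in> G" "y \<in> G" "x \<le> y" for x y
    using c Suc.prems(3,4) that unfolding block_coloring_def by (metis le_neq_implies_less less_imp_le order.refl)
  moreover have "c (h x) < N \<and> N \<le> x" if "x \<in> G" for x
    using c Suc.prems(3) that unfolding block_coloring_def by (metis order_trans)
  ultimately have "block_coloring (\<lambda>G. G \<in> schreier0 k) G (\<lambda>x. c (h x)) N"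
    using Suc.prems(2) unfolding block_coloring_def by blast
  then show ?case using schreier0_Suc by blast
qed

lemma schreier0_subset: "F \<in> schreier0 k \<Longrightarrow> G \<subseteq> F \<Longrightarrow> G \<in> schreier0 k"
  by (rule schreier0_spread[of F k G id]) (auto intro: finite_subset schreier0_finite)

text \<open>A single colour does: all elements are at least 1, so one piece is always
  permitted.\<close>

lemma schreier0_Suc_mono: "F \<in> schreier0 k \<Longrightarrow> F \<in> schreier0 (Suc k)"
  unfolding schreier0_Suc
  by (rule exI[of _ "\<lambda>_. 0"], rule exI[of _ 1])
     (auto simp: block_coloring_def schreier0_finite intro: schreier0_subset dest: schreier0_ge_1)

lemma schreier0_mono: "k \<le> m \<Longrightarrow> F \<in> schreier0 k \<Longrightarrow> F \<in> schreier0 m"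
  by (induction m rule: dec_induct) (auto intro: schreier0_Suc_mono)

lemma schreier0_singleton: "1 \<le> m \<Longrightarrow> {m} \<in> schreier0 k"
  by (rule schreier0_mono[of 0]) (auto simp: schreier0_0)

section \<open>The norming set\<close>

text \<open>The zero functional is added so that the set is closed under restriction to any set of
  coordinates.\<close>

definition W0 :: "nat \<Rightarrow> (nat \<Rightarrow>\<^sub>0 real) set" where
  "W0 n = insert 0 (norming_set n)"

text \<open>An average with explicit parts. These are indexed by a set of numbers in increasing
  order and may vanish, so that restricting or replacing them one by one leaves the index set and
  the size unchanged.\<close>

definition avg_rep :: "nat \<Rightarrow> nat \<Rightarrow> (nat \<Rightarrow>\<^sub>0 real) \<Rightarrow> nat set \<Rightarrow> (nat \<Rightarrow> nat \<Rightarrow>\<^sub>0 real) \<Rightarrow> bool" where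
  "avg_rep n l \<alpha> R g \<longleftrightarrow> 2 \<le> l \<and> finite R \<and> card R \<le> l \<and> (\<forall>r\<in>R. g r \<in> W0 n) \<and>
     (\<forall>r\<in>R. \<forall>s\<in>R. r < s \<longrightarrow> before (g r) (g s)) \<and> \<alpha> = (1 / real l) *\<^sub>R (\<Sum>r\<in>R. g r)"

definition avg :: "nat \<Rightarrow> nat \<Rightarrow> (nat \<Rightarrow>\<^sub>0 real) \<Rightarrow> bool" where
  "avg n l \<alpha> \<longleftrightarrow> (\<exists>R g. avg_rep n l \<alpha> R g)"

text \<open>
  The sizes of a very fast growing sequence are strictly increasing, so such a sequence is
  indexed here by the set of its sizes. Vanishing averages are admitted; they are ignored
  by the admissibility condition.
\<close>

definition fam :: "nat \<Rightarrow> nat \<Rightarrow> nat set \<Rightarrow> (nat \<Rightarrow> nat \<Rightarrow>\<^sub>0 real) \<Rightarrow> bool" where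
  "fam n k L \<alpha> \<longleftrightarrow> finite L \<and> (\<forall>l\<in>L. avg n l (\<alpha> l)) \<and>
     (\<forall>l\<in>L. \<forall>m\<in>L. l < m \<longrightarrow> before (\<alpha> l) (\<alpha> m) \<and> (\<forall>i\<in>supp (\<alpha> l). i < m)) \<and>
     {Min (supp (\<alpha> l)) |l. l \<in> L \<and> \<alpha> l \<noteq> 0} \<in> schreier0 k"

lemma norming_level_mono: "m \<le> m' \<Longrightarrow> norming_level n m \<subseteq> norming_level n m'"
  by (rule lift_Suc_mono_le[of "norming_level n"]) auto

lemma finite_subset_norming_level:
  "finite A \<Longrightarrow> A \<subseteq> norming_set n \<Longrightarrow> \<exists>m. A \<subseteq> norming_level n m"
proof (induction A rule: finite_induct)
  case (insert f A)
  then obtain m m' where "A \<subseteq> norming_level n m" "f \<in> norming_level n m'"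
    by (auto simp: norming_set_def)
  then have "insert f A \<subseteq> norming_level n (max m m')"
    using norming_level_mono[of m "max m m'" n] norming_level_mono[of m' "max m m'" n] by auto
  then show ?case by blast
qed auto

lemma sum_list_before_lookup:
  assumes "sorted_wrt before fs" "f \<in> set fs" "i \<in> supp f"
  shows "Poly_Mapping.lookup (sum_list fs) i = Poly_Mapping.lookup f i"
  using assms
proof (induction fs)
  case (Cons g fs)
  show ?case
  proof (cases "f = g")
    case True
    have "Poly_Mapping.lookup h i = 0" if "h \<in> set fs" for h
      using Cons.prems that True by (force simp: before_iff simp flip: not_in_keys_iff_lookup_eq_zero)
    then have "Poly_Mapping.lookup (sum_list fs) i = 0"
      by (induction fs) (auto simp: lookup_add)
    then show ?thesis using True by (simp add: lookup_add)
  next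
    case False
    then have f: "f \<in> set fs" using Cons.prems by simp
    then have "i \<notin> supp g" using Cons.prems by (force simp: before_iff)
    then show ?thesis using Cons.IH Cons.prems f by (simp add: lookup_add in_keys_iff)
  qed
qed auto

lemma sum_list_before_nonzero:
  assumes "sorted_wrt before fs" "fs \<noteq> []" "\<And>f. f \<in> set fs \<Longrightarrow> f \<noteq> 0"
  shows "sum_list fs \<noteq> 0"
proof -
  obtain f where f: "f \<in> set fs" using assms(2) by (cases fs) auto
  then obtain i where "i \<in> supp f" using assms(3) by fastforce
  then show ?thesis using sum_list_before_lookup[OF assms(1) f] by (force simp: in_keys_iff)
qed

lemma supp_sum_list_subset: "supp (sum_list fs) \<subseteq> (\<Union>f\<in>set fs. supp f)"
  by (induction fs) (use Poly_Mapping.keys_add in fastforce)+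

text \<open>Successive supports cannot cancel, and an admissible list is nonempty because the
  Schreier families omit the empty set. Hence minima and maxima of supports of norming functionals
  are taken over nonempty sets.\<close>

lemma norming_level_nonzero: "f \<in> norming_level n m \<Longrightarrow> f \<noteq> 0 \<and> 0 \<notin> supp f"
proof (induction m arbitrary: f)
  case 0
  then obtain i where "1 \<le> i" "supp f = {i}" by auto
  then show ?case by auto
next
  case (Suc m)
  have avg: "\<alpha> \<noteq> 0 \<and> 0 \<notin> supp \<alpha>" if a: "(\<alpha>, l) \<in> averages (norming_level n m)" for \<alpha> l
  proof -
    obtain fs where fs: "\<alpha> = (1 / real l) *\<^sub>R sum_list fs" "fs \<noteq> []" "set fs \<subseteq> norming_level n m"
      "sorted_wrt before fs" "2 \<le> l"
      using a by (auto simp: averages_def)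
    have "sum_list fs \<noteq> 0" using fs Suc.IH by (intro sum_list_before_nonzero) auto
    moreover have "0 \<notin> supp (sum_list fs)"
      using fs(3) Suc.IH supp_sum_list_subset[of fs] by blast
    ultimately show ?thesis using fs by (auto simp: supp_scaleR)
  qed
  from Suc.prems consider "f \<in> norming_level n m" | l where "(f, l) \<in> averages (norming_level n m)"
    | as where "f = sum_list (map fst as)" "set as \<subseteq> alpha_averages (norming_level n m)"
        "admissible n as" by force
  then show ?case
  proof cases
    case 3
    have "as \<noteq> []"
    proof
      assume "as = []"
      then have "{} \<in> schreier n" using 3 by (simp add: admissible_def)
      then show False using schreier_nonempty_finite by blast
    qed
    moreover have nz: "a \<noteq> 0 \<and> 0 \<notin> supp a" if "a \<in> set (map fst as)" for a
      using that 3(2) avg by (auto simp: alpha_averages_def)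
    ultimately have "f \<noteq> 0" using 3 unfolding 3(1) admissible_def
      by (intro sum_list_before_nonzero) auto
    moreover have "0 \<notin> supp f" using 3(1) supp_sum_list_subset[of "map fst as"] nz by blast
    ultimately show ?thesis by blast
  qed (use Suc.IH avg in blast)+
qed

lemma W0_supp: "f \<in> W0 n \<Longrightarrow> i \<in> supp f \<Longrightarrow> 1 \<le> i"
  using norming_level_nonzero by (cases "i = 0") (auto simp: W0_def norming_set_def)

lemma W0_uminus: "f \<in> W0 n \<Longrightarrow> - f \<in> W0 n"
  by (auto simp: W0_def norming_set_uminus)

lemma W0_zero [simp]: "0 \<in> W0 n"
  by (simp add: W0_def)

lemma averages_mono: "G \<subseteq> H \<Longrightarrow> averages G \<subseteq> averages H"
  by (fastforce simp: averages_def)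

text \<open>Vanishing parts are dropped, and the finitely many others lie in one common
  level.\<close>

lemma avg_nonzero_level:
  assumes "avg n l \<alpha>" "\<alpha> \<noteq> 0"
  shows "\<exists>m. (\<alpha>, l) \<in> averages (norming_level n m)"
proof -
  obtain R g where R: "avg_rep n l \<alpha> R g" using assms by (auto simp: avg_def)
  define R' where "R' = {r\<in>R. g r \<noteq> 0}"
  have fin: "finite R'" using R by (auto simp: R'_def avg_rep_def)
  have "g ` R' \<subseteq> norming_set n" using R by (auto simp: R'_def avg_rep_def W0_def)
  then obtain m where m: "g ` R' \<subseteq> norming_level n m"
    using finite_subset_norming_level fin by (meson finite_imageI)
  define fs where "fs = map g (sorted_list_of_set R')"
  have sum: "sum_list fs = (\<Sum>r\<in>R. g r)"
  proof -
    have "sum_list fs = (\<Sum>r\<in>R'. g r)"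
      unfolding fs_def using fin by (simp add: sum_list_distinct_conv_sum_set)
    also have "\<dots> = (\<Sum>r\<in>R. g r)"
      using R by (intro sum.mono_neutral_left) (auto simp: R'_def avg_rep_def)
    finally show ?thesis .
  qed
  have "fs \<noteq> []" using sum assms(2) R by (auto simp: avg_rep_def)
  moreover have "set fs \<subseteq> norming_level n m" using m fin by (simp add: fs_def)
  moreover have "sorted_wrt before fs"
  proof -
    have "sorted_wrt (<) (sorted_list_of_set R')" by simp
    then show ?thesis unfolding fs_def sorted_wrt_map
      by (rule sorted_wrt_mono_rel[rotated]) (use R fin in \<open>auto simp: R'_def avg_rep_def\<close>)
  qed
  moreover have "length fs \<le> l"
    using R fin card_mono[of R R'] by (auto simp: fs_def avg_rep_def R'_def)
  moreover have "\<alpha> = (1 / real l) *\<^sub>R sum_list fs" "2 \<le> l" using R sum by (auto simp: avg_rep_def)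
  ultimately show ?thesis unfolding averages_def by blast
qed

lemma avg_W0: "avg n l \<alpha> \<Longrightarrow> \<alpha> \<in> W0 n"
proof (cases "\<alpha> = 0")
  case False
  assume "avg n l \<alpha>"
  then obtain m where "(\<alpha>, l) \<in> averages (norming_level n m)" using avg_nonzero_level False by blast
  then have "\<alpha> \<in> norming_level n (Suc m)" by force
  then show ?thesis unfolding W0_def norming_set_def by blast
qed simp

lemma supp_avg: "avg n l \<alpha> \<Longrightarrow> i \<in> supp \<alpha> \<Longrightarrow> 1 \<le> i"
  using avg_W0 W0_supp by blast

text \<open>Back from indexed families to lists: the nonzero averages, ordered by size, form an
  admissible and very fast growing list in some level, so their sum lies one level higher. If all
  averages vanish, the sum is the zero functional.\<close>

lemma fam_sum_W0:
  assumes "fam n n L \<alpha>"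
  shows "(\<Sum>l\<in>L. \<alpha> l) \<in> W0 n"
proof -
  define L' where "L' = {l\<in>L. \<alpha> l \<noteq> 0}"
  have fin: "finite L'" using assms by (auto simp: fam_def L'_def)
  have sumL: "(\<Sum>l\<in>L. \<alpha> l) = (\<Sum>l\<in>L'. \<alpha> l)"
    using assms by (intro sum.mono_neutral_right) (auto simp: fam_def L'_def)
  show ?thesis
  proof (cases "L' = {}")
    case True
    then show ?thesis using sumL by simp
  next
    case False
    have "\<forall>l\<in>L'. \<exists>m. (\<alpha> l, l) \<in> averages (norming_level n m)"
      using assms avg_nonzero_level by (auto simp: fam_def L'_def)
    then obtain m where m: "\<And>l. l \<in> L' \<Longrightarrow> (\<alpha> l, l) \<in> averages (norming_level n (m l))" by metis
    define M where "M = Suc (Max (m ` L'))"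
    have aa: "(\<alpha> l, l) \<in> alpha_averages (norming_level n M)" if l: "l \<in> L'" for l
    proof -
      have le: "m l \<le> Max (m ` L')" using l fin by simp
      have "(\<alpha> l, l) \<in> averages (norming_level n (Max (m ` L')))"
        using m[OF l] averages_mono[OF norming_level_mono[OF le]] by blast
      then have "\<alpha> l \<in> norming_level n M" "(\<alpha> l, l) \<in> averages (norming_level n M)"
        using averages_mono[OF norming_level_mono[of "Max (m ` L')" M n]] by (force simp: M_def)+
      then show ?thesis by (simp add: alpha_averages_def)
    qed
    define as where "as = map (\<lambda>l. (\<alpha> l, l)) (sorted_list_of_set L')"
    have srt: "sorted_wrt (<) (sorted_list_of_set L')" by simp
    have bef: "before (\<alpha> l) (\<alpha> k) \<and> (\<forall>i\<in>supp (\<alpha> l). i < k)" if "l \<in> L'" "k \<in> L'" "l < k" for l k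
      using that assms by (auto simp: fam_def L'_def)
    have set_as: "set as = (\<lambda>l. (\<alpha> l, l)) ` L'" using fin by (simp add: as_def)
    have sb: "sorted_wrt before (map fst as)"
      unfolding as_def map_map sorted_wrt_map
      by (rule sorted_wrt_mono_rel[rotated, OF srt]) (use bef fin in auto)
    moreover have "sorted_wrt (<) (map snd as)"
      unfolding as_def map_map by (simp add: comp_def)
    moreover have "Max (supp (fst (as ! (q - 1)))) < snd (as ! q)" if q: "0 < q" "q < length as" for q
    proof -
      have len: "length as = length (sorted_list_of_set L')" by (simp add: as_def)
      define l k where "l = sorted_list_of_set L' ! (q - 1)" and "k = sorted_list_of_set L' ! q"
      have "l \<in> set (sorted_list_of_set L')" "k \<in> set (sorted_list_of_set L')"
        unfolding l_def k_def using q unfolding len by (auto intro!: nth_mem simp del: length_sorted_list_of_set)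
      moreover have "l < k"
        using srt q unfolding l_def k_def sorted_wrt_iff_nth_less len by (simp del: length_sorted_list_of_set)
      ultimately have lk: "l \<in> L'" "k \<in> L'" "l < k" using fin by auto
      have "supp (\<alpha> l) \<noteq> {}" using lk(1) by (auto simp: L'_def)
      then have "Max (supp (\<alpha> l)) < k" using bef[OF lk] by simp
      then show ?thesis using q len by (simp add: as_def l_def k_def)
    qed
    ultimately have vfg: "very_fast_growing as" by (simp add: very_fast_growing_def)
    have mins: "(\<lambda>(\<alpha>, l). Min (supp \<alpha>)) ` set as = {Min (supp (\<alpha> l)) |l. l \<in> L \<and> \<alpha> l \<noteq> 0}"
      unfolding set_as by (auto simp: L'_def)
    have "(\<lambda>(\<alpha>, l). Min (supp \<alpha>)) ` set as \<noteq> {}" using False set_as by simp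
    then have "(\<lambda>(\<alpha>, l). Min (supp \<alpha>)) ` set as \<in> schreier n"
      using mins assms unfolding fam_def schreier0_def by auto
    then have adm: "admissible n as" using sb by (simp add: admissible_def)
    have "sum_list (map fst as) = (\<Sum>l\<in>L'. \<alpha> l)"
      unfolding as_def map_map using fin by (simp add: sum_list_distinct_conv_sum_set comp_def)
    moreover have "set as \<subseteq> alpha_averages (norming_level n M)" using set_as aa by auto
    ultimately have "(\<Sum>l\<in>L. \<alpha> l) \<in> norming_level n (Suc M)"
      using adm vfg sumL by auto
    then show ?thesis unfolding W0_def norming_set_def by blast
  qed
qed

text \<open>Induction over the construction of functionals, with the levels hidden. In the case of a
  sum the hypothesis is given for the parts of each average and not for the averages themselves,
  because the estimates below treat an average inside a sum through its parts and its size.\<close>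

lemma W0_induct [consumes 1, case_names zero unit neg_unit average sum]:
  assumes "f \<in> W0 n" and "P 0" and "\<And>i. 1 \<le> i \<Longrightarrow> P (Poly_Mapping.single i 1)"
    and "\<And>i. 1 \<le> i \<Longrightarrow> P (- Poly_Mapping.single i 1)"
    and average: "\<And>l R g \<alpha>. avg_rep n l \<alpha> R g \<Longrightarrow> R \<noteq> {} \<Longrightarrow> \<alpha> \<noteq> 0 \<Longrightarrow> (\<And>r. r \<in> R \<Longrightarrow> g r \<noteq> 0 \<and> P (g r)) \<Longrightarrow> P \<alpha>"
    and sum: "\<And>L \<alpha>. fam n n L \<alpha> \<Longrightarrow> L \<noteq> {} \<Longrightarrow> (\<Sum>l\<in>L. \<alpha> l) \<noteq> 0 \<Longrightarrow>
       (\<And>l. l \<in> L \<Longrightarrow> \<alpha> l \<noteq> 0 \<and> (\<exists>R g. avg_rep n l (\<alpha> l) R g \<and> R \<noteq> {} \<and> (\<forall>r\<in>R. g r \<noteq> 0 \<and> P (g r))))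
       \<Longrightarrow> P (\<Sum>l\<in>L. \<alpha> l)"
  shows "P f"
proof -
  have avg: "\<exists>R g. avg_rep n l \<alpha> R g \<and> R \<noteq> {} \<and> (\<forall>r\<in>R. g r \<noteq> 0 \<and> P (g r))"
    if a: "(\<alpha>, l) \<in> averages (norming_level n m)" and IH: "\<And>f. f \<in> norming_level n m \<Longrightarrow> P f" for \<alpha> l m
  proof -
    obtain fs where fs: "\<alpha> = (1 / real l) *\<^sub>R sum_list fs" "fs \<noteq> []" "set fs \<subseteq> norming_level n m"
      "sorted_wrt before fs" "length fs \<le> l" "2 \<le> l"
      using a by (auto simp: averages_def)
    have "fs ! r \<in> norming_level n m" if "r < length fs" for r using fs(3) that nth_mem by blast
    then have "fs ! r \<in> W0 n \<and> fs ! r \<noteq> 0 \<and> P (fs ! r)" if "r < length fs" for r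
      using that IH norming_level_nonzero unfolding W0_def norming_set_def by blast
    then have "avg_rep n l \<alpha> {..<length fs} (\<lambda>r. fs ! r) \<and> {..<length fs} \<noteq> {} \<and> (\<forall>r\<in>{..<length fs}. fs ! r \<noteq> 0 \<and> P (fs ! r))"
      using fs by (auto simp: avg_rep_def sum_list_sum_nth atLeast0LessThan sorted_wrt_iff_nth_less)
    then show ?thesis by blast
  qed
  have "P f" if "f \<in> norming_level n m" for m f
    using that
  proof (induction m arbitrary: f)
    case 0
    then show ?case using assms(3,4) by auto
  next
    case (Suc m)
    have nz: "f \<noteq> 0" using norming_level_nonzero Suc.prems by blast
    from Suc.prems consider "f \<in> norming_level n m" | l where "(f, l) \<in> averages (norming_level n m)"
      | as where "f = sum_list (map fst as)" "set as \<subseteq> alpha_averages (norming_level n m)"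
          "admissible n as" "very_fast_growing as" by force
    then show ?case
    proof cases
      case 1
      then show ?thesis by (rule Suc.IH)
    next
      case 2
      then obtain R g where "avg_rep n l f R g \<and> R \<noteq> {} \<and> (\<forall>r\<in>R. g r \<noteq> 0 \<and> P (g r))"
        using avg Suc.IH by blast
      then show ?thesis using average nz by blast
    next
      case 3
      define L where "L = snd ` set as"
      \<comment> \<open>Sizes increase strictly along the list, so each size in \<open>L\<close>
        determines its average.\<close>
      define \<alpha> where "\<alpha> l = fst (SOME a. a \<in> set as \<and> snd a = l)" for l
      have inj: "inj_on snd (set as)"
      proof -
        have "sorted_wrt (<) (map snd as)" using 3(4) by (simp add: very_fast_growing_def)
        then have "distinct (map snd as)" by (simp add: strict_sorted_iff)
        then show ?thesis by (simp add: distinct_map)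
      qed
      have \<alpha>: "\<alpha> (snd a) = fst a" if a: "a \<in> set as" for a
      proof -
        have "(SOME b. b \<in> set as \<and> snd b = snd a) = a"
          using a inj by (intro some_equality) (auto dest: inj_onD)
        then show ?thesis by (simp add: \<alpha>_def)
      qed
      have rep: "\<alpha> l \<noteq> 0 \<and> (\<exists>R g. avg_rep n l (\<alpha> l) R g \<and> R \<noteq> {} \<and> (\<forall>r\<in>R. g r \<noteq> 0 \<and> P (g r)))"
        if l: "l \<in> L" for l
      proof -
        obtain a where a: "a \<in> set as" "snd a = l" using l by (auto simp: L_def)
        then have "(\<alpha> l, l) \<in> alpha_averages (norming_level n m)" using \<alpha>[OF a(1)] 3(2) by force
        then have *: "(\<alpha> l, l) \<in> averages (norming_level n m)" "\<alpha> l \<in> norming_level n m"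
          by (auto simp: alpha_averages_def)
        show ?thesis using avg[OF *(1) Suc.IH] norming_level_nonzero[OF *(2)] by blast
      qed
      have bef: "before (\<alpha> l) (\<alpha> k) \<and> (\<forall>i\<in>supp (\<alpha> l). i < k)" if lk: "l \<in> L" "k \<in> L" "l < k" for l k
      proof -
        obtain p q where pq: "p < length as" "snd (as ! p) = l" "q < length as" "snd (as ! q) = k"
          using lk by (auto simp: L_def in_set_conv_nth)
        have srt: "sorted_wrt (<) (map snd as)" "sorted_wrt before (map fst as)"
          using 3(4) by (auto simp: very_fast_growing_def)
        have "p < q"
        proof (rule ccontr)
          assume "\<not> p < q"
          then have "q < p \<or> q = p" by auto
          then have "k \<le> l" using srt(1) pq by (auto simp: sorted_wrt_iff_nth_less less_imp_le)
          then show False using lk by simp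
        qed
        have a: "\<alpha> l = fst (as ! p)" "\<alpha> k = fst (as ! q)"
          using \<alpha>[of "as ! p"] \<alpha>[of "as ! q"] pq by auto
        have b: "before (\<alpha> l) (\<alpha> k)"
          using srt(2) \<open>p < q\<close> pq unfolding a by (auto simp: sorted_wrt_iff_nth_less)
        \<comment> \<open>The growth condition compares neighbours only; the increasing sizes carry
          it from the successor of \<open>p\<close> on to \<open>q\<close>.\<close>
        have "Max (supp (fst (as ! p))) < snd (as ! Suc p)"
          using 3(4) \<open>p < q\<close> pq unfolding very_fast_growing_def by force
        also have "snd (as ! Suc p) \<le> k"
        proof (cases "Suc p = q")
          case False
          then have "Suc p < q" using \<open>p < q\<close> by simp
          then have "map snd as ! Suc p < map snd as ! q" using srt(1) pq by (auto simp: sorted_wrt_iff_nth_less)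
          then show ?thesis using pq \<open>Suc p < q\<close> by simp
        qed (use pq in simp)
        finally have "Max (supp (\<alpha> l)) < k" using a by simp
        moreover have "supp (\<alpha> l) \<noteq> {}" using rep[OF lk(1)] by simp
        ultimately show ?thesis using b by simp
      qed
      have "{Min (supp (\<alpha> l)) |l. l \<in> L \<and> \<alpha> l \<noteq> 0} = (\<lambda>(\<alpha>, l). Min (supp \<alpha>)) ` set as"
      proof -
        have "{Min (supp (\<alpha> l)) |l. l \<in> L \<and> \<alpha> l \<noteq> 0} = (\<lambda>l. Min (supp (\<alpha> l))) ` L"
          using rep by auto
        also have "\<dots> = (\<lambda>a. Min (supp (fst a))) ` set as"
          unfolding L_def image_image using \<alpha> by (intro image_cong) auto
        finally show ?thesis by (simp add: split_beta)
      qed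
      then have "{Min (supp (\<alpha> l)) |l. l \<in> L \<and> \<alpha> l \<noteq> 0} \<in> schreier0 n"
        using 3(3) by (auto simp: admissible_def schreier0_def)
      moreover have "finite L" by (simp add: L_def)
      moreover have "\<forall>l\<in>L. avg n l (\<alpha> l)" using rep unfolding avg_def by blast
      ultimately have fam: "fam n n L \<alpha>"
        unfolding fam_def using bef by (intro conjI ballI impI) auto
      have "(\<Sum>l\<in>L. \<alpha> l) = (\<Sum>a\<in>set as. fst a)"
        unfolding L_def using inj \<alpha> by (simp add: sum.reindex)
      also have "\<dots> = sum_list (map fst as)"
      proof (rule sum_list_distinct_conv_sum_set[symmetric])
        have "sorted_wrt (<) (map snd as)" using 3(4) by (simp add: very_fast_growing_def)
        then have "distinct (map snd as)" by (simp add: strict_sorted_iff)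
        then show "distinct as" by (simp add: distinct_map)
      qed
      finally have f: "f = (\<Sum>l\<in>L. \<alpha> l)" using 3(1) by simp
      have "L \<noteq> {}"
        using f nz by auto
      then show ?thesis using sum[OF fam _ _ rep] nz unfolding f by blast
    qed
  qed
  then show ?thesis using assms(1,2) by (auto simp: W0_def norming_set_def)
qed

section \<open>Families of averages\<close>

lemma dual_pairing_sum: "dual_pairing f (\<Sum>i\<in>I. x i) = (\<Sum>i\<in>I. dual_pairing f (x i))"
proof (induction I rule: infinite_finite_induct)
qed (auto simp: dual_pairing_add, simp_all add: dual_pairing_def)

lemma dual_pairing_zero [simp]: "dual_pairing 0 x = 0" "dual_pairing f 0 = 0"
  by (simp_all add: dual_pairing_def)

lemma dual_pairing_add_left: "dual_pairing (f + g) x = dual_pairing f x + dual_pairing g x"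
  by (simp add: dual_pairing_def lookup_add distrib_right sum.distrib)

lemma dual_pairing_scaleR_left: "dual_pairing (c *\<^sub>R f) x = c * dual_pairing f x"
  by (simp add: dual_pairing_def lookup_scaleR sum_distrib_left mult.assoc)

lemma dual_pairing_sum_left: "dual_pairing (\<Sum>i\<in>I. f i) x = (\<Sum>i\<in>I. dual_pairing (f i) x)"
  by (induction I rule: infinite_finite_induct) (auto simp: dual_pairing_add_left)

lemma dual_pairing_eq_0:
  assumes "supp f \<inter> supp x = {}" shows "dual_pairing f x = 0"
  unfolding dual_pairing_def using assms by (intro sum.neutral) (force simp: in_keys_iff)

lemma dual_pairing_restr_left: "supp x \<subseteq> A \<Longrightarrow> dual_pairing (restr A f) x = dual_pairing f x"
  unfolding dual_pairing_def by (intro sum.cong) (auto simp: lookup_restr)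

lemma W0_le_norm01: "f \<in> W0 n \<Longrightarrow> \<bar>dual_pairing f x\<bar> \<le> norm01 n x"
proof -
  have "0 \<le> norm01 n x"
    using abs_dual_pairing_le_norm01 norming_set_nonempty by (meson abs_ge_zero all_not_in_conv order_trans)
  then show "f \<in> W0 n \<Longrightarrow> \<bar>dual_pairing f x\<bar> \<le> norm01 n x"
    by (auto simp: W0_def abs_dual_pairing_le_norm01)
qed

lemma norm01_nonneg: "0 \<le> norm01 n x"
  using W0_le_norm01[OF W0_zero] by force

lemma norm01_le:
  assumes "\<And>f. f \<in> W0 n \<Longrightarrow> dual_pairing f x \<le> C" shows "norm01 n x \<le> C"
  unfolding norm01_def using assms by (intro cSUP_least[OF norming_set_nonempty]) (auto simp: W0_def)

lemma norm01_attained: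
  assumes "r < norm01 n x" obtains f where "f \<in> W0 n" "r < dual_pairing f x"
  using assms norm01_le[of n x r] by (meson not_le)

lemma famD:
  assumes "fam n k L \<alpha>"
  shows "finite L" "\<And>l. l \<in> L \<Longrightarrow> avg n l (\<alpha> l)"
    "\<And>l m. l \<in> L \<Longrightarrow> m \<in> L \<Longrightarrow> l < m \<Longrightarrow> before (\<alpha> l) (\<alpha> m)"
    "\<And>l m i. l \<in> L \<Longrightarrow> m \<in> L \<Longrightarrow> l < m \<Longrightarrow> i \<in> supp (\<alpha> l) \<Longrightarrow> i < m"
    "{Min (supp (\<alpha> l)) |l. l \<in> L \<and> \<alpha> l \<noteq> 0} \<in> schreier0 k"
  using assms by (simp_all add: fam_def)

lemma before_Max_Min:
  assumes "before f g" "f \<noteq> 0" "g \<noteq> 0" shows "Max (supp f) < Min (supp g)" "Min (supp f) < Min (supp g)"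
proof -
  have "Max (supp f) \<in> supp f" "Min (supp f) \<in> supp f" "Min (supp g) \<in> supp g"
    using assms by (auto intro!: Max_in Min_in)
  then show "Max (supp f) < Min (supp g)" "Min (supp f) < Min (supp g)"
    using assms(1) by (auto simp: before_iff)
qed

text \<open>Each average may be replaced by any average of the same size whose support stays in the
  hull of the old support: order and growth depend on the hulls only, and minima can only move to
  the right, which spreading permits. Restriction, change of signs, subfamilies and the
  substitutions of the domination argument are all instances.\<close>

lemma fam_spread:
  assumes "fam n k L \<alpha>" "K \<subseteq> L" "\<And>l. l \<in> K \<Longrightarrow> avg n l (\<beta> l)"
    and sub: "\<And>l i. l \<in> K \<Longrightarrow> i \<in> supp (\<beta> l) \<Longrightarrow> \<alpha> l \<noteq> 0 \<and> Min (supp (\<alpha> l)) \<le> i \<and> i \<le> Max (supp (\<alpha> l))"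
  shows "fam n k K \<beta>"
proof -
  have fin: "finite K" using assms(1,2) by (auto simp: fam_def intro: finite_subset)
  have nz: "\<alpha> l \<noteq> 0" if "l \<in> K" "\<beta> l \<noteq> 0" for l
    using sub[OF that(1)] that(2) by fastforce
  have bef0: "Max (supp (\<alpha> l)) < Min (supp (\<alpha> m)) \<and> Max (supp (\<alpha> l)) < m"
    if "l \<in> K" "m \<in> K" "l < m" "\<alpha> l \<noteq> 0" "\<alpha> m \<noteq> 0" for l m
  proof -
    have "before (\<alpha> l) (\<alpha> m)" "\<forall>i\<in>supp (\<alpha> l). i < m"
      using famD(3,4)[OF assms(1)] assms(2) that by blast+
    then show ?thesis using that before_Max_Min by simp
  qed
  have bef: "before (\<beta> l) (\<beta> m) \<and> (\<forall>i\<in>supp (\<beta> l). i < m)" if lm: "l \<in> K" "m \<in> K" "l < m" for l m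
  proof -
    have "i < j" if "i \<in> supp (\<beta> l)" "j \<in> supp (\<beta> m)" for i j
      using sub[OF lm(1) that(1)] sub[OF lm(2) that(2)] bef0[OF lm] by linarith
    moreover have "i < m" if i: "i \<in> supp (\<beta> l)" for i
    proof -
      have "\<forall>i\<in>supp (\<alpha> l). i < m" using famD(4)[OF assms(1)] assms(2) lm by blast
      then have "Max (supp (\<alpha> l)) < m" using sub[OF lm(1) i] by simp
      then show ?thesis using sub[OF lm(1) i] by linarith
    qed
    ultimately show ?thesis by (auto simp: before_iff)
  qed
  let ?G = "{Min (supp (\<beta> l)) |l. l \<in> K \<and> \<beta> l \<noteq> 0}"
  define S where "S g = (SOME l. l \<in> K \<and> \<beta> l \<noteq> 0 \<and> g = Min (supp (\<beta> l)))" for g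
  have S: "S g \<in> K \<and> \<beta> (S g) \<noteq> 0 \<and> g = Min (supp (\<beta> (S g)))" if g: "g \<in> ?G" for g
  proof -
    have "\<exists>l. l \<in> K \<and> \<beta> l \<noteq> 0 \<and> g = Min (supp (\<beta> l))" using g by auto
    then show ?thesis unfolding S_def by (rule someI_ex)
  qed
  have "?G \<in> schreier0 k"
  proof (rule schreier0_spread[of _ _ _ "\<lambda>g. Min (supp (\<alpha> (S g)))"])
    show "{Min (supp (\<alpha> l)) |l. l \<in> L \<and> \<alpha> l \<noteq> 0} \<in> schreier0 k"
      using assms(1) by (simp add: fam_def)
    show "finite ?G" using fin by (rule finite_surj[of K _ "\<lambda>l. Min (supp (\<beta> l))"]) auto
  next
    fix g assume g: "g \<in> ?G"
    have "g \<in> supp (\<beta> (S g))" using S[OF g] Min_in[of "supp (\<beta> (S g))"] by simp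
    then have "Min (supp (\<alpha> (S g))) \<le> g" using sub[of "S g" g] S[OF g] by blast
    moreover have "\<alpha> (S g) \<noteq> 0 \<and> S g \<in> L" using nz S[OF g] assms(2) by blast
    ultimately show "Min (supp (\<alpha> (S g))) \<in> {Min (supp (\<alpha> l)) |l. l \<in> L \<and> \<alpha> l \<noteq> 0} \<and> Min (supp (\<alpha> (S g))) \<le> g"
      by blast
  next
    fix g g' assume g: "g \<in> ?G" "g' \<in> ?G" "g < g'"
    have "S g < S g'"
    proof (rule ccontr)
      assume "\<not> S g < S g'"
      then consider "S g = S g'" | "S g' < S g" by linarith
      then show False
      proof cases
        case 1
        then show ?thesis using S[OF g(1)] S[OF g(2)] g(3) by simp
      next
        case 2
        then have "before (\<beta> (S g')) (\<beta> (S g))" using bef S[OF g(1)] S[OF g(2)] by blast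
        then have "Min (supp (\<beta> (S g'))) < Min (supp (\<beta> (S g)))"
          using S[OF g(1)] S[OF g(2)] before_Max_Min by blast
        then show ?thesis using S[OF g(1)] S[OF g(2)] g(3) by linarith
      qed
    qed
    then have *: "Max (supp (\<alpha> (S g))) < Min (supp (\<alpha> (S g')))"
      using bef0[of "S g" "S g'"] S[OF g(1)] S[OF g(2)] nz by blast
    have "\<alpha> (S g) \<noteq> 0" using nz S[OF g(1)] by blast
    then have "Min (supp (\<alpha> (S g))) \<le> Max (supp (\<alpha> (S g)))" by simp
    then show "Min (supp (\<alpha> (S g))) < Min (supp (\<alpha> (S g')))" using * by linarith
  qed
  then show ?thesis using fin assms(3) bef unfolding fam_def by blast
qed

lemma fam_subset: "fam n k L \<alpha> \<Longrightarrow> K \<subseteq> L \<Longrightarrow> fam n k K \<alpha>"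
proof (rule fam_spread[of n k L \<alpha>])
  fix l i assume "i \<in> supp (\<alpha> l)"
  then show "\<alpha> l \<noteq> 0 \<and> Min (supp (\<alpha> l)) \<le> i \<and> i \<le> Max (supp (\<alpha> l))" by auto
qed (auto intro: famD(2))

lemma before_restr: "before f g \<Longrightarrow> before (restr A f) (restr A g)"
  by (auto simp: before_iff supp_restr)

lemma before_uminus: "before f g \<Longrightarrow> before (- f) (- g)"
  by (simp add: before_iff)

lemma restr_W0_avg:
  assumes "\<And>r. r \<in> R \<Longrightarrow> restr A (g r) \<in> W0 n" "avg_rep n l \<alpha> R g"
  shows "avg n l (restr A \<alpha>)"
proof -
  have "avg_rep n l (restr A \<alpha>) R (\<lambda>r. restr A (g r))"
    using assms by (simp add: avg_rep_def restr_scaleR restr_sum before_restr)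
  then show ?thesis by (auto simp: avg_def)
qed

text \<open>Restriction acts termwise on averages and, by spreading, on admissible sums. Hence
  projections onto arbitrary sets of coordinates, and not only onto intervals, do not increase the
  norm.\<close>

lemma restr_W0: "f \<in> W0 n \<Longrightarrow> restr A f \<in> W0 n"
proof (induction rule: W0_induct)
  case (unit i)
  then have "Poly_Mapping.single i 1 \<in> norming_level n 0" by auto
  then have "Poly_Mapping.single i 1 \<in> norming_set n" unfolding norming_set_def by blast
  then show ?case by (auto simp: restr_single W0_def)
next
  case (neg_unit i)
  then have "- Poly_Mapping.single i 1 \<in> norming_level n 0" by auto
  then have "- Poly_Mapping.single i 1 \<in> norming_set n" unfolding norming_set_def by blast
  then show ?case by (auto simp: restr_single restr_uminus W0_def)
next
  case (average l R g \<alpha>)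
  then show ?case using restr_W0_avg[of R A g n l \<alpha>] avg_W0 by blast
next
  case (sum L \<alpha>)
  have "fam n n L (\<lambda>l. restr A (\<alpha> l))"
  proof (rule fam_spread[OF sum(1)])
    fix l assume "l \<in> L"
    then show "avg n l (restr A (\<alpha> l))" using sum(4)[of l] restr_W0_avg by blast
  next
    fix l i assume "l \<in> L" "i \<in> supp (restr A (\<alpha> l))"
    then show "\<alpha> l \<noteq> 0 \<and> Min (supp (\<alpha> l)) \<le> i \<and> i \<le> Max (supp (\<alpha> l))"
      by (auto simp: supp_restr)
  qed auto
  then show ?case using fam_sum_W0 by (fastforce simp: restr_sum)
qed simp

lemma avg_restr: "avg n l \<alpha> \<Longrightarrow> avg n l (restr A \<alpha>)"
  unfolding avg_def[of n l \<alpha>] using restr_W0_avg restr_W0 by (metis avg_rep_def)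

lemma fam_restr: "fam n k L \<alpha> \<Longrightarrow> fam n k L (\<lambda>l. restr A (\<alpha> l))"
  by (rule fam_spread[of n k L \<alpha>]) (auto simp: supp_restr intro: avg_restr famD(2))

lemma avg_uminus: "avg n l \<alpha> \<Longrightarrow> avg n l (- \<alpha>)"
proof -
  assume "avg n l \<alpha>"
  then obtain R g where "avg_rep n l \<alpha> R g" by (auto simp: avg_def)
  then have "avg_rep n l (- \<alpha>) R (\<lambda>r. - g r)"
    by (simp add: avg_rep_def before_uminus sum_negf W0_uminus)
  then show ?thesis by (auto simp: avg_def)
qed

lemma fam_uminus: "fam n k L \<alpha> \<Longrightarrow> fam n k L (\<lambda>l. - \<alpha> l)"
  by (rule fam_spread[of n k L \<alpha>]) (auto intro: avg_uminus famD(2))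

lemma fam_mono: "fam n k L \<alpha> \<Longrightarrow> k \<le> m \<Longrightarrow> fam n m L \<alpha>"
  unfolding fam_def using schreier0_mono by blast

lemma fam_single:
  assumes "avg n l (\<alpha> l)" shows "fam n k {l} \<alpha>"
proof -
  have "{Min (supp (\<alpha> m)) |m. m \<in> {l} \<and> \<alpha> m \<noteq> 0} = (if \<alpha> l = 0 then {} else {Min (supp (\<alpha> l))})"
    by auto
  moreover have "1 \<le> Min (supp (\<alpha> l))" if "\<alpha> l \<noteq> 0"
    using supp_avg[OF assms] that by (simp add: Min_in)
  ultimately show ?thesis using assms unfolding fam_def by (auto intro: schreier0_singleton)
qed

lemma fam_sum_le:
  assumes "fam n k L \<alpha>" "k \<le> n" shows "\<bar>\<Sum>l\<in>L. dual_pairing (\<alpha> l) x\<bar> \<le> norm01 n x"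
  using W0_le_norm01[OF fam_sum_W0[OF fam_mono[OF assms]]] by (simp add: dual_pairing_sum_left)

text \<open>Two nonzero averages of a family have different minima, so order 0 leaves room for only
  one: nullness of order 0 concerns single averages.\<close>

lemma fam_0_eq_single:
  assumes "fam n 0 L \<alpha>" "(\<Sum>l\<in>L. dual_pairing (\<alpha> l) x) \<noteq> 0"
  shows "\<exists>l\<in>L. (\<Sum>l\<in>L. dual_pairing (\<alpha> l) x) = dual_pairing (\<alpha> l) x"
proof -
  obtain l where l: "l \<in> L" "dual_pairing (\<alpha> l) x \<noteq> 0"
    using assms(2) by (meson sum.neutral)
  then have nl: "\<alpha> l \<noteq> 0" by auto
  have "\<alpha> m = 0" if m: "m \<in> L" "m \<noteq> l" for m
  proof (rule ccontr)
    assume nm: "\<alpha> m \<noteq> 0"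
    have *: "{Min (supp (\<alpha> l)) |l. l \<in> L \<and> \<alpha> l \<noteq> 0} \<in> schreier0 0" using assms(1) by (simp add: fam_def)
    then obtain p where "{Min (supp (\<alpha> l)) |l. l \<in> L \<and> \<alpha> l \<noteq> 0} = {p}"
      using l nl by (auto simp: schreier0_0)
    then have "Min (supp (\<alpha> l)) = p" "Min (supp (\<alpha> m)) = p" using l nl m nm by blast+
    moreover have "before (\<alpha> l) (\<alpha> m) \<or> before (\<alpha> m) (\<alpha> l)"
      using famD(3)[OF assms(1)] l m by (meson neq_iff)
    ultimately show False using nl nm before_Max_Min(2) by (metis less_irrefl)
  qed
  then have "(\<Sum>l\<in>L. dual_pairing (\<alpha> l) x) = (\<Sum>l\<in>{l}. dual_pairing (\<alpha> l) x)"
    using famD(1)[OF assms(1)] l \<open>\<And>m. m \<in> L \<Longrightarrow> m \<noteq> l \<Longrightarrow> \<alpha> m = 0\<close>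
    by (intro sum.mono_neutral_right) auto
  then show ?thesis using l by auto
qed

lemma block_coloringD:
  assumes "block_coloring P F c N"
  shows "finite F" "\<And>x y. x \<in> F \<Longrightarrow> y \<in> F \<Longrightarrow> x \<le> y \<Longrightarrow> c x \<le> c y"
    "\<And>x. x \<in> F \<Longrightarrow> c x < N" "\<And>x. x \<in> F \<Longrightarrow> N \<le> x" "\<And>j. P {x\<in>F. c x = j}"
  using assms by (simp_all add: block_coloring_def)

text \<open>A family of order \<open>k + 1\<close> splits into at most \<open>N\<close> colour
  classes of order \<open>k\<close>, where \<open>N\<close> lies below every minimum. One average
  starting at or before \<open>P\<close> therefore bounds the number of classes by \<open>P\<close>,
  even for a subfamily \<open>B\<close> that starts much later.\<close>

lemma fam_color_bound:
  assumes fam: "fam n (Suc k) L \<alpha>" and "B \<subseteq> L" and "0 \<le> \<eta>"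
    and le: "\<And>K. K \<subseteq> B \<Longrightarrow> fam n k K \<alpha> \<Longrightarrow> (\<Sum>l\<in>K. dual_pairing (\<alpha> l) x) \<le> \<eta>"
    and l0: "l0 \<in> L" "i0 \<in> supp (\<alpha> l0)" "i0 \<le> P"
  shows "(\<Sum>l\<in>B. dual_pairing (\<alpha> l) x) \<le> real P * \<eta>"
proof -
  let ?F = "{Min (supp (\<alpha> l)) |l. l \<in> L \<and> \<alpha> l \<noteq> 0}"
  obtain c N where c: "block_coloring (\<lambda>G. G \<in> schreier0 k) ?F c N"
    using fam unfolding fam_def schreier0_Suc by blast
  have "Min (supp (\<alpha> l0)) \<in> ?F" using l0 by auto
  then have "N \<le> Min (supp (\<alpha> l0))" by (rule block_coloringD(4)[OF c])
  also have "\<dots> \<le> P" using l0 by (meson Min_le finite_keys order_trans)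
  finally have NP: "N \<le> P" .
  define B' where "B' = {l\<in>B. \<alpha> l \<noteq> 0}"
  define C where "C l = c (Min (supp (\<alpha> l)))" for l
  have fin: "finite L" "finite B'" using famD(1)[OF fam] assms(2) by (auto simp: B'_def intro: finite_subset)
  have mem: "Min (supp (\<alpha> l)) \<in> ?F" if "l \<in> B'" for l using that assms(2) by (auto simp: B'_def)
  have "C ` B' \<subseteq> {..<N}" using block_coloringD(3)[OF c mem] unfolding C_def by blast
  then have "(\<Sum>l\<in>B'. dual_pairing (\<alpha> l) x) = (\<Sum>j<N. \<Sum>l\<in>{l\<in>B'. C l = j}. dual_pairing (\<alpha> l) x)"
    using fin by (intro sum.group[symmetric]) auto
  also have "\<dots> \<le> (\<Sum>j<N. \<eta>)"
  proof (rule sum_mono, rule le)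
    fix j
    show "{l\<in>B'. C l = j} \<subseteq> B" by (auto simp: B'_def)
    have "{Min (supp (\<alpha> l)) |l. l \<in> {l\<in>B'. C l = j} \<and> \<alpha> l \<noteq> 0} \<subseteq> {y\<in>?F. c y = j}"
      using mem by (auto simp: C_def)
    then have "{Min (supp (\<alpha> l)) |l. l \<in> {l\<in>B'. C l = j} \<and> \<alpha> l \<noteq> 0} \<in> schreier0 k"
      using schreier0_subset[OF block_coloringD(5)[OF c]] by blast
    moreover have "fam n (Suc k) {l\<in>B'. C l = j} \<alpha>"
      using assms(2) by (intro fam_subset[OF fam]) (auto simp: B'_def)
    ultimately show "fam n k {l\<in>B'. C l = j} \<alpha>" by (simp add: fam_def)
  qed
  also have "\<dots> \<le> real P * \<eta>" using NP assms(3) by (simp add: mult_right_mono)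
  finally have "(\<Sum>l\<in>B'. dual_pairing (\<alpha> l) x) \<le> real P * \<eta>" .
  moreover have "(\<Sum>l\<in>B'. dual_pairing (\<alpha> l) x) = (\<Sum>l\<in>B. dual_pairing (\<alpha> l) x)"
    using fin assms(2) by (intro sum.mono_neutral_left) (auto simp: B'_def intro: finite_subset)
  ultimately show ?thesis by simp
qed

text \<open>The vanishing of the averaging index of order \<open>k\<close> of the sequence: averages
  of large size are tested on late vectors. A one-sided bound is also a two-sided one, as families
  may be negated.\<close>

definition null :: "nat \<Rightarrow> nat \<Rightarrow> (nat \<Rightarrow> nat \<Rightarrow>\<^sub>0 real) \<Rightarrow> bool" where
  "null n k x \<longleftrightarrow> (\<forall>\<epsilon>>0. \<exists>j i. \<forall>i'\<ge>i. \<forall>L \<alpha>. fam n k L \<alpha> \<longrightarrow> (\<forall>l\<in>L. j \<le> l) \<longrightarrow>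
     (\<Sum>l\<in>L. dual_pairing (\<alpha> l) (x i')) < \<epsilon>)"

lemma not_null_iff:
  "\<not> null n k x \<longleftrightarrow> (\<exists>\<epsilon>>0. \<forall>j i. \<exists>i'\<ge>i. \<exists>L \<alpha>. fam n k L \<alpha> \<and> (\<forall>l\<in>L. j \<le> l) \<and>
     \<epsilon> \<le> (\<Sum>l\<in>L. dual_pairing (\<alpha> l) (x i')))"
  unfolding null_def by (meson not_le)

section \<open>Block sequences\<close>

definition block_seq :: "(nat \<Rightarrow> nat) \<Rightarrow> (nat \<Rightarrow> nat) \<Rightarrow> bool" where
  "block_seq a b \<longleftrightarrow> (\<forall>k. 1 \<le> a k \<and> a k < b k \<and> b k \<le> a (Suc k))"

definition blocks :: "(nat \<Rightarrow> nat) \<Rightarrow> (nat \<Rightarrow> nat) \<Rightarrow> (nat \<Rightarrow> nat \<Rightarrow>\<^sub>0 real) \<Rightarrow> bool" where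
  "blocks a b x \<longleftrightarrow> (\<forall>k. supp (x k) \<subseteq> {a k..<b k})"

lemma block_seqD:
  assumes "block_seq a b"
  shows "1 \<le> a k" "a k < b k" "k < m \<Longrightarrow> b k \<le> a m" "k \<le> m \<Longrightarrow> a k \<le> a m" "k \<le> m \<Longrightarrow> b k \<le> b m" "k < a k"
proof -
  have *: "1 \<le> a k" "a k < b k" "b k \<le> a (Suc k)" for k using assms by (auto simp: block_seq_def)
  have mono: "a k \<le> a m" if "k \<le> m" for k m
    using that by (rule lift_Suc_mono_le[rotated]) (use * in \<open>meson le_trans less_imp_le\<close>)
  show "1 \<le> a k" "a k < b k" by (fact *)+
  show lt: "k < m \<Longrightarrow> b k \<le> a m" using *(3)[of k] mono[of "Suc k" m] by (meson Suc_leI le_trans)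
  show "k \<le> m \<Longrightarrow> a k \<le> a m" by (rule mono)
  show "k \<le> m \<Longrightarrow> b k \<le> b m" using lt *(2)[of m] by (cases "k = m") auto
  show "k < a k"
  proof (induction k)
    case (Suc k)
    then show ?case using *(2,3)[of k] by linarith
  qed (use *(1)[of 0] in simp)
qed

lemma block_seq_subseq:
  assumes "block_seq a b" "strict_mono s" shows "block_seq (a \<circ> s) (b \<circ> s)"
  using block_seqD[OF assms(1)] strict_monoD[OF assms(2), OF lessI] unfolding block_seq_def by simp

lemma blocks_subseq: "blocks a b x \<Longrightarrow> blocks (a \<circ> s) (b \<circ> s) (x \<circ> s)"
  by (simp add: blocks_def)

lemma supp_sum_scaleR_subset:
  fixes x :: "'i \<Rightarrow> nat \<Rightarrow>\<^sub>0 real"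
  assumes "\<And>k. k \<in> G \<Longrightarrow> supp (x k) \<subseteq> A" shows "supp (\<Sum>k\<in>G. c k *\<^sub>R x k) \<subseteq> A"
  by (rule order_trans[OF keys_sum UN_least]) (rule order_trans[OF keys_scaleR_subset assms])

lemma block_seq_combine:
  assumes "block_seq a b" "\<And>j. finite (G j) \<and> G j \<noteq> {}" "\<And>j. Max (G j) < Min (G (Suc j))"
  shows "block_seq (\<lambda>j. a (Min (G j))) (\<lambda>j. b (Max (G j)))"
proof -
  have "Min (G j) \<le> Max (G j)" for j using assms(2)[of j] by simp
  then show ?thesis using block_seqD[OF assms(1)] assms(3) unfolding block_seq_def
    by (metis le_less_trans less_le_trans)
qed

lemma blocks_combine:
  assumes "block_seq a b" "blocks a b x" "\<And>j. finite (G j) \<and> G j \<noteq> {}"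
  shows "blocks (\<lambda>j. a (Min (G j))) (\<lambda>j. b (Max (G j))) (\<lambda>j. \<Sum>k\<in>G j. c j k *\<^sub>R x k)"
  unfolding blocks_def
proof (intro allI supp_sum_scaleR_subset)
  fix j k assume "k \<in> G j"
  then have "Min (G j) \<le> k" "k \<le> Max (G j)" using assms(3)[of j] by auto
  then have "a (Min (G j)) \<le> a k" "b k \<le> b (Max (G j))" using block_seqD(4,5)[OF assms(1)] by auto
  then show "supp (x k) \<subseteq> {a (Min (G j))..<b (Max (G j))}"
    using assms(2) unfolding blocks_def by fastforce
qed

lemma blocks_pairing_eq_0:
  assumes "block_seq a b" "blocks a b x" "supp f \<subseteq> {a m..<b m}" "k \<noteq> m" shows "dual_pairing f (x k) = 0"
proof (rule dual_pairing_eq_0)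
  have "supp (x k) \<subseteq> {a k..<b k}" using assms(2) by (simp add: blocks_def)
  moreover have "b k \<le> a m \<or> b m \<le> a k" using block_seqD(3)[OF assms(1)] assms(4) by (meson neq_iff)
  ultimately show "supp f \<inter> supp (x k) = {}" using assms(3) by fastforce
qed

text \<open>The counterpart of \<open>fam_color_bound\<close>: families of order \<kappa> on blocks
  numbered within a range of length \<open>N\<close> join to one of order \<kappa> + 1 if all
  supports lie beyond \<open>N\<close>, because the number of the block can serve as the
  colour.\<close>

lemma fam_union:
  assumes fam: "\<And>k. k \<in> G \<Longrightarrow> fam n \<kappa> (L k) (\<beta> k)" and G: "G \<subseteq> {t..<t + N}"
    and sep: "\<And>k k' l l' i. k \<in> G \<Longrightarrow> k' \<in> G \<Longrightarrow> k < k' \<Longrightarrow> l \<in> L k \<Longrightarrow> l' \<in> L k' \<Longrightarrow>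
      l < l' \<and> before (\<beta> k l) (\<beta> k' l') \<and> (i \<in> supp (\<beta> k l) \<longrightarrow> i < l')"
    and N: "\<And>k l i. k \<in> G \<Longrightarrow> l \<in> L k \<Longrightarrow> i \<in> supp (\<beta> k l) \<Longrightarrow> N \<le> i"
    and \<gamma>: "\<And>k l. k \<in> G \<Longrightarrow> l \<in> L k \<Longrightarrow> \<gamma> l = \<beta> k l"
  shows "fam n (Suc \<kappa>) (\<Union>k\<in>G. L k) \<gamma>"
    and "(\<Sum>l\<in>(\<Union>k\<in>G. L k). dual_pairing (\<gamma> l) x) = (\<Sum>k\<in>G. \<Sum>l\<in>L k. dual_pairing (\<beta> k l) x)"
proof -
  let ?L = "\<Union>k\<in>G. L k"
  let ?F = "{Min (supp (\<gamma> l)) |l. l \<in> ?L \<and> \<gamma> l \<noteq> 0}"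
  have finG: "finite G" using G finite_subset by blast
  have fin: "finite ?L" using finG famD(1)[OF fam] by blast
  have ord: "before (\<gamma> l) (\<gamma> m) \<and> (\<forall>i\<in>supp (\<gamma> l). i < m)" if lm: "l \<in> ?L" "m \<in> ?L" "l < m" for l m
  proof -
    obtain k k' where k: "k \<in> G" "l \<in> L k" "k' \<in> G" "m \<in> L k'" using lm by blast
    consider "k < k'" | "k = k'" | "k' < k" by linarith
    then show ?thesis
    proof cases
      case 1
      then show ?thesis using sep[OF k(1,3) 1 k(2,4)] unfolding \<gamma>[OF k(1,2)] \<gamma>[OF k(3,4)] by blast
    next
      case 2
      then have m: "m \<in> L k" using k by simp
      then show ?thesis
        using famD(3)[OF fam[OF k(1)] k(2) m lm(3)] famD(4)[OF fam[OF k(1)] k(2) m lm(3)] \<gamma>[OF k(1,2)] \<gamma>[OF k(1) m] by simp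
    next
      case 3
      then show ?thesis using sep[OF k(3,1) 3 k(4,2)] lm by simp
    qed
  qed
  define K where "K m = (SOME k. k \<in> G \<and> (\<exists>l\<in>L k. \<gamma> l \<noteq> 0 \<and> m = Min (supp (\<gamma> l))))" for m
  have K: "K m \<in> G \<and> (\<exists>l\<in>L (K m). \<gamma> l \<noteq> 0 \<and> m = Min (supp (\<gamma> l)))" if m: "m \<in> ?F" for m
    unfolding K_def by (rule someI_ex) (use m in auto)
  have K_mono: "K m \<le> K m'" if m: "m \<in> ?F" "m' \<in> ?F" "m \<le> m'" for m m'
  proof (rule ccontr)
    assume "\<not> K m \<le> K m'"
    then have lt: "K m' < K m" by simp
    obtain l where l: "l \<in> L (K m)" "\<gamma> l \<noteq> 0" "m = Min (supp (\<gamma> l))" using K[OF m(1)] by blast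
    obtain l' where l': "l' \<in> L (K m')" "\<gamma> l' \<noteq> 0" "m' = Min (supp (\<gamma> l'))" using K[OF m(2)] by blast
    have kk: "K m' \<in> G" "K m \<in> G" using K[OF m(1)] K[OF m(2)] by blast+
    have "before (\<beta> (K m') l') (\<beta> (K m) l)" using sep[OF kk lt l'(1) l(1)] by blast
    then have "before (\<gamma> l') (\<gamma> l)" by (simp only: \<gamma>[OF kk(1) l'(1)] \<gamma>[OF kk(2) l(1)])
    then have "Min (supp (\<gamma> l')) < Min (supp (\<gamma> l))" using before_Max_Min(2) l l' by blast
    then show False using l l' m(3) by linarith
  qed
  have fib: "{m\<in>?F. K m - t = j} \<in> schreier0 \<kappa>" for j
  proof (cases "t + j \<in> G")
    case True
    have "{m\<in>?F. K m - t = j} \<subseteq> {Min (supp (\<beta> (t + j) l)) |l. l \<in> L (t + j) \<and> \<beta> (t + j) l \<noteq> 0}"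
    proof
      fix m assume "m \<in> {m\<in>?F. K m - t = j}"
      then have m: "m \<in> ?F" "K m - t = j" by simp_all
      have "K m \<in> {t..<t + N}" using K[OF m(1)] G by blast
      then have Km: "K m = t + j" using m(2) by auto
      obtain l where l: "l \<in> L (K m)" "\<gamma> l \<noteq> 0" "m = Min (supp (\<gamma> l))" using K[OF m(1)] by blast
      then show "m \<in> {Min (supp (\<beta> (t + j) l)) |l. l \<in> L (t + j) \<and> \<beta> (t + j) l \<noteq> 0}"
        using \<gamma>[OF True] unfolding Km by auto
    qed
    then show ?thesis by (rule schreier0_subset[OF famD(5)[OF fam[OF True]]])
  next
    case False
    have "K m - t \<noteq> j" if m: "m \<in> ?F" for m
    proof
      assume "K m - t = j"
      moreover have "K m \<in> {t..<t + N}" using K[OF m] G by blast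
      ultimately have "K m = t + j" by auto
      then show False using False K[OF m] by simp
    qed
    then have "{m\<in>?F. K m - t = j} = {}" by blast
    then show ?thesis by (simp only: schreier0_empty)
  qed
  have "block_coloring (\<lambda>G. G \<in> schreier0 \<kappa>) ?F (\<lambda>m. K m - t) N"
    unfolding block_coloring_def
  proof (intro conjI ballI impI allI)
    show "finite ?F" using fin by (rule finite_surj[of ?L _ "\<lambda>l. Min (supp (\<gamma> l))"]) auto
    show "K x - t \<le> K y - t" if "x \<in> ?F" "y \<in> ?F" "x \<le> y" for x y
      using K_mono[OF that] by simp
    fix m assume m: "m \<in> ?F"
    have "K m \<in> {t..<t + N}" using K[OF m] G by blast
    then show "K m - t < N" by auto
    obtain l where l: "l \<in> L (K m)" "\<gamma> l \<noteq> 0" "m = Min (supp (\<gamma> l))" using K[OF m] by blast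
    then have "m \<in> supp (\<beta> (K m) l)" using \<gamma>[OF conjunct1[OF K[OF m]] l(1)] by (metis Min_in finite_keys keys_eq_empty)
    then show "N \<le> m" using N[OF conjunct1[OF K[OF m]] l(1)] by blast
  qed (rule fib)
  then have "?F \<in> schreier0 (Suc \<kappa>)" unfolding schreier0_Suc by blast
  moreover have "avg n l (\<gamma> l)" if "l \<in> ?L" for l
    using that famD(2)[OF fam] \<gamma> by auto
  ultimately show "fam n (Suc \<kappa>) ?L \<gamma>" using fin ord unfolding fam_def by blast
  have "(\<Sum>l\<in>?L. dual_pairing (\<gamma> l) x) = (\<Sum>k\<in>G. \<Sum>l\<in>L k. dual_pairing (\<gamma> l) x)"
  proof (rule sum.UNION_disjoint[OF finG])
    show "\<forall>k\<in>G. finite (L k)" using famD(1)[OF fam] by blast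
    show "\<forall>k\<in>G. \<forall>k'\<in>G. k \<noteq> k' \<longrightarrow> L k \<inter> L k' = {}"
      using sep by (metis disjoint_iff less_irrefl neq_iff)
  qed
  then show "(\<Sum>l\<in>?L. dual_pairing (\<gamma> l) x) = (\<Sum>k\<in>G. \<Sum>l\<in>L k. dual_pairing (\<beta> k l) x)"
    using \<gamma> by simp
qed

text \<open>Nullness of order \<open>K\<close> made quantitative along a subsequence.
  \<open>B m\<close> bounds the earlier blocks, hence also the number of colours of a family of
  order \<open>K + 1\<close> that starts there. The factor \<open>B m + 1\<close> absorbs this
  number and leaves the summable 1/(m+1)^2.\<close>

definition fast :: "nat \<Rightarrow> nat \<Rightarrow> (nat \<Rightarrow> nat) \<Rightarrow> (nat \<Rightarrow> nat) \<Rightarrow> (nat \<Rightarrow> nat) \<Rightarrow> (nat \<Rightarrow> nat \<Rightarrow>\<^sub>0 real) \<Rightarrow> bool" where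
  "fast n K a b B x \<longleftrightarrow> (\<forall>k m. k < m \<longrightarrow> b k \<le> B m) \<and>
     (\<forall>m k L \<alpha>. m \<le> k \<longrightarrow> fam n K L \<alpha> \<longrightarrow> (\<forall>l\<in>L. a m \<le> l) \<longrightarrow>
        (\<Sum>l\<in>L. dual_pairing (\<alpha> l) (x k)) \<le> 1 / (real (m + 1) ^ 2 * real (B m + 1)))"

text \<open>Of the averages meeting block \<open>k\<close> only the smallest can have size below
  \<open>a k\<close>, since the later sizes exceed a coordinate of it inside the block. The others
  are bounded colour by colour with the estimate for sizes from \<open>a k\<close> on, the smallest
  one alone with the estimate for sizes from \<open>a m\<close> on.\<close>

lemma fast_tail:
  assumes "block_seq a b" "blocks a b x" "fast n K a b B x" and fam: "fam n (Suc K) L \<alpha>"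
    and l0: "l0 \<in> L" "i0 \<in> supp (\<alpha> l0)" "i0 \<le> B k"
    and M: "M \<subseteq> L" "m \<le> k" "\<And>l. l \<in> M \<Longrightarrow> a m \<le> l"
  shows "(\<Sum>l\<in>M. dual_pairing (\<alpha> l) (x k)) \<le> 1 / real (m + 1) ^ 2 + 1 / real (k + 1) ^ 2"
proof -
  define A where "A = {l\<in>M. supp (\<alpha> l) \<inter> {a k..<b k} \<noteq> {}}"
  have finM: "finite M" using famD(1)[OF fam] M(1) finite_subset by blast
  have eq: "(\<Sum>l\<in>M. dual_pairing (\<alpha> l) (x k)) = (\<Sum>l\<in>A. dual_pairing (\<alpha> l) (x k))"
  proof (rule sum.mono_neutral_right[OF finM])
    show "\<forall>l\<in>M - A. dual_pairing (\<alpha> l) (x k) = 0"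
      using assms(2) unfolding A_def blocks_def by (blast intro: dual_pairing_eq_0)
  qed (auto simp: A_def)
  show ?thesis
  proof (cases "A = {}")
    case True
    then show ?thesis unfolding eq by (simp add: add_nonneg_nonneg)
  next
    case False
    define l1 where "l1 = Min A"
    have finA: "finite A" using finM by (simp add: A_def)
    have l1: "l1 \<in> A" unfolding l1_def using False finA by simp
    have gt: "l1 < l" if "l \<in> A - {l1}" for l
      using that Min_le[OF finA, of l] unfolding l1_def by (metis DiffE insertI1 le_neq_implies_less)
    have l1L: "l1 \<in> L" using l1 M(1) by (auto simp: A_def)
    obtain i1 where i1: "i1 \<in> supp (\<alpha> l1)" "a k \<le> i1" using l1 by (auto simp: A_def)
    have big: "a k \<le> l" if "l \<in> A - {l1}" for l
    proof -
      have "l \<in> L" using that M(1) by (auto simp: A_def)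
      then have "i1 < l" using famD(4)[OF fam l1L _ gt[OF that] i1(1)] by blast
      then show ?thesis using i1(2) by simp
    qed
    have "(\<Sum>l\<in>A - {l1}. dual_pairing (\<alpha> l) (x k)) \<le> real (B k) * (1 / (real (k + 1) ^ 2 * real (B k + 1)))"
    proof (rule fam_color_bound[OF fam])
      show "A - {l1} \<subseteq> L" using M(1) by (auto simp: A_def)
      fix K' assume "K' \<subseteq> A - {l1}" "fam n K K' \<alpha>"
      then show "(\<Sum>l\<in>K'. dual_pairing (\<alpha> l) (x k)) \<le> 1 / (real (k + 1) ^ 2 * real (B k + 1))"
        using assms(3) big unfolding fast_def by blast
    qed (use l0 in auto)
    also have "\<dots> \<le> 1 / real (k + 1) ^ 2"
      by (simp add: divide_simps)
    finally have "(\<Sum>l\<in>A - {l1}. dual_pairing (\<alpha> l) (x k)) \<le> 1 / real (k + 1) ^ 2" .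
    moreover have "dual_pairing (\<alpha> l1) (x k) \<le> 1 / real (m + 1) ^ 2"
    proof -
      have "fam n K {l1} \<alpha>" using famD(2)[OF fam l1L] by (rule fam_single)
      moreover have "\<forall>l\<in>{l1}. a m \<le> l" using M(3) l1 by (simp add: A_def)
      ultimately have "(\<Sum>l\<in>{l1}. dual_pairing (\<alpha> l) (x k)) \<le> 1 / (real (m + 1) ^ 2 * real (B m + 1))"
        using assms(3) M(2) unfolding fast_def by blast
      also have "\<dots> \<le> 1 / real (m + 1) ^ 2"
        by (intro divide_left_mono) (auto simp: mult_le_cancel_left1)
      finally show ?thesis by simp
    qed
    moreover have "(\<Sum>l\<in>A. dual_pairing (\<alpha> l) (x k)) = dual_pairing (\<alpha> l1) (x k) + (\<Sum>l\<in>A - {l1}. dual_pairing (\<alpha> l) (x k))"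
      using finA l1 by (simp add: sum.remove)
    ultimately show ?thesis unfolding eq by linarith
  qed
qed

text \<open>\<Theta> stands for a property found arbitrarily far out: given the bound
  \<open>B\<close> reached so far, it holds at the chosen index and produces a bound
  \<open>B'\<close> that the next choice has to respect. The decay of the errors is arranged in the
  same choice.\<close>

lemma fast_subseq:
  assumes "block_seq a b" "null n K x"
    and err: "\<And>\<epsilon>. 0 < \<epsilon> \<Longrightarrow> \<exists>i0. \<forall>i\<ge>i0. err i \<le> (\<epsilon>::real)"
    and freq: "\<And>B j. \<exists>i\<ge>j. \<exists>B'. \<Theta> B i B'"
  obtains s B where "strict_mono s" "fast n K (a \<circ> s) (b \<circ> s) B (x \<circ> s)"
    "\<forall>k. err (s k) \<le> 1 / real (k + 1) ^ 2" "\<forall>k. \<exists>B'\<le>B (Suc k). \<Theta> (B k) (s k) B'" "\<forall>k. k \<le> B k"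
proof -
  define Q where "Q k B i \<longleftrightarrow> err i \<le> 1 / real (k + 1) ^ 2 \<and> (\<forall>i'\<ge>i. \<forall>L \<alpha>. fam n K L \<alpha> \<longrightarrow> (\<forall>l\<in>L. a i \<le> l) \<longrightarrow>
        (\<Sum>l\<in>L. dual_pairing (\<alpha> l) (x i')) \<le> 1 / (real (k + 1) ^ 2 * real (B + 1)))" for k B i
  have step: "\<exists>i>m. Q k B i \<and> (\<exists>B'. \<Theta> B i B')" for k B m
  proof -
    let ?\<eta> = "1 / (real (k + 1) ^ 2 * real (B + 1))"
    have pos: "0 < ?\<eta>" by simp
    obtain j i where ji: "\<forall>i'\<ge>i. \<forall>L \<alpha>. fam n K L \<alpha> \<longrightarrow> (\<forall>l\<in>L. j \<le> l) \<longrightarrow>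
     (\<Sum>l\<in>L. dual_pairing (\<alpha> l) (x i')) < ?\<eta>" using assms(2) pos unfolding null_def by meson
    obtain i0 where i0: "\<forall>i\<ge>i0. err i \<le> 1 / real (k + 1) ^ 2" using err[of "1 / real (k + 1) ^ 2"] by auto
    obtain i1 B' where i1: "i1 \<ge> max (max i j) (max i0 (Suc m))" "\<Theta> B i1 B'" using freq by blast
    have "a i1 \<ge> j" using block_seqD(6)[OF assms(1), of i1] i1(1) by linarith
    have "Q k B i1" unfolding Q_def
    proof (intro conjI allI impI)
      show "err i1 \<le> 1 / real (k + 1) ^ 2" using i0 i1(1) by simp
      fix i' L \<alpha> assume *: "i1 \<le> i'" "fam n K L \<alpha>" "\<forall>l\<in>L. a i1 \<le> l"
      have "i \<le> i'" using * i1(1) by simp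
      moreover have "j \<le> l" if "l \<in> L" for l using * that \<open>a i1 \<ge> j\<close> by fastforce
      ultimately show "(\<Sum>l\<in>L. dual_pairing (\<alpha> l) (x i')) \<le> ?\<eta>" using ji *(2) by (meson less_imp_le)
    qed
    moreover have "m < i1" using i1(1) by simp
    ultimately show ?thesis using i1(2) by blast
  qed
  \<comment> \<open>The state consists of an index, the bound in force when it was chosen, and the
    bound handed on to the next choice.\<close>
  define PP where "PP k p \<longleftrightarrow> (case p of (i, B, B') \<Rightarrow> Q k B i \<and> (\<exists>B''\<le>B'. \<Theta> B i B'') \<and> b i \<le> B' \<and> B < B' \<and> k \<le> B)" for k p
  define QQ where "QQ p q \<longleftrightarrow> (case p of (i :: nat, B :: nat, B' :: nat) \<Rightarrow> case q of (i', C, C' :: nat) \<Rightarrow> i < i' \<and> C = B')" for p q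
  have "\<exists>f. \<forall>k. PP k (f k) \<and> QQ (f k) (f (Suc k))"
  proof (rule dependent_nat_choice)
    obtain i B' where "Q 0 0 i" "\<Theta> 0 i B'" using step[of 0 0 0] by blast
    then show "\<exists>p. PP 0 p"
      unfolding PP_def by (intro exI[of _ "(i, 0, Suc (max B' (b i)))"]) (auto intro!: exI[of _ B'])
  next
    fix p k
    assume p: "PP k p"
    obtain i B B' where pe: "p = (i, B, B')" by (cases p) auto
    obtain i' C where iC: "i' > i" "Q (Suc k) B' i'" "\<Theta> B' i' C" using step[of i "Suc k" B'] by blast
    have "PP (Suc k) (i', B', Suc (max B' (max C (b i'))))" "QQ p (i', B', Suc (max B' (max C (b i'))))"
      using p iC unfolding pe PP_def QQ_def by (auto intro!: exI[of _ C])
    then show "\<exists>q. PP (Suc k) q \<and> QQ p q" by blast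
  qed
  then obtain f where F: "\<forall>k. PP k (f k) \<and> QQ (f k) (f (Suc k))" by blast
  have f: "PP k (f k)" "QQ (f k) (f (Suc k))" for k using F by blast+
  define s B where "s k = fst (f k)" and "B k = fst (snd (f k))" for k
  have BS: "snd (snd (f k)) = B (Suc k)" "s k < s (Suc k)" for k
    using f(2)[of k] by (auto simp: QQ_def s_def B_def split: prod.splits)
  have fk: "Q k (B k) (s k)" "\<exists>B'\<le>B (Suc k). \<Theta> (B k) (s k) B'" "b (s k) \<le> B (Suc k)" "B k < B (Suc k)" "k \<le> B k" for k
    using f(1)[of k] BS(1)[of k] by (auto simp: PP_def s_def B_def split: prod.splits)
  have s: "strict_mono s" using BS(2) by (simp add: strict_mono_Suc_iff)
  have Bmono: "B k \<le> B m" if "k \<le> m" for k m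
    using that by (rule lift_Suc_mono_le[rotated]) (simp add: fk(4) less_imp_le)
  have "fast n K (a \<circ> s) (b \<circ> s) B (x \<circ> s)"
    unfolding fast_def comp_def
  proof (intro conjI allI impI)
    show "b (s k) \<le> B m" if "k < m" for k m
      using fk(3)[of k] Bmono[of "Suc k" m] that by linarith
    fix m k L \<alpha> assume "m \<le> k" "fam n K L \<alpha>" "\<forall>l\<in>L. a (s m) \<le> l"
    moreover have "s m \<le> s k" using s \<open>m \<le> k\<close> by (simp add: strict_mono_less_eq)
    ultimately show "(\<Sum>l\<in>L. dual_pairing (\<alpha> l) (x (s k))) \<le> 1 / ((real (m + 1))\<^sup>2 * real (B m + 1))"
      using fk(1)[of m] unfolding Q_def by blast
  qed
  then show thesis using that[of s B] s fk unfolding Q_def by blast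
qed

section \<open>Averages of fast blocks\<close>

locale operator_on_X01 =
  fixes n :: nat and J :: "(nat \<Rightarrow>\<^sub>0 real) \<Rightarrow> 'a::banach" and Y :: "'a set" and S :: "'a \<Rightarrow> 'a"
  assumes n: "1 \<le> n" and J: "linear J" and norm_J: "\<And>x. x \<in> c00 \<Longrightarrow> norm (J x) = norm01 n x"
    and Y: "subspace Y" and S: "bounded_operator_on Y S"
begin

lemma S_in: "v \<in> Y \<Longrightarrow> S v \<in> Y"
  using S by (auto simp: bounded_operator_on_def)

lemma S_sum:
  assumes "\<And>k. k \<in> G \<Longrightarrow> X k \<in> Y"
  shows "S (\<Sum>k\<in>G. c k *\<^sub>R X k) = (\<Sum>k\<in>G. c k *\<^sub>R S (X k))"
proof -
  have S0: "S 0 = 0"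
    using S subspace_0[OF Y] by (metis bounded_operator_on_def scaleR_zero_left)
  show ?thesis
    using assms
  proof (induction G rule: infinite_finite_induct)
    case (insert k G)
    then have "(\<Sum>k\<in>G. c k *\<^sub>R X k) \<in> Y" "c k *\<^sub>R X k \<in> Y"
      using Y by (auto intro!: subspace_sum subspace_scale)
    then have "S (c k *\<^sub>R X k + (\<Sum>k\<in>G. c k *\<^sub>R X k)) = c k *\<^sub>R S (X k) + S (\<Sum>k\<in>G. c k *\<^sub>R X k)"
      using S insert.prems unfolding bounded_operator_on_def by (metis insertI1)
    then show ?case using insert by simp
  qed (simp_all add: S0)
qed

definition err :: "(nat \<Rightarrow> nat \<Rightarrow>\<^sub>0 real) \<Rightarrow> (nat \<Rightarrow> nat \<Rightarrow>\<^sub>0 real) \<Rightarrow> (nat \<Rightarrow> 'a) \<Rightarrow> nat \<Rightarrow> real" where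
  "err x y X k = norm (X k - J (x k)) + norm (S (X k) - J (y k))"

text \<open>The blocks \<open>x\<close> and \<open>y\<close> carry the estimates, the vectors
  \<open>X\<close> in \<open>Y\<close> carry the operator. Vectors and images share their intervals,
  so a linear combination is controlled on both sides at once.\<close>

definition approx where
  "approx a b x y X \<longleftrightarrow> block_seq a b \<and> blocks a b x \<and> blocks a b y \<and> (\<forall>k. X k \<in> Y) \<and> err x y X \<longlonglongrightarrow> 0"

lemma err_nonneg: "0 \<le> err x y X k"
  by (simp add: err_def)

lemma norm_sum_diff_J_le: "norm ((\<Sum>k\<in>G. c k *\<^sub>R X k) - J (\<Sum>k\<in>G. c k *\<^sub>R x k)) \<le> (\<Sum>k\<in>G. \<bar>c k\<bar> * norm (X k - J (x k)))"
proof -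
  have "(\<Sum>k\<in>G. c k *\<^sub>R X k) - J (\<Sum>k\<in>G. c k *\<^sub>R x k) = (\<Sum>k\<in>G. c k *\<^sub>R (X k - J (x k)))"
    using J by (simp add: linear_sum linear_scale scaleR_diff_right sum_subtractf)
  then show ?thesis by (simp add: sum_norm_le)
qed

lemma err_combine_le:
  assumes "\<And>k. k \<in> G \<Longrightarrow> X k \<in> Y"
  shows "norm ((\<Sum>k\<in>G. c k *\<^sub>R X k) - J (\<Sum>k\<in>G. c k *\<^sub>R x k)) + norm (S (\<Sum>k\<in>G. c k *\<^sub>R X k) - J (\<Sum>k\<in>G. c k *\<^sub>R y k))
    \<le> (\<Sum>k\<in>G. \<bar>c k\<bar> * err x y X k)"
proof -
  have "(\<Sum>k\<in>G. \<bar>c k\<bar> * err x y X k) = (\<Sum>k\<in>G. \<bar>c k\<bar> * norm (X k - J (x k))) + (\<Sum>k\<in>G. \<bar>c k\<bar> * norm (S (X k) - J (y k)))"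
    by (simp add: err_def distrib_left sum.distrib)
  then show ?thesis
    using norm_sum_diff_J_le[of c X G x] norm_sum_diff_J_le[of c "\<lambda>k. S (X k)" G y] S_sum[of G X c] assms by simp
qed

lemma approx_combine:
  assumes "approx a b x y X" "\<And>j. finite (G j) \<and> G j \<noteq> {}" "\<And>j. Max (G j) < Min (G (Suc j))"
    and lim: "(\<lambda>j. \<Sum>k\<in>G j. \<bar>c j k\<bar> * err x y X k) \<longlonglongrightarrow> 0"
  shows "approx (\<lambda>j. a (Min (G j))) (\<lambda>j. b (Max (G j))) (\<lambda>j. \<Sum>k\<in>G j. c j k *\<^sub>R x k)
    (\<lambda>j. \<Sum>k\<in>G j. c j k *\<^sub>R y k) (\<lambda>j. \<Sum>k\<in>G j. c j k *\<^sub>R X k)"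
proof -
  have X: "X k \<in> Y" for k using assms(1) by (simp add: approx_def)
  have "err (\<lambda>j. \<Sum>k\<in>G j. c j k *\<^sub>R x k) (\<lambda>j. \<Sum>k\<in>G j. c j k *\<^sub>R y k) (\<lambda>j. \<Sum>k\<in>G j. c j k *\<^sub>R X k) \<longlonglongrightarrow> 0"
  proof (rule Lim_null_comparison[OF always_eventually lim], rule allI)
    fix j
    show "norm (err (\<lambda>j. \<Sum>k\<in>G j. c j k *\<^sub>R x k) (\<lambda>j. \<Sum>k\<in>G j. c j k *\<^sub>R y k) (\<lambda>j. \<Sum>k\<in>G j. c j k *\<^sub>R X k) j) \<le> (\<Sum>k\<in>G j. \<bar>c j k\<bar> * err x y X k)"
      using err_combine_le[of "G j" X "c j" x y] X by (simp add: err_def)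
  qed
  then show ?thesis
    using assms block_seq_combine[of a b G] blocks_combine[of a b _ G c] X Y
    unfolding approx_def by (simp add: subspace_sum subspace_scale)
qed

lemma approx_subseq:
  assumes "approx a b x y X" "strict_mono s" shows "approx (a \<circ> s) (b \<circ> s) (x \<circ> s) (y \<circ> s) (X \<circ> s)"
proof -
  have "err (x \<circ> s) (y \<circ> s) (X \<circ> s) = err x y X \<circ> s" by (auto simp: err_def)
  then show ?thesis
    using assms block_seq_subseq blocks_subseq LIMSEQ_subseq_LIMSEQ[of "err x y X" 0 s] by (auto simp: approx_def)
qed

text \<open>Windows of length \<open>j + 1\<close> starting at (j+1)^2: they are successive, they
  start no earlier than at their own length, as \<open>fam_union\<close> demands, and errors bounded
  by 1/(k+1)^2 have sums over the windows that tend to zero.\<close>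

definition win :: "nat \<Rightarrow> nat set" where "win j = {(j + 1)\<^sup>2..<(j + 1)\<^sup>2 + (j + 1)}"

lemma win: "finite (win j) \<and> win j \<noteq> {}" "card (win j) = j + 1" "Min (win j) = (j + 1)\<^sup>2"
    "Max (win j) = (j + 1)\<^sup>2 + j" "Max (win j) < Min (win (Suc j))" "k \<in> win j \<Longrightarrow> (j + 1)\<^sup>2 \<le> k"
proof -
  show "finite (win j) \<and> win j \<noteq> {}" "card (win j) = j + 1" by (auto simp: win_def)
  show M: "Min (win j) = (j + 1)\<^sup>2" for j by (rule Min_eqI) (auto simp: win_def)
  show M': "Max (win j) = (j + 1)\<^sup>2 + j" by (rule Max_eqI) (auto simp: win_def)
  show "Max (win j) < Min (win (Suc j))" unfolding M M' by (simp add: power2_eq_square)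
qed (auto simp: win_def)

lemma win_ge: "k \<in> win j \<Longrightarrow> j + 1 \<le> k"
  using win(6)[of k j] by (simp add: power2_eq_square)

lemma win_err_null:
  assumes "\<And>k. e k \<le> 1 / real (k + 1) ^ 2" "\<And>k. 0 \<le> e k" "\<And>j k. \<bar>c j k\<bar> \<le> 1"
  shows "(\<lambda>j. \<Sum>k\<in>win j. \<bar>c j k\<bar> * e k) \<longlonglongrightarrow> 0"
proof (rule Lim_null_comparison[of _ "\<lambda>j. inverse (real (Suc j))"])
  show "\<forall>\<^sub>F j in sequentially. norm (\<Sum>k\<in>win j. \<bar>c j k\<bar> * e k) \<le> inverse (real (Suc j))"
  proof (intro always_eventually allI)
    fix j
    have "\<bar>c j k\<bar> * e k \<le> 1 / real (j + 1) ^ 2" if k: "k \<in> win j" for k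
    proof -
      have "\<bar>c j k\<bar> * e k \<le> 1 * e k" using assms by (intro mult_right_mono) auto
      also have "\<dots> \<le> 1 / real (k + 1) ^ 2" using assms(1) by simp
      also have "\<dots> \<le> 1 / real (j + 1) ^ 2"
        using win_ge[OF k] by (intro divide_left_mono power_mono mult_pos_pos) auto
      finally show ?thesis .
    qed
    then have "(\<Sum>k\<in>win j. \<bar>c j k\<bar> * e k) \<le> (\<Sum>k\<in>win j. 1 / real (j + 1) ^ 2)" by (rule sum_mono)
    also have "\<dots> = inverse (real (Suc j))" using win(2)[of j] by (simp add: power2_eq_square divide_simps)
    finally show "norm (\<Sum>k\<in>win j. \<bar>c j k\<bar> * e k) \<le> inverse (real (Suc j))"
      using assms(2) by (simp add: sum_nonneg)
  qed
qed (rule LIMSEQ_inverse_real_of_nat)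

lemma approx_err_small: "approx a b x y X \<Longrightarrow> 0 < \<epsilon> \<Longrightarrow> \<exists>i0. \<forall>i\<ge>i0. err x y X i \<le> \<epsilon>"
proof -
  assume "approx a b x y X" "0 < \<epsilon>"
  then have "\<forall>\<^sub>F i in sequentially. err x y X i < \<epsilon>"
    unfolding approx_def by (auto dest: order_tendstoD(2))
  then show ?thesis unfolding eventually_sequentially by (meson less_imp_le)
qed

lemma norm01_average_le:
  assumes "\<And>k. norm01 n (x k) \<le> C" "finite G" "G \<noteq> {}"
  shows "norm01 n (\<Sum>k\<in>G. (1 / real (card G)) *\<^sub>R x k) \<le> C"
proof (rule norm01_le)
  fix f assume f: "f \<in> W0 n"
  have "dual_pairing f (x k) \<le> C" for k using W0_le_norm01[OF f, of "x k"] assms(1)[of k] by linarith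
  then have "(\<Sum>k\<in>G. dual_pairing f (x k)) \<le> real (card G) * C" using sum_bounded_above[of G _ C] by simp
  then show "dual_pairing f (\<Sum>k\<in>G. (1 / real (card G)) *\<^sub>R x k) \<le> C"
    using assms(2,3) by (simp add: dual_pairing_sum dual_pairing_scaleR divide_simps card_gt_0_iff mult.commute flip: sum_divide_distrib)
qed

text \<open>Only the first block met by the family can contribute as much as \<open>C\<close>, and
  averaging divides this by \<open>j + 1\<close>. The family starts before every later block of the
  window, so \<open>fast_tail\<close> applies there.\<close>

lemma fast_average_bound:
  assumes bs: "block_seq a b" "blocks a b x" and fast: "fast n K a b B x" and K: "Suc K \<le> n"
    and C: "\<And>k. norm01 n (x k) \<le> C"
    and fam: "fam n (Suc K) L \<alpha>" and m: "m \<le> j" "\<And>l. l \<in> L \<Longrightarrow> a m \<le> l"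
  shows "(\<Sum>l\<in>L. dual_pairing (\<alpha> l) (\<Sum>k\<in>win j. (1 / real (j + 1)) *\<^sub>R x k)) \<le> C / real (j + 1) + 2 / real (m + 1) ^ 2"
proof -
  let ?D = "\<lambda>k. \<Sum>l\<in>L. dual_pairing (\<alpha> l) (x k)"
  have C0: "0 \<le> C" using C[of 0] norm01_nonneg[of n "x 0"] by linarith
  have D_le: "?D k \<le> C" for k
    using fam_sum_le[OF fam K, of "x k"] C[of k] by linarith
  have "(\<Sum>k\<in>win j. ?D k) \<le> C + real (j + 1) * (2 / real (m + 1) ^ 2)"
  proof (cases "\<exists>k\<in>win j. \<exists>l\<in>L. supp (\<alpha> l) \<inter> {a k..<b k} \<noteq> {}")
    case False
    have "?D k = 0" if k: "k \<in> win j" for k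
      using False bs(2) k unfolding blocks_def by (intro sum.neutral ballI dual_pairing_eq_0) blast
    then show ?thesis using C0 by simp
  next
    case True
    define k0 where "k0 = (LEAST k. k \<in> win j \<and> (\<exists>l\<in>L. supp (\<alpha> l) \<inter> {a k..<b k} \<noteq> {}))"
    have k0: "k0 \<in> win j" "\<exists>l\<in>L. supp (\<alpha> l) \<inter> {a k0..<b k0} \<noteq> {}"
      unfolding k0_def using LeastI_ex[of "\<lambda>k. k \<in> win j \<and> (\<exists>l\<in>L. supp (\<alpha> l) \<inter> {a k..<b k} \<noteq> {})"] True by blast+
    obtain l0 i0 where l0: "l0 \<in> L" "i0 \<in> supp (\<alpha> l0)" "i0 < b k0" using k0(2) by fastforce
    have D0: "?D k \<le> 2 / real (m + 1) ^ 2" if k: "k \<in> win j - {k0}" for k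
    proof (cases "k < k0")
      case True
      then have "\<not> (\<exists>l\<in>L. supp (\<alpha> l) \<inter> {a k..<b k} \<noteq> {})"
        using not_less_Least[of k] k unfolding k0_def by blast
      then have "?D k = 0"
        using bs(2) unfolding blocks_def by (intro sum.neutral ballI dual_pairing_eq_0) blast
      then show ?thesis by simp
    next
      case False
      then have lt: "k0 < k" using k by auto
      then have "b k0 \<le> B k" using fast by (simp add: fast_def)
      then have i0: "i0 \<le> B k" using l0(3) by simp
      have mk: "m \<le> k" using win_ge[of k j] k m(1) by auto
      have "?D k \<le> 1 / real (m + 1) ^ 2 + 1 / real (k + 1) ^ 2"
        using fast_tail[OF bs fast fam l0(1,2) i0 subset_refl mk] m(2) by blast
      also have "1 / real (k + 1) ^ 2 \<le> 1 / real (m + 1) ^ 2"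
        using mk by (intro divide_left_mono power_mono mult_pos_pos) auto
      finally show ?thesis by simp
    qed
    have "(\<Sum>k\<in>win j. ?D k) = ?D k0 + (\<Sum>k\<in>win j - {k0}. ?D k)"
      using win(1)[of j] k0(1) by (simp add: sum.remove)
    also have "(\<Sum>k\<in>win j - {k0}. ?D k) \<le> (\<Sum>k\<in>win j - {k0}. 2 / real (m + 1) ^ 2)"
      by (rule sum_mono) (rule D0)
    also have "\<dots> \<le> real (j + 1) * (2 / real (m + 1) ^ 2)"
      using win(1,2)[of j] k0(1) by (simp add: card_Diff_singleton mult_right_mono divide_right_mono)
    finally show ?thesis using D_le[of k0] by simp
  qed
  moreover have "(\<Sum>l\<in>L. dual_pairing (\<alpha> l) (\<Sum>k\<in>win j. (1 / real (j + 1)) *\<^sub>R x k)) = (1 / real (j + 1)) * (\<Sum>k\<in>win j. ?D k)"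
    unfolding dual_pairing_sum dual_pairing_scaleR sum.swap[of _ "win j" L] by (simp add: sum_distrib_left)
  moreover have "(1 / N) * T \<le> C / N + e" if "T \<le> C + N * e" "0 < N" for N T e :: real
    using that by (simp add: field_simps)
  ultimately show ?thesis by simp
qed

text \<open>Averaging over windows makes the contribution of the first block met small, so
  \<open>x\<close> gains one order of nullness. On the \<open>y\<close> side the witnesses of order
  \<open>K + 1\<close> from all blocks of a window join to one of order \<open>K + 2\<close>, and
  the average keeps their common lower bound.\<close>

lemma step_up:
  assumes app: "approx a b x y X" and C: "\<And>k. norm01 n (x k) \<le> C"
    and null: "null n K x" and nn: "\<not> null n (Suc K) y" and K: "Suc K \<le> n"
  obtains a' b' x' y' X' where "approx a' b' x' y' X'" "\<And>k. norm01 n (x' k) \<le> C"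
    "null n (Suc K) x'" "\<not> null n (Suc (Suc K)) y'"
proof -
  have bs: "block_seq a b" using app by (simp add: approx_def)
  obtain \<epsilon> where eps: "0 < \<epsilon>" and freq: "\<forall>j i. \<exists>i'\<ge>i. \<exists>L \<alpha>. fam n (Suc K) L \<alpha> \<and> (\<forall>l\<in>L. j \<le> l) \<and>
     \<epsilon> \<le> (\<Sum>l\<in>L. dual_pairing (\<alpha> l) (y i'))" using nn unfolding not_null_iff by blast
  \<comment> \<open>The sizes of a witness lie in \<open>(B, B']\<close>. Thus witnesses on
    different blocks use disjoint sets of sizes, and the sizes on a block exceed all coordinates of
    the blocks before it.\<close>
  define \<Theta> where "\<Theta> B i B' \<longleftrightarrow> (\<exists>L \<beta>. fam n (Suc K) L \<beta> \<and> (\<forall>l\<in>L. B < l \<and> l \<le> B') \<and> \<epsilon> \<le> (\<Sum>l\<in>L. dual_pairing (\<beta> l) (y i)))" for B i B'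
  have fr: "\<exists>i\<ge>j. \<exists>B'. \<Theta> B i B'" for B j
  proof -
    obtain i L \<alpha> where *: "i \<ge> j" "fam n (Suc K) L \<alpha>" "\<forall>l\<in>L. Suc B \<le> l" "\<epsilon> \<le> (\<Sum>l\<in>L. dual_pairing (\<alpha> l) (y i))"
      using freq by blast
    have "\<forall>l\<in>L. B < l \<and> l \<le> Max L" using *(3) famD(1)[OF *(2)] by (auto simp: Suc_le_eq)
    then show ?thesis using * unfolding \<Theta>_def by blast
  qed
  obtain s B where s: "strict_mono s" "fast n K (a \<circ> s) (b \<circ> s) B (x \<circ> s)"
    "\<And>k. err x y X (s k) \<le> 1 / real (k + 1) ^ 2" "\<And>k. \<exists>B'\<le>B (Suc k). \<Theta> (B k) (s k) B'" "\<And>k. k \<le> B k"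
    using fast_subseq[where \<Theta> = \<Theta>, OF bs null approx_err_small[OF app] fr] by metis
  define A Bb x1 y1 X1 where defs: "A = a \<circ> s" "Bb = b \<circ> s" "x1 = x \<circ> s" "y1 = y \<circ> s" "X1 = X \<circ> s"
  have app1: "approx A Bb x1 y1 X1" unfolding defs using approx_subseq[OF app s(1)] .
  then have bs1: "block_seq A Bb" "blocks A Bb x1" "blocks A Bb y1" by (auto simp: approx_def)
  have fast: "fast n K A Bb B x1" using s(2) by (simp add: defs)
  have err1: "err x1 y1 X1 k \<le> 1 / real (k + 1) ^ 2" for k using s(3)[of k] by (simp add: err_def defs)
  have C1: "norm01 n (x1 k) \<le> C" for k using C by (simp add: defs)
  have "\<forall>k. \<exists>L \<beta>. fam n (Suc K) L \<beta> \<and> (\<forall>l\<in>L. B k < l \<and> l \<le> B (Suc k)) \<and> \<epsilon> \<le> (\<Sum>l\<in>L. dual_pairing (\<beta> l) (y1 k))"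
  proof
    fix k
    obtain B' L \<beta> where "B' \<le> B (Suc k)" "fam n (Suc K) L \<beta>" "\<forall>l\<in>L. B k < l \<and> l \<le> B'" "\<epsilon> \<le> (\<Sum>l\<in>L. dual_pairing (\<beta> l) (y1 k))"
      using s(4)[of k] unfolding \<Theta>_def defs by auto
    then show "\<exists>L \<beta>. fam n (Suc K) L \<beta> \<and> (\<forall>l\<in>L. B k < l \<and> l \<le> B (Suc k)) \<and> \<epsilon> \<le> (\<Sum>l\<in>L. dual_pairing (\<beta> l) (y1 k))"
      by (meson le_trans)
  qed
  then obtain L \<beta> where L: "\<And>k. fam n (Suc K) (L k) (\<beta> k)" "\<And>k l. l \<in> L k \<Longrightarrow> B k < l \<and> l \<le> B (Suc k)"
      "\<And>k. \<epsilon> \<le> (\<Sum>l\<in>L k. dual_pairing (\<beta> k l) (y1 k))" by metis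
  define \<beta>' where "\<beta>' k l = restr {A k..<Bb k} (\<beta> k l)" for k l
  have fam': "fam n (Suc K) (L k) (\<beta>' k)" for k unfolding \<beta>'_def by (rule fam_restr[OF L(1)])
  have val: "dual_pairing (\<beta>' k l) (y1 k) = dual_pairing (\<beta> k l) (y1 k)" for k l
    unfolding \<beta>'_def using bs1(3) by (intro dual_pairing_restr_left) (simp add: blocks_def)
  have supp': "supp (\<beta>' k l) \<subseteq> {A k..<Bb k}" for k l by (auto simp: \<beta>'_def supp_restr)
  have Bmono: "B k \<le> B k'" if "k \<le> k'" for k k'
  proof (rule lift_Suc_mono_le[OF _ that])
    fix k
    obtain l where "l \<in> L k" using L(3)[of k] eps by fastforce
    then show "B k \<le> B (Suc k)" using L(2)[of l k] by linarith
  qed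
  define x2 y2 X2 where d2: "x2 = (\<lambda>j. \<Sum>k\<in>win j. (1 / real (j + 1)) *\<^sub>R x1 k)"
    "y2 = (\<lambda>j. \<Sum>k\<in>win j. (1 / real (j + 1)) *\<^sub>R y1 k)" "X2 = (\<lambda>j. \<Sum>k\<in>win j. (1 / real (j + 1)) *\<^sub>R X1 k)"
  have app2: "approx (\<lambda>j. A (Min (win j))) (\<lambda>j. Bb (Max (win j))) x2 y2 X2"
    unfolding d2 by (rule approx_combine[OF app1 win(1) win(5) win_err_null[OF err1 err_nonneg]]) simp
  have C2: "norm01 n (x2 j) \<le> C" for j
    using norm01_average_le[OF C1, of "win j"] win(1,2)[of j] by (simp add: d2)
  have null2: "null n (Suc K) x2"
    unfolding null_def
  proof (intro allI impI)
    fix e :: real assume e: "0 < e"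
    obtain m where m: "4 / e < real m" using reals_Archimedean2 by blast
    obtain i where i: "4 * \<bar>C\<bar> / e < real i" using reals_Archimedean2 by blast
    show "\<exists>j i. \<forall>i'\<ge>i. \<forall>L \<alpha>. fam n (Suc K) L \<alpha> \<longrightarrow> (\<forall>l\<in>L. j \<le> l) \<longrightarrow> (\<Sum>l\<in>L. dual_pairing (\<alpha> l) (x2 i')) < e"
    proof (rule exI[of _ "A m"], rule exI[of _ "max i m"], intro allI impI)
      fix j La \<alpha> assume j: "max i m \<le> j" and fam: "fam n (Suc K) La \<alpha>" and la: "\<forall>l\<in>La. A m \<le> l"
      have "(\<Sum>l\<in>La. dual_pairing (\<alpha> l) (x2 j)) \<le> C / real (j + 1) + 2 / real (m + 1) ^ 2"
        unfolding d2 using j la by (intro fast_average_bound[OF bs1(1,2) fast K C1 fam]) auto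
      also have "C / real (j + 1) \<le> e / 4"
      proof -
        have "4 * \<bar>C\<bar> < e * real i" using i e by (simp add: divide_simps mult.commute)
        also have "\<dots> \<le> e * real (j + 1)" using j e by simp
        finally show ?thesis by (simp add: divide_simps mult.commute)
      qed
      also have "2 / real (m + 1) ^ 2 \<le> e / 2"
      proof -
        have "4 < e * real m" using m e by (simp add: divide_simps mult.commute)
        also have "\<dots> \<le> e * real (m + 1) ^ 2"
          using e by (simp add: power2_eq_square algebra_simps)
        finally show ?thesis by (simp add: divide_simps mult.commute)
      qed
      finally show "(\<Sum>l\<in>La. dual_pairing (\<alpha> l) (x2 j)) < e" using e by simp
    qed
  qed
  have "\<not> null n (Suc (Suc K)) y2"
  proof
    assume "null n (Suc (Suc K)) y2"
    then obtain j0 i0 where ji: "\<forall>i'\<ge>i0. \<forall>L \<alpha>. fam n (Suc (Suc K)) L \<alpha> \<longrightarrow> (\<forall>l\<in>L. j0 \<le> l) \<longrightarrow>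
       (\<Sum>l\<in>L. dual_pairing (\<alpha> l) (y2 i')) < \<epsilon>"
      using eps unfolding null_def by meson
    define j where "j = max i0 j0"
    \<comment> \<open>Well defined, because a size occurs on one block only.\<close>
    define \<gamma> where "\<gamma> l = \<beta>' (SOME k. l \<in> L k) l" for l
    have sep0: "l < l'" if "k < k'" "l \<in> L k" "l' \<in> L k'" for k k' l l'
      using L(2)[OF that(2)] L(2)[OF that(3)] Bmono[of "Suc k" k'] that(1) by linarith
    have \<gamma>: "\<gamma> l = \<beta>' k l" if l: "l \<in> L k" for k l
    proof -
      have "(SOME k. l \<in> L k) = k"
        using l sep0 by (metis (mono_tags, lifting) less_irrefl nat_neq_iff someI)
      then show ?thesis by (simp add: \<gamma>_def)
    qed
    have wsub: "win j \<subseteq> {(j + 1)\<^sup>2..<(j + 1)\<^sup>2 + (j + 1)}" by (simp add: win_def)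
    have sep: "l < l' \<and> before (\<beta>' k l) (\<beta>' k' l') \<and> (i \<in> supp (\<beta>' k l) \<longrightarrow> i < l')"
      if kk: "k < k'" "l \<in> L k" "l' \<in> L k'" for k k' l l' i
    proof (intro conjI impI)
      show "l < l'" using sep0[OF kk] .
      have bA: "Bb k \<le> A k'" using block_seqD(3)[OF bs1(1) kk(1)] .
      show "before (\<beta>' k l) (\<beta>' k' l')" unfolding before_iff
      proof (intro ballI)
        fix i j assume "i \<in> supp (\<beta>' k l)" "j \<in> supp (\<beta>' k' l')"
        then have "i < Bb k" "A k' \<le> j" using supp' by fastforce+
        then show "i < j" using bA by linarith
      qed
      assume "i \<in> supp (\<beta>' k l)"
      then have "i < Bb k" using supp' by fastforce
      moreover have "Bb k \<le> B k'" using fast kk(1) by (simp add: fast_def)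
      ultimately show "i < l'" using L(2)[OF kk(3)] by linarith
    qed
    have Nle: "j + 1 \<le> i" if k: "k \<in> win j" and i: "i \<in> supp (\<beta>' k l)" for k l i
    proof -
      have "A k \<le> i" using i supp' by fastforce
      then show ?thesis using win_ge[OF k] block_seqD(6)[OF bs1(1), of k] by linarith
    qed
    note un = fam_union[where G = "win j" and \<beta> = \<beta>' and L = L and \<gamma> = \<gamma> and n = n and \<kappa> = "Suc K", OF fam' wsub sep Nle \<gamma>]
    have "fam n (Suc (Suc K)) (\<Union>k\<in>win j. L k) \<gamma>" by (rule un(1)) auto
    moreover have "\<forall>l\<in>(\<Union>k\<in>win j. L k). j0 \<le> l"
    proof
      fix l assume "l \<in> (\<Union>k\<in>win j. L k)"
      then obtain k where k: "k \<in> win j" "l \<in> L k" by blast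
      then have "k < l" using L(2)[OF k(2)] s(5)[of k] by linarith
      then show "j0 \<le> l" using win_ge[OF k(1)] by (simp add: j_def)
    qed
    moreover have "i0 \<le> j" by (simp add: j_def)
    ultimately have "(\<Sum>l\<in>(\<Union>k\<in>win j. L k). dual_pairing (\<gamma> l) (y2 j)) < \<epsilon>"
      using ji by blast
    moreover have "(\<Sum>l\<in>(\<Union>k\<in>win j. L k). dual_pairing (\<gamma> l) (y2 j)) = (\<Sum>k\<in>win j. \<Sum>l\<in>L k. dual_pairing (\<beta>' k l) (y2 j))"
      by (rule un(2)) auto
    moreover have "dual_pairing (\<beta>' k l) (y2 j) = (1 / real (j + 1)) * dual_pairing (\<beta> k l) (y1 k)" if k: "k \<in> win j" for k l
    proof -
      have "dual_pairing (\<beta>' k l) (y2 j) = (\<Sum>k'\<in>win j. (1 / real (j + 1)) * dual_pairing (\<beta>' k l) (y1 k'))"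
        by (simp add: d2 dual_pairing_sum dual_pairing_scaleR)
      also have "\<dots> = (\<Sum>k'\<in>{k}. (1 / real (j + 1)) * dual_pairing (\<beta>' k l) (y1 k'))"
        using k win(1)[of j] blocks_pairing_eq_0[OF bs1(1,3) supp'] by (intro sum.mono_neutral_right) auto
      finally show ?thesis using val by simp
    qed
    ultimately have "(\<Sum>k\<in>win j. (1 / real (j + 1)) * (\<Sum>l\<in>L k. dual_pairing (\<beta> k l) (y1 k))) < \<epsilon>"
      by (simp add: sum_distrib_left)
    moreover have "(\<Sum>k\<in>win j. (1 / real (j + 1)) * (\<Sum>l\<in>L k. dual_pairing (\<beta> k l) (y1 k))) \<ge> (\<Sum>k\<in>win j. (1 / real (j + 1)) * \<epsilon>)"
      by (intro sum_mono mult_left_mono L(3)) auto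
    ultimately show False using win(2)[of j] by simp
  qed
  then show thesis using that[OF app2 C2 null2] by blast
qed

end

section \<open>Plain sums over windows, for order \<open>n - 1\<close>\<close>

context operator_on_X01
begin

text \<open>The bound drops by 4/N with every block, and this drop pays for an induction over the
  functional. In a sum of averages consider the first block \<open>k0\<close> that is met and the
  first average \<open>l1\<close> meeting it. On the later blocks all other averages together cost
  2/N. If \<open>l1\<close> does not pass the end of \<open>k0\<close>, the only further cost is
  \<open>C\<close> for the vector \<open>x k0\<close>. Otherwise the other averages vanish on
  \<open>x k0\<close>, and at most one part of \<open>l1\<close> crosses the end of
  \<open>k0\<close>; its excess 4/N is divided by the size of \<open>l1\<close>, which is at least
  2. So 2/N + 2/N is all that this block costs.\<close>

lemma fast_tail_sum_bound:
  assumes bs: "block_seq a b" "blocks a b x" and fast: "fast n K a b B x" and K: "n = Suc K"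
    and C: "\<And>k. norm01 n (x k) \<le> C" and f: "f \<in> W0 n"
    and N: "N = real (j + 1)" and E: "E = (j + 1)\<^sup>2 + (j + 1)"
  shows "(j + 1)\<^sup>2 \<le> k \<Longrightarrow> dual_pairing f (\<Sum>k'\<in>{k..<E}. x k') \<le> C + 2 + (4 / N) * real (E - k)"
proof -
  define T where "T k = (\<Sum>k'\<in>{k..<E}. x k')" for k
  define \<beta> where "\<beta> k = C + 2 + (4 / N) * real (E - k)" for k
  have N1: "1 \<le> N" by (simp add: N)
  have C0: "0 \<le> C" using C[of 0] norm01_nonneg[of n "x 0"] by linarith
  have \<beta>C: "C + 2 \<le> \<beta> k" for k using N1 by (simp add: \<beta>_def)
  have \<beta>_mono: "\<beta> k' \<le> \<beta> k" if "k \<le> k'" for k k'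
    using that N1 by (auto simp: \<beta>_def divide_right_mono)
  have T_Suc: "T k = x k + T (Suc k)" if "k < E" for k
    using that unfolding T_def by (simp add: sum.atLeast_Suc_lessThan)
  have sx: "supp (x k) \<subseteq> {a k..<b k}" for k using bs(2) by (simp add: blocks_def)
  have le_C: "dual_pairing g (x k) \<le> C" if "g \<in> W0 n" for g k
    using W0_le_norm01[OF that, of "x k"] C[of k] by linarith
  have zero: "dual_pairing g (T k) = 0" if "\<And>k' i. k \<le> k' \<Longrightarrow> k' < E \<Longrightarrow> i \<in> supp g \<Longrightarrow> i \<notin> {a k'..<b k'}" for g k
    unfolding T_def dual_pairing_sum using sx that by (intro sum.neutral ballI dual_pairing_eq_0) fastforce
  have skip: "dual_pairing g (T k) = dual_pairing g (T k0)"
    if kk: "k \<le> k0" "k0 \<le> E" "\<And>k' i. k \<le> k' \<Longrightarrow> k' < k0 \<Longrightarrow> i \<in> supp g \<Longrightarrow> i \<notin> {a k'..<b k'}" for g k k0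
    unfolding T_def dual_pairing_sum
  proof (rule sum.mono_neutral_right)
    show "\<forall>i\<in>{k..<E} - {k0..<E}. dual_pairing g (x i) = 0"
      using sx kk(3) by (intro ballI dual_pairing_eq_0) fastforce
  qed (use kk in auto)
  have bE: "b k0 \<le> a k'" if "k0 < k'" for k0 k' using block_seqD(3)[OF bs(1) that] .
  have single: "dual_pairing g (T k) \<le> C" if g: "g \<in> W0 n" "supp g = {i}" for g k i
  proof (cases "\<exists>m. k \<le> m \<and> m < E \<and> i \<in> {a m..<b m}")
    case False
    then have "dual_pairing g (T k) = 0" using g by (intro zero) auto
    then show ?thesis using C0 by simp
  next
    case True
    then obtain m where m: "k \<le> m" "m < E" "i \<in> {a m..<b m}" by blast
    have "dual_pairing g (T k) = (\<Sum>k'\<in>{m}. dual_pairing g (x k'))"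
      unfolding T_def dual_pairing_sum
      using m g blocks_pairing_eq_0[OF bs, of g m] by (intro sum.mono_neutral_right) auto
    then show ?thesis using le_C[OF g(1), of m] by simp
  qed
  have "\<forall>k\<ge>(j + 1)\<^sup>2. dual_pairing f (T k) \<le> \<beta> k"
    using f
  proof (induction rule: W0_induct)
    case zero
    then show ?case using \<beta>C C0 by (auto intro: order_trans[OF _ \<beta>C])
  next
    case (unit i)
    have iW: "Poly_Mapping.single i 1 \<in> W0 n"
    proof -
      have "Poly_Mapping.single i 1 \<in> norming_level n 0" using unit by auto
      then show ?thesis unfolding W0_def norming_set_def by blast
    qed
    show ?case
    proof (intro allI impI)
      fix k show "dual_pairing (Poly_Mapping.single i 1) (T k) \<le> \<beta> k"
        using single[OF iW, of i k] \<beta>C[of k] by simp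
    qed
  next
    case (neg_unit i)
    have iW: "- Poly_Mapping.single i 1 \<in> W0 n"
    proof -
      have "- Poly_Mapping.single i 1 \<in> norming_level n 0" using neg_unit by auto
      then show ?thesis unfolding W0_def norming_set_def by blast
    qed
    show ?case
    proof (intro allI impI)
      fix k show "dual_pairing (- Poly_Mapping.single i 1) (T k) \<le> \<beta> k"
        using single[OF iW, of i k] \<beta>C[of k] by simp
    qed
  next
    case (average l R g \<alpha>)
    show ?case
    proof (intro allI impI)
      fix k assume k: "(j + 1)\<^sup>2 \<le> k"
      have "(\<Sum>r\<in>R. dual_pairing (g r) (T k)) \<le> real (card R) * \<beta> k"
        using average(4) k by (intro sum_bounded_above) auto
      also have "\<dots> \<le> real l * \<beta> k"
        using average(1) \<beta>C[of k] C0 by (intro mult_right_mono) (auto simp: avg_rep_def)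
      finally show "dual_pairing \<alpha> (T k) \<le> \<beta> k"
        using average(1) by (simp add: avg_rep_def dual_pairing_scaleR_left dual_pairing_sum_left divide_simps mult.commute)
    qed
  next
    case (sum L \<alpha>)
    note fam = sum(1)
    have \<alpha>W: "\<alpha> l \<in> W0 n" if "l \<in> L" for l using famD(2)[OF fam that] avg_W0 by blast
    show ?case
    proof (intro allI impI)
      fix k assume k: "(j + 1)\<^sup>2 \<le> k"
      show "dual_pairing (\<Sum>l\<in>L. \<alpha> l) (T k) \<le> \<beta> k"
      proof (cases "\<exists>k'. k \<le> k' \<and> k' < E \<and> (\<exists>l\<in>L. \<exists>i\<in>supp (\<alpha> l). i \<in> {a k'..<b k'})")
        case False
        then have "dual_pairing (\<alpha> l) (T k) = 0" if "l \<in> L" for l using that by (intro zero) blast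
        then have "dual_pairing (\<Sum>l\<in>L. \<alpha> l) (T k) = 0" by (simp add: dual_pairing_sum_left)
        then show ?thesis using \<beta>C[of k] C0 by simp
      next
        case True
        define k0 where "k0 = (LEAST k'. k \<le> k' \<and> k' < E \<and> (\<exists>l\<in>L. \<exists>i\<in>supp (\<alpha> l). i \<in> {a k'..<b k'}))"
        have k0: "k \<le> k0 \<and> k0 < E \<and> (\<exists>l\<in>L. \<exists>i\<in>supp (\<alpha> l). i \<in> {a k0..<b k0})"
          unfolding k0_def using True by (rule LeastI_ex)
        have least: "\<not> (\<exists>l\<in>L. \<exists>i\<in>supp (\<alpha> l). i \<in> {a k'..<b k'})" if "k \<le> k'" "k' < k0" for k'
          using not_less_Least[OF that(2)[unfolded k0_def]] that less_trans[OF that(2) conjunct1[OF conjunct2[OF k0]]] by blast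
        have eqk0: "dual_pairing (\<Sum>l\<in>L. \<alpha> l) (T k) = (\<Sum>l\<in>L. dual_pairing (\<alpha> l) (T k0))"
          unfolding dual_pairing_sum_left using least k0 by (intro sum.cong refl skip) auto
        define A where "A = {l\<in>L. \<exists>i\<in>supp (\<alpha> l). i \<in> {a k0..<b k0}}"
        define l1 where "l1 = Min A"
        have finL: "finite L" by (rule famD(1)[OF fam])
        have "l1 \<in> A" unfolding l1_def using k0 finL by (intro Min_in) (auto simp: A_def)
        then obtain i1 where l1: "l1 \<in> L" "i1 \<in> supp (\<alpha> l1)" "a k0 \<le> i1" "i1 < b k0" by (auto simp: A_def)
        have finA: "finite A" using finL by (simp add: A_def)
        have l1_min: "l \<notin> A" if "l < l1" for l
          using that Min_le[OF finA, of l] unfolding l1_def by linarith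
        have kk0: "j + 1 \<le> k0 + 1"
        proof -
          have "j + 1 \<le> (j + 1)\<^sup>2" by (simp add: power2_eq_square)
          then show ?thesis using k conjunct1[OF k0] by linarith
        qed
        have low: "dual_pairing (\<alpha> l) (x k') = 0" if l: "l \<in> L" "l < l1" "k0 \<le> k'" for l k'
        proof (rule dual_pairing_eq_0)
          show "supp (\<alpha> l) \<inter> supp (x k') = {}"
          proof (rule ccontr)
            assume "supp (\<alpha> l) \<inter> supp (x k') \<noteq> {}"
            then obtain i where i: "i \<in> supp (\<alpha> l)" "i \<in> {a k'..<b k'}" using sx by blast
            have lt: "i < i1" using famD(3)[OF fam l(1) l1(1) l(2)] i(1) l1(2) by (auto simp: before_iff)
            show False
            proof (cases "k' = k0")
              case True
              then show ?thesis using i l1_min[OF l(2)] l(1) by (auto simp: A_def)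
            next
              case False
              then have "b k0 \<le> a k'" using bE l(3) by simp
              then show ?thesis using lt i l1 by simp
            qed
          qed
        qed
        \<comment> \<open>Sizes after \<open>l1\<close> exceed a coordinate in block
          \<open>k0\<close>, so \<open>fast_tail\<close> gives at most 2/N^2 on each of at most
          \<open>N\<close> later blocks.\<close>
        have rest: "(\<Sum>l\<in>L - {l1}. dual_pairing (\<alpha> l) (T (Suc k0))) \<le> 2 / N"
        proof -
          have "(\<Sum>l\<in>L - {l1}. dual_pairing (\<alpha> l) (T (Suc k0))) = (\<Sum>k'\<in>{Suc k0..<E}. \<Sum>l\<in>L - {l1}. dual_pairing (\<alpha> l) (x k'))"
            unfolding T_def dual_pairing_sum by (rule sum.swap)
          also have "\<dots> \<le> (\<Sum>k'\<in>{Suc k0..<E}. 2 / N\<^sup>2)"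
          proof (rule sum_mono)
            fix k' assume k': "k' \<in> {Suc k0..<E}"
            define M where "M = {l\<in>L. l1 < l}"
            have "(\<Sum>l\<in>L - {l1}. dual_pairing (\<alpha> l) (x k')) = (\<Sum>l\<in>M. dual_pairing (\<alpha> l) (x k'))"
            proof (rule sum.mono_neutral_right)
              show "\<forall>l\<in>L - {l1} - M. dual_pairing (\<alpha> l) (x k') = 0"
              proof
                fix l assume "l \<in> L - {l1} - M"
                then have "l \<in> L" "l < l1" by (auto simp: M_def)
                then show "dual_pairing (\<alpha> l) (x k') = 0" using low k' by simp
              qed
            qed (use finL in \<open>auto simp: M_def\<close>)
            also have "\<dots> \<le> 1 / real (k0 + 1) ^ 2 + 1 / real (k' + 1) ^ 2"
            proof (rule fast_tail[OF bs fast])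
              show "fam n (Suc K) L \<alpha>" using fam K by simp
              show "l1 \<in> L" "i1 \<in> supp (\<alpha> l1)" by fact+
              have "b k0 \<le> B k'" using fast k' by (simp add: fast_def)
              then show "i1 \<le> B k'" using l1 by simp
              show "M \<subseteq> L" "k0 \<le> k'" using k' by (auto simp: M_def)
              fix l assume "l \<in> M"
              then have "i1 < l" using famD(4)[OF fam l1(1) _ _ l1(2)] by (simp add: M_def)
              then show "a k0 \<le> l" using l1 by simp
            qed
            also have "1 / real (k0 + 1) ^ 2 \<le> 1 / N\<^sup>2"
              using kk0 N1 unfolding N by (intro divide_left_mono power_mono mult_pos_pos) auto
            also have "1 / real (k' + 1) ^ 2 \<le> 1 / N\<^sup>2"
              using kk0 k' N1 unfolding N by (intro divide_left_mono power_mono mult_pos_pos) auto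
            finally show "(\<Sum>l\<in>L - {l1}. dual_pairing (\<alpha> l) (x k')) \<le> 2 / N\<^sup>2" by simp
          qed
          also have "\<dots> = real (E - Suc k0) * (2 / N\<^sup>2)" by simp
          also have "\<dots> \<le> N * (2 / N\<^sup>2)"
          proof (intro mult_right_mono)
            have "E - Suc k0 \<le> j + 1" using k conjunct1[OF k0] unfolding E by linarith
            then show "real (E - Suc k0) \<le> N" unfolding N by (rule of_nat_mono)
          qed simp
          also have "\<dots> = 2 / N" using N1 by (simp add: power2_eq_square)
          finally show ?thesis .
        qed
        have fW: "(\<Sum>l\<in>L. \<alpha> l) \<in> W0 n" using fam_sum_W0[OF fam] .
        have "(\<Sum>l\<in>L. dual_pairing (\<alpha> l) (T k0)) \<le> \<beta> k0"
        proof (cases "\<exists>i\<in>supp (\<alpha> l1). b k0 \<le> i")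
          case False
          have "dual_pairing (\<alpha> l1) (T (Suc k0)) = 0"
            using False bE by (intro zero) (fastforce simp: Suc_le_eq)
          then have "(\<Sum>l\<in>L. dual_pairing (\<alpha> l) (T (Suc k0))) \<le> 2 / N"
            using rest finL l1(1) by (simp add: sum.remove)
          moreover have "(\<Sum>l\<in>L. dual_pairing (\<alpha> l) (x k0)) \<le> C"
            using le_C[OF fW, of k0] by (simp add: dual_pairing_sum_left)
          moreover have "(\<Sum>l\<in>L. dual_pairing (\<alpha> l) (T k0)) = (\<Sum>l\<in>L. dual_pairing (\<alpha> l) (x k0)) + (\<Sum>l\<in>L. dual_pairing (\<alpha> l) (T (Suc k0)))"
            using T_Suc[of k0] k0 by (simp add: dual_pairing_add sum.distrib)
          moreover have "2 / N \<le> 2" using N1 by (simp add: divide_simps)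
          ultimately show ?thesis using \<beta>C[of k0] by linarith
        next
          case True
          then obtain i2 where i2: "i2 \<in> supp (\<alpha> l1)" "b k0 \<le> i2" by blast
          have xk0: "dual_pairing (\<alpha> l) (x k0) = 0" if l: "l \<in> L - {l1}" for l
          proof (cases "l < l1")
            case False
            then have "l1 < l" using l by auto
            then have "before (\<alpha> l1) (\<alpha> l)" using famD(3)[OF fam l1(1)] l by blast
            then have "\<forall>i\<in>supp (\<alpha> l). b k0 < i" using i2 by (auto simp: before_iff intro: le_less_trans)
            then show ?thesis using sx[of k0] by (intro dual_pairing_eq_0) fastforce
          qed (use low l in auto)
          have "(\<Sum>l\<in>L - {l1}. dual_pairing (\<alpha> l) (T k0)) = (\<Sum>l\<in>L - {l1}. dual_pairing (\<alpha> l) (T (Suc k0)))"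
            using T_Suc[of k0] k0 xk0 by (intro sum.cong) (auto simp: dual_pairing_add)
          then have le1: "(\<Sum>l\<in>L. dual_pairing (\<alpha> l) (T k0)) \<le> dual_pairing (\<alpha> l1) (T k0) + 2 / N"
            using rest finL l1(1) by (simp add: sum.remove)
          obtain R g where R: "avg_rep n l1 (\<alpha> l1) R g" "\<forall>r\<in>R. g r \<noteq> 0 \<and> (\<forall>k\<ge>(j + 1)\<^sup>2. dual_pairing (g r) (T k) \<le> \<beta> k)"
            using sum(4)[OF l1(1)] by blast
          \<comment> \<open>Parts of \<open>l1\<close> that meet block \<open>k0\<close> and also
            pass its end. Of two successive parts the earlier one would end the block for the later
            one, so there is at most one.\<close>
          define M where "M = {r\<in>R. (\<exists>i\<in>supp (g r). i \<in> {a k0..<b k0}) \<and> (\<exists>i\<in>supp (g r). b k0 \<le> i)}"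
          have finR: "finite R" "card R \<le> l1" "2 \<le> l1" using R(1) by (auto simp: avg_rep_def)
          have M_eq: "r = s" if rs: "r \<in> M" "s \<in> M" for r s
          proof (rule ccontr)
            have no: False if rs: "r \<in> M" "s \<in> M" "r < s" for r s
            proof -
              obtain i i' where i: "i \<in> supp (g r)" "b k0 \<le> i" "i' \<in> supp (g s)" "i' < b k0"
                using rs by (auto simp: M_def)
              have "before (g r) (g s)" using R(1) rs by (auto simp: avg_rep_def M_def)
              then have "i < i'" using i unfolding before_iff by blast
              then show False using i by linarith
            qed
            assume "r \<noteq> s"
            then show False using no rs by (meson neq_iff)
          qed
          have cardM: "card M \<le> 1"
          proof (cases "M = {}")
            case False
            then obtain r where "r \<in> M" by blast
            then have "M \<subseteq> {r}" using M_eq by blast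
            then show ?thesis using card_mono[of "{r}" M] by simp
          qed simp
          have pk: "(j + 1)\<^sup>2 \<le> k0" "(j + 1)\<^sup>2 \<le> Suc k0" using k k0 by auto
          have \<beta>S: "\<beta> k0 = \<beta> (Suc k0) + 4 / N"
          proof -
            have eq: "real (E - k0) = real (E - Suc k0) + 1" using k0 by linarith
            show ?thesis by (simp only: \<beta>_def eq distrib_left mult_1_right add.assoc)
          qed
          have gr: "dual_pairing (g r) (T k0) \<le> \<beta> (Suc k0) + (if r \<in> M then 4 / N else 0)" if r: "r \<in> R" for r
          proof -
            consider "r \<in> M" | "r \<notin> M" "\<not> (\<exists>i\<in>supp (g r). i \<in> {a k0..<b k0})" | "r \<notin> M" "\<not> (\<exists>i\<in>supp (g r). b k0 \<le> i)"
              using r by (auto simp: M_def)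
            then show ?thesis
            proof cases
              case 1
              have "dual_pairing (g r) (T k0) \<le> \<beta> k0" using R(2) r pk(1) by blast
              then show ?thesis using 1 \<beta>S by simp
            next
              case 2
              then have "dual_pairing (g r) (T k0) = dual_pairing (g r) (T (Suc k0))"
                using k0 by (intro skip) (auto simp: less_Suc_eq_le)
              moreover have "dual_pairing (g r) (T (Suc k0)) \<le> \<beta> (Suc k0)" using R(2) r pk(2) by blast
              ultimately show ?thesis using 2 by simp
            next
              case 3
              have "dual_pairing (g r) (T (Suc k0)) = 0"
                using 3 bE by (intro zero) (fastforce simp: Suc_le_eq)
              then have "dual_pairing (g r) (T k0) = dual_pairing (g r) (x k0)"
                using T_Suc[of k0] k0 by (simp add: dual_pairing_add)
              moreover have "g r \<in> W0 n" using R(1) r by (simp add: avg_rep_def)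
              ultimately show ?thesis using le_C[of "g r" k0] \<beta>C[of "Suc k0"] 3 by simp
            qed
          qed
          have "(\<Sum>r\<in>R. dual_pairing (g r) (T k0)) \<le> (\<Sum>r\<in>R. \<beta> (Suc k0) + (if r \<in> M then 4 / N else 0))"
            by (rule sum_mono) (rule gr)
          also have "\<dots> = real (card R) * \<beta> (Suc k0) + real (card M) * (4 / N)"
          proof -
            have "(\<Sum>r\<in>R. if r \<in> M then 4 / N else 0) = (\<Sum>r\<in>M. 4 / N)"
              using finR by (intro sum.mono_neutral_cong_right) (auto simp: M_def)
            then show ?thesis by (simp add: sum.distrib)
          qed
          also have "\<dots> \<le> real l1 * \<beta> (Suc k0) + 1 * (4 / N)"
            using finR cardM \<beta>C[of "Suc k0"] C0 N1 by (intro add_mono mult_right_mono) auto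
          finally have "dual_pairing (\<alpha> l1) (T k0) \<le> (1 / real l1) * (real l1 * \<beta> (Suc k0) + 4 / N)"
            using R(1) by (auto simp: avg_rep_def dual_pairing_scaleR_left dual_pairing_sum_left intro!: divide_right_mono)
          also have "\<dots> = \<beta> (Suc k0) + (1 / real l1) * (4 / N)" using finR by (simp add: distrib_left)
          \<comment> \<open>Here it is decisive that sizes are at least 2: half of the drop 4/N is
            left over for the other averages.\<close>
          also have "\<dots> \<le> \<beta> (Suc k0) + (1 / 2) * (4 / N)"
            using finR N1 by (intro add_left_mono mult_right_mono divide_left_mono) auto
          finally show ?thesis using le1 \<beta>S by simp
        qed
        then show ?thesis using eqk0 \<beta>_mono[of k k0] k0 by linarith
      qed
    qed
  qed
  then show "(j + 1)\<^sup>2 \<le> k \<Longrightarrow> dual_pairing f (\<Sum>k'\<in>{k..<E}. x k') \<le> C + 2 + (4 / N) * real (E - k)"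
    by (simp add: T_def \<beta>_def)
qed

text \<open>The sums over windows are taken without dividing by the length. They stay bounded on the
  \<open>x\<close> side, whereas on the \<open>y\<close> side the average of size
  \<open>j + 1\<close> of functionals norming the single blocks up to the factor 1/2 still gives
  \<delta>/2, with sizes tending to infinity.\<close>

lemma step_sums:
  assumes app: "approx a b x y X" and C: "\<And>k. norm01 n (x k) \<le> C"
    and null: "null n K x" and K: "n = Suc K" and \<delta>: "0 < \<delta>" "\<forall>j. \<exists>i\<ge>j. \<delta> \<le> norm01 n (y i)"
  obtains a' b' x' y' X' where "approx a' b' x' y' X'" "\<And>k. norm01 n (x' k) \<le> C + 6" "\<not> null n 0 y'"
proof -
  have bs: "block_seq a b" using app by (simp add: approx_def)
  define \<Theta> where "\<Theta> B i B' \<longleftrightarrow> \<delta> \<le> norm01 n (y i)" for B i B' :: nat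
  have fr: "\<exists>i\<ge>j. \<exists>B'. \<Theta> B i B'" for B j using \<delta> by (auto simp: \<Theta>_def)
  obtain s B where s: "strict_mono s" "fast n K (a \<circ> s) (b \<circ> s) B (x \<circ> s)"
    "\<And>k. err x y X (s k) \<le> 1 / real (k + 1) ^ 2" "\<And>k. \<exists>B'\<le>B (Suc k). \<Theta> (B k) (s k) B'" "\<And>k. k \<le> B k"
    using fast_subseq[where \<Theta> = \<Theta>, OF bs null approx_err_small[OF app] fr] by metis
  define A Bb x1 y1 X1 where defs: "A = a \<circ> s" "Bb = b \<circ> s" "x1 = x \<circ> s" "y1 = y \<circ> s" "X1 = X \<circ> s"
  have app1: "approx A Bb x1 y1 X1" unfolding defs using approx_subseq[OF app s(1)] .
  then have bs1: "block_seq A Bb" "blocks A Bb x1" "blocks A Bb y1" by (auto simp: approx_def)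
  have fast: "fast n K A Bb B x1" using s(2) by (simp add: defs)
  have err1: "err x1 y1 X1 k \<le> 1 / real (k + 1) ^ 2" for k using s(3)[of k] by (simp add: err_def defs)
  have C1: "norm01 n (x1 k) \<le> C" for k using C by (simp add: defs)
  have y1: "\<delta> \<le> norm01 n (y1 k)" for k using s(4)[of k] by (auto simp: \<Theta>_def defs)
  define x2 y2 X2 where d2: "x2 = (\<lambda>j. \<Sum>k\<in>win j. 1 *\<^sub>R x1 k)"
    "y2 = (\<lambda>j. \<Sum>k\<in>win j. 1 *\<^sub>R y1 k)" "X2 = (\<lambda>j. \<Sum>k\<in>win j. 1 *\<^sub>R X1 k)"
  have app2: "approx (\<lambda>j. A (Min (win j))) (\<lambda>j. Bb (Max (win j))) x2 y2 X2"
    unfolding d2 by (rule approx_combine[OF app1 win(1) win(5) win_err_null[OF err1 err_nonneg]]) simp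
  have C2: "norm01 n (x2 j) \<le> C + 6" for j
  proof (rule norm01_le)
    fix f assume "f \<in> W0 n"
    from fast_tail_sum_bound[OF bs1(1,2) fast K C1 this refl refl, of j "(j + 1)\<^sup>2"]
    have "dual_pairing f (x2 j) \<le> C + 2 + (4 / real (j + 1)) * real ((j + 1)\<^sup>2 + (j + 1) - (j + 1)\<^sup>2)"
      by (simp add: d2 win_def)
    moreover have "(4 / real (j + 1)) * real ((j + 1)\<^sup>2 + (j + 1) - (j + 1)\<^sup>2) = 4"
      unfolding add_diff_cancel_left' by (simp add: field_simps)
    ultimately show "dual_pairing f (x2 j) \<le> C + 6" by linarith
  qed
  have "\<forall>k. \<exists>g. g \<in> W0 n \<and> \<delta> / 2 < dual_pairing g (y1 k)"
  proof
    fix k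
    have "\<delta> / 2 < norm01 n (y1 k)" using y1[of k] \<delta> by simp
    then show "\<exists>g. g \<in> W0 n \<and> \<delta> / 2 < dual_pairing g (y1 k)" by (metis norm01_attained)
  qed
  then obtain g where g: "\<And>k. g k \<in> W0 n" "\<And>k. \<delta> / 2 < dual_pairing (g k) (y1 k)" by metis
  define h where "h k = restr {A k..<Bb k} (g k)" for k
  have h: "h k \<in> W0 n" "supp (h k) \<subseteq> {A k..<Bb k}" "\<delta> / 2 < dual_pairing (h k) (y1 k)" for k
  proof -
    show "h k \<in> W0 n" unfolding h_def using g(1) by (rule restr_W0)
    show "supp (h k) \<subseteq> {A k..<Bb k}" by (auto simp: h_def supp_restr)
    have "dual_pairing (h k) (y1 k) = dual_pairing (g k) (y1 k)"
      unfolding h_def using bs1(3) by (intro dual_pairing_restr_left) (simp add: blocks_def)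
    then show "\<delta> / 2 < dual_pairing (h k) (y1 k)" using g(2) by simp
  qed
  have "\<not> null n 0 y2"
  proof
    assume "null n 0 y2"
    then obtain j0 i0 where ji: "\<forall>i'\<ge>i0. \<forall>L \<alpha>. fam n 0 L \<alpha> \<longrightarrow> (\<forall>l\<in>L. j0 \<le> l) \<longrightarrow>
       (\<Sum>l\<in>L. dual_pairing (\<alpha> l) (y2 i')) < \<delta> / 2"
      using \<delta>(1) unfolding null_def by (meson half_gt_zero)
    \<comment> \<open>The successor makes the size \<open>j + 1\<close> at least 2, as averages
      require.\<close>
    define j where "j = Suc (max i0 j0)"
    define \<alpha> where "\<alpha> = (1 / real (j + 1)) *\<^sub>R (\<Sum>k\<in>win j. h k)"
    have hb: "before (h k) (h k')" if "k < k'" for k k'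
    proof -
      have "Bb k \<le> A k'" using block_seqD(3)[OF bs1(1) that] .
      then show ?thesis using h(2)[of k] h(2)[of k'] unfolding before_iff by fastforce
    qed
    have "avg_rep n (j + 1) \<alpha> (win j) h"
      unfolding avg_rep_def using h(1) hb win(1,2)[of j] by (simp add: \<alpha>_def j_def)
    then have "avg n (j + 1) \<alpha>" unfolding avg_def by blast
    then have "fam n 0 {j + 1} (\<lambda>_. \<alpha>)" by (rule fam_single)
    moreover have "\<forall>l\<in>{j + 1}. j0 \<le> l" "i0 \<le> j" by (auto simp: j_def)
    ultimately have "(\<Sum>l\<in>{j + 1}. dual_pairing \<alpha> (y2 j)) < \<delta> / 2" using ji by blast
    moreover have "dual_pairing \<alpha> (y2 j) = (1 / real (j + 1)) * (\<Sum>k\<in>win j. dual_pairing (h k) (y1 k))"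
    proof -
      have "dual_pairing (h k) (y2 j) = dual_pairing (h k) (y1 k)" if k: "k \<in> win j" for k
      proof -
        have "dual_pairing (h k) (y2 j) = (\<Sum>k'\<in>win j. dual_pairing (h k) (y1 k'))"
          by (simp add: d2 dual_pairing_sum)
        also have "\<dots> = (\<Sum>k'\<in>{k}. dual_pairing (h k) (y1 k'))"
          using k win(1)[of j] blocks_pairing_eq_0[OF bs1(1,3) h(2)] by (intro sum.mono_neutral_right) auto
        finally show ?thesis by simp
      qed
      then show ?thesis by (simp add: \<alpha>_def dual_pairing_scaleR_left dual_pairing_sum_left)
    qed
    moreover have "(\<Sum>k\<in>win j. dual_pairing (h k) (y1 k)) \<ge> real (j + 1) * (\<delta> / 2)"
      using sum_bounded_below[of "win j" "\<delta> / 2" "\<lambda>k. dual_pairing (h k) (y1 k)"] h(3) win(2)[of j] by (simp add: less_imp_le)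
    ultimately show False by (simp add: divide_simps mult.commute)
  qed
  then show thesis using that[OF app2 C2] by blast
qed

end

section \<open>Special convex combinations\<close>

lemma schreier0_spread_image:
  fixes f h :: "nat \<Rightarrow> nat"
  assumes "F \<in> schreier0 k" "finite G" "\<And>g. g \<in> G \<Longrightarrow> h g \<in> F \<and> h g \<le> f g"
    "\<And>g g'. g \<in> G \<Longrightarrow> g' \<in> G \<Longrightarrow> g < g' \<Longrightarrow> h g < h g' \<and> f g < f g'"
  shows "f ` G \<in> schreier0 k"
proof (rule schreier0_spread[OF assms(1), of _ "\<lambda>v. h (inv_into G f v)"])
  have less_iff: "g < g'" if "g \<in> G" "g' \<in> G" "f g < f g'" for g g'
    using assms(4)[of g' g] that by (metis less_asym not_less_iff_gr_or_eq)
  have inv: "inv_into G f v \<in> G \<and> f (inv_into G f v) = v" if "v \<in> f ` G" for v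
    using that by (simp add: inv_into_into f_inv_into_f)
  show "finite (f ` G)" using assms(2) by simp
  fix v assume v: "v \<in> f ` G"
  show "h (inv_into G f v) \<in> F \<and> h (inv_into G f v) \<le> v"
    using assms(3)[of "inv_into G f v"] inv[OF v] by simp
  fix w assume w: "w \<in> f ` G" "v < w"
  show "h (inv_into G f v) < h (inv_into G f w)"
    using assms(4) less_iff inv[OF v] inv[OF w(1)] w(2) by metis
qed

lemma schreier0_UNION:
  assumes "\<And>j. j < N \<Longrightarrow> A j \<in> schreier0 m" "\<And>i j u v. i < j \<Longrightarrow> j < N \<Longrightarrow> u \<in> A i \<Longrightarrow> v \<in> A j \<Longrightarrow> u < v"
    "\<And>j u. j < N \<Longrightarrow> u \<in> A j \<Longrightarrow> N \<le> u"
  shows "(\<Union>j<N. A j) \<in> schreier0 (Suc m)"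
proof -
  define c where "c u = (SOME j. j < N \<and> u \<in> A j)" for u
  have c: "c u < N \<and> u \<in> A (c u)" if u: "u \<in> (\<Union>j<N. A j)" for u
    unfolding c_def by (rule someI_ex) (use u in auto)
  have c_eq: "c u = j" if "j < N" "u \<in> A j" for u j
  proof -
    have "c u < N" "u \<in> A (c u)" using c[of u] that by blast+
    then show ?thesis using assms(2)[of "c u" j u u] assms(2)[of j "c u" u u] that by (meson less_irrefl nat_neq_iff)
  qed
  have "block_coloring (\<lambda>G. G \<in> schreier0 m) (\<Union>j<N. A j) c N"
    unfolding block_coloring_def
  proof (intro conjI ballI impI allI)
    show "finite (\<Union>j<N. A j)" using assms(1) schreier0_finite by blast
    fix u assume u: "u \<in> (\<Union>j<N. A j)"
    show "c u < N" using c[OF u] by blast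
    show "N \<le> u" using assms(3) c[OF u] by blast
    fix v assume v: "v \<in> (\<Union>j<N. A j)" "u \<le> v"
    show "c u \<le> c v" using assms(2)[of "c v" "c u" v u] c[OF u] c[OF v(1)] v(2) by (meson leI not_less)
  next
    fix j
    show "{u \<in> (\<Union>j<N. A j). c u = j} \<in> schreier0 m"
    proof (cases "j < N")
      case True
      then have "{u \<in> (\<Union>j<N. A j). c u = j} \<subseteq> A j" using c by blast
      then show ?thesis using assms(1)[OF True] by (rule schreier0_subset[rotated])
    next
      case False
      then have "{u \<in> (\<Union>j<N. A j). c u = j} = {}" using c by blast
      then show ?thesis by (simp only: schreier0_empty)
    qed
  qed
  then show ?thesis unfolding schreier0_Suc by blast
qed

text \<open>Smallness of order \<open>m\<close> refers to the Schreier family of order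
  \<open>m - 1\<close>; at order 0 only the empty set counts as small.\<close>

definition small_set :: "nat \<Rightarrow> (nat \<Rightarrow> nat) \<Rightarrow> nat set \<Rightarrow> bool" where
  "small_set m b G \<longleftrightarrow> (case m of 0 \<Rightarrow> G = {} | Suc p \<Rightarrow> b ` G \<in> schreier0 p)"

text \<open>A special convex combination. Left ends of blocks test the admissibility of its support
  and right ends test smallness of subsets. As the families are spreading, both are the more
  demanding choices, and the properties pass to any points picked from the blocks.\<close>

definition scc :: "nat \<Rightarrow> (nat \<Rightarrow> nat) \<Rightarrow> (nat \<Rightarrow> nat) \<Rightarrow> real \<Rightarrow> nat set \<Rightarrow> (nat \<Rightarrow> real) \<Rightarrow> bool" where
  "scc m a b \<epsilon> F c \<longleftrightarrow> finite F \<and> F \<noteq> {} \<and> (\<forall>k. 0 \<le> c k) \<and> sum c F = 1 \<and> a ` F \<in> schreier0 m \<and>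
     (\<forall>G. G \<subseteq> F \<longrightarrow> small_set m b G \<longrightarrow> sum c G \<le> \<epsilon>)"

lemma block_seq_strict: "block_seq a b \<Longrightarrow> k < m \<Longrightarrow> a k < a m \<and> b k < b m"
  using block_seqD(2,3) by (meson less_le_trans order_le_less_trans)

text \<open>A point \<open>b k0\<close> in front limits the number of colours of a set of order
  \<open>m\<close> to \<open>b k0\<close>, and each colour class is small.\<close>

lemma small_set_sum_le:
  assumes bs: "block_seq a b" and scc: "scc m a b \<epsilon> F c" and G: "G \<subseteq> F" "b ` (insert k0 G) \<in> schreier0 m"
    and k0: "\<And>k. k \<in> G \<Longrightarrow> k0 < k" and \<epsilon>: "0 \<le> \<epsilon>"
  shows "sum c G \<le> real (b k0) * \<epsilon>"
proof (cases m)
  case 0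
  have "G = {}"
  proof (rule ccontr)
    assume "G \<noteq> {}"
    then obtain k where k: "k \<in> G" by blast
    then have "b k0 < b k" using block_seq_strict[OF bs k0] by blast
    moreover have "b k0 = b k" using G(2) k unfolding 0 schreier0_0 by auto
    ultimately show False by simp
  qed
  then show ?thesis using \<epsilon> by simp
next
  case (Suc p)
  obtain col N where col: "block_coloring (\<lambda>G. G \<in> schreier0 p) (b ` insert k0 G) col N"
    using G(2) unfolding Suc schreier0_Suc by blast
  have N: "N \<le> b k0" using block_coloringD(4)[OF col] by blast
  have fin: "finite G" using scc G(1) by (auto simp: scc_def intro: finite_subset)
  have "(\<lambda>k. col (b k)) ` G \<subseteq> {..<N}" using block_coloringD(3)[OF col] by blast
  then have "sum c G = (\<Sum>i<N. sum c {k\<in>G. col (b k) = i})"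
    using fin by (intro sum.group[symmetric]) auto
  also have "\<dots> \<le> (\<Sum>i<N. \<epsilon>)"
  proof (rule sum_mono)
    fix i
    have "b ` {k\<in>G. col (b k) = i} \<subseteq> {v \<in> b ` insert k0 G. col v = i}" by blast
    then have "b ` {k\<in>G. col (b k) = i} \<in> schreier0 p"
      by (rule schreier0_subset[OF block_coloringD(5)[OF col]])
    then have "small_set m b {k\<in>G. col (b k) = i}" by (simp add: small_set_def Suc)
    moreover have "{k\<in>G. col (b k) = i} \<subseteq> F" using G(1) by blast
    ultimately show "sum c {k\<in>G. col (b k) = i} \<le> \<epsilon>" using scc unfolding scc_def by blast
  qed
  also have "\<dots> \<le> real (b k0) * \<epsilon>" using N \<epsilon> by (simp add: mult_right_mono)
  finally show ?thesis .
qed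

text \<open>An average of \<open>N\<close> successive combinations of order \<open>m\<close>, each
  chosen with an error so small that it absorbs the right end of the previous one. A small set of
  order \<open>m + 1\<close> may exhaust the first combination it meets, which costs 1/N \<le>
  \<epsilon>/2. It starts before every later combination and has weight at most \<epsilon>/2
  there.\<close>

lemma scc_exists:
  assumes bs: "block_seq a b"
  shows "0 < \<epsilon> \<Longrightarrow> \<exists>F c. scc m a b \<epsilon> F c \<and> F \<subseteq> {t..}"
proof (induction m arbitrary: \<epsilon> t)
  case 0
  have "{a t} \<in> schreier0 0" using block_seqD(1)[OF bs, of t] by (intro schreier0_singleton)
  then have "scc 0 a b \<epsilon> {t} (\<lambda>_. 1)"
    using 0 by (auto simp: scc_def small_set_def)
  then show ?case by (intro exI[of _ "{t}"] exI) auto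
next
  case (Suc m)
  obtain N0 where N0: "2 / \<epsilon> < real N0" using reals_Archimedean2 by blast
  define N where "N = Suc N0"
  have N: "1 \<le> N" "1 / real N \<le> \<epsilon> / 2"
  proof -
    have "2 < real N0 * \<epsilon>" using N0 Suc.prems by (simp add: divide_simps)
    also have "\<dots> \<le> real N * \<epsilon>" using Suc.prems by (simp add: N_def)
    finally show "1 / real N \<le> \<epsilon> / 2" by (simp add: N_def divide_simps mult.commute)
  qed (simp add: N_def)
  define P where "P Fc \<longleftrightarrow> (\<exists>\<epsilon>'>0. scc m a b \<epsilon>' (fst Fc) (snd Fc)) \<and> fst Fc \<subseteq> {max t N..}" for Fc :: "nat set \<times> (nat \<Rightarrow> real)"
  define Q where "Q Fc Fc' \<longleftrightarrow> fst Fc' \<subseteq> {Suc (Max (fst Fc))..} \<and> scc m a b (\<epsilon> / (2 * real (b (Max (fst Fc))))) (fst Fc') (snd Fc')"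
    for Fc Fc' :: "nat set \<times> (nat \<Rightarrow> real)"
  have "\<exists>f. \<forall>j. P (f j) \<and> Q (f j) (f (Suc j))"
  proof (rule dependent_nat_choice)
    obtain F c where "scc m a b 1 F c" "F \<subseteq> {max t N..}" using Suc.IH[of 1 "max t N"] by auto
    then show "\<exists>Fc. P Fc" unfolding P_def by (intro exI[of _ "(F, c)"]) (auto intro: exI[of _ 1])
  next
    fix Fc assume P: "P Fc"
    have bpos: "0 < b k" for k using block_seqD(1,2)[OF bs, of k] by linarith
    \<comment> \<open>Cancels the factor \<open>b k0\<close> of \<open>small_set_sum_le\<close>,
      because the \<open>k0\<close> used there does not exceed this maximum.\<close>
    define e where "e = \<epsilon> / (2 * real (b (Max (fst Fc))))"
    have e: "0 < e" using Suc.prems bpos[of "Max (fst Fc)"] by (simp add: e_def)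
    obtain F c where F: "scc m a b e F c" "F \<subseteq> {Suc (Max (fst Fc))..}" using Suc.IH[OF e] by blast
    have "fst Fc \<noteq> {}" "finite (fst Fc)" using P by (auto simp: P_def scc_def)
    then have "Max (fst Fc) \<in> fst Fc" by simp
    then have "Max (fst Fc) \<in> {max t N..}" using P unfolding P_def by blast
    then have "max t N \<le> Max (fst Fc)" by simp
    then have "F \<subseteq> {max t N..}" using F(2) by auto
    then have "P (F, c)" "Q Fc (F, c)" using F e unfolding P_def Q_def e_def by auto
    then show "\<exists>Fc'. P Fc' \<and> Q Fc Fc'" by blast
  qed
  then obtain f where f: "\<forall>j. P (f j) \<and> Q (f j) (f (Suc j))" by blast
  define A C where "A j = fst (f j)" and "C j = snd (f j)" for j
  have A: "finite (A j)" "A j \<noteq> {}" "\<And>k. 0 \<le> C j k" "sum (C j) (A j) = 1" "a ` A j \<in> schreier0 m" "A j \<subseteq> {max t N..}" for j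
    using f unfolding P_def scc_def A_def C_def by blast+
  have AS: "A (Suc j) \<subseteq> {Suc (Max (A j))..}" "scc m a b (\<epsilon> / (2 * real (b (Max (A j))))) (A (Suc j)) (C (Suc j))" for j
    using f unfolding Q_def A_def C_def by blast+
  have MaxA: "Max (A i) < k" if "i < j" "k \<in> A j" for i j k
    using that
  proof (induction j arbitrary: k)
    case (Suc j)
    have k: "Max (A j) < k" using AS(1)[of j] Suc.prems by auto
    have "Max (A j) \<in> A j" using A(1,2)[of j] by simp
    then show ?case using k Suc by (cases "i = j") (auto simp: less_Suc_eq intro: less_trans)
  qed simp
  have ord: "k < k'" if "i < j" "k \<in> A i" "k' \<in> A j" for i j k k'
    using MaxA[OF that(1,3)] Max_ge[OF A(1) that(2)] by linarith
  define F where "F = (\<Union>j<N. A j)"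
  define c where "c k = (\<Sum>j<N. if k \<in> A j then C j k / real N else 0)" for k
  have finF: "finite F" using A(1) by (simp add: F_def)
  have sumc: "sum c G = (1 / real N) * (\<Sum>j<N. sum (C j) (G \<inter> A j))" if G: "G \<subseteq> F" for G
  proof -
    have finG: "finite G" using G finF finite_subset by blast
    have "sum c G = (\<Sum>j<N. \<Sum>k\<in>G. if k \<in> A j then C j k / real N else 0)"
      unfolding c_def by (rule sum.swap)
    also have "\<dots> = (\<Sum>j<N. sum (C j) (G \<inter> A j) / real N)"
      using finG by (simp add: sum.If_cases sum_divide_distrib Int_def)
    finally show ?thesis by (simp add: sum_divide_distrib sum_distrib_left)
  qed
  have "F \<noteq> {}" using A(2)[of 0] N(1) by (auto simp: F_def intro!: bexI[of _ 0])
  moreover have "0 \<le> c k" for k unfolding c_def using A(3) by (intro sum_nonneg) auto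
  moreover have "sum c F = 1"
  proof -
    have "F \<inter> A j = A j" if "j < N" for j using that by (auto simp: F_def)
    then show ?thesis using sumc[of F] A(4) N(1) by simp
  qed
  moreover have "a ` F \<in> schreier0 (Suc m)"
  proof -
    have "(\<Union>j<N. a ` A j) \<in> schreier0 (Suc m)"
    proof (rule schreier0_UNION)
      fix i j u v assume "i < j" "j < N" "u \<in> a ` A i" "v \<in> a ` A j"
      then show "u < v" using ord block_seq_strict[OF bs] by blast
    next
      fix j u assume "j < N" "u \<in> a ` A j"
      then obtain k where "k \<in> A j" "u = a k" by blast
      then show "N \<le> u" using A(6)[of j] block_seqD(6)[OF bs, of k] by fastforce
    qed (rule A(5))
    then show ?thesis by (simp add: F_def image_UN)
  qed
  moreover have "sum c G \<le> \<epsilon>" if G: "G \<subseteq> F" "small_set (Suc m) b G" for G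
  proof (cases "G = {}")
    case True
    then show ?thesis using Suc.prems by simp
  next
    case False
    have bG: "b ` G \<in> schreier0 m" using G(2) by (simp add: small_set_def)
    define j0 where "j0 = (LEAST j. j < N \<and> G \<inter> A j \<noteq> {})"
    have "\<exists>j. j < N \<and> G \<inter> A j \<noteq> {}" using False G(1) by (auto simp: F_def)
    then have j0: "j0 < N \<and> G \<inter> A j0 \<noteq> {}" unfolding j0_def by (rule LeastI_ex)
    then obtain k0 where k0: "k0 \<in> G" "k0 \<in> A j0" by blast
    have less: "sum (C j) (G \<inter> A j) = 0" if "j < j0" for j
    proof -
      have "\<not> (j < N \<and> G \<inter> A j \<noteq> {})" using that unfolding j0_def by (rule not_less_Least)
      then have "G \<inter> A j = {}" using that j0 by simp
      then show ?thesis by simp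
    qed
    have more: "sum (C j) (G \<inter> A j) \<le> \<epsilon> / 2" if j: "j0 < j" for j
    proof -
      obtain i where i: "j = Suc i" "j0 \<le> i" using j by (cases j) auto
      have bpos: "0 < b (Max (A i))" using block_seqD(1,2)[OF bs, of "Max (A i)"] by linarith
      have "sum (C j) (G \<inter> A j) \<le> real (b k0) * (\<epsilon> / (2 * real (b (Max (A i)))))"
      proof (rule small_set_sum_le[OF bs])
        show "scc m a b (\<epsilon> / (2 * real (b (Max (A i))))) (A j) (C j)" using AS(2)[of i] i by simp
        have "b ` insert k0 (G \<inter> A j) \<subseteq> b ` G" using k0 by blast
        then show "b ` insert k0 (G \<inter> A j) \<in> schreier0 m" by (rule schreier0_subset[OF bG])
        show "k0 < k" if "k \<in> G \<inter> A j" for k using ord[OF j k0(2)] that by blast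
      qed (use Suc.prems in auto)
      also have "\<dots> \<le> real (b (Max (A i))) * (\<epsilon> / (2 * real (b (Max (A i)))))"
      proof (intro mult_right_mono)
        have "k0 \<le> Max (A i)"
        proof (cases "j0 = i")
          case True
          then show ?thesis using k0(2) A(1) by simp
        next
          case False
          then have "k0 < Max (A i)" using ord[of j0 i k0 "Max (A i)"] i k0(2) A(1,2) by simp
          then show ?thesis by simp
        qed
        then show "real (b k0) \<le> real (b (Max (A i)))" using block_seqD(5)[OF bs] by simp
      qed (use Suc.prems in auto)
      also have "\<dots> = \<epsilon> / 2" using bpos by simp
      finally show ?thesis .
    qed
    have one: "sum (C j0) (G \<inter> A j0) \<le> 1"
      using sum_mono2[of "A j0" "G \<inter> A j0" "C j0"] A(1,3,4)[of j0] by auto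
    have "(\<Sum>j<N. sum (C j) (G \<inter> A j)) \<le> (\<Sum>j<N. \<epsilon> / 2 + (if j = j0 then 1 else 0))"
    proof (rule sum_mono)
      fix j
      show "sum (C j) (G \<inter> A j) \<le> \<epsilon> / 2 + (if j = j0 then 1 else 0)"
        using less[of j] more[of j] one Suc.prems by (cases j j0 rule: linorder_cases) auto
    qed
    also have "\<dots> = real N * (\<epsilon> / 2) + 1" using j0 by (simp add: sum.distrib)
    finally have "sum c G \<le> (1 / real N) * (real N * (\<epsilon> / 2) + 1)"
      unfolding sumc[OF G(1)] by (rule mult_left_mono) simp
    also have "\<dots> = \<epsilon> / 2 + 1 / real N" using N(1) by (simp add: distrib_left)
    finally show ?thesis using N(2) by linarith
  qed
  ultimately have "scc (Suc m) a b \<epsilon> F c" unfolding scc_def using finF by blast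
  moreover have "F \<subseteq> {t..}" using A(6) by (fastforce simp: F_def)
  ultimately show ?case by blast
qed

lemma scc_coeff_le:
  assumes "block_seq a b" "scc (Suc m) a b \<epsilon> F c" "k \<in> F" shows "c k \<le> \<epsilon>"
proof -
  have "1 \<le> b k" using block_seqD(1,2)[OF assms(1), of k] by linarith
  then have "small_set (Suc m) b {k}" by (simp add: small_set_def schreier0_singleton)
  then have "sum c {k} \<le> \<epsilon>" using assms(2,3) unfolding scc_def by blast
  then show ?thesis by simp
qed

section \<open>Norming functionals on convex combinations of blocks\<close>

lemma sum_disjoint_le:
  assumes "finite K" "finite R" "\<And>r. r \<in> R \<Longrightarrow> A r \<subseteq> K" "\<And>r s. r \<in> R \<Longrightarrow> s \<in> R \<Longrightarrow> r \<noteq> s \<Longrightarrow> A r \<inter> A s = {}"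
    "\<And>k. k \<in> K \<Longrightarrow> 0 \<le> c k"
  shows "(\<Sum>r\<in>R. sum c (A r)) \<le> (sum c K :: real)"
proof -
  have "(\<Sum>r\<in>R. sum c (A r)) = sum c (\<Union>r\<in>R. A r)"
    using assms by (intro sum.UNION_disjoint[symmetric]) (auto intro: finite_subset)
  also have "\<dots> \<le> sum c K" using assms by (intro sum_mono2) auto
  finally show ?thesis .
qed

lemma meets_order:
  assumes bs: "block_seq a b" and "before f g" "i \<in> supp f" "i \<in> {a k..<b k}" "j \<in> supp g" "j \<in> {a m..<b m}"
  shows "k \<le> m"
proof (rule ccontr)
  assume "\<not> k \<le> m"
  then have "b m \<le> a k" using block_seqD(3)[OF bs] by simp
  moreover have "i < j" using assms(2,3,5) unfolding before_iff by blast
  ultimately show False using assms(4,6) by simp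
qed

text \<open>Each functional gives up the first block it meets, at the cost of one coefficient \<mu>.
  The remaining blocks are disjoint for different functionals, since a block shared by two
  successive functionals must be the first one met by the later of them.\<close>

lemma successive_le:
  fixes R :: "nat set"
  assumes bs: "block_seq a b" "blocks a b x" and C: "\<And>k. norm01 n (x k) \<le> C"
    and R: "finite R" "\<And>r. r \<in> R \<Longrightarrow> g r \<in> W0 n" "\<And>r s. r \<in> R \<Longrightarrow> s \<in> R \<Longrightarrow> r < s \<Longrightarrow> before (g r) (g s)"
    and K: "finite K" "\<And>k. k \<in> K \<Longrightarrow> 0 \<le> c k \<and> c k \<le> \<mu>" and \<mu>: "0 \<le> \<mu>"
  shows "(\<Sum>r\<in>R. \<Sum>k\<in>K. c k * \<bar>dual_pairing (g r) (x k)\<bar>) \<le> C * (sum c K + real (card R) * \<mu>)"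
proof -
  have C0: "0 \<le> C" using C[of 0] norm01_nonneg[of n "x 0"] by linarith
  have sx: "supp (x k) \<subseteq> {a k..<b k}" for k using bs(2) by (simp add: blocks_def)
  define V where "V r = {k\<in>K. supp (g r) \<inter> {a k..<b k} \<noteq> {}}" for r
  define V' where "V' r = V r - {Min (V r)}" for r
  have finV: "finite (V r)" for r using K(1) by (simp add: V_def)
  have each: "(\<Sum>k\<in>K. c k * \<bar>dual_pairing (g r) (x k)\<bar>) \<le> C * (sum c (V' r) + \<mu>)" if r: "r \<in> R" for r
  proof -
    have "(\<Sum>k\<in>K. c k * \<bar>dual_pairing (g r) (x k)\<bar>) = (\<Sum>k\<in>V r. c k * \<bar>dual_pairing (g r) (x k)\<bar>)"
    proof (rule sum.mono_neutral_right[OF K(1)])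
      show "\<forall>k\<in>K - V r. c k * \<bar>dual_pairing (g r) (x k)\<bar> = 0"
      proof
        fix k assume "k \<in> K - V r"
        then have "dual_pairing (g r) (x k) = 0" using sx by (intro dual_pairing_eq_0) (auto simp: V_def)
        then show "c k * \<bar>dual_pairing (g r) (x k)\<bar> = 0" by simp
      qed
    qed (auto simp: V_def)
    also have "\<dots> \<le> (\<Sum>k\<in>V r. c k * C)"
    proof (intro sum_mono mult_left_mono)
      fix k show "\<bar>dual_pairing (g r) (x k)\<bar> \<le> C" using W0_le_norm01[OF R(2)[OF r], of "x k"] C[of k] by linarith
    qed (use K in \<open>auto simp: V_def\<close>)
    also have "\<dots> = C * sum c (V r)" by (simp add: sum_distrib_left mult.commute)
    also have "sum c (V r) \<le> sum c (V' r) + \<mu>"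
    proof (cases "V r = {}")
      case False
      then have "Min (V r) \<in> V r" using finV by simp
      then have "sum c (V r) = c (Min (V r)) + sum c (V' r)" unfolding V'_def using finV by (simp add: sum.remove)
      moreover have "c (Min (V r)) \<le> \<mu>" using K(2) \<open>Min (V r) \<in> V r\<close> by (auto simp: V_def)
      ultimately show ?thesis by simp
    qed (use \<mu> in \<open>simp add: V'_def\<close>)
    finally show ?thesis using C0 by (simp add: mult_left_mono)
  qed
  have disj: "V' r \<inter> V' s = {}" if rs: "r \<in> R" "s \<in> R" "r < s" for r s
  proof (rule ccontr)
    assume "V' r \<inter> V' s \<noteq> {}"
    then obtain k where k: "k \<in> V' r" "k \<in> V' s" by blast
    then have kV: "k \<in> V r" "k \<in> V s" "k \<noteq> Min (V s)" by (auto simp: V'_def)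
    have "V s \<noteq> {}" using kV(2) by blast
    then have m: "Min (V s) < k" "Min (V s) \<in> V s"
      using Min_le[OF finV kV(2)] kV(3) Min_in[OF finV[of s]] by (simp_all add: le_neq_implies_less)
    obtain i where i: "i \<in> supp (g r)" "i \<in> {a k..<b k}" using kV(1) unfolding V_def by blast
    obtain j where j: "j \<in> supp (g s)" "j \<in> {a (Min (V s))..<b (Min (V s))}" using m(2) unfolding V_def by blast
    show False using meets_order[OF bs(1) R(3)[OF rs] i j] m(1) by simp
  qed
  have "(\<Sum>r\<in>R. \<Sum>k\<in>K. c k * \<bar>dual_pairing (g r) (x k)\<bar>) \<le> (\<Sum>r\<in>R. C * (sum c (V' r) + \<mu>))"
    by (rule sum_mono) (rule each)
  also have "\<dots> = C * ((\<Sum>r\<in>R. sum c (V' r)) + real (card R) * \<mu>)"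
    by (simp add: sum.distrib flip: sum_distrib_left)
  also have "\<dots> \<le> C * (sum c K + real (card R) * \<mu>)"
  proof (intro mult_left_mono add_right_mono C0 sum_disjoint_le)
    fix r s assume "r \<in> R" "s \<in> R" "r \<noteq> s"
    then show "V' r \<inter> V' s = {}" using disj[of r s] disj[of s r] by (cases r s rule: linorder_cases) auto
  qed (use K R in \<open>auto simp: V'_def V_def\<close>)
  finally show ?thesis .
qed

text \<open>There are at most \<open>l\<close> parts, so the boundary terms of
  \<open>successive_le\<close> survive division by \<open>l\<close> as \<open>C * \<mu>\<close>,
  whereas the main term gains the factor 1/l.\<close>

lemma average_le:
  assumes bs: "block_seq a b" "blocks a b x" and C: "\<And>k. norm01 n (x k) \<le> C" and avg: "avg n l \<alpha>"
    and K: "finite K" "\<And>k. k \<in> K \<Longrightarrow> 0 \<le> c k \<and> c k \<le> \<mu>" and \<mu>: "0 \<le> \<mu>"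
  shows "\<bar>\<Sum>k\<in>K. c k * dual_pairing \<alpha> (x k)\<bar> \<le> C * sum c K / real l + C * \<mu>"
proof -
  have C0: "0 \<le> C" using C[of 0] norm01_nonneg[of n "x 0"] by linarith
  obtain R g where R: "avg_rep n l \<alpha> R g" using avg by (auto simp: avg_def)
  have l: "2 \<le> l" "card R \<le> l" using R by (auto simp: avg_rep_def)
  have "(\<Sum>k\<in>K. c k * dual_pairing \<alpha> (x k)) = (1 / real l) * (\<Sum>r\<in>R. \<Sum>k\<in>K. c k * dual_pairing (g r) (x k))"
  proof -
    have "(\<Sum>k\<in>K. c k * dual_pairing \<alpha> (x k)) = (\<Sum>k\<in>K. \<Sum>r\<in>R. (1 / real l) * (c k * dual_pairing (g r) (x k)))"
      using R by (simp add: avg_rep_def dual_pairing_scaleR_left dual_pairing_sum_left sum_distrib_left)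
    then show ?thesis unfolding sum.swap[of _ R K] by (simp add: sum_distrib_left)
  qed
  then have "\<bar>\<Sum>k\<in>K. c k * dual_pairing \<alpha> (x k)\<bar> = (1 / real l) * \<bar>\<Sum>r\<in>R. \<Sum>k\<in>K. c k * dual_pairing (g r) (x k)\<bar>"
    by (simp add: abs_mult)
  also have "\<bar>\<Sum>r\<in>R. \<Sum>k\<in>K. c k * dual_pairing (g r) (x k)\<bar> \<le> (\<Sum>r\<in>R. \<Sum>k\<in>K. c k * \<bar>dual_pairing (g r) (x k)\<bar>)"
    using K(2) by (intro order_trans[OF sum_abs] sum_mono order_trans[OF sum_abs]) (simp add: abs_mult)
  also have "\<dots> \<le> C * (sum c K + real (card R) * \<mu>)"
    using R K \<mu> by (intro successive_le[OF bs C]) (auto simp: avg_rep_def)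
  also have "\<dots> \<le> C * (sum c K + real l * \<mu>)"
    using C0 \<mu> l by (intro mult_left_mono add_left_mono mult_right_mono) auto
  finally have "\<bar>\<Sum>k\<in>K. c k * dual_pairing \<alpha> (x k)\<bar> \<le> (1 / real l) * (C * (sum c K + real l * \<mu>))"
    using l by (simp add: mult_left_mono divide_right_mono)
  also have "\<dots> = C * sum c K / real l + C * \<mu>" using l by (simp add: field_simps)
  finally show ?thesis .
qed

text \<open>Every block of \<open>G\<close> is met by an average of its own. The minima of these
  averages increase and lie to the left of the right ends, so spreading makes each colour class of
  \<open>G\<close> small; and as the family starts at or before \<open>p\<close>, there are at most
  \<open>p\<close> classes.\<close>

lemma covered_sum_le:
  fixes ch :: "nat \<Rightarrow> nat"
  assumes bs: "block_seq a b" and scc: "scc (Suc m) a b \<epsilon> F c" and fam: "fam n (Suc m) L \<alpha>"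
    and l0: "l0 \<in> L" "i0 \<in> supp (\<alpha> l0)" "i0 \<le> p" and \<epsilon>: "0 \<le> \<epsilon>"
    and G: "G \<subseteq> F" "inj_on ch G" "\<And>k. k \<in> G \<Longrightarrow> ch k \<in> L \<and> supp (\<alpha> (ch k)) \<inter> {a k..<b k} \<noteq> {}"
  shows "sum c G \<le> real p * \<epsilon>"
proof -
  let ?F = "{Min (supp (\<alpha> l)) |l. l \<in> L \<and> \<alpha> l \<noteq> 0}"
  obtain col N where col: "block_coloring (\<lambda>G. G \<in> schreier0 m) ?F col N"
    using famD(5)[OF fam] unfolding schreier0_Suc by blast
  have "Min (supp (\<alpha> l0)) \<in> ?F" using l0 by auto
  then have "N \<le> Min (supp (\<alpha> l0))" by (rule block_coloringD(4)[OF col])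
  also have "\<dots> \<le> p" using l0 by (meson Min_le finite_keys order_trans)
  finally have N: "N \<le> p" .
  define h where "h k = Min (supp (\<alpha> (ch k)))" for k
  have nz: "\<alpha> (ch k) \<noteq> 0" if "k \<in> G" for k using G(3)[OF that] by auto
  have h: "h k \<in> ?F" "h k \<le> b k" if k: "k \<in> G" for k
  proof -
    show "h k \<in> ?F" using G(3)[OF k] nz[OF k] unfolding h_def by blast
    obtain i where "i \<in> supp (\<alpha> (ch k))" "i < b k" using G(3)[OF k] by auto
    then show "h k \<le> b k" unfolding h_def by (meson Min_le finite_keys le_trans less_imp_le)
  qed
  have mono: "ch k < ch k' \<and> h k < h k'" if k: "k \<in> G" "k' \<in> G" "k < k'" for k k'
  proof -
    obtain i where i: "i \<in> supp (\<alpha> (ch k))" "i \<in> {a k..<b k}" using G(3)[OF k(1)] by blast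
    obtain j where j: "j \<in> supp (\<alpha> (ch k'))" "j \<in> {a k'..<b k'}" using G(3)[OF k(2)] by blast
    have lt: "ch k < ch k'"
    proof (rule ccontr)
      assume "\<not> ch k < ch k'"
      moreover have "ch k \<noteq> ch k'" using G(2) k by (auto dest: inj_onD)
      ultimately have "before (\<alpha> (ch k')) (\<alpha> (ch k))" using famD(3)[OF fam] G(3) k by (meson linorder_neqE_nat)
      then show False using meets_order[OF bs _ j i] k(3) by simp
    qed
    then have "before (\<alpha> (ch k)) (\<alpha> (ch k'))" using famD(3)[OF fam] G(3) k by blast
    then show ?thesis using lt before_Max_Min(2) nz k unfolding h_def by blast
  qed
  have finG: "finite G" using scc G(1) by (auto simp: scc_def intro: finite_subset)
  have "(\<lambda>k. col (h k)) ` G \<subseteq> {..<N}" using block_coloringD(3)[OF col h(1)] by blast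
  then have "sum c G = (\<Sum>i<N. sum c {k\<in>G. col (h k) = i})"
    using finG by (intro sum.group[symmetric]) auto
  also have "\<dots> \<le> (\<Sum>i<N. \<epsilon>)"
  proof (rule sum_mono)
    fix i
    have "b ` {k\<in>G. col (h k) = i} \<in> schreier0 m"
    proof (rule schreier0_spread_image[OF block_coloringD(5)[OF col, of i]])
      show "h g \<in> {x \<in> ?F. col x = i} \<and> h g \<le> b g" if "g \<in> {k\<in>G. col (h k) = i}" for g
        using h[of g] that by blast
      show "h g < h g' \<and> b g < b g'" if "g \<in> {k\<in>G. col (h k) = i}" "g' \<in> {k\<in>G. col (h k) = i}" "g < g'" for g g'
        using mono[of g g'] block_seq_strict[OF bs that(3)] that by blast
    qed (use finG in simp)
    then have "small_set (Suc m) b {k\<in>G. col (h k) = i}" by (simp add: small_set_def)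
    moreover have "{k\<in>G. col (h k) = i} \<subseteq> F" using G(1) by blast
    ultimately show "sum c {k\<in>G. col (h k) = i} \<le> \<epsilon>" using scc unfolding scc_def by blast
  qed
  also have "\<dots> \<le> real p * \<epsilon>" using N \<epsilon> by (simp add: mult_right_mono)
  finally show ?thesis .
qed

text \<open>Blocks that are the first one met by some average are set aside: each of them has an
  average of its own, so their total weight is at most \<open>p * \<epsilon>\<close>. Every other
  block is met by at most one average. There \<open>average_le\<close> gains 1/p, as the sizes are
  at least \<open>p\<close>, and loses one largest coefficient per average. These largest
  coefficients again sit on blocks with an average of their own and sum to at most
  \<open>p * \<epsilon>\<close>.\<close>

lemma late_averages_le:
  assumes bs: "block_seq a b" "blocks a b x" and C: "\<And>k. norm01 n (x k) \<le> C"
    and scc: "scc (Suc m) a b \<epsilon> F c" and fam: "fam n (Suc m) L \<alpha>" and n: "Suc m = n"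
    and l0: "l0 \<in> L" "i0 \<in> supp (\<alpha> l0)" "i0 \<le> p" and \<epsilon>: "0 \<le> \<epsilon>" and p: "1 \<le> p"
    and M: "M \<subseteq> L" "\<And>l. l \<in> M \<Longrightarrow> p \<le> l"
  shows "\<bar>\<Sum>l\<in>M. \<Sum>k\<in>F. c k * dual_pairing (\<alpha> l) (x k)\<bar> \<le> C * (2 * real p * \<epsilon> + 1 / real p)"
proof -
  have C0: "0 \<le> C" using C[of 0] norm01_nonneg[of n "x 0"] by linarith
  have sx: "supp (x k) \<subseteq> {a k..<b k}" for k using bs(2) by (simp add: blocks_def)
  have F: "finite F" "\<And>k. 0 \<le> c k" "sum c F = 1" using scc by (auto simp: scc_def)
  have finM: "finite M" using famD(1)[OF fam] M(1) finite_subset by blast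
  define V where "V l = {k\<in>F. supp (\<alpha> l) \<inter> {a k..<b k} \<noteq> {}}" for l
  have finV: "finite (V l)" for l using F(1) by (simp add: V_def)
  define Bad where "Bad = {Min (V l) |l. l \<in> M \<and> V l \<noteq> {}}"
  have VF: "V l \<subseteq> F" for l by (auto simp: V_def)
  have BadF: "Bad \<subseteq> F"
  proof
    fix k assume "k \<in> Bad"
    then obtain l where "V l \<noteq> {}" "k = Min (V l)" by (auto simp: Bad_def)
    then show "k \<in> F" using Min_in[OF finV[of l]] VF by blast
  qed
  define K where "K l = V l - Bad" for l
  have disj: "K l \<inter> K l' = {}" if ll: "l \<in> M" "l' \<in> M" "l < l'" for l l'
  proof (rule ccontr)
    assume "K l \<inter> K l' \<noteq> {}"
    then obtain k where k: "k \<in> V l" "k \<in> V l'" "k \<notin> Bad" by (auto simp: K_def)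
    then have "V l' \<noteq> {}" by blast
    then have V: "Min (V l') \<in> V l'" "Min (V l') \<le> k" using Min_in[OF finV[of l']] Min_le[OF finV k(2)] by blast+
    have "Min (V l') \<in> Bad" using k ll by (auto simp: Bad_def)
    then have lt: "Min (V l') < k" using V(2) k(3) by (metis le_neq_implies_less)
    obtain i where i: "i \<in> supp (\<alpha> l)" "i \<in> {a k..<b k}" using k(1) unfolding V_def by blast
    obtain j where j: "j \<in> supp (\<alpha> l')" "j \<in> {a (Min (V l'))..<b (Min (V l'))}" using V(1) unfolding V_def by blast
    have "before (\<alpha> l) (\<alpha> l')" using famD(3)[OF fam] M(1) ll by blast
    then show False using meets_order[OF bs(1) _ i j] lt by simp
  qed
  have sumBad: "sum c Bad \<le> real p * \<epsilon>"
  proof -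
    define ch where "ch k = (SOME l. l \<in> M \<and> V l \<noteq> {} \<and> k = Min (V l))" for k
    have ch: "ch k \<in> M \<and> V (ch k) \<noteq> {} \<and> k = Min (V (ch k))" if "k \<in> Bad" for k
      unfolding ch_def by (rule someI_ex) (use that in \<open>auto simp: Bad_def\<close>)
    show ?thesis
    proof (rule covered_sum_le[OF bs(1) scc fam l0 \<epsilon> BadF, where ch = ch])
      show "inj_on ch Bad" using ch by (metis inj_onI)
      fix k assume k: "k \<in> Bad"
      have "k \<in> V (ch k)" using ch[OF k] Min_in[OF finV[of "ch k"]] by simp
      then show "ch k \<in> L \<and> supp (\<alpha> (ch k)) \<inter> {a k..<b k} \<noteq> {}" using ch[OF k] M(1) by (auto simp: V_def)
    qed
  qed
  define M' where "M' = {l\<in>M. K l \<noteq> {}}"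
  have finM': "finite M'" using finM by (simp add: M'_def)
  have "\<forall>l\<in>M'. \<exists>k\<in>K l. \<forall>k'\<in>K l. c k' \<le> c k"
  proof
    fix l assume "l \<in> M'"
    then have "finite (c ` K l)" "c ` K l \<noteq> {}" using finV by (auto simp: M'_def K_def)
    then have "Max (c ` K l) \<in> c ` K l" "\<forall>k'\<in>K l. c k' \<le> Max (c ` K l)" by (auto intro: Max_in)
    then obtain k where "k \<in> K l" "Max (c ` K l) = c k" "\<forall>k'\<in>K l. c k' \<le> Max (c ` K l)" by blast
    then show "\<exists>k\<in>K l. \<forall>k'\<in>K l. c k' \<le> c k" by (intro bexI[of _ k]) simp_all
  qed
  then obtain \<kappa> where \<kappa>: "\<And>l. l \<in> M' \<Longrightarrow> \<kappa> l \<in> K l" "\<And>l k'. l \<in> M' \<Longrightarrow> k' \<in> K l \<Longrightarrow> c k' \<le> c (\<kappa> l)" by metis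
  have inj\<kappa>: "inj_on \<kappa> M'"
  proof (rule inj_onI, rule ccontr)
    fix l l' assume l: "l \<in> M'" "l' \<in> M'" "\<kappa> l = \<kappa> l'" "l \<noteq> l'"
    then have "\<kappa> l \<in> K l \<inter> K l'" using \<kappa>(1) by (metis IntI)
    then show False using disj[of l l'] disj[of l' l] l by (auto simp: M'_def neq_iff)
  qed
  have sum\<kappa>: "(\<Sum>l\<in>M'. c (\<kappa> l)) \<le> real p * \<epsilon>"
  proof -
    have "sum c (\<kappa> ` M') \<le> real p * \<epsilon>"
    proof (rule covered_sum_le[OF bs(1) scc fam l0 \<epsilon>, where ch = "inv_into M' \<kappa>"])
      show "\<kappa> ` M' \<subseteq> F" using \<kappa>(1) by (auto simp: K_def V_def)
      show "inj_on (inv_into M' \<kappa>) (\<kappa> ` M')" by (simp add: inj_on_inv_into)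
      fix k assume "k \<in> \<kappa> ` M'"
      then obtain l where l: "l \<in> M'" "k = \<kappa> l" by blast
      then have "inv_into M' \<kappa> k = l" using inj\<kappa> by simp
      then show "inv_into M' \<kappa> k \<in> L \<and> supp (\<alpha> (inv_into M' \<kappa> k)) \<inter> {a k..<b k} \<noteq> {}"
        using \<kappa>(1)[OF l(1)] l M(1) by (auto simp: M'_def K_def V_def)
    qed
    then show ?thesis using inj\<kappa> by (simp add: sum.reindex)
  qed
  have part1: "\<bar>\<Sum>k\<in>Bad. c k * (\<Sum>l\<in>M. dual_pairing (\<alpha> l) (x k))\<bar> \<le> C * (real p * \<epsilon>)"
  proof -
    have "\<bar>\<Sum>k\<in>Bad. c k * (\<Sum>l\<in>M. dual_pairing (\<alpha> l) (x k))\<bar> \<le> (\<Sum>k\<in>Bad. c k * C)"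
    proof (rule order_trans[OF sum_abs], rule sum_mono)
      fix k
      have "\<bar>\<Sum>l\<in>M. dual_pairing (\<alpha> l) (x k)\<bar> \<le> C"
        using fam_sum_le[OF fam_subset[OF fam M(1)], of "x k"] n C[of k] by simp
      then show "\<bar>c k * (\<Sum>l\<in>M. dual_pairing (\<alpha> l) (x k))\<bar> \<le> c k * C"
        using F(2) by (simp add: abs_mult mult_left_mono)
    qed
    also have "\<dots> = C * sum c Bad" by (simp add: sum_distrib_left mult.commute)
    finally show ?thesis using mult_left_mono[OF sumBad C0] by linarith
  qed
  have part2: "\<bar>\<Sum>l\<in>M. \<Sum>k\<in>K l. c k * dual_pairing (\<alpha> l) (x k)\<bar> \<le> C * (1 / real p) + C * (real p * \<epsilon>)"
  proof -
    have "(\<Sum>l\<in>M. \<Sum>k\<in>K l. c k * dual_pairing (\<alpha> l) (x k)) = (\<Sum>l\<in>M'. \<Sum>k\<in>K l. c k * dual_pairing (\<alpha> l) (x k))"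
      using finM by (intro sum.mono_neutral_right) (auto simp: M'_def)
    also have "\<bar>\<dots>\<bar> \<le> (\<Sum>l\<in>M'. C * sum c (K l) / real p + C * c (\<kappa> l))"
    proof (rule order_trans[OF sum_abs], rule sum_mono)
      fix l assume l: "l \<in> M'"
      have lM: "l \<in> M" using l by (simp add: M'_def)
      have "\<bar>\<Sum>k\<in>K l. c k * dual_pairing (\<alpha> l) (x k)\<bar> \<le> C * sum c (K l) / real l + C * c (\<kappa> l)"
      proof (rule average_le[OF bs C])
        show "avg n l (\<alpha> l)" using famD(2)[OF fam] M(1) lM by blast
        show "finite (K l)" using finV by (simp add: K_def)
      qed (use F(2) \<kappa>(2)[OF l] in auto)
      also have "C * sum c (K l) / real l \<le> C * sum c (K l) / real p"
        using M(2)[OF lM] p C0 F(2) by (intro divide_left_mono mult_nonneg_nonneg sum_nonneg) auto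
      finally show "\<bar>\<Sum>k\<in>K l. c k * dual_pairing (\<alpha> l) (x k)\<bar> \<le> C * sum c (K l) / real p + C * c (\<kappa> l)" by simp
    qed
    also have "\<dots> = C * (\<Sum>l\<in>M'. sum c (K l)) / real p + C * (\<Sum>l\<in>M'. c (\<kappa> l))"
      by (simp add: sum.distrib sum_distrib_left sum_divide_distrib)
    also have "\<dots> \<le> C * 1 / real p + C * (real p * \<epsilon>)"
    proof (intro add_mono divide_right_mono mult_left_mono C0 sum\<kappa>)
      have "(\<Sum>l\<in>M'. sum c (K l)) \<le> sum c F"
      proof (rule sum_disjoint_le[OF F(1) finM'])
        fix r s assume "r \<in> M'" "s \<in> M'" "r \<noteq> s"
        then show "K r \<inter> K s = {}" using disj[of r s] disj[of s r] by (auto simp: M'_def neq_iff)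
      qed (use F(2) in \<open>auto simp: K_def V_def\<close>)
      then show "(\<Sum>l\<in>M'. sum c (K l)) \<le> 1" using F(3) by simp
    qed simp
    finally show ?thesis by simp
  qed
  have "(\<Sum>l\<in>M. \<Sum>k\<in>F. c k * dual_pairing (\<alpha> l) (x k)) =
      (\<Sum>l\<in>M. (\<Sum>k\<in>Bad. c k * dual_pairing (\<alpha> l) (x k)) + (\<Sum>k\<in>K l. c k * dual_pairing (\<alpha> l) (x k)))"
  proof (rule sum.cong[OF refl])
    fix l assume "l \<in> M"
    have "(\<Sum>k\<in>F. c k * dual_pairing (\<alpha> l) (x k)) = (\<Sum>k\<in>Bad. c k * dual_pairing (\<alpha> l) (x k)) + (\<Sum>k\<in>F - Bad. c k * dual_pairing (\<alpha> l) (x k))"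
      using F(1) BadF by (simp add: sum.subset_diff add.commute)
    also have "(\<Sum>k\<in>F - Bad. c k * dual_pairing (\<alpha> l) (x k)) = (\<Sum>k\<in>K l. c k * dual_pairing (\<alpha> l) (x k))"
    proof (rule sum.mono_neutral_right)
      show "\<forall>k\<in>F - Bad - K l. c k * dual_pairing (\<alpha> l) (x k) = 0"
      proof
        fix k assume "k \<in> F - Bad - K l"
        then have "dual_pairing (\<alpha> l) (x k) = 0" using sx by (intro dual_pairing_eq_0) (auto simp: K_def V_def)
        then show "c k * dual_pairing (\<alpha> l) (x k) = 0" by simp
      qed
    qed (use F(1) in \<open>auto simp: K_def V_def\<close>)
    finally show "(\<Sum>k\<in>F. c k * dual_pairing (\<alpha> l) (x k)) = (\<Sum>k\<in>Bad. c k * dual_pairing (\<alpha> l) (x k)) + (\<Sum>k\<in>K l. c k * dual_pairing (\<alpha> l) (x k))" .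
  qed
  also have "\<dots> = (\<Sum>k\<in>Bad. c k * (\<Sum>l\<in>M. dual_pairing (\<alpha> l) (x k))) + (\<Sum>l\<in>M. \<Sum>k\<in>K l. c k * dual_pairing (\<alpha> l) (x k))"
    unfolding sum.distrib sum.swap[of _ Bad M] by (simp add: sum_distrib_left)
  finally have eq: "(\<Sum>l\<in>M. \<Sum>k\<in>F. c k * dual_pairing (\<alpha> l) (x k)) = \<dots>" .
  have "C * (2 * real p * \<epsilon> + 1 / real p) = C * (real p * \<epsilon>) + (C * (1 / real p) + C * (real p * \<epsilon>))"
    by (simp add: algebra_simps)
  then show ?thesis unfolding eq using part1 part2 by linarith
qed

section \<open>Domination\<close>

lemma restr_restr: "restr A (restr B f) = restr (A \<inter> B) f"
  by (auto intro!: poly_mapping_eqI simp: lookup_restr)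

text \<open>\<open>schreier0_spread\<close> with the number of colours kept visible; joining two
  families requires knowing how many colours each of them uses.\<close>

lemma block_coloring_spread:
  assumes "block_coloring (\<lambda>G. G \<in> schreier0 k) F c N" "finite G" "\<And>g. g \<in> G \<Longrightarrow> h g \<in> F \<and> h g \<le> g"
    "\<And>g g'. g \<in> G \<Longrightarrow> g' \<in> G \<Longrightarrow> g < g' \<Longrightarrow> h g < h g'"
  shows "block_coloring (\<lambda>G. G \<in> schreier0 k) G (\<lambda>g. c (h g)) N"
  unfolding block_coloring_def
proof (intro conjI ballI impI allI)
  show "finite G" by fact
  fix g assume g: "g \<in> G"
  show "c (h g) < N" using block_coloringD(3)[OF assms(1)] assms(3)[OF g] by blast
  show "N \<le> g" using block_coloringD(4)[OF assms(1), of "h g"] assms(3)[OF g] by simp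
  fix g' assume g': "g' \<in> G" "g \<le> g'"
  have "h g \<le> h g'"
  proof (cases "g = g'")
    case False
    then show ?thesis using assms(4)[OF g g'(1)] g'(2) by simp
  qed simp
  then show "c (h g) \<le> c (h g')" using block_coloringD(2)[OF assms(1)] assms(3) g g' by blast
next
  fix j
  show "{g\<in>G. c (h g) = j} \<in> schreier0 k"
  proof (rule schreier0_spread[OF block_coloringD(5)[OF assms(1), of j], of _ h])
    show "finite {g\<in>G. c (h g) = j}" using assms(2) by simp
    show "h g \<in> {x\<in>F. c x = j} \<and> h g \<le> g" if "g \<in> {g\<in>G. c (h g) = j}" for g
      using assms(3)[of g] that by blast
    show "h g < h g'" if "g \<in> {g\<in>G. c (h g) = j}" "g' \<in> {g\<in>G. c (h g) = j}" "g < g'" for g g'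
      using assms(4)[of g g'] that by blast
  qed
qed

text \<open>The colours of the second set are shifted by \<open>N1\<close>. The result is admissible
  once all elements are at least the total number of colours.\<close>

lemma block_coloring_union:
  assumes "block_coloring (\<lambda>G. G \<in> schreier0 k) F1 c1 N1" "block_coloring (\<lambda>G. G \<in> schreier0 k) F2 c2 N2"
    and "\<And>u v. u \<in> F1 \<Longrightarrow> v \<in> F2 \<Longrightarrow> u < v" "\<And>u. u \<in> F1 \<union> F2 \<Longrightarrow> N1 + N2 \<le> u"
  shows "F1 \<union> F2 \<in> schreier0 (Suc k)"
proof -
  define c where "c u = (if u \<in> F1 then c1 u else N1 + c2 u)" for u
  note D1 = block_coloringD[OF assms(1)] and D2 = block_coloringD[OF assms(2)]
  have c1: "c u = c1 u" "c u < N1" if "u \<in> F1" for u using D1(3) that by (auto simp: c_def)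
  have c2: "c u = N1 + c2 u" if "u \<in> F2" for u using assms(3)[of u u] that by (auto simp: c_def)
  have "block_coloring (\<lambda>G. G \<in> schreier0 k) (F1 \<union> F2) c (N1 + N2)"
    unfolding block_coloring_def
  proof (intro conjI ballI impI allI)
    show "finite (F1 \<union> F2)" using D1(1) D2(1) by simp
    fix u assume u: "u \<in> F1 \<union> F2"
    show "N1 + N2 \<le> u" using assms(4)[OF u] .
    show "c u < N1 + N2" using u c1[of u] c2[of u] D2(3)[of u] by (metis UnE add_less_cancel_left trans_less_add1)
    fix v assume v: "v \<in> F1 \<union> F2" "u \<le> v"
    show "c u \<le> c v"
    proof (cases "u \<in> F1")
      case True
      then show ?thesis using c1[of u] c1[of v] c2[of v] D1(2)[of u v] v
        by (metis UnE less_imp_le trans_le_add1)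
    next
      case False
      then have "u \<in> F2" using u by blast
      moreover have "v \<in> F2" using v assms(3)[of v u] \<open>u \<in> F2\<close> by (meson UnE leD)
      ultimately show ?thesis using c2 D2(2) v by simp
    qed
  next
    fix j
    show "{u \<in> F1 \<union> F2. c u = j} \<in> schreier0 k"
    proof (cases "j < N1")
      case True
      have "{u \<in> F1 \<union> F2. c u = j} \<subseteq> {u \<in> F1. c1 u = j}" using c1 c2 True by force
      then show ?thesis by (rule schreier0_subset[OF D1(5)])
    next
      case False
      have "{u \<in> F1 \<union> F2. c u = j} \<subseteq> {u \<in> F2. c2 u = j - N1}" using c1 c2 False by force
      then show ?thesis by (rule schreier0_subset[OF D2(5)])
    qed
  qed
  then show ?thesis unfolding schreier0_Suc by blast
qed

lemma lookup_sum_successive: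
  fixes R :: "nat set"
  assumes "finite R" "\<And>r s. r \<in> R \<Longrightarrow> s \<in> R \<Longrightarrow> r < s \<Longrightarrow> before (g r) (g s)" "r \<in> R" "v \<in> supp (g r)"
  shows "Poly_Mapping.lookup (\<Sum>r\<in>R. g r) v = Poly_Mapping.lookup (g r) v"
proof -
  have "Poly_Mapping.lookup (g t) v = 0" if t: "t \<in> R" "t \<noteq> r" for t
  proof (rule ccontr)
    assume "Poly_Mapping.lookup (g t) v \<noteq> 0"
    then have "v \<in> supp (g t)" by (simp add: in_keys_iff)
    moreover have "before (g t) (g r) \<or> before (g r) (g t)" using assms(2,3) t by (meson neq_iff)
    ultimately show False using assms(4) unfolding before_iff by blast
  qed
  then have "(\<Sum>t\<in>R. Poly_Mapping.lookup (g t) v) = (\<Sum>t\<in>{r}. Poly_Mapping.lookup (g t) v)"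
    using assms(1,3) by (intro sum.mono_neutral_right) auto
  then show ?thesis by (simp add: lookup_sum)
qed

lemma supp_sum_successive:
  fixes R :: "nat set"
  assumes "finite R" "\<And>r s. r \<in> R \<Longrightarrow> s \<in> R \<Longrightarrow> r < s \<Longrightarrow> before (g r) (g s)" "r \<in> R"
  shows "supp (g r) \<subseteq> supp (\<Sum>r\<in>R. g r)"
  using lookup_sum_successive[OF assms] by (auto simp: in_keys_iff)

section \<open>Setting and budgets of the domination argument\<close>

abbreviation "lo f \<equiv> Min (supp f)"
abbreviation "hi f \<equiv> Max (supp f)"

lemma lo_hi: "f \<noteq> 0 \<Longrightarrow> lo f \<in> supp f" "f \<noteq> 0 \<Longrightarrow> hi f \<in> supp f" "i \<in> supp f \<Longrightarrow> lo f \<le> i" "i \<in> supp f \<Longrightarrow> i \<le> hi f"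
  for f :: "nat \<Rightarrow>\<^sub>0 real"
  by (auto intro: Min_in Max_in)

text \<open>Special convex combinations of \<open>x\<close> and \<open>y\<close> over the sets
  \<open>F i\<close> are compared, \<open>m\<close> of them at a time, with coefficients of modulus
  at most \<open>M\<close>. \<open>A k\<close> is an average of size \<open>s k\<close> that sees
  \<open>y k\<close> with value at least \<delta>. As \<open>s k\<close> does not exceed
  \<open>b k\<close>, averages of a functional that live beyond the block can still follow
  \<open>A k\<close>; the condition \<open>2 * b j \<le> a k\<close> leaves room for two numbers of
  colours. \<open>e1\<close> and \<open>e2\<close> make the two error terms of
  \<open>late_averages_le\<close> at most e i/16 each.\<close>

locale domination =
  fixes n n' :: nat and a b :: "nat \<Rightarrow> nat" and x y :: "nat \<Rightarrow> nat \<Rightarrow>\<^sub>0 real" and C \<delta> :: real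
    and A :: "nat \<Rightarrow> nat \<Rightarrow>\<^sub>0 real" and s :: "nat \<Rightarrow> nat" and F :: "nat \<Rightarrow> nat set"
    and c :: "nat \<Rightarrow> nat \<Rightarrow> real" and \<epsilon> :: "nat \<Rightarrow> real" and p :: "nat \<Rightarrow> nat" and e :: "nat \<Rightarrow> real"
    and m :: nat and M :: real
  assumes n: "n = Suc n'" and bs: "block_seq a b" and bx: "blocks a b x" and by_: "blocks a b y"
    and C: "\<And>k. norm01 n (x k) \<le> C" and \<delta>: "0 < \<delta>"
    and A: "\<And>k. avg n (s k) (A k)" "\<And>k. supp (A k) \<subseteq> {a k..<b k}" "\<And>k. \<delta> \<le> dual_pairing (A k) (y k)"
    and s: "\<And>k. s k \<le> b k" and gap: "\<And>j k. j < k \<Longrightarrow> b j < s k \<and> 2 * b j \<le> a k"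
    and scc: "\<And>i. scc n a b (\<epsilon> i) (F i) (c i)" and \<epsilon>: "\<And>i. 0 \<le> \<epsilon> i"
    and FS: "\<And>i. Max (F i) < Min (F (Suc i))" and p0: "p 0 = 1" and pS: "\<And>i. p (Suc i) = b (Max (F i))"
    and e1: "\<And>i. C / real (p i) \<le> e i / 16" and e2: "\<And>i. 2 * C * real (p i) * \<epsilon> i \<le> e i / 16"
    and M: "0 \<le> M"
begin

definition "w i = (\<Sum>k\<in>F i. c i k *\<^sub>R x k)"
definition "z i = (\<Sum>k\<in>F i. c i k *\<^sub>R y k)"
definition "xs d = (\<Sum>i<m. d i *\<^sub>R w i)" for d :: "nat \<Rightarrow> real"
definition "zs d = (\<Sum>i<m. d i *\<^sub>R z i)" for d :: "nat \<Rightarrow> real"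
text \<open>A norming functional has modulus at most \<open>C\<close> on \<open>x k\<close>, while
  \<open>A k\<close> reaches \<delta> on \<open>y k\<close>; the quotient is the price of exchanging
  one for the other.\<close>

definition "K = C / \<delta>"

lemma C0: "0 \<le> C"
  using C[of 0] norm01_nonneg[of n "x 0"] by linarith

lemma F: "finite (F i)" "F i \<noteq> {}" "0 \<le> c i k" "sum (c i) (F i) = 1" "a ` F i \<in> schreier0 n"
  using scc[of i] unfolding scc_def by blast+

lemma c_le: "k \<in> F i \<Longrightarrow> c i k \<le> \<epsilon> i"
  using scc_coeff_le[OF bs, of n' "\<epsilon> i" "F i" "c i" k] scc[of i] n by simp

lemma F_p: "k \<in> F i \<Longrightarrow> p i \<le> a k" "k \<in> F i \<Longrightarrow> b k \<le> p (Suc i)"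
proof -
  assume k: "k \<in> F i"
  show "p i \<le> a k"
  proof (cases i)
    case 0
    then show ?thesis using p0 block_seqD(1)[OF bs] by simp
  next
    case (Suc j)
    have "Min (F i) \<le> k" using k F(1) by simp
    then have "Max (F j) < k" using FS[of j] Suc by simp
    then show ?thesis using block_seqD(3)[OF bs] pS[of j] Suc by simp
  qed
  show "b k \<le> p (Suc i)" unfolding pS using k F(1) by (intro block_seqD(5)[OF bs]) simp
qed

lemma p_Suc_less: "p i < p (Suc i)"
proof -
  obtain k where "k \<in> F i" using F(2) by blast
  then show ?thesis using F_p[of k i] block_seqD(2)[OF bs, of k] by linarith
qed

lemma p_strict: "i < j \<Longrightarrow> p i < p j"
  using p_Suc_less by (rule lift_Suc_mono_less)

lemma p_mono: "i \<le> j \<Longrightarrow> p i \<le> p j"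
  using p_strict by (metis le_less)

lemma p_pos: "1 \<le> p i"
  using p_mono[of 0 i] p0 by simp

lemma p_gt: "i < p i"
proof (induction i)
  case (Suc i)
  then show ?case using p_Suc_less[of i] by linarith
qed (simp add: p0)

lemma e_nonneg: "0 \<le> e i"
proof -
  have "0 \<le> C / real (p i)" using C0 by simp
  then show ?thesis using e1[of i] by linarith
qed

lemma C\<epsilon>: "C * \<epsilon> i \<le> e i / 32"
proof -
  have "C * \<epsilon> i * 1 \<le> C * \<epsilon> i * real (p i)" using p_pos[of i] C0 \<epsilon> by (intro mult_left_mono) auto
  then show ?thesis using e2[of i] by (simp add: mult_ac)
qed

text \<open>The index of the combination to whose interval a coordinate belongs; \<open>fi\<close>
  and \<open>la\<close> below are the first and the last index in the range of a functional.\<close>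

definition ix :: "nat \<Rightarrow> nat" where "ix v = (LEAST i. v < p (Suc i))"

lemma ix: "v < p (Suc (ix v))" "1 \<le> v \<Longrightarrow> p (ix v) \<le> v"
proof -
  have "v < p (Suc v)" using p_gt[of "Suc v"] by simp
  then show "v < p (Suc (ix v))" unfolding ix_def by (rule LeastI)
  assume v: "1 \<le> v"
  show "p (ix v) \<le> v"
  proof (cases "ix v")
    case 0
    then show ?thesis using v p0 by simp
  next
    case (Suc j)
    then have "\<not> v < p (Suc j)" unfolding ix_def by (intro not_less_Least) simp
    then show ?thesis using Suc by simp
  qed
qed

lemma ix_unique: "p i \<le> v \<Longrightarrow> v < p (Suc i) \<Longrightarrow> ix v = i"
proof -
  assume v: "p i \<le> v" "v < p (Suc i)"
  then have "1 \<le> v" using p_pos[of i] by simp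
  then have "p (ix v) \<le> v" "v < p (Suc (ix v))" using ix by auto
  then show "ix v = i" using v p_mono[of "Suc i" "ix v"] p_mono[of "Suc (ix v)" i] by (meson Suc_leI leD le_less_trans less_le_trans linorder_neqE_nat)
qed

lemma ix_mono: "u \<le> v \<Longrightarrow> ix u \<le> ix v"
  unfolding ix_def[of u] using ix(1)[of v] by (intro Least_le) simp

lemma ix_less_iff: "1 \<le> v \<Longrightarrow> i < ix v \<longleftrightarrow> p (Suc i) \<le> v"
  using ix[of v] ix_def not_less_Least[of i "\<lambda>i. v < p (Suc i)"] p_mono[of "Suc (ix v)" "Suc i"]
  by (metis Suc_le_mono le_less_trans not_le)

abbreviation "fi f \<equiv> ix (lo f)"
abbreviation "la f \<equiv> ix (hi f)"

lemma supp_w: "supp (w i) \<subseteq> {p i..<p (Suc i)}" "supp (z i) \<subseteq> {p i..<p (Suc i)}"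
proof -
  have "{a k..<b k} \<subseteq> {p i..<p (Suc i)}" if "k \<in> F i" for k using F_p[OF that] by auto
  then have "supp (x k) \<subseteq> {p i..<p (Suc i)}" "supp (y k) \<subseteq> {p i..<p (Suc i)}" if "k \<in> F i" for k
    using that bx by_ unfolding blocks_def by blast+
  then show "supp (w i) \<subseteq> {p i..<p (Suc i)}" "supp (z i) \<subseteq> {p i..<p (Suc i)}"
    unfolding w_def z_def by (intro supp_sum_scaleR_subset; blast)+
qed

lemma pairing_w_eq_0: "(\<And>v. v \<in> supp f \<Longrightarrow> ix v \<noteq> i) \<Longrightarrow> dual_pairing f (w i) = 0"
  using supp_w(1)[of i] ix_unique[of i] by (intro dual_pairing_eq_0) fastforce

lemma pairing_z_eq_0: "(\<And>v. v \<in> supp f \<Longrightarrow> ix v \<noteq> i) \<Longrightarrow> dual_pairing f (z i) = 0"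
  using supp_w(2)[of i] ix_unique[of i] by (intro dual_pairing_eq_0) fastforce

lemma ix_supp: "v \<in> supp f \<Longrightarrow> fi f \<le> ix v \<and> ix v \<le> la f"
  using lo_hi(3,4)[of v f] by (auto intro: ix_mono)

lemma pairing_xs: "dual_pairing f (xs d) = (\<Sum>i<m. d i * dual_pairing f (w i))"
  by (simp add: xs_def dual_pairing_sum dual_pairing_scaleR)

lemma pairing_zs: "dual_pairing f (zs d) = (\<Sum>i<m. d i * dual_pairing f (z i))"
  by (simp add: zs_def dual_pairing_sum dual_pairing_scaleR)

lemma pairing_w: "dual_pairing f (w i) = (\<Sum>k\<in>F i. c i k * dual_pairing f (x k))"
  by (simp add: w_def dual_pairing_sum dual_pairing_scaleR)

text \<open>A functional confined to one index is granted only a quarter of the budget, because many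
  of them may occur as parts of one average, next to a part that arrives from the left and is
  granted everything.\<close>

definition er :: "(nat \<Rightarrow>\<^sub>0 real) \<Rightarrow> nat \<Rightarrow> real" where
  "er f i = (if i < fi f \<or> la f < i then 0 else if fi f = la f then e i / 4 else e i)"

text \<open>At the last index, an average of size \<open>l\<close> whose range covers several
  indices costs at most 1/4 + (3/4)/l of \<open>e i\<close>, hence 5/8 as l \<ge> 2. The saved 3/8
  is what a sum of averages may spend.\<close>

definition ea :: "(nat \<Rightarrow>\<^sub>0 real) \<Rightarrow> nat \<Rightarrow> real" where
  "ea f i = (if i < fi f \<or> la f < i then 0 else if fi f = la f then e i / 4 else if i = la f then 5 / 8 * e i else e i)"

lemma ea_le_er: "ea f i \<le> er f i"
  using e_nonneg[of i] by (auto simp: ea_def er_def)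

lemma er_nonneg: "0 \<le> er f i" and ea_nonneg: "0 \<le> ea f i"
  using e_nonneg[of i] by (auto simp: ea_def er_def)

text \<open>The substitute may depend on the coefficients. It is confined to the range of
  \<open>f\<close>, so that substitutes for successive functionals are again successive.\<close>

definition dominated :: "(nat \<Rightarrow>\<^sub>0 real) \<Rightarrow> bool" where
  "dominated f \<longleftrightarrow> (\<forall>d. (\<forall>i. \<bar>d i\<bar> \<le> M) \<longrightarrow> (\<exists>g\<in>W0 n. supp g \<subseteq> {lo f..hi f} \<and>
     dual_pairing f (xs d) \<le> K * dual_pairing g (zs d) + M * (\<Sum>i<m. er f i)))"

text \<open>The size is preserved, since inside a very fast growing sum it is tied to the
  neighbouring averages.\<close>

definition dominated_avg :: "nat \<Rightarrow> (nat \<Rightarrow>\<^sub>0 real) \<Rightarrow> bool" where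
  "dominated_avg l f \<longleftrightarrow> (\<forall>d. (\<forall>i. \<bar>d i\<bar> \<le> M) \<longrightarrow> (\<exists>g. avg n l g \<and> supp g \<subseteq> {lo f..hi f} \<and>
     dual_pairing f (xs d) \<le> K * dual_pairing g (zs d) + M * (\<Sum>i<m. ea f i)))"

lemma s_strict: "j < k \<Longrightarrow> s j < s k"
  using s[of j] gap[of j k] by linarith

text \<open>Only the units strictly inside the range of \<open>f\<close> are kept, so that the functional on the
  \<open>y\<close>-side stays within the range of \<open>f\<close>.\<close>

lemma single_block_units:
  assumes f: "f \<in> W0 n" "f \<noteq> 0" "fi f = i" "la f = i"
  shows "\<exists>G\<subseteq>F i. \<bar>dual_pairing f (w i)\<bar> \<le> C * sum (c i) G + 2 * C * \<epsilon> i \<and>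
    (\<forall>k\<in>G. b k \<le> hi f \<and> (\<exists>k1\<in>F i. k1 < k \<and> lo f < b k1))"
proof -
  define V where "V = {k\<in>F i. lo f < b k \<and> a k \<le> hi f}"
  have finV: "finite V" using F(1) by (simp add: V_def)
  define G where "G = {k\<in>V. Min V < k \<and> k < Max V}"
  have sx: "supp (x k) \<subseteq> {a k..<b k}" for k using bx by (simp add: blocks_def)
  have le: "\<bar>dual_pairing f (w i)\<bar> \<le> C * sum (c i) V"
  proof -
    have "dual_pairing f (w i) = (\<Sum>k\<in>V. c i k * dual_pairing f (x k))"
      unfolding pairing_w
    proof (rule sum.mono_neutral_right[OF F(1)])
      show "\<forall>k\<in>F i - V. c i k * dual_pairing f (x k) = 0"
      proof
        fix k assume k: "k \<in> F i - V"
        have "supp f \<inter> supp (x k) = {}"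
        proof (rule ccontr)
          assume "supp f \<inter> supp (x k) \<noteq> {}"
          then obtain v where v: "v \<in> supp f" "v \<in> {a k..<b k}" using sx by blast
          then show False using k lo_hi(3,4)[OF v(1)] by (auto simp: V_def)
        qed
        then show "c i k * dual_pairing f (x k) = 0" by (simp add: dual_pairing_eq_0)
      qed
    qed (auto simp: V_def)
    also have "\<bar>\<dots>\<bar> \<le> (\<Sum>k\<in>V. c i k * C)"
    proof (rule order_trans[OF sum_abs], rule sum_mono)
      fix k
      have "\<bar>dual_pairing f (x k)\<bar> \<le> C" using W0_le_norm01[OF f(1), of "x k"] C[of k] by linarith
      then show "\<bar>c i k * dual_pairing f (x k)\<bar> \<le> c i k * C" using F(3) by (simp add: abs_mult mult_left_mono)
    qed
    also have "\<dots> = C * sum (c i) V" by (simp add: sum_distrib_left mult.commute)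
    finally show ?thesis .
  qed
  have "sum (c i) V \<le> sum (c i) G + 2 * \<epsilon> i"
  proof (cases "V = {}")
    case True
    then show ?thesis using \<epsilon>[of i] by (simp add: G_def)
  next
    case False
    then have MV: "Min V \<in> V" "Max V \<in> V" using finV by auto
    have "V \<subseteq> G \<union> {Min V, Max V}"
      using Min_le[OF finV] Max_ge[OF finV] unfolding G_def by (auto simp: le_less)
    then have "sum (c i) V \<le> sum (c i) (G \<union> {Min V, Max V})" using finV F(3) by (intro sum_mono2) (auto simp: G_def)
    also have "\<dots> = sum (c i) G + sum (c i) {Min V, Max V}"
      using finV by (intro sum.union_disjoint) (auto simp: G_def)
    also have "sum (c i) {Min V, Max V} \<le> c i (Min V) + c i (Max V)" using F(3) by (cases "Min V = Max V") auto
    also have "\<dots> \<le> 2 * \<epsilon> i" using MV c_le[of "Min V" i] c_le[of "Max V" i] by (auto simp: V_def)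
    finally show ?thesis by simp
  qed
  then have "C * sum (c i) V \<le> C * (sum (c i) G + 2 * \<epsilon> i)" using C0 by (rule mult_left_mono)
  then have "\<bar>dual_pairing f (w i)\<bar> \<le> C * sum (c i) G + 2 * C * \<epsilon> i" using le by (simp add: distrib_left)
  moreover have "b k \<le> hi f \<and> (\<exists>k1\<in>F i. k1 < k \<and> lo f < b k1)" if k: "k \<in> G" for k
  proof -
    have ne: "V \<noteq> {}" using k by (auto simp: G_def)
    then have MV: "Min V \<in> V" "Max V \<in> V" using finV by auto
    have "b k \<le> a (Max V)" using k block_seqD(3)[OF bs] by (simp add: G_def)
    also have "\<dots> \<le> hi f" using MV(2) unfolding V_def by blast
    finally show ?thesis using k MV(1) unfolding G_def V_def by blast
  qed
  moreover have "G \<subseteq> F i" by (auto simp: G_def V_def)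
  ultimately show ?thesis by blast
qed

text \<open>The averages \<open>A k\<close> indexed by their sizes, as \<open>fam\<close> demands;
  \<open>s\<close> is injective.\<close>

definition "AA l = A (inv s l)"

lemma AA: "AA (s k) = A k"
proof -
  have "inj s" using s_strict by (metis injI less_irrefl neq_iff)
  then show ?thesis by (simp add: AA_def)
qed

lemma units_before: "j < k \<Longrightarrow> before (A j) (A k)"
  unfolding before_iff using A(2)[of j] A(2)[of k] block_seqD(3)[OF bs, of j k] by fastforce

text \<open>The colouring is inherited from the left ends of the blocks of \<open>F i\<close>. Its
  number of colours lies below all these ends, also for blocks outside \<open>G\<close>; such a
  discarded block is what makes it possible to join the family with another one.\<close>

lemma units_coloring:
  assumes G: "G \<subseteq> F i" "finite G"
  shows "\<exists>col N. block_coloring (\<lambda>G. G \<in> schreier0 n') {Min (supp (AA l)) |l. l \<in> s ` G \<and> AA l \<noteq> 0} col N \<and> (\<forall>k\<in>F i. N \<le> a k)"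
proof -
  obtain col N where col: "block_coloring (\<lambda>G. G \<in> schreier0 n') (a ` F i) col N"
    using F(5)[of i] unfolding n schreier0_Suc by blast
  have Ank: "A k \<noteq> 0" for k using A(3)[of k] \<delta> by auto
  have Min: "Min (supp (A k)) \<in> {a k..<b k}" for k using lo_hi(1)[OF Ank] A(2) by blast
  have eq: "{Min (supp (AA l)) |l. l \<in> s ` G \<and> AA l \<noteq> 0} = (\<lambda>k. Min (supp (A k))) ` G"
  proof -
    have nz: "AA l \<noteq> 0" if "l \<in> s ` G" for l using that AA Ank by auto
    then have "{Min (supp (AA l)) |l. l \<in> s ` G \<and> AA l \<noteq> 0} = (\<lambda>l. Min (supp (AA l))) ` s ` G" by auto
    then show ?thesis by (simp add: image_image AA)
  qed
  have mono: "Min (supp (A j)) < Min (supp (A k))" if "j < k" for j k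
    using before_Max_Min(2)[OF units_before[OF that] Ank Ank] .
  have inj: "j < k" if "Min (supp (A j)) < Min (supp (A k))" for j k
    using mono[of k j] that by (metis less_asym nat_neq_iff)
  define h where "h v = a (inv_into G (\<lambda>k. Min (supp (A k))) v)" for v
  have inv: "inv_into G (\<lambda>k. Min (supp (A k))) v \<in> G" "Min (supp (A (inv_into G (\<lambda>k. Min (supp (A k))) v))) = v"
    if "v \<in> (\<lambda>k. Min (supp (A k))) ` G" for v
    using inv_into_into[OF that] f_inv_into_f[OF that] by simp_all
  have "block_coloring (\<lambda>G. G \<in> schreier0 n') ((\<lambda>k. Min (supp (A k))) ` G) (\<lambda>g. col (h g)) N"
  proof (rule block_coloring_spread[OF col])
    show "finite ((\<lambda>k. Min (supp (A k))) ` G)" using G by simp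
    fix v assume v: "v \<in> (\<lambda>k. Min (supp (A k))) ` G"
    show "h v \<in> a ` F i \<and> h v \<le> v"
      using inv[OF v] G(1) Min[of "inv_into G (\<lambda>k. Min (supp (A k))) v"] unfolding h_def by auto
    fix v' assume v': "v' \<in> (\<lambda>k. Min (supp (A k))) ` G" "v < v'"
    show "h v < h v'" unfolding h_def
      using block_seq_strict[OF bs] inj inv(2)[OF v] inv(2)[OF v'(1)] v'(2) by metis
  qed
  then show ?thesis unfolding eq using block_coloringD(4)[OF col] by blast
qed

lemma units_pairing:
  assumes G: "G \<subseteq> F i" "finite G" and i: "i < m"
  shows "(\<Sum>l\<in>s ` G. dual_pairing (AA l) (zs d)) = d i * (\<Sum>k\<in>G. c i k * dual_pairing (A k) (y k))"
proof -
  have "inj_on s G" using s_strict by (metis inj_onI less_irrefl neq_iff)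
  then have "(\<Sum>l\<in>s ` G. dual_pairing (AA l) (zs d)) = (\<Sum>k\<in>G. dual_pairing (A k) (zs d))"
    by (simp add: sum.reindex AA)
  also have "\<dots> = (\<Sum>k\<in>G. d i * (c i k * dual_pairing (A k) (y k)))"
  proof (rule sum.cong[OF refl])
    fix k assume k: "k \<in> G"
    have ixk: "ix v = i" if "v \<in> supp (A k)" for v
      using A(2)[of k] that F_p[of k i] k G by (intro ix_unique) fastforce+
    have "dual_pairing (A k) (zs d) = (\<Sum>j\<in>{i}. d j * dual_pairing (A k) (z j))"
      unfolding pairing_zs using i ixk by (intro sum.mono_neutral_right) (auto intro!: pairing_z_eq_0)
    moreover have "dual_pairing (A k) (z i) = (\<Sum>k'\<in>{k}. c i k' * dual_pairing (A k) (y k'))"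
      unfolding z_def dual_pairing_sum dual_pairing_scaleR
      using G k F(1) blocks_pairing_eq_0[OF bs by_ A(2)[of k]] by (intro sum.mono_neutral_right) auto
    ultimately show "dual_pairing (A k) (zs d) = d i * (c i k * dual_pairing (A k) (y k))" by simp
  qed
  finally show ?thesis by (simp add: sum_distrib_left)
qed

lemma units_fam:
  assumes G: "G \<subseteq> F i" "finite G"
  shows "fam n n (s ` G) AA"
  unfolding fam_def
proof (intro conjI ballI impI)
  show "finite (s ` G)" using G by simp
  show "avg n l (AA l)" if "l \<in> s ` G" for l using that A(1) AA by auto
  show "{Min (supp (AA l)) |l. l \<in> s ` G \<and> AA l \<noteq> 0} \<in> schreier0 n"
    using units_coloring[OF G] unfolding n schreier0_Suc by blast
  fix l l' assume l: "l \<in> s ` G" "l' \<in> s ` G" "l < l'"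
  then obtain j k where jk: "l = s j" "l' = s k" by auto
  have lt: "j < k" using l(3) s_strict[of k j] unfolding jk by (metis less_asym nat_neq_iff)
  show "before (AA l) (AA l')" unfolding jk AA using units_before[OF lt] .
  fix v assume "v \<in> supp (AA l)"
  then have "v < b j" using A(2)[of j] unfolding jk AA by auto
  then show "v < l'" using gap[OF lt] unfolding jk by simp
qed

text \<open>Unlike \<open>sgn\<close> this never vanishes, so multiplication by it does not change
  supports.\<close>

definition "sg d = (if d < 0 then - 1 else (1::real))"

lemma sg_fam: "fam n k L \<alpha> \<Longrightarrow> fam n k L (\<lambda>l. sg d *\<^sub>R \<alpha> l)"
  using fam_uminus[of n k L \<alpha>] by (simp add: sg_def)

lemma units_value:
  assumes G: "G \<subseteq> F i" "finite G" and i: "i < m"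
  shows "C * sum (c i) G * \<bar>d i\<bar> \<le> K * (\<Sum>l\<in>s ` G. dual_pairing (sg (d i) *\<^sub>R AA l) (zs d))"
proof -
  have "(\<Sum>l\<in>s ` G. dual_pairing (sg (d i) *\<^sub>R AA l) (zs d)) = sg (d i) * (\<Sum>l\<in>s ` G. dual_pairing (AA l) (zs d))"
    by (simp add: dual_pairing_scaleR_left sum_distrib_left)
  also have "\<dots> = \<bar>d i\<bar> * (\<Sum>k\<in>G. c i k * dual_pairing (A k) (y k))"
    unfolding units_pairing[OF G i] by (simp add: sg_def)
  also have "\<dots> \<ge> \<bar>d i\<bar> * (\<Sum>k\<in>G. c i k * \<delta>)"
    using A(3) F(3) by (intro mult_left_mono sum_mono) auto
  finally have "K * (\<bar>d i\<bar> * (\<Sum>k\<in>G. c i k * \<delta>)) \<le> K * (\<Sum>l\<in>s ` G. dual_pairing (sg (d i) *\<^sub>R AA l) (zs d))"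
    using C0 \<delta> by (intro mult_left_mono) (auto simp: K_def)
  moreover have "K * (\<bar>d i\<bar> * (\<Sum>k\<in>G. c i k * \<delta>)) = C * sum (c i) G * \<bar>d i\<bar>"
    using \<delta> by (simp add: K_def flip: sum_distrib_right)
  ultimately show ?thesis by simp
qed

lemma single_xs:
  assumes f: "f \<noteq> 0" "fi f = i" "la f = i"
  shows "dual_pairing f (xs d) = (if i < m then d i * dual_pairing f (w i) else 0)"
proof -
  have z: "dual_pairing f (w j) = 0" if "j \<noteq> i" for j
    using ix_supp[of _ f] f that by (intro pairing_w_eq_0) force
  show ?thesis
  proof (cases "i < m")
    case True
    then have "dual_pairing f (xs d) = (\<Sum>j\<in>{i}. d j * dual_pairing f (w j))"
      unfolding pairing_xs using z by (intro sum.mono_neutral_right) auto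
    then show ?thesis using True by simp
  next
    case False
    then show ?thesis unfolding pairing_xs using z by (auto intro!: sum.neutral)
  qed
qed

text \<open>The modulus of \<open>f\<close> on \<open>w i\<close> is at most \<open>C\<close> times
  the weight of the blocks in its range, and the averages \<open>A k\<close> on all but the two
  outermost of these blocks reach \<delta> times their weight on \<open>z i\<close>. The outermost
  two cost \<open>2 * C * \<epsilon> i\<close>, which is at most e i/16 and so within the
  quarter.\<close>

lemma single_dominated:
  assumes f: "f \<in> W0 n" "f \<noteq> 0" "fi f = la f"
  shows "dominated f"
  unfolding dominated_def
proof (intro allI impI)
  fix d :: "nat \<Rightarrow> real" assume d: "\<forall>i. \<bar>d i\<bar> \<le> M"
  define i where "i = fi f"
  have fi: "fi f = i" "la f = i" using f(3) by (simp_all add: i_def)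
  have Er: "0 \<le> (\<Sum>i<m. er f i)" by (intro sum_nonneg er_nonneg)
  show "\<exists>g\<in>W0 n. supp g \<subseteq> {lo f..hi f} \<and>
     dual_pairing f (xs d) \<le> K * dual_pairing g (zs d) + M * (\<Sum>i<m. er f i)"
  proof (cases "i < m")
    case False
    then have "dual_pairing f (xs d) = 0" using single_xs[OF f(2) fi, of d] by simp
    then show ?thesis using mult_nonneg_nonneg[OF M Er] by (intro bexI[of _ 0]) simp_all
  next
    case True
    obtain G where G: "G \<subseteq> F i" "\<bar>dual_pairing f (w i)\<bar> \<le> C * sum (c i) G + 2 * C * \<epsilon> i"
        "\<forall>k\<in>G. b k \<le> hi f \<and> (\<exists>k1\<in>F i. k1 < k \<and> lo f < b k1)"
      using single_block_units[OF f(1,2) fi] by blast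
    have finG: "finite G" using G(1) F(1) finite_subset by blast
    define g where "g = (\<Sum>l\<in>s ` G. sg (d i) *\<^sub>R AA l)"
    have "g \<in> W0 n" unfolding g_def by (intro fam_sum_W0 sg_fam units_fam[OF G(1) finG])
    moreover have "supp g \<subseteq> {lo f..hi f}"
      unfolding g_def
    proof (rule supp_sum_scaleR_subset)
      fix l assume "l \<in> s ` G"
      then obtain k where k: "k \<in> G" "l = s k" by blast
      obtain k1 where "k1 < k" "lo f < b k1" using G(3) k(1) by blast
      then have "lo f \<le> a k" using block_seqD(3)[OF bs, of k1 k] by simp
      moreover have "b k \<le> hi f" using G(3) k(1) by blast
      ultimately show "supp (AA l) \<subseteq> {lo f..hi f}" using A(2)[of k] unfolding k(2) AA by fastforce
    qed
    moreover have "dual_pairing f (xs d) \<le> K * dual_pairing g (zs d) + M * (\<Sum>i<m. er f i)"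
    proof -
      have "dual_pairing f (xs d) = d i * dual_pairing f (w i)"
        using single_xs[OF f(2) fi, of d] True by simp
      also have "\<dots> \<le> \<bar>d i\<bar> * \<bar>dual_pairing f (w i)\<bar>" using abs_ge_self[of "d i * dual_pairing f (w i)"] by (simp add: abs_mult)
      also have "\<dots> \<le> \<bar>d i\<bar> * (C * sum (c i) G + 2 * C * \<epsilon> i)" using G(2) by (intro mult_left_mono) auto
      also have "\<dots> = C * sum (c i) G * \<bar>d i\<bar> + \<bar>d i\<bar> * (2 * C * \<epsilon> i)" by (simp add: algebra_simps)
      also have "C * sum (c i) G * \<bar>d i\<bar> \<le> K * dual_pairing g (zs d)"
        using units_value[where d = d, OF G(1) finG True] by (simp add: g_def dual_pairing_sum_left)
      also have "\<bar>d i\<bar> * (2 * C * \<epsilon> i) \<le> M * (e i / 4)"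
        using d M C0 \<epsilon>[of i] C\<epsilon>[of i] e_nonneg[of i] by (intro mult_mono) auto
      also have "e i / 4 = er f i" unfolding er_def fi by simp
      also have "er f i \<le> (\<Sum>i<m. er f i)"
        using True er_nonneg by (intro member_le_sum) auto
      finally show ?thesis using M by (simp add: mult_left_mono)
    qed
    ultimately show ?thesis by blast
  qed
qed

text \<open>The parts are replaced one by one and the size is kept. Away from the last index of
  \<open>f\<close> the budgets of the parts just average out; at the last index they have to be
  counted.\<close>

lemma average_dominated:
  assumes R: "avg_rep n l f R g" and f: "f \<noteq> 0" and dom: "\<And>r. r \<in> R \<Longrightarrow> g r \<noteq> 0 \<Longrightarrow> dominated (g r)"
  shows "dominated_avg l f"
  unfolding dominated_avg_def
proof (intro allI impI)
  fix d :: "nat \<Rightarrow> real" assume d: "\<forall>i. \<bar>d i\<bar> \<le> M"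
  have l: "2 \<le> l" "finite R" "card R \<le> l" and fR: "f = (1 / real l) *\<^sub>R (\<Sum>r\<in>R. g r)"
    and gW: "\<And>r. r \<in> R \<Longrightarrow> g r \<in> W0 n" and bef: "\<And>r s. r \<in> R \<Longrightarrow> s \<in> R \<Longrightarrow> r < s \<Longrightarrow> before (g r) (g s)"
    using R by (auto simp: avg_rep_def)
  define R' where "R' = {r\<in>R. g r \<noteq> 0}"
  have finR': "finite R'" "card R' \<le> l" using l card_mono[OF l(2), of R'] by (auto simp: R'_def)
  have supp_g: "supp (g r) \<subseteq> supp f" if "r \<in> R" for r
    using supp_sum_successive[OF l(2) bef that] l(1) by (simp add: fR supp_scaleR)
  have hull: "lo f \<le> lo (g r)" "hi (g r) \<le> hi f" if "r \<in> R'" for r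
    using that supp_g[of r] lo_hi(1,2)[of "g r"] lo_hi(3,4)[of _ f] by (auto simp: R'_def)
  have sumR': "(\<Sum>r\<in>R. g r) = (\<Sum>r\<in>R'. g r)" using l(2) by (intro sum.mono_neutral_right) (auto simp: R'_def)
  have "\<forall>r\<in>R'. \<exists>h. h \<in> W0 n \<and> supp h \<subseteq> {lo (g r)..hi (g r)} \<and>
     dual_pairing (g r) (xs d) \<le> K * dual_pairing h (zs d) + M * (\<Sum>i<m. er (g r) i)"
    using dom d unfolding dominated_def R'_def by blast
  then obtain h where h: "\<And>r. r \<in> R' \<Longrightarrow> h r \<in> W0 n" "\<And>r. r \<in> R' \<Longrightarrow> supp (h r) \<subseteq> {lo (g r)..hi (g r)}"
     "\<And>r. r \<in> R' \<Longrightarrow> dual_pairing (g r) (xs d) \<le> K * dual_pairing (h r) (zs d) + M * (\<Sum>i<m. er (g r) i)" by metis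
  define \<beta> where "\<beta> = (1 / real l) *\<^sub>R (\<Sum>r\<in>R'. h r)"
  have ord: "hi (g r) < lo (g s)" if "r \<in> R'" "s \<in> R'" "r < s" for r s
    using before_Max_Min(1)[OF bef] that by (auto simp: R'_def)
  have "avg_rep n l \<beta> R' h"
    unfolding avg_rep_def
  proof (intro conjI ballI impI)
    fix r s assume rs: "r \<in> R'" "s \<in> R'" "r < s"
    show "before (h r) (h s)" unfolding before_iff
    proof (intro ballI)
      fix u v assume "u \<in> supp (h r)" "v \<in> supp (h s)"
      then have "u \<le> hi (g r)" "lo (g s) \<le> v" using h(2) rs by fastforce+
      then show "u < v" using ord[OF rs] by linarith
    qed
  qed (use l finR' h(1) in \<open>auto simp: \<beta>_def\<close>)
  then have "avg n l \<beta>" unfolding avg_def by blast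
  moreover have "supp \<beta> \<subseteq> {lo f..hi f}"
  proof -
    have "supp (\<Sum>r\<in>R'. 1 *\<^sub>R h r) \<subseteq> {lo f..hi f}"
      using h(2) hull by (intro supp_sum_scaleR_subset) fastforce
    then show ?thesis using l(1) by (simp add: \<beta>_def supp_scaleR)
  qed
  moreover have "dual_pairing f (xs d) \<le> K * dual_pairing \<beta> (zs d) + M * (\<Sum>i<m. ea f i)"
  proof -
    have pt: "(\<Sum>r\<in>R'. er (g r) i) \<le> real l * ea f i" for i
    proof -
      have fila: "fi f \<le> fi (g r)" "la (g r) \<le> la f" "fi (g r) \<le> la (g r)" if "r \<in> R'" for r
        using hull[OF that] that lo_hi(4)[OF lo_hi(1)[of "g r"]] by (auto intro!: ix_mono simp: R'_def)
      have cardle: "real (card R') * t \<le> real l * t" if "0 \<le> t" for t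
        using finR'(2) that by (intro mult_right_mono) auto
      consider "i < fi f \<or> la f < i" | "fi f = la f" "i = la f" | "fi f \<le> i" "i < la f" | "fi f < la f" "i = la f"
        by linarith
      then show ?thesis
      proof cases
        case 1
        then have "er (g r) i = 0" if "r \<in> R'" for r using fila[OF that] by (auto simp: er_def)
        then show ?thesis using ea_nonneg by simp
      next
        case 2
        have "er (g r) i \<le> e i / 4" if "r \<in> R'" for r
          using fila[OF that] 2 e_nonneg[of i] by (auto simp: er_def)
        then have "(\<Sum>r\<in>R'. er (g r) i) \<le> real (card R') * (e i / 4)" by (rule sum_bounded_above)
        then show ?thesis using cardle[of "e i / 4"] e_nonneg[of i] 2 by (auto simp: ea_def)
      next
        case 3
        have "er (g r) i \<le> e i" for r using e_nonneg[of i] by (auto simp: er_def)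
        then have "(\<Sum>r\<in>R'. er (g r) i) \<le> real (card R') * e i" by (rule sum_bounded_above)
        then show ?thesis using cardle[of "e i"] e_nonneg[of i] 3 by (auto simp: ea_def)
      next
        case 4
        \<comment> \<open>Parts that arrive at the last index from a smaller one. There is at most
          one: once such a part has reached the index, every later part starts there.\<close>
        define T where "T = {r\<in>R'. fi (g r) < i \<and> la (g r) = i}"
        have T_eq: "r = s" if rs: "r \<in> T" "s \<in> T" for r s
        proof (rule ccontr)
          have no: False if rs: "r \<in> T" "s \<in> T" "r < s" for r s
          proof -
            have "hi (g r) < lo (g s)" using ord rs by (auto simp: T_def)
            then have "la (g r) \<le> fi (g s)" by (intro ix_mono) simp
            then show False using rs by (auto simp: T_def)
          qed
          assume "r \<noteq> s"
          then show False using no rs by (meson neq_iff)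
        qed
        have cardT: "card T \<le> 1"
        proof (cases "T = {}")
          case False
          then obtain r where "r \<in> T" by blast
          then have "T \<subseteq> {r}" using T_eq by blast
          then show ?thesis using card_mono[of "{r}" T] by simp
        qed simp
        have "er (g r) i \<le> e i / 4 + (if r \<in> T then 3 / 4 * e i else 0)" if "r \<in> R'" for r
          using fila[OF that] that 4 e_nonneg[of i] by (auto simp: er_def T_def)
        then have "(\<Sum>r\<in>R'. er (g r) i) \<le> (\<Sum>r\<in>R'. e i / 4 + (if r \<in> T then 3 / 4 * e i else 0))"
          by (rule sum_mono)
        also have "\<dots> = real (card R') * (e i / 4) + real (card T) * (3 / 4 * e i)"
        proof -
          have "(\<Sum>r\<in>R'. if r \<in> T then 3 / 4 * e i else 0) = (\<Sum>r\<in>T. 3 / 4 * e i)"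
            using finR' by (intro sum.mono_neutral_cong_right) (auto simp: T_def)
          then show ?thesis by (simp add: sum.distrib)
        qed
        also have "\<dots> \<le> real l * (e i / 4) + 1 * (3 / 4 * e i)"
        proof (rule add_mono)
          show "real (card R') * (e i / 4) \<le> real l * (e i / 4)" by (rule cardle) (simp add: e_nonneg)
          show "real (card T) * (3 / 4 * e i) \<le> 1 * (3 / 4 * e i)"
            by (rule mult_right_mono) (use cardT e_nonneg[of i] in auto)
        qed
        also have "\<dots> \<le> real l * (5 / 8 * e i)"
        proof -
          have "2 * e i \<le> real l * e i" using l(1) e_nonneg[of i] by (intro mult_right_mono) auto
          then show ?thesis by (simp add: algebra_simps)
        qed
        finally show ?thesis using 4 by (simp add: ea_def)
      qed
    qed
    have "(\<Sum>r\<in>R'. dual_pairing (g r) (xs d)) \<le> (\<Sum>r\<in>R'. K * dual_pairing (h r) (zs d) + M * (\<Sum>i<m. er (g r) i))"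
      by (rule sum_mono) (rule h(3))
    also have "\<dots> = K * (\<Sum>r\<in>R'. dual_pairing (h r) (zs d)) + M * (\<Sum>i<m. \<Sum>r\<in>R'. er (g r) i)"
      by (simp add: sum.distrib sum.swap[of _ "{..<m}"] flip: sum_distrib_left)
    also have "\<dots> \<le> K * (\<Sum>r\<in>R'. dual_pairing (h r) (zs d)) + M * (\<Sum>i<m. real l * ea f i)"
      using M pt by (intro add_left_mono mult_left_mono sum_mono)
    finally have le: "(\<Sum>r\<in>R'. dual_pairing (g r) (xs d)) \<le> K * (\<Sum>r\<in>R'. dual_pairing (h r) (zs d)) + real l * (M * (\<Sum>i<m. ea f i))"
      by (simp add: mult_ac flip: sum_distrib_left)
    have "dual_pairing f (xs d) = (1 / real l) * (\<Sum>r\<in>R'. dual_pairing (g r) (xs d))"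
      unfolding fR sumR' by (simp add: dual_pairing_scaleR_left dual_pairing_sum_left)
    also have "\<dots> \<le> (1 / real l) * (K * (\<Sum>r\<in>R'. dual_pairing (h r) (zs d)) + real l * (M * (\<Sum>i<m. ea f i)))"
      using le by (rule mult_left_mono) simp
    also have "\<dots> = K * dual_pairing \<beta> (zs d) + M * (\<Sum>i<m. ea f i)"
      unfolding \<beta>_def dual_pairing_scaleR_left dual_pairing_sum_left using l(1) by (simp add: distrib_left mult_ac)
    finally show ?thesis .
  qed
  ultimately show "\<exists>g. avg n l g \<and> supp g \<subseteq> {lo f..hi f} \<and>
     dual_pairing f (xs d) \<le> K * dual_pairing g (zs d) + M * (\<Sum>i<m. ea f i)" by blast
qed

lemma dominated_avg_imp_dominated: "dominated_avg l f \<Longrightarrow> dominated f"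
  unfolding dominated_def dominated_avg_def
  using avg_W0 sum_mono[of "{..<m}" "ea f" "er f"] ea_le_er M
  by (meson add_left_mono mult_left_mono order_trans)

end

text \<open>A sum of averages, with the coefficients \<open>d\<close> fixed. Domination is assumed
  for all right tails of the averages, because averages are going to be cut after the first index of
  their range.\<close>

locale sum_node = domination +
  fixes L :: "nat set" and \<alpha> :: "nat \<Rightarrow> nat \<Rightarrow>\<^sub>0 real" and d :: "nat \<Rightarrow> real"
  assumes fam: "fam n n L \<alpha>" and L: "L \<noteq> {}" and nz: "\<And>l. l \<in> L \<Longrightarrow> \<alpha> l \<noteq> 0"
    and hyp: "\<And>l v. l \<in> L \<Longrightarrow> restr {v..} (\<alpha> l) \<noteq> 0 \<Longrightarrow> dominated_avg l (restr {v..} (\<alpha> l))"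
    and d: "\<And>i. \<bar>d i\<bar> \<le> M"
begin

definition "f = (\<Sum>l\<in>L. \<alpha> l)"
definition "l1 = Min L"
abbreviation "fl l \<equiv> fi (\<alpha> l)"
abbreviation "ll l \<equiv> la (\<alpha> l)"
definition "b0 = ll l1"
text \<open>Averages are split at the end of their first index. The right part is left to the
  induction hypothesis. The left parts of the averages other than \<open>l1\<close> that start at
  the same index are collected in \<open>Rm\<close> and estimated jointly, since there may be
  arbitrarily many of them.\<close>

definition "\<alpha>0 l = restr {p (Suc (fl l))..} (\<alpha> l)"
definition "ha l i = (if \<alpha>0 l = 0 then 0 else ea (\<alpha>0 l) i)"
definition "Mi i = {l\<in>L. l \<noteq> l1 \<and> fl l = i}"
definition "Rm i = (\<Sum>l\<in>Mi i. dual_pairing (\<alpha> l) (w i))"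

section \<open>Positions of the averages and sizes of the remainders\<close>

lemma finL: "finite L"
  by (rule famD(1)[OF fam])

lemma l1: "l1 \<in> L" "l \<in> L \<Longrightarrow> l \<noteq> l1 \<Longrightarrow> l1 < l"
  using finL L Min_le[OF finL, of l] by (auto simp: l1_def le_less)

lemma pos: "l \<in> L \<Longrightarrow> i \<in> supp (\<alpha> l) \<Longrightarrow> 1 \<le> i"
  using supp_avg famD(2)[OF fam] by blast

lemma ord: "l \<in> L \<Longrightarrow> l' \<in> L \<Longrightarrow> l < l' \<Longrightarrow> hi (\<alpha> l) < lo (\<alpha> l')" "l \<in> L \<Longrightarrow> l' \<in> L \<Longrightarrow> l < l' \<Longrightarrow> hi (\<alpha> l) < l'"
    "l \<in> L \<Longrightarrow> l' \<in> L \<Longrightarrow> l < l' \<Longrightarrow> ll l \<le> fl l'"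
proof -
  assume l: "l \<in> L" "l' \<in> L" "l < l'"
  show *: "hi (\<alpha> l) < lo (\<alpha> l')" using before_Max_Min(1)[OF famD(3)[OF fam l]] nz l by blast
  show "hi (\<alpha> l) < l'" using famD(4)[OF fam l lo_hi(2)] nz l(1) by blast
  show "ll l \<le> fl l'" using * by (intro ix_mono) simp
qed

lemma lo_le_hi: "l \<in> L \<Longrightarrow> lo (\<alpha> l) \<le> hi (\<alpha> l)" "l \<in> L \<Longrightarrow> fl l \<le> ll l"
  using lo_hi(4)[OF lo_hi(1)] nz by (auto intro: ix_mono)

lemma hull: "l \<in> L \<Longrightarrow> lo f \<le> lo (\<alpha> l)" "l \<in> L \<Longrightarrow> hi (\<alpha> l) \<le> hi f" "l \<in> L \<Longrightarrow> fi f \<le> fl l" "l \<in> L \<Longrightarrow> ll l \<le> la f"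
proof -
  assume l: "l \<in> L"
  have "supp (\<alpha> l) \<subseteq> supp f" unfolding f_def by (rule supp_sum_successive[OF finL famD(3)[OF fam] l])
  then show "lo f \<le> lo (\<alpha> l)" "hi (\<alpha> l) \<le> hi f"
    using lo_hi(1,2)[OF nz[OF l]] lo_hi(3,4)[of _ f] by blast+
  then show "fi f \<le> fl l" "ll l \<le> la f" by (auto intro: ix_mono)
qed

lemma f: "f \<noteq> 0"
proof -
  have "supp (\<alpha> l1) \<subseteq> supp f" unfolding f_def by (rule supp_sum_successive[OF finL famD(3)[OF fam] l1(1)])
  then show "f \<noteq> 0" using nz[OF l1(1)] by auto
qed

lemma p_ll: "l \<in> L \<Longrightarrow> p (ll l) \<le> hi (\<alpha> l)" "l \<in> L \<Longrightarrow> hi (\<alpha> l) < p (Suc (ll l))"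
  "l \<in> L \<Longrightarrow> p (fl l) \<le> lo (\<alpha> l)" "l \<in> L \<Longrightarrow> lo (\<alpha> l) < p (Suc (fl l))"
proof -
  assume l: "l \<in> L"
  have "1 \<le> hi (\<alpha> l)" "1 \<le> lo (\<alpha> l)" using pos[OF l lo_hi(2)[OF nz[OF l]]] pos[OF l lo_hi(1)[OF nz[OF l]]] .
  then show "p (ll l) \<le> hi (\<alpha> l)" "hi (\<alpha> l) < p (Suc (ll l))" "p (fl l) \<le> lo (\<alpha> l)" "lo (\<alpha> l) < p (Suc (fl l))"
    using ix by blast+
qed

lemma b0_le: "l \<in> L \<Longrightarrow> l \<noteq> l1 \<Longrightarrow> b0 \<le> fl l"
  using ord(3)[OF l1(1)] l1(2) by (simp add: b0_def)

lemma Mi_empty: "i < b0 \<Longrightarrow> Mi i = {}" "l \<in> L \<Longrightarrow> fl l < i \<Longrightarrow> i < ll l \<Longrightarrow> Mi i = {}"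
proof -
  show "i < b0 \<Longrightarrow> Mi i = {}" using b0_le by (fastforce simp: Mi_def)
  assume l: "l \<in> L" "fl l < i" "i < ll l"
  show "Mi i = {}"
  proof (rule ccontr)
    assume "Mi i \<noteq> {}"
    then obtain l' where l': "l' \<in> L" "fl l' = i" by (auto simp: Mi_def)
    consider "l < l'" | "l = l'" | "l' < l" by linarith
    then show False
    proof cases
      case 1
      then show ?thesis using ord(3)[OF l(1) l'(1)] l l' by simp
    next
      case 3
      then show ?thesis using ord(3)[OF l'(1) l(1)] lo_le_hi(2)[OF l'(1)] l l' by simp
    qed (use l l' in simp)
  qed
qed

lemma pairing_\<alpha>:
  assumes l: "l \<in> L"
  shows "dual_pairing (\<alpha> l) (xs d) = dual_pairing (\<alpha>0 l) (xs d) + (if fl l < m then d (fl l) * dual_pairing (\<alpha> l) (w (fl l)) else 0)"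
proof -
  have "dual_pairing (\<alpha> l) (w i) = dual_pairing (\<alpha>0 l) (w i) + (if i = fl l then dual_pairing (\<alpha> l) (w i) else 0)" for i
  proof (cases i "fl l" rule: linorder_cases)
    case less
    have "dual_pairing (\<alpha> l) (w i) = 0" using less ix_supp[of _ "\<alpha> l"] by (intro pairing_w_eq_0) fastforce
    moreover have "dual_pairing (\<alpha>0 l) (w i) = 0" using less ix_supp[of _ "\<alpha> l"]
      by (intro pairing_w_eq_0) (fastforce simp: \<alpha>0_def supp_restr)
    ultimately show ?thesis using less by simp
  next
    case equal
    have "dual_pairing (\<alpha>0 l) (w i) = 0"
      using supp_w(1)[of i] equal by (intro dual_pairing_eq_0) (fastforce simp: \<alpha>0_def supp_restr)
    then show ?thesis using equal by simp
  next
    case greater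
    have "p (Suc (fl l)) \<le> p i" using greater by (intro p_mono) simp
    then have "supp (w i) \<subseteq> {p (Suc (fl l))..}" using supp_w(1)[of i] by fastforce
    then show ?thesis using greater by (simp add: \<alpha>0_def dual_pairing_restr_left)
  qed
  then have "dual_pairing (\<alpha> l) (xs d) = (\<Sum>i<m. d i * (dual_pairing (\<alpha>0 l) (w i) + (if i = fl l then dual_pairing (\<alpha> l) (w i) else 0)))"
    unfolding pairing_xs by (intro sum.cong) auto
  also have "\<dots> = dual_pairing (\<alpha>0 l) (xs d) + (\<Sum>i<m. if i = fl l then d i * dual_pairing (\<alpha> l) (w i) else 0)"
    unfolding pairing_xs distrib_left sum.distrib by (simp add: if_distrib cong: if_cong)
  finally show ?thesis by simp
qed

lemma sum_remainders:
  "(\<Sum>l\<in>L - {l1}. if fl l < m then d (fl l) * dual_pairing (\<alpha> l) (w (fl l)) else 0) = (\<Sum>i<m. d i * Rm i)"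
proof -
  have "(\<Sum>l\<in>L - {l1}. if fl l < m then d (fl l) * dual_pairing (\<alpha> l) (w (fl l)) else 0)
      = (\<Sum>l\<in>L - {l1}. \<Sum>i<m. if fl l = i then d i * dual_pairing (\<alpha> l) (w i) else 0)"
    by (intro sum.cong refl) simp
  also have "\<dots> = (\<Sum>i<m. \<Sum>l\<in>L - {l1}. if fl l = i then d i * dual_pairing (\<alpha> l) (w i) else 0)"
    by (rule sum.swap)
  also have "\<dots> = (\<Sum>i<m. \<Sum>l\<in>Mi i. d i * dual_pairing (\<alpha> l) (w i))"
    using finL by (intro sum.cong refl sum.mono_neutral_cong_right) (auto simp: Mi_def)
  finally show ?thesis by (simp add: Rm_def sum_distrib_left)
qed

text \<open>The two terms of \<open>late_averages_le\<close> take e i/16 each. The average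
  \<open>l0\<close> that starts early is what limits the number of colours to
  \<open>p i\<close>.\<close>

lemma late_le:
  assumes l0: "l0 \<in> L" "lo (\<alpha> l0) \<le> p i" and Q: "Q \<subseteq> L" "\<And>l. l \<in> Q \<Longrightarrow> p i \<le> l"
  shows "\<bar>\<Sum>l\<in>Q. dual_pairing (\<alpha> l) (w i)\<bar> \<le> e i / 8"
proof -
  have "\<bar>\<Sum>l\<in>Q. \<Sum>k\<in>F i. c i k * dual_pairing (\<alpha> l) (x k)\<bar> \<le> C * (2 * real (p i) * \<epsilon> i + 1 / real (p i))"
    using scc[of i] fam lo_hi(1)[OF nz[OF l0(1)]] l0 Q
    by (intro late_averages_le[OF bs bx C, where m = n' and L = L and ?l0.0 = l0 and ?i0.0 = "lo (\<alpha> l0)"])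
       (use p_pos[of i] in \<open>auto simp: n \<epsilon>\<close>)
  also have "\<dots> = 2 * C * real (p i) * \<epsilon> i + C / real (p i)" by (simp add: algebra_simps)
  also have "\<dots> \<le> e i / 8" using e1[of i] e2[of i] by linarith
  finally show ?thesis by (simp add: pairing_w)
qed

lemma one_le:
  assumes l: "l \<in> L" shows "\<bar>dual_pairing (\<alpha> l) (w i)\<bar> \<le> C / real l + e i / 32"
proof -
  have "\<bar>dual_pairing (\<alpha> l) (w i)\<bar> \<le> C * sum (c i) (F i) / real l + C * \<epsilon> i"
    unfolding pairing_w using F(1,3) c_le \<epsilon> by (intro average_le[OF bs bx C famD(2)[OF fam l]]) auto
  then show ?thesis using C\<epsilon>[of i] F(4)[of i] by simp
qed

text \<open>An average \<open>l\<close> arriving from the left forces all averages that start at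
  \<open>i\<close> to come later. Their sizes exceed \<open>hi (\<alpha> l)\<close>, which is at
  least \<open>p i\<close>.\<close>

lemma Rm_covered:
  assumes l: "l \<in> L" "fl l < i" "i \<le> ll l"
  shows "\<bar>Rm i\<bar> \<le> e i / 8"
  unfolding Rm_def
proof (rule late_le[OF l(1)])
  have "p (Suc (fl l)) \<le> p i" using l by (intro p_mono) simp
  then show "lo (\<alpha> l) \<le> p i" using p_ll(4)[OF l(1)] by simp
  fix l' assume l': "l' \<in> Mi i"
  then have l'L: "l' \<in> L" "fl l' = i" by (auto simp: Mi_def)
  have "l < l'"
  proof (rule ccontr)
    assume "\<not> l < l'"
    then have "l' < l" using l'L l by (metis less_irrefl nat_neq_iff)
    then show False using ord(3)[OF l'L(1) l(1)] lo_le_hi(2)[OF l'L(1)] l l'L by simp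
  qed
  then have "hi (\<alpha> l) < l'" using ord(2) l l'L by blast
  moreover have "p i \<le> p (ll l)" using l by (intro p_mono)
  ultimately show "p i \<le> l'" using p_ll(1)[OF l(1)] by simp
qed (auto simp: Mi_def)

text \<open>The first average starting at \<open>i\<close> may have a small size and costs
  \<open>C\<close> divided by that size, plus e i/32. All further ones exceed a coordinate belonging
  to \<open>i\<close>, count as late and cost e i/8; the multiples of \<open>e i\<close> add up to
  5/32.\<close>

lemma Rm_le:
  assumes i: "b0 < i" "Mi i \<noteq> {}"
  shows "\<bar>Rm i\<bar> \<le> 5 / 32 * e i + C / real (Min (Mi i))"
proof -
  have fin: "finite (Mi i)" using finL by (simp add: Mi_def)
  define li where "li = Min (Mi i)"
  have li: "li \<in> Mi i" unfolding li_def using fin i by simp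
  then have liL: "li \<in> L" "fl li = i" by (auto simp: Mi_def)
  have "\<bar>\<Sum>l\<in>Mi i - {li}. dual_pairing (\<alpha> l) (w i)\<bar> \<le> e i / 8"
  proof (rule late_le[OF l1(1)])
    have "p (Suc b0) \<le> p i" using i by (intro p_mono) simp
    then show "lo (\<alpha> l1) \<le> p i" using p_ll(2)[OF l1(1)] lo_le_hi(1)[OF l1(1)] by (simp add: b0_def)
    fix l assume l: "l \<in> Mi i - {li}"
    then have "li < l" using Min_le[OF fin, of l] unfolding li_def by (metis DiffE insertI1 le_neq_implies_less)
    then have "hi (\<alpha> li) < l" using ord(2) liL l by (auto simp: Mi_def)
    then show "p i \<le> l" using p_ll(3)[OF liL(1)] lo_le_hi(1)[OF liL(1)] liL by simp
  qed (auto simp: Mi_def)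
  moreover have "Rm i = dual_pairing (\<alpha> li) (w i) + (\<Sum>l\<in>Mi i - {li}. dual_pairing (\<alpha> l) (w i))"
    unfolding Rm_def using fin li by (simp add: sum.remove)
  ultimately show ?thesis using one_le[OF liL(1), of i] unfolding li_def by linarith
qed

definition "rho i = (if b0 < i \<and> Mi i \<noteq> {} then 5 / 32 * e i else 0)"
text \<open>The amount charged in the next lemma to an index at which averages end, regardless of
  how many end there.\<close>

definition "ends i = (if \<exists>l\<in>L. ll l = i then e i / 16 else 0)"

text \<open>A block that meets a fresh average \<open>\<alpha> l\<close> costs \<open>C / l\<close>. As \<open>l\<close> exceeds the range of the
  preceding average, this is charged to the block in which that average ends.\<close>

lemma sum_Rm_le: "(\<Sum>i\<in>{i. i < m \<and> b0 < i}. \<bar>Rm i\<bar>) \<le> (\<Sum>i<m. rho i) + (\<Sum>i<m. ends i)"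
proof -
  \<comment> \<open>The fresh indices: some average other than \<open>l1\<close> starts there and
    none arrives from the left.\<close>
  define TS where "TS = {i. i < m \<and> b0 < i \<and> Mi i \<noteq> {} \<and> \<not> (\<exists>l\<in>L. fl l < i \<and> i \<le> ll l)}"
  have finTS: "finite TS" by (simp add: TS_def)
  define pd where "pd i = Max {l\<in>L. l < Min (Mi i)}" for i
  have finM: "finite (Mi i)" for i using finL by (simp add: Mi_def)
  have pd: "pd i \<in> L" "pd i < Min (Mi i)" "\<And>l. l \<in> L \<Longrightarrow> l < Min (Mi i) \<Longrightarrow> l \<le> pd i" "Min (Mi i) \<in> Mi i" if i: "i \<in> TS" for i
  proof -
    show min: "Min (Mi i) \<in> Mi i" using finM[of i] i by (auto simp: TS_def)
    then have "l1 \<in> {l\<in>L. l < Min (Mi i)}" using l1 by (auto simp: Mi_def)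
    moreover have fin: "finite {l\<in>L. l < Min (Mi i)}" using finL by simp
    ultimately have "pd i \<in> {l\<in>L. l < Min (Mi i)}" unfolding pd_def by (intro Max_in) auto
    then show "pd i \<in> L" "pd i < Min (Mi i)" by auto
    show "l \<le> pd i" if "l \<in> L" "l < Min (Mi i)" for l unfolding pd_def using fin that by (intro Max_ge) auto
  qed
  define \<pi> where "\<pi> i = ll (pd i)" for i
  have \<pi>_less: "\<pi> i < i" if i: "i \<in> TS" for i
  proof (rule ccontr)
    assume not: "\<not> \<pi> i < i"
    have min: "Min (Mi i) \<in> L" "fl (Min (Mi i)) = i" using pd(4)[OF i] by (auto simp: Mi_def)
    have "ll (pd i) \<le> i" using ord(3)[OF pd(1)[OF i] min(1) pd(2)[OF i]] min(2) by simp
    then have eq: "ll (pd i) = i" using not by (simp add: \<pi>_def)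
    then have "\<not> fl (pd i) < i" using i pd(1)[OF i] by (auto simp: TS_def)
    then have "fl (pd i) = i" using lo_le_hi(2)[OF pd(1)[OF i]] eq by simp
    moreover have "pd i \<noteq> l1" using eq i by (auto simp: b0_def TS_def)
    ultimately have "pd i \<in> Mi i" using pd(1)[OF i] by (simp add: Mi_def)
    then show False using pd(2)[OF i] Min_le[OF finM, of "pd i" i] by simp
  qed
  \<comment> \<open>The average preceding a fresh index ends at or after every earlier fresh index,
    and by \<open>\<pi>_less\<close> before the fresh index itself. Hence \<pi> is injective and no
    index is charged twice.\<close>
  have \<pi>_ge: "i \<le> \<pi> i'" if i: "i \<in> TS" "i' \<in> TS" "i < i'" for i i'
  proof -
    have mins: "Min (Mi i) \<in> L" "fl (Min (Mi i)) = i" "Min (Mi i') \<in> L" "fl (Min (Mi i')) = i'"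
      using pd(4)[OF i(1)] pd(4)[OF i(2)] by (auto simp: Mi_def)
    have "Min (Mi i) < Min (Mi i')"
    proof (rule ccontr)
      assume "\<not> Min (Mi i) < Min (Mi i')"
      then have "Min (Mi i') < Min (Mi i)" using mins i(3) by (metis less_irrefl nat_neq_iff)
      then have "ll (Min (Mi i')) \<le> i" using ord(3)[OF mins(3,1)] mins(2) by simp
      then show False using lo_le_hi(2)[OF mins(3)] mins(4) i(3) by simp
    qed
    then have "Min (Mi i) \<le> pd i'" using pd(3)[OF i(2) mins(1)] by blast
    then have "fl (Min (Mi i)) \<le> ll (pd i')"
    proof (cases "Min (Mi i) = pd i'")
      case True
      then show ?thesis using lo_le_hi(2)[OF mins(1)] by simp
    next
      case False
      then have "ll (Min (Mi i)) \<le> fl (pd i')" using ord(3)[OF mins(1) pd(1)[OF i(2)]] \<open>Min (Mi i) \<le> pd i'\<close> by simp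
      then show ?thesis using lo_le_hi(2)[OF mins(1)] lo_le_hi(2)[OF pd(1)[OF i(2)]] by linarith
    qed
    then show ?thesis using mins(2) by (simp add: \<pi>_def)
  qed
  have inj: "inj_on \<pi> TS"
  proof (rule inj_onI, rule ccontr)
    fix i i' assume i: "i \<in> TS" "i' \<in> TS" "\<pi> i = \<pi> i'" "i \<noteq> i'"
    then show False using \<pi>_less[of i] \<pi>_less[of i'] \<pi>_ge[of i i'] \<pi>_ge[of i' i] by (cases "i < i'") auto
  qed
  have charge: "C / real (Min (Mi i)) \<le> ends (\<pi> i)" if i: "i \<in> TS" for i
  proof -
    have "p (\<pi> i) \<le> hi (\<alpha> (pd i))" unfolding \<pi>_def by (rule p_ll(1)[OF pd(1)[OF i]])
    also have "\<dots> < Min (Mi i)" using ord(2)[OF pd(1)[OF i] _ pd(2)[OF i]] pd(4)[OF i] by (auto simp: Mi_def)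
    finally have "C / real (Min (Mi i)) \<le> C / real (p (\<pi> i))"
      using C0 p_pos[of "\<pi> i"] by (intro divide_left_mono mult_pos_pos) auto
    also have "\<dots> \<le> e (\<pi> i) / 16" by (rule e1)
    also have "\<dots> = ends (\<pi> i)" using pd(1)[OF i] by (auto simp: ends_def \<pi>_def)
    finally show ?thesis .
  qed
  have ends0: "0 \<le> ends i" for i using e_nonneg[of i] by (simp add: ends_def)
  have "(\<Sum>i\<in>TS. C / real (Min (Mi i))) \<le> (\<Sum>i\<in>TS. ends (\<pi> i))" by (rule sum_mono) (rule charge)
  also have "\<dots> = (\<Sum>i\<in>\<pi> ` TS. ends i)" using inj by (simp add: sum.reindex)
  also have "\<dots> \<le> (\<Sum>i<m. ends i)"
  proof (rule sum_mono2)
    show "\<pi> ` TS \<subseteq> {..<m}" using \<pi>_less by (force simp: TS_def)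
  qed (use ends0 in auto)
  finally have charges: "(\<Sum>i\<in>TS. C / real (Min (Mi i))) \<le> (\<Sum>i<m. ends i)" .
  have "(\<Sum>i\<in>{i. i < m \<and> b0 < i}. \<bar>Rm i\<bar>) \<le> (\<Sum>i\<in>{i. i < m \<and> b0 < i}. rho i + (if i \<in> TS then C / real (Min (Mi i)) else 0))"
  proof (rule sum_mono)
    fix i assume i: "i \<in> {i. i < m \<and> b0 < i}"
    show "\<bar>Rm i\<bar> \<le> rho i + (if i \<in> TS then C / real (Min (Mi i)) else 0)"
    proof (cases "Mi i = {}")
      case True
      then show ?thesis by (simp add: Rm_def rho_def TS_def)
    next
      case False
      show ?thesis
      proof (cases "i \<in> TS")
        case True
        then show ?thesis using Rm_le[of i] i False by (simp add: rho_def)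
      next
        case nTS: False
        then obtain l where "l \<in> L" "fl l < i" "i \<le> ll l" using i False by (auto simp: TS_def)
        then have "\<bar>Rm i\<bar> \<le> e i / 8" by (rule Rm_covered)
        then show ?thesis using nTS i False e_nonneg[of i] by (simp add: rho_def)
      qed
    qed
  qed
  also have "\<dots> = (\<Sum>i\<in>{i. i < m \<and> b0 < i}. rho i) + (\<Sum>i\<in>TS. C / real (Min (Mi i)))"
  proof -
    have "TS \<subseteq> {i. i < m \<and> b0 < i}" by (auto simp: TS_def)
    then have "(\<Sum>i\<in>{i. i < m \<and> b0 < i}. if i \<in> TS then C / real (Min (Mi i)) else 0) = (\<Sum>i\<in>TS. C / real (Min (Mi i)))"
      by (intro sum.mono_neutral_cong_right) auto
    then show ?thesis by (simp only: sum.distrib)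
  qed
  also have "(\<Sum>i\<in>{i. i < m \<and> b0 < i}. rho i) = (\<Sum>i<m. rho i)"
    by (rule sum.mono_neutral_left) (auto simp: rho_def)
  finally show ?thesis using charges by linarith
qed

lemma \<alpha>0_fi: "l \<in> L \<Longrightarrow> \<alpha>0 l \<noteq> 0 \<Longrightarrow> fl l < fi (\<alpha>0 l) \<and> la (\<alpha>0 l) \<le> ll l"
proof -
  assume l: "l \<in> L" "\<alpha>0 l \<noteq> 0"
  have lo: "lo (\<alpha>0 l) \<in> supp (\<alpha> l)" "p (Suc (fl l)) \<le> lo (\<alpha>0 l)" and hi: "hi (\<alpha>0 l) \<in> supp (\<alpha> l)"
    using lo_hi(1,2)[OF l(2)] by (auto simp: \<alpha>0_def supp_restr)
  have "fl l < fi (\<alpha>0 l)" using ix_less_iff[of "lo (\<alpha>0 l)"] lo pos[OF l(1)] by blast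
  moreover have "la (\<alpha>0 l) \<le> ll l" using lo_hi(4)[OF hi] by (rule ix_mono)
  ultimately show ?thesis by blast
qed

lemma ha: "0 \<le> ha l i" "l \<in> L \<Longrightarrow> ha l i \<le> e i" "l \<in> L \<Longrightarrow> \<not> (fl l < i \<and> i \<le> ll l) \<Longrightarrow> ha l i = 0"
    "l \<in> L \<Longrightarrow> i = ll l \<Longrightarrow> ha l i \<le> 5 / 8 * e i"
proof -
  show "0 \<le> ha l i" by (simp add: ha_def ea_nonneg)
  assume l: "l \<in> L"
  show "ha l i \<le> e i" using e_nonneg[of i] by (auto simp: ha_def ea_def)
  show "\<not> (fl l < i \<and> i \<le> ll l) \<Longrightarrow> ha l i = 0"
    using \<alpha>0_fi[OF l] by (auto simp: ha_def ea_def)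
  show "i = ll l \<Longrightarrow> ha l i \<le> 5 / 8 * e i"
    using \<alpha>0_fi[OF l] e_nonneg[of i] by (auto simp: ha_def ea_def)
qed

text \<open>The range of \<open>f\<close> covers several indices, so all of \<open>e i\<close> is
  available, and \<open>u\<close> is the error made for the first average. At the last index of a
  later average the shares are 5/8 + 5/32 + 1/16 = 27/32. Strictly inside an average no other one
  starts or ends, so it may use the full \<open>e i\<close>. At \<open>b0\<close> the shares are 3/4
  + 1/16.\<close>

lemma pointwise:
  assumes multi: "fi f < la f" and u: "\<And>i. fi f \<le> i \<Longrightarrow> i < b0 \<Longrightarrow> u i \<le> e i" "u b0 \<le> 3 / 4 * e b0"
    "\<And>i. b0 < i \<or> i < fi f \<Longrightarrow> u i = 0"
  shows "u i + (\<Sum>l\<in>L - {l1}. ha l i) + rho i + ends i \<le> er f i"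
proof -
  have zero: "(\<Sum>l\<in>L - {l1}. ha l i) = 0" if "\<And>l. l \<in> L \<Longrightarrow> l \<noteq> l1 \<Longrightarrow> \<not> (fl l < i \<and> i \<le> ll l)"
    using that ha(3) by (intro sum.neutral) blast
  have one: "(\<Sum>l\<in>L - {l1}. ha l i) = ha l i" if l: "l \<in> L" "l \<noteq> l1" "fl l < i" "i \<le> ll l" for l
  proof -
    have "ha l' i = 0" if l': "l' \<in> L" "l' \<noteq> l" for l'
    proof (rule ha(3)[OF l'(1)])
      consider "l < l'" | "l' < l" using l' by linarith
      then show "\<not> (fl l' < i \<and> i \<le> ll l')"
      proof cases
        case 1
        then show ?thesis using ord(3)[OF l(1) l'(1)] l by simp
      next
        case 2
        then show ?thesis using ord(3)[OF l'(1) l(1)] l by simp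
      qed
    qed
    then have "(\<Sum>l\<in>L - {l1}. ha l i) = (\<Sum>l\<in>{l}. ha l i)"
      using finL l by (intro sum.mono_neutral_right) auto
    then show ?thesis by simp
  qed
  have b0f: "fi f \<le> b0" "b0 \<le> la f" using hull(3,4)[OF l1(1)] lo_le_hi(2)[OF l1(1)] by (auto simp: b0_def)
  consider "i < fi f \<or> la f < i" | "fi f \<le> i" "i < b0" | "i = b0" | "b0 < i" "i \<le> la f" by linarith
  then show ?thesis
  proof cases
    case 1
    have "(\<Sum>l\<in>L - {l1}. ha l i) = 0" using 1 hull(3,4) by (intro zero) fastforce
    moreover have "Mi i = {}" using 1 hull(3,4) lo_le_hi(2) by (fastforce simp: Mi_def)
    moreover have "\<not> (\<exists>l\<in>L. ll l = i)" using 1 hull(3,4) lo_le_hi(2) by fastforce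
    moreover have "u i = 0" using 1 b0f u(3) by auto
    ultimately show ?thesis by (simp add: rho_def ends_def er_nonneg)
  next
    case 2
    have er: "er f i = e i" using 2 b0f multi by (simp add: er_def)
    have "(\<Sum>l\<in>L - {l1}. ha l i) = 0" using 2 b0_le by (intro zero) fastforce
    moreover have "\<not> (\<exists>l\<in>L. ll l = i)"
    proof
      assume "\<exists>l\<in>L. ll l = i"
      then obtain l where l: "l \<in> L" "ll l = i" by blast
      then show False using 2 b0_le[of l] lo_le_hi(2)[of l] by (cases "l = l1") (auto simp: b0_def)
    qed
    ultimately show ?thesis using u(1)[OF 2] 2 er by (simp add: rho_def ends_def)
  next
    case 3
    have er: "er f i = e i" using 3 b0f multi by (simp add: er_def)
    have "(\<Sum>l\<in>L - {l1}. ha l i) = 0" using 3 b0_le by (intro zero) fastforce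
    then show ?thesis using u(2) 3 er e_nonneg[of i] by (simp add: rho_def ends_def)
  next
    case 4
    have er: "er f i = e i" using 4 b0f multi by (simp add: er_def)
    have u0: "u i = 0" using u(3) 4 by simp
    have ends: "ends i \<le> e i / 16" and rho: "rho i \<le> 5 / 32 * e i" using e_nonneg[of i] by (auto simp: ends_def rho_def)
    show ?thesis
    proof (cases "\<exists>l\<in>L. fl l < i \<and> i \<le> ll l")
      case False
      then have "(\<Sum>l\<in>L - {l1}. ha l i) = 0" by (intro zero) blast
      then show ?thesis using u0 er ends rho e_nonneg[of i] by linarith
    next
      case True
      then obtain l where l: "l \<in> L" "fl l < i" "i \<le> ll l" by blast
      then have ne: "l \<noteq> l1" using 4 by (auto simp: b0_def)
      show ?thesis
      proof (cases "i = ll l")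
        case True
        then show ?thesis using one[OF l(1) ne l(2,3)] ha(4)[OF l(1) True] u0 er ends rho e_nonneg[of i] by linarith
      next
        case False
        then have lt: "i < ll l" using l by simp
        have "Mi i = {}" using Mi_empty(2)[OF l(1,2) lt] .
        moreover have "ll l' \<noteq> i" if l': "l' \<in> L" for l'
        proof (cases l l' rule: linorder_cases)
          case less
          then show ?thesis using ord(3)[OF l(1) l'] lo_le_hi(2)[OF l'] lt by simp
        next
          case greater
          then show ?thesis using ord(3)[OF l' l(1)] l(2) by simp
        qed (use lt in simp)
        ultimately show ?thesis using one[OF l(1) ne l(2,3)] ha(2)[OF l(1), of i] u0 er by (auto simp: rho_def ends_def)
      qed
    qed
  qed
qed

lemma betas:
  "\<exists>\<beta>. \<forall>l\<in>L. avg n l (\<beta> l) \<and> supp (\<beta> l) \<subseteq> {lo (\<alpha> l)..hi (\<alpha> l)} \<and> (ll l = fl l \<longrightarrow> \<beta> l = 0) \<and>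
     dual_pairing (\<alpha>0 l) (xs d) \<le> K * dual_pairing (\<beta> l) (zs d) + M * (\<Sum>i<m. ha l i)"
proof -
  have "\<forall>l\<in>L. \<exists>\<beta>. avg n l \<beta> \<and> supp \<beta> \<subseteq> {lo (\<alpha> l)..hi (\<alpha> l)} \<and> (ll l = fl l \<longrightarrow> \<beta> = 0) \<and>
     dual_pairing (\<alpha>0 l) (xs d) \<le> K * dual_pairing \<beta> (zs d) + M * (\<Sum>i<m. ha l i)"
  proof
    fix l assume l: "l \<in> L"
    show "\<exists>\<beta>. avg n l \<beta> \<and> supp \<beta> \<subseteq> {lo (\<alpha> l)..hi (\<alpha> l)} \<and> (ll l = fl l \<longrightarrow> \<beta> = 0) \<and>
     dual_pairing (\<alpha>0 l) (xs d) \<le> K * dual_pairing \<beta> (zs d) + M * (\<Sum>i<m. ha l i)"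
    proof (cases "\<alpha>0 l = 0")
      case True
      \<comment> \<open>Zero is an average of size \<open>l\<close>, being the empty restriction of
        one.\<close>
      have "avg n l (restr {} (\<alpha> l))" using famD(2)[OF fam l] by (rule avg_restr)
      moreover have "restr {} (\<alpha> l) = 0" by (auto intro!: poly_mapping_eqI simp: lookup_restr)
      ultimately show ?thesis using True by (intro exI[of _ 0]) (simp add: ha_def)
    next
      case False
      then have "dominated_avg l (\<alpha>0 l)" using hyp[OF l] by (simp add: \<alpha>0_def)
      then obtain \<beta> where \<beta>: "avg n l \<beta>" "supp \<beta> \<subseteq> {lo (\<alpha>0 l)..hi (\<alpha>0 l)}"
         "dual_pairing (\<alpha>0 l) (xs d) \<le> K * dual_pairing \<beta> (zs d) + M * (\<Sum>i<m. ea (\<alpha>0 l) i)"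
        using d unfolding dominated_avg_def by blast
      have "lo (\<alpha>0 l) \<in> supp (\<alpha> l)" "hi (\<alpha>0 l) \<in> supp (\<alpha> l)"
        using lo_hi(1,2)[OF False] by (auto simp: \<alpha>0_def supp_restr)
      then have "lo (\<alpha> l) \<le> lo (\<alpha>0 l)" "hi (\<alpha>0 l) \<le> hi (\<alpha> l)" using lo_hi(3,4) by auto
      then have "supp \<beta> \<subseteq> {lo (\<alpha> l)..hi (\<alpha> l)}" using \<beta>(2) by auto
      moreover have "ll l \<noteq> fl l" using \<alpha>0_fi[OF l False] lo_hi(4)[OF lo_hi(1)[OF False]] ix_mono[of "lo (\<alpha>0 l)" "hi (\<alpha>0 l)"] by linarith
      ultimately show ?thesis using \<beta> False by (intro exI[of _ \<beta>]) (simp add: ha_def)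
    qed
  qed
  then show ?thesis by metis
qed

lemma fam_hull:
  assumes Q: "Q \<subseteq> L" and avg: "\<And>l. l \<in> Q \<Longrightarrow> avg n l (\<beta> l)" and supp: "\<And>l. l \<in> Q \<Longrightarrow> supp (\<beta> l) \<subseteq> {lo (\<alpha> l)..hi (\<alpha> l)}"
  shows "fam n n Q \<beta>"
proof (rule fam_spread[OF fam Q avg])
  fix l i assume "l \<in> Q" "i \<in> supp (\<beta> l)"
  then show "\<alpha> l \<noteq> 0 \<and> lo (\<alpha> l) \<le> i \<and> i \<le> hi (\<alpha> l)" using supp nz Q by fastforce
qed

lemma main_sum_split:
  "dual_pairing f (xs d) = dual_pairing (\<alpha> l1) (xs d) + (if b0 < m then d b0 * Rm b0 else 0)
     + (\<Sum>l\<in>L - {l1}. dual_pairing (\<alpha>0 l) (xs d)) + (\<Sum>i\<in>{i. i < m \<and> b0 < i}. d i * Rm i)"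
proof -
  have "(\<Sum>i<m. d i * Rm i) = (\<Sum>i\<in>{i. i < m \<and> b0 \<le> i}. d i * Rm i)"
  proof (rule sum.mono_neutral_right)
    show "\<forall>i\<in>{..<m} - {i. i < m \<and> b0 \<le> i}. d i * Rm i = 0"
    proof
      fix i assume "i \<in> {..<m} - {i. i < m \<and> b0 \<le> i}"
      then have "Mi i = {}" by (intro Mi_empty(1)) auto
      then show "d i * Rm i = 0" by (simp add: Rm_def)
    qed
  qed auto
  also have "{i. i < m \<and> b0 \<le> i} = (if b0 < m then insert b0 {i. i < m \<and> b0 < i} else {i. i < m \<and> b0 < i})"
    by auto
  also have "(\<Sum>i\<in>\<dots>. d i * Rm i) = (if b0 < m then d b0 * Rm b0 else 0) + (\<Sum>i\<in>{i. i < m \<and> b0 < i}. d i * Rm i)"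
    by simp
  finally have R: "(\<Sum>i<m. d i * Rm i) = (if b0 < m then d b0 * Rm b0 else 0) + (\<Sum>i\<in>{i. i < m \<and> b0 < i}. d i * Rm i)" .
  have "dual_pairing f (xs d) = dual_pairing (\<alpha> l1) (xs d) + (\<Sum>l\<in>L - {l1}. dual_pairing (\<alpha> l) (xs d))"
    unfolding f_def dual_pairing_sum_left using finL l1(1) by (simp add: sum.remove)
  also have "(\<Sum>l\<in>L - {l1}. dual_pairing (\<alpha> l) (xs d)) = (\<Sum>l\<in>L - {l1}. dual_pairing (\<alpha>0 l) (xs d)) + (\<Sum>i<m. d i * Rm i)"
    unfolding sum_remainders[symmetric] sum.distrib[symmetric] using pairing_\<alpha> by (intro sum.cong) auto
  finally show ?thesis using R by simp
qed

text \<open>The first average reaches beyond its first index and is used as a whole. At its last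
  index \<open>b0\<close> it costs 5/8 of the budget, and since it arrives there from the left, the
  averages starting at \<open>b0\<close> are late and add only 1/8.\<close>

lemma first_case_I:
  assumes lt: "fl l1 < b0"
  shows "\<exists>g\<in>W0 n. supp g \<subseteq> {lo f..hi f} \<and> dual_pairing (\<alpha> l1) (xs d) + (if b0 < m then d b0 * Rm b0 else 0)
     + (\<Sum>l\<in>L - {l1}. dual_pairing (\<alpha>0 l) (xs d))
     \<le> K * dual_pairing g (zs d) + M * ((\<Sum>i<m. ea (\<alpha> l1) i + (if i = b0 then e i / 8 else 0)) + (\<Sum>l\<in>L - {l1}. \<Sum>i<m. ha l i))"
proof -
  obtain \<beta> where \<beta>: "\<And>l. l \<in> L \<Longrightarrow> avg n l (\<beta> l)" "\<And>l. l \<in> L \<Longrightarrow> supp (\<beta> l) \<subseteq> {lo (\<alpha> l)..hi (\<alpha> l)}"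
     "\<And>l. l \<in> L \<Longrightarrow> dual_pairing (\<alpha>0 l) (xs d) \<le> K * dual_pairing (\<beta> l) (zs d) + M * (\<Sum>i<m. ha l i)"
    using betas by metis
  have "restr {0..} (\<alpha> l1) = \<alpha> l1" by (rule restr_id) auto
  then have "dominated_avg l1 (\<alpha> l1)" using hyp[OF l1(1), of 0] nz[OF l1(1)] by simp
  then obtain \<beta>1 where \<beta>1: "avg n l1 \<beta>1" "supp \<beta>1 \<subseteq> {lo (\<alpha> l1)..hi (\<alpha> l1)}"
     "dual_pairing (\<alpha> l1) (xs d) \<le> K * dual_pairing \<beta>1 (zs d) + M * (\<Sum>i<m. ea (\<alpha> l1) i)"
    using d unfolding dominated_avg_def by blast
  define \<gamma> where "\<gamma> l = (if l = l1 then \<beta>1 else \<beta> l)" for l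
  have \<gamma>: "avg n l (\<gamma> l)" "supp (\<gamma> l) \<subseteq> {lo (\<alpha> l)..hi (\<alpha> l)}" if "l \<in> L" for l
    using \<beta>(1,2)[OF that] \<beta>1(1,2) by (simp_all add: \<gamma>_def)
  define g where "g = (\<Sum>l\<in>L. \<gamma> l)"
  have "g \<in> W0 n" unfolding g_def using \<gamma> by (intro fam_sum_W0 fam_hull) auto
  moreover have "supp g \<subseteq> {lo f..hi f}"
  proof -
    have "supp (\<Sum>l\<in>L. 1 *\<^sub>R \<gamma> l) \<subseteq> {lo f..hi f}"
    proof (rule supp_sum_scaleR_subset)
      fix l assume "l \<in> L"
      then show "supp (\<gamma> l) \<subseteq> {lo f..hi f}" using \<gamma>(2)[of l] hull(1,2)[of l] by fastforce
    qed
    then show ?thesis by (simp add: g_def)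
  qed
  moreover have "dual_pairing (\<alpha> l1) (xs d) + (if b0 < m then d b0 * Rm b0 else 0) + (\<Sum>l\<in>L - {l1}. dual_pairing (\<alpha>0 l) (xs d))
     \<le> K * dual_pairing g (zs d) + M * ((\<Sum>i<m. ea (\<alpha> l1) i + (if i = b0 then e i / 8 else 0)) + (\<Sum>l\<in>L - {l1}. \<Sum>i<m. ha l i))"
  proof -
    have r: "(if b0 < m then d b0 * Rm b0 else 0) \<le> M * (\<Sum>i<m. if i = b0 then e i / 8 else 0)"
    proof (cases "b0 < m")
      case True
      have "\<bar>Rm b0\<bar> \<le> e b0 / 8" using Rm_covered[OF l1(1) lt] by (simp add: b0_def)
      then have "\<bar>d b0\<bar> * \<bar>Rm b0\<bar> \<le> M * (e b0 / 8)" using d M by (intro mult_mono) auto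
      then have "d b0 * Rm b0 \<le> M * (e b0 / 8)" using abs_ge_self[of "d b0 * Rm b0"] by (simp add: abs_mult)
      then show ?thesis using True by simp
    qed simp
    have "(\<Sum>l\<in>L - {l1}. dual_pairing (\<alpha>0 l) (xs d)) \<le> (\<Sum>l\<in>L - {l1}. K * dual_pairing (\<beta> l) (zs d) + M * (\<Sum>i<m. ha l i))"
      using \<beta>(3) by (intro sum_mono) auto
    also have "\<dots> = K * (\<Sum>l\<in>L - {l1}. dual_pairing (\<gamma> l) (zs d)) + M * (\<Sum>l\<in>L - {l1}. \<Sum>i<m. ha l i)"
      by (simp add: sum.distrib \<gamma>_def flip: sum_distrib_left)
    finally have s: "(\<Sum>l\<in>L - {l1}. dual_pairing (\<alpha>0 l) (xs d)) \<le> \<dots>" .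
    have "dual_pairing g (zs d) = dual_pairing \<beta>1 (zs d) + (\<Sum>l\<in>L - {l1}. dual_pairing (\<gamma> l) (zs d))"
      unfolding g_def dual_pairing_sum_left using finL l1(1) by (simp add: sum.remove \<gamma>_def)
    then show ?thesis using r s \<beta>1(3) by (simp add: sum.distrib distrib_left)
  qed
  ultimately show ?thesis by blast
qed

text \<open>As in \<open>fam_spread\<close>, but with the number of colours, which stays at or below
  the start of the first average.\<close>

lemma hull_coloring:
  assumes Q: "Q \<subseteq> L" and avg: "\<And>l. l \<in> Q \<Longrightarrow> avg n l (\<beta> l)" and supp: "\<And>l. l \<in> Q \<Longrightarrow> supp (\<beta> l) \<subseteq> {lo (\<alpha> l)..hi (\<alpha> l)}"
  shows "\<exists>col N. block_coloring (\<lambda>G. G \<in> schreier0 n') {Min (supp (\<beta> l)) |l. l \<in> Q \<and> \<beta> l \<noteq> 0} col N \<and> N \<le> lo (\<alpha> l1)"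
proof -
  let ?F = "{Min (supp (\<alpha> l)) |l. l \<in> L \<and> \<alpha> l \<noteq> 0}"
  let ?G = "{Min (supp (\<beta> l)) |l. l \<in> Q \<and> \<beta> l \<noteq> 0}"
  obtain col N where col: "block_coloring (\<lambda>G. G \<in> schreier0 n') ?F col N"
    using famD(5)[OF fam] unfolding n schreier0_Suc by blast
  have "lo (\<alpha> l1) \<in> ?F" using l1(1) nz by blast
  then have N: "N \<le> lo (\<alpha> l1)" by (rule block_coloringD(4)[OF col])
  define S where "S g = (SOME l. l \<in> Q \<and> \<beta> l \<noteq> 0 \<and> g = Min (supp (\<beta> l)))" for g
  have S: "S g \<in> Q \<and> \<beta> (S g) \<noteq> 0 \<and> g = Min (supp (\<beta> (S g)))" if g: "g \<in> ?G" for g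
    unfolding S_def by (rule someI_ex) (use g in auto)
  have Sg: "S g \<in> L" "lo (\<alpha> (S g)) \<le> g" "g \<le> hi (\<alpha> (S g))" if g: "g \<in> ?G" for g
  proof -
    show "S g \<in> L" using S[OF g] Q by blast
    have "g \<in> supp (\<beta> (S g))" using S[OF g] lo_hi(1)[of "\<beta> (S g)"] by simp
    then have "g \<in> {lo (\<alpha> (S g))..hi (\<alpha> (S g))}" using supp S[OF g] by blast
    then show "lo (\<alpha> (S g)) \<le> g" "g \<le> hi (\<alpha> (S g))" by auto
  qed
  have "block_coloring (\<lambda>G. G \<in> schreier0 n') ?G (\<lambda>g. col (lo (\<alpha> (S g)))) N"
  proof (rule block_coloring_spread[OF col])
    have "finite Q" using finL Q by (rule rev_finite_subset)
    then show "finite ?G" by (rule finite_surj[of Q _ "\<lambda>l. Min (supp (\<beta> l))"]) auto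
    fix g assume g: "g \<in> ?G"
    show "lo (\<alpha> (S g)) \<in> ?F \<and> lo (\<alpha> (S g)) \<le> g" using Sg[OF g] nz by blast
    fix g' assume g': "g' \<in> ?G" "g < g'"
    have "S g \<noteq> S g'" using S[OF g] S[OF g'(1)] g'(2) by (metis less_irrefl)
    moreover have "\<not> S g' < S g" using ord(1)[OF Sg(1)[OF g'(1)] Sg(1)[OF g]] Sg(2)[OF g] Sg(3)[OF g'(1)] g'(2) by linarith
    ultimately have "S g < S g'" by linarith
    then show "lo (\<alpha> (S g)) < lo (\<alpha> (S g'))"
      using ord(1)[OF Sg(1)[OF g] Sg(1)[OF g'(1)]] lo_le_hi(1)[OF Sg(1)[OF g]] by linarith
  qed
  then show ?thesis using N by blast
qed

text \<open>The first average stays at one index. No average is known to start by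
  \<open>p b0\<close>, so the number of colours is not under control and the averages at
  \<open>b0\<close> cannot be estimated as late ones. Those that begin and end at \<open>b0\<close>
  are merged into a functional \<open>fb\<close> confined to this index and exchanged for averages
  \<open>A k\<close>. It remains to see that these, together with the substitutes for
  \<open>L0\<close>, are again very fast growing and admissible. Of the error 5/32, the outer blocks
  of \<open>fb\<close> take 2/32 and an average that starts at \<open>b0\<close> and continues takes
  3/32.\<close>

lemma first_case_II:
  assumes eq: "fl l1 = b0"
  shows "\<exists>g\<in>W0 n. supp g \<subseteq> {lo f..hi f} \<and> dual_pairing (\<alpha> l1) (xs d) + (if b0 < m then d b0 * Rm b0 else 0)
     + (\<Sum>l\<in>L - {l1}. dual_pairing (\<alpha>0 l) (xs d))
     \<le> K * dual_pairing g (zs d) + M * ((\<Sum>i<m. (if i = b0 then 5 / 32 * e i else 0)) + (\<Sum>l\<in>L - {l1}. \<Sum>i<m. ha l i))"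
proof -
  obtain \<beta> where \<beta>: "\<And>l. l \<in> L \<Longrightarrow> avg n l (\<beta> l)" "\<And>l. l \<in> L \<Longrightarrow> supp (\<beta> l) \<subseteq> {lo (\<alpha> l)..hi (\<alpha> l)}"
     "\<And>l. l \<in> L \<Longrightarrow> ll l = fl l \<Longrightarrow> \<beta> l = 0"
     "\<And>l. l \<in> L \<Longrightarrow> dual_pairing (\<alpha>0 l) (xs d) \<le> K * dual_pairing (\<beta> l) (zs d) + M * (\<Sum>i<m. ha l i)"
    using betas by metis
  define Lb where "Lb = {l\<in>L. ll l = b0}"
  define L0 where "L0 = L - Lb"
  define fb where "fb = (\<Sum>l\<in>Lb. \<alpha> l)"
  have b0_le': "b0 \<le> fl l" if "l \<in> L" for l using b0_le[OF that] eq by (cases "l = l1") auto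
  have Lb: "l \<in> L" "ll l = b0" "fl l = b0" if "l \<in> Lb" for l
    using that b0_le'[of l] lo_le_hi(2)[of l] by (auto simp: Lb_def)
  have l1b: "l1 \<in> Lb" using l1(1) by (simp add: Lb_def b0_def)
  have Lb_less: "l < l'" if l: "l \<in> Lb" "l' \<in> L0" for l l'
  proof (rule ccontr)
    have l'L: "l' \<in> L" "ll l' \<noteq> b0" using l by (auto simp: L0_def Lb_def)
    assume "\<not> l < l'"
    then have "l' < l" using Lb(2)[OF l(1)] l'L by (metis nat_neq_iff)
    then have "ll l' \<le> b0" using ord(3)[OF l'L(1) Lb(1)[OF l(1)]] Lb(3)[OF l(1)] by simp
    then show False using b0_le'[OF l'L(1)] lo_le_hi(2)[OF l'L(1)] l'L(2) by linarith
  qed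
  have supp_fb: "\<exists>l\<in>Lb. v \<in> supp (\<alpha> l)" if "v \<in> supp fb" for v
    using keys_sum[of \<alpha> Lb] that unfolding fb_def by blast
  have fbW: "fb \<in> W0 n" unfolding fb_def
    by (rule fam_sum_W0[OF fam_subset[OF fam]]) (auto simp: Lb_def)
  have fb0: "fb \<noteq> 0"
  proof -
    have "supp (\<alpha> l1) \<subseteq> supp fb" unfolding fb_def
      using finL famD(3)[OF fam] l1b by (intro supp_sum_successive) (auto simp: Lb_def)
    then show ?thesis using nz[OF l1(1)] by auto
  qed
  have ixfb: "ix v = b0" if v: "v \<in> supp fb" for v
  proof -
    obtain l where l: "l \<in> Lb" "v \<in> supp (\<alpha> l)" using supp_fb[OF v] by blast
    then show ?thesis using ix_supp[OF l(2)] Lb(2,3)[OF l(1)] by simp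
  qed
  have fbi: "fi fb = b0" "la fb = b0" using ixfb lo_hi(1,2)[OF fb0] by auto
  have lo_fb: "lo (\<alpha> l1) \<le> lo fb"
  proof -
    obtain l where l: "l \<in> Lb" "lo fb \<in> supp (\<alpha> l)" using supp_fb[OF lo_hi(1)[OF fb0]] by blast
    have "lo (\<alpha> l1) \<le> lo (\<alpha> l)"
      using ord(1)[OF l1(1) Lb(1)[OF l(1)]] l1(2)[OF Lb(1)[OF l(1)]] lo_le_hi(1)[OF l1(1)] by (cases "l = l1") auto
    then show ?thesis using lo_hi(3)[OF l(2)] by linarith
  qed
  have hi_fb: "hi fb < l' \<and> hi fb < lo (\<alpha> l')" if l': "l' \<in> L0" for l'
  proof -
    obtain l where l: "l \<in> Lb" "hi fb \<in> supp (\<alpha> l)" using supp_fb[OF lo_hi(2)[OF fb0]] by blast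
    have "hi fb \<le> hi (\<alpha> l)" using lo_hi(4)[OF l(2)] .
    moreover have "hi (\<alpha> l) < l'" "hi (\<alpha> l) < lo (\<alpha> l')"
      using ord(1,2)[OF Lb(1)[OF l(1)] _ Lb_less[OF l(1) l']] l' by (auto simp: L0_def)
    ultimately show ?thesis by simp
  qed
  have fb_hull: "lo f \<le> lo fb" "hi fb \<le> hi f"
  proof -
    show "lo f \<le> lo fb" using hull(1)[OF l1(1)] lo_fb by linarith
    obtain l where l: "l \<in> Lb" "hi fb \<in> supp (\<alpha> l)" using supp_fb[OF lo_hi(2)[OF fb0]] by blast
    then show "hi fb \<le> hi f" using hull(2)[OF Lb(1)[OF l(1)]] lo_hi(4)[OF l(2)] by linarith
  qed
  obtain G0 where G0: "G0 \<subseteq> F b0" "\<bar>dual_pairing fb (w b0)\<bar> \<le> C * sum (c b0) G0 + 2 * C * \<epsilon> b0"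
     "\<forall>k\<in>G0. b k \<le> hi fb \<and> (\<exists>k1\<in>F b0. k1 < k \<and> lo fb < b k1)"
    using single_block_units[OF fbW fb0 fbi] by blast
  \<comment> \<open>Indices from \<open>m\<close> on carry no vector, so nothing is inserted
    there.\<close>
  define G where "G = (if b0 < m then G0 else {})"
  have G: "G \<subseteq> F b0" "finite G" "\<And>k. k \<in> G \<Longrightarrow> b k \<le> hi fb" "\<And>k. k \<in> G \<Longrightarrow> \<exists>k1\<in>F b0. k1 < k \<and> lo fb < b k1"
    using G0 F(1)[of b0] finite_subset by (auto simp: G_def split: if_splits)
  define \<sigma> where "\<sigma> = sg (d b0)"
  have \<sigma>0: "\<sigma> \<noteq> 0" by (simp add: \<sigma>_def sg_def)
  define \<gamma> where "\<gamma> l = (if l \<in> L0 then \<beta> l else \<sigma> *\<^sub>R AA l)" for l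
  \<comment> \<open>The condition \<open>s k \<le> b k\<close> pays off: inserted sizes do not
    exceed the right end of the range of \<open>fb\<close>, which lies below all sizes in
    \<open>L0\<close>.\<close>
  have sG: "l < l'" if "l \<in> s ` G" "l' \<in> L0" for l l'
    using that s G(3) hi_fb[OF that(2)] by (fastforce intro: le_less_trans)
  have disj: "s ` G \<inter> L0 = {}" using sG by (metis disjoint_iff less_irrefl)
  have \<gamma>1: "\<gamma> l = \<sigma> *\<^sub>R AA l" if "l \<in> s ` G" for l using that disj by (auto simp: \<gamma>_def)
  have \<gamma>2: "\<gamma> l = \<beta> l" if "l \<in> L0" for l using that by (simp add: \<gamma>_def)
  have famG: "fam n n (s ` G) (\<lambda>l. \<sigma> *\<^sub>R AA l)" unfolding \<sigma>_def by (rule sg_fam[OF units_fam[OF G(1,2)]])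
  have L0L: "L0 \<subseteq> L" by (auto simp: L0_def)
  have fam0: "fam n n L0 \<beta>" using \<beta>(1,2) L0L by (intro fam_hull) auto
  have suppAA: "\<exists>k\<in>G. a k \<le> v \<and> v < b k" if lv: "l \<in> s ` G" "v \<in> supp (\<sigma> *\<^sub>R AA l)" for l v
  proof -
    obtain k where k: "k \<in> G" "l = s k" using lv(1) by blast
    have "v \<in> supp (A k)" using lv(2) \<sigma>0 unfolding k(2) AA by (simp add: supp_scaleR)
    then show ?thesis using A(2)[of k] k(1) by fastforce
  qed
  have famU: "fam n n (s ` G \<union> L0) \<gamma>"
    unfolding fam_def
  proof (intro conjI ballI impI)
    show "finite (s ` G \<union> L0)" using G(2) finL by (simp add: L0_def)
    show "avg n l (\<gamma> l)" if "l \<in> s ` G \<union> L0" for l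
      using that famD(2)[OF famG] famD(2)[OF fam0] \<gamma>1 \<gamma>2 by auto
    show "before (\<gamma> l) (\<gamma> l')" "\<And>i. i \<in> supp (\<gamma> l) \<Longrightarrow> i < l'" if l: "l \<in> s ` G \<union> L0" "l' \<in> s ` G \<union> L0" "l < l'" for l l'
    proof -
      consider "l \<in> s ` G" "l' \<in> s ` G" | "l \<in> s ` G" "l' \<in> L0" | "l \<in> L0" "l' \<in> L0"
        using l sG[of l' l] by (auto dest: less_asym)
      then have "before (\<gamma> l) (\<gamma> l') \<and> (\<forall>i\<in>supp (\<gamma> l). i < l')"
      proof cases
        case 1
        then show ?thesis using famD(3,4)[OF famG _ _ l(3)] unfolding \<gamma>1[OF 1(1)] \<gamma>1[OF 1(2)] by blast
      next
        case 2
        have lt: "i \<le> hi fb" if "i \<in> supp (\<gamma> l)" for i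
          using suppAA[OF 2(1), of i] that G(3) unfolding \<gamma>1[OF 2(1)] by (meson le_trans less_imp_le)
        have "lo (\<alpha> l') \<le> j" if "j \<in> supp (\<gamma> l')" for j
          using that \<beta>(2)[of l'] 2(2) L0L unfolding \<gamma>2[OF 2(2)] by fastforce
        then show ?thesis using lt hi_fb[OF 2(2)] unfolding before_iff by (meson le_less_trans less_le_trans)
      next
        case 3
        then show ?thesis using famD(3,4)[OF fam0 _ _ l(3)] unfolding \<gamma>2[OF 3(1)] \<gamma>2[OF 3(2)] by blast
      qed
      then show "before (\<gamma> l) (\<gamma> l')" "\<And>i. i \<in> supp (\<gamma> l) \<Longrightarrow> i < l'" by blast+
    qed
    let ?F1 = "{Min (supp (AA l)) |l. l \<in> s ` G \<and> AA l \<noteq> 0}"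
    let ?F2 = "{Min (supp (\<beta> l)) |l. l \<in> L0 \<and> \<beta> l \<noteq> 0}"
    have eqF: "{Min (supp (\<gamma> l)) |l. l \<in> s ` G \<union> L0 \<and> \<gamma> l \<noteq> 0} = ?F1 \<union> ?F2"
    proof -
      have "{Min (supp (\<gamma> l)) |l. l \<in> s ` G \<union> L0 \<and> \<gamma> l \<noteq> 0} = {Min (supp (\<gamma> l)) |l. l \<in> s ` G \<and> \<gamma> l \<noteq> 0} \<union> {Min (supp (\<gamma> l)) |l. l \<in> L0 \<and> \<gamma> l \<noteq> 0}"
        by blast
      moreover have "{Min (supp (\<gamma> l)) |l. l \<in> L0 \<and> \<gamma> l \<noteq> 0} = ?F2" using \<gamma>2 by force
      moreover have "{Min (supp (\<gamma> l)) |l. l \<in> s ` G \<and> \<gamma> l \<noteq> 0} = ?F1" using \<gamma>1 \<sigma>0 by (force simp: supp_scaleR)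
      ultimately show ?thesis by simp
    qed
    show "{Min (supp (\<gamma> l)) |l. l \<in> s ` G \<union> L0 \<and> \<gamma> l \<noteq> 0} \<in> schreier0 n"
    proof (cases "G = {}")
      case True
      then have "?F1 \<union> ?F2 = ?F2" by simp
      then show ?thesis unfolding eqF using famD(5)[OF fam0] by simp
    next
      case False
      obtain c1 N1 where c1: "block_coloring (\<lambda>G. G \<in> schreier0 n') ?F1 c1 N1" "\<forall>k\<in>F b0. N1 \<le> a k"
        using units_coloring[OF G(1,2)] by blast
      obtain c2 N2 where c2: "block_coloring (\<lambda>G. G \<in> schreier0 n') ?F2 c2 N2" "N2 \<le> lo (\<alpha> l1)"
        using hull_coloring[OF L0L] \<beta>(1,2) L0L by blast
      \<comment> \<open>The block \<open>k1\<close> in front of \<open>k\<close> meets the same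
        index beyond the start of \<open>fb\<close>. Both numbers of colours are at most
        \<open>b k1\<close>, and \<open>a k\<close> is at least twice as large.\<close>
      have N: "N1 + N2 \<le> a k" if k: "k \<in> G" for k
      proof -
        obtain k1 where k1: "k1 \<in> F b0" "k1 < k" "lo fb < b k1" using G(4)[OF k] by blast
        have "N1 \<le> b k1" using c1(2) k1(1) block_seqD(2)[OF bs, of k1] by (meson le_trans less_imp_le)
        moreover have "N2 \<le> b k1" using c2(2) lo_fb k1(3) by simp
        ultimately show ?thesis using gap[OF k1(2)] by simp
      qed
      have F1: "\<exists>k\<in>G. a k \<le> u \<and> u < b k" if u: "u \<in> ?F1" for u
      proof -
        obtain l where l: "l \<in> s ` G" "AA l \<noteq> 0" "u = Min (supp (AA l))" using u by blast
        then have "u \<in> supp (\<sigma> *\<^sub>R AA l)" using lo_hi(1)[of "AA l"] \<sigma>0 by (simp add: supp_scaleR)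
        then show ?thesis by (rule suppAA[OF l(1)])
      qed
      have F2: "hi fb < v" if v: "v \<in> ?F2" for v
      proof -
        obtain l where l: "l \<in> L0" "\<beta> l \<noteq> 0" "v = Min (supp (\<beta> l))" using v by blast
        then have "v \<in> supp (\<beta> l)" using lo_hi(1) by simp
        then have "lo (\<alpha> l) \<le> v" using \<beta>(2)[of l] l(1) L0L by fastforce
        then show ?thesis using hi_fb[OF l(1)] by simp
      qed
      have "?F1 \<union> ?F2 \<in> schreier0 (Suc n')"
      proof (rule block_coloring_union[OF c1(1) c2(1)])
        show "u < v" if "u \<in> ?F1" "v \<in> ?F2" for u v
          using F1[OF that(1)] F2[OF that(2)] G(3) by (meson le_less_trans less_imp_le less_le_trans)
        obtain k where k: "k \<in> G" using False by blast
        fix u assume "u \<in> ?F1 \<union> ?F2"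
        then consider "u \<in> ?F1" | "u \<in> ?F2" by blast
        then show "N1 + N2 \<le> u"
        proof cases
          case 1
          then show ?thesis using F1[OF 1] N by (meson le_trans)
        next
          case 2
          have "N1 + N2 \<le> a k" by (rule N[OF k])
          also have "a k < b k" by (rule block_seqD(2)[OF bs])
          also have "b k \<le> hi fb" by (rule G(3)[OF k])
          finally show ?thesis using F2[OF 2] by simp
        qed
      qed
      then show ?thesis unfolding eqF n .
    qed
  qed
  define g where "g = (\<Sum>l\<in>s ` G \<union> L0. \<gamma> l)"
  have "g \<in> W0 n" unfolding g_def by (rule fam_sum_W0[OF famU])
  moreover have "supp g \<subseteq> {lo f..hi f}"
  proof -
    have "supp (\<Sum>l\<in>s ` G \<union> L0. 1 *\<^sub>R \<gamma> l) \<subseteq> {lo f..hi f}"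
    proof (rule supp_sum_scaleR_subset)
      fix l assume "l \<in> s ` G \<union> L0"
      then consider "l \<in> s ` G" | "l \<in> L0" by blast
      then show "supp (\<gamma> l) \<subseteq> {lo f..hi f}"
      proof cases
        case 1
        show ?thesis
        proof
          fix v assume "v \<in> supp (\<gamma> l)"
          then obtain k where k: "k \<in> G" "a k \<le> v" "v < b k" using suppAA[OF 1] unfolding \<gamma>1[OF 1] by blast
          obtain k1 where k1: "k1 < k" "lo fb < b k1" using G(4)[OF k(1)] by blast
          have "b k1 \<le> a k" using block_seqD(3)[OF bs k1(1)] .
          then show "v \<in> {lo f..hi f}" using k k1 G(3)[OF k(1)] fb_hull by simp
        qed
      next
        case 2
        then have "supp (\<beta> l) \<subseteq> {lo (\<alpha> l)..hi (\<alpha> l)}" "lo f \<le> lo (\<alpha> l)" "hi (\<alpha> l) \<le> hi f" using \<beta>(2) hull(1,2) L0L by auto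
        then show ?thesis unfolding \<gamma>2[OF 2] by fastforce
      qed
    qed
    then show ?thesis by (simp add: g_def)
  qed
  moreover have "dual_pairing (\<alpha> l1) (xs d) + (if b0 < m then d b0 * Rm b0 else 0) + (\<Sum>l\<in>L - {l1}. dual_pairing (\<alpha>0 l) (xs d))
     \<le> K * dual_pairing g (zs d) + M * ((\<Sum>i<m. (if i = b0 then 5 / 32 * e i else 0)) + (\<Sum>l\<in>L - {l1}. \<Sum>i<m. ha l i))"
  proof -
    have g_eq: "dual_pairing g (zs d) = (\<Sum>l\<in>s ` G. dual_pairing (\<sigma> *\<^sub>R AA l) (zs d)) + (\<Sum>l\<in>L0. dual_pairing (\<beta> l) (zs d))"
    proof -
      have "dual_pairing g (zs d) = (\<Sum>l\<in>s ` G. dual_pairing (\<gamma> l) (zs d)) + (\<Sum>l\<in>L0. dual_pairing (\<gamma> l) (zs d))"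
        unfolding g_def dual_pairing_sum_left using G(2) finL disj by (intro sum.union_disjoint) (auto simp: L0_def)
      then show ?thesis using \<gamma>1 \<gamma>2 by simp
    qed
    have part: "dual_pairing (\<alpha> l1) (xs d) + (if b0 < m then d b0 * Rm b0 else 0)
        \<le> K * (\<Sum>l\<in>s ` G. dual_pairing (\<sigma> *\<^sub>R AA l) (zs d)) + M * (\<Sum>i<m. if i = b0 then 5 / 32 * e i else 0)"
    proof (cases "b0 < m")
      case False
      then show ?thesis using single_xs[OF nz[OF l1(1)] eq, of d] by (simp add: G_def b0_def)
    next
      case True
      \<comment> \<open>Averages that start at \<open>b0\<close> and end later. There is at most
        one, because the next average starts no earlier than at the index where it ends.\<close>
      define Q where "Q = {l\<in>L0. fl l = b0}"
      have finQ: "finite Q" using finL by (simp add: Q_def L0_def)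
      have Qle: "\<bar>\<Sum>l\<in>Q. dual_pairing (\<alpha> l) (w b0)\<bar> \<le> 3 / 32 * e b0"
      proof (cases "Q = {}")
        case True
        then show ?thesis using e_nonneg by simp
      next
        case False
        then obtain q where q: "q \<in> Q" by blast
        have no: False if qq: "q \<in> Q" "q' \<in> Q" "q < q'" for q q'
        proof -
          have "ll q \<le> b0" using ord(3)[of q q'] qq by (auto simp: Q_def L0_def)
          moreover have "ll q \<noteq> b0" "b0 \<le> ll q" using qq lo_le_hi(2)[of q] by (auto simp: Q_def L0_def Lb_def)
          ultimately show False by simp
        qed
        have "q' = q" if "q' \<in> Q" for q' using no[OF q that] no[OF that q] by (cases q q' rule: linorder_cases) auto
        then have "Q = {q}" using q by blast
        moreover have qL: "q \<in> L" using q by (simp add: Q_def L0_def)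
        moreover have "C / real q \<le> e b0 / 16"
        proof -
          have "hi (\<alpha> l1) < q" using ord(2)[OF l1(1) qL] Lb_less[OF l1b] q by (simp add: Q_def)
          then have "p b0 \<le> q" using p_ll(1)[OF l1(1)] by (simp add: b0_def)
          then have "C / real q \<le> C / real (p b0)" using C0 p_pos[of b0] by (intro divide_left_mono mult_pos_pos) auto
          then show ?thesis using e1[of b0] by linarith
        qed
        ultimately show ?thesis using one_le[OF qL, of b0] by simp
      qed
      have "dual_pairing (\<alpha> l1) (w b0) + Rm b0 = (\<Sum>l\<in>{l\<in>L. fl l = b0}. dual_pairing (\<alpha> l) (w b0))"
      proof -
        have "{l\<in>L. fl l = b0} = insert l1 (Mi b0)" using l1(1) eq by (auto simp: Mi_def)
        moreover have "l1 \<notin> Mi b0" "finite (Mi b0)" using finL by (auto simp: Mi_def)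
        ultimately show ?thesis by (simp add: Rm_def)
      qed
      also have "{l\<in>L. fl l = b0} = Lb \<union> Q" using Lb by (auto simp: Q_def L0_def)
      also have "(\<Sum>l\<in>Lb \<union> Q. dual_pairing (\<alpha> l) (w b0)) = dual_pairing fb (w b0) + (\<Sum>l\<in>Q. dual_pairing (\<alpha> l) (w b0))"
        unfolding fb_def dual_pairing_sum_left using finQ finL by (intro sum.union_disjoint) (auto simp: Lb_def Q_def L0_def)
      finally have tot: "\<bar>dual_pairing (\<alpha> l1) (w b0) + Rm b0\<bar> \<le> C * sum (c b0) G + 5 / 32 * e b0"
        using G0(2) Qle C\<epsilon>[of b0] True unfolding G_def by simp
      have "dual_pairing (\<alpha> l1) (xs d) = d b0 * dual_pairing (\<alpha> l1) (w b0)"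
        using single_xs[OF nz[OF l1(1)] eq, of d] True by (simp add: b0_def)
      then have "dual_pairing (\<alpha> l1) (xs d) + (if b0 < m then d b0 * Rm b0 else 0) = d b0 * (dual_pairing (\<alpha> l1) (w b0) + Rm b0)"
        using True by (simp add: distrib_left)
      also have "\<dots> \<le> \<bar>d b0\<bar> * \<bar>dual_pairing (\<alpha> l1) (w b0) + Rm b0\<bar>"
        using abs_ge_self[of "d b0 * (dual_pairing (\<alpha> l1) (w b0) + Rm b0)"] by (simp add: abs_mult)
      also have "\<dots> \<le> \<bar>d b0\<bar> * (C * sum (c b0) G + 5 / 32 * e b0)" using tot by (intro mult_left_mono) auto
      also have "\<dots> = C * sum (c b0) G * \<bar>d b0\<bar> + \<bar>d b0\<bar> * (5 / 32 * e b0)" by (simp add: algebra_simps)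
      also have "C * sum (c b0) G * \<bar>d b0\<bar> \<le> K * (\<Sum>l\<in>s ` G. dual_pairing (\<sigma> *\<^sub>R AA l) (zs d))"
        unfolding \<sigma>_def by (rule units_value[where d = d, OF G(1,2) True])
      also have "\<bar>d b0\<bar> * (5 / 32 * e b0) \<le> M * (5 / 32 * e b0)" using d e_nonneg[of b0] by (intro mult_right_mono) auto
      finally show ?thesis using True by simp
    qed
    have "(\<Sum>l\<in>L - {l1}. dual_pairing (\<alpha>0 l) (xs d)) \<le> (\<Sum>l\<in>L - {l1}. K * dual_pairing (\<beta> l) (zs d) + M * (\<Sum>i<m. ha l i))"
      using \<beta>(4) by (intro sum_mono) auto
    also have "\<dots> = K * (\<Sum>l\<in>L - {l1}. dual_pairing (\<beta> l) (zs d)) + M * (\<Sum>l\<in>L - {l1}. \<Sum>i<m. ha l i)"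
      by (simp add: sum.distrib flip: sum_distrib_left)
    also have "(\<Sum>l\<in>L - {l1}. dual_pairing (\<beta> l) (zs d)) = (\<Sum>l\<in>L0. dual_pairing (\<beta> l) (zs d))"
    proof (rule sum.mono_neutral_right)
      show "\<forall>l\<in>L - {l1} - L0. dual_pairing (\<beta> l) (zs d) = 0"
      proof
        fix l assume "l \<in> L - {l1} - L0"
        then have "l \<in> Lb" by (simp add: L0_def)
        then have "\<beta> l = 0" using \<beta>(3) Lb by simp
        then show "dual_pairing (\<beta> l) (zs d) = 0" by simp
      qed
    qed (use finL l1b in \<open>auto simp: L0_def\<close>)
    finally show ?thesis using part unfolding g_eq by (simp add: distrib_left)
  qed
  ultimately show ?thesis by blast
qed

lemma multi_block_dominated:
  assumes multi: "fi f < la f"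
  shows "\<exists>g\<in>W0 n. supp g \<subseteq> {lo f..hi f} \<and> dual_pairing f (xs d) \<le> K * dual_pairing g (zs d) + M * (\<Sum>i<m. er f i)"
proof -
  have "\<exists>u. (\<forall>i. fi f \<le> i \<longrightarrow> i < b0 \<longrightarrow> u i \<le> e i) \<and> u b0 \<le> 3 / 4 * e b0 \<and> (\<forall>i. b0 < i \<or> i < fi f \<longrightarrow> u i = 0) \<and>
     (\<exists>g\<in>W0 n. supp g \<subseteq> {lo f..hi f} \<and> dual_pairing (\<alpha> l1) (xs d) + (if b0 < m then d b0 * Rm b0 else 0)
     + (\<Sum>l\<in>L - {l1}. dual_pairing (\<alpha>0 l) (xs d))
     \<le> K * dual_pairing g (zs d) + M * ((\<Sum>i<m. u i) + (\<Sum>l\<in>L - {l1}. \<Sum>i<m. ha l i)))"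
  proof (cases "fl l1 = b0")
    case True
    have "fi f \<le> b0" using hull(3)[OF l1(1)] True by simp
    then show ?thesis using first_case_II[OF True] e_nonneg
      by (intro exI[of _ "\<lambda>i. if i = b0 then 5 / 32 * e i else 0"] conjI) auto
  next
    case False
    then have lt: "fl l1 < b0" using lo_le_hi(2)[OF l1(1)] by (simp add: b0_def)
    have "fi f \<le> fl l1" using hull(3)[OF l1(1)] .
    then show ?thesis using first_case_I[OF lt] e_nonneg lt
      by (intro exI[of _ "\<lambda>i. ea (\<alpha> l1) i + (if i = b0 then e i / 8 else 0)"] conjI) (auto simp: ea_def b0_def)
  qed
  then obtain u g where u: "\<And>i. fi f \<le> i \<Longrightarrow> i < b0 \<Longrightarrow> u i \<le> e i" "u b0 \<le> 3 / 4 * e b0" "\<And>i. b0 < i \<or> i < fi f \<Longrightarrow> u i = 0"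
    and g: "g \<in> W0 n" "supp g \<subseteq> {lo f..hi f}" "dual_pairing (\<alpha> l1) (xs d) + (if b0 < m then d b0 * Rm b0 else 0)
     + (\<Sum>l\<in>L - {l1}. dual_pairing (\<alpha>0 l) (xs d))
     \<le> K * dual_pairing g (zs d) + M * ((\<Sum>i<m. u i) + (\<Sum>l\<in>L - {l1}. \<Sum>i<m. ha l i))" by blast
  have "(\<Sum>i\<in>{i. i < m \<and> b0 < i}. d i * Rm i) \<le> (\<Sum>i\<in>{i. i < m \<and> b0 < i}. M * \<bar>Rm i\<bar>)"
  proof (rule sum_mono)
    fix i
    have "d i * Rm i \<le> \<bar>d i\<bar> * \<bar>Rm i\<bar>" using abs_ge_self[of "d i * Rm i"] by (simp add: abs_mult)
    also have "\<dots> \<le> M * \<bar>Rm i\<bar>" using d by (intro mult_right_mono) auto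
    finally show "d i * Rm i \<le> M * \<bar>Rm i\<bar>" .
  qed
  also have "\<dots> \<le> M * ((\<Sum>i<m. rho i) + (\<Sum>i<m. ends i))"
    unfolding sum_distrib_left[symmetric] using sum_Rm_le M by (rule mult_left_mono)
  finally have r: "(\<Sum>i\<in>{i. i < m \<and> b0 < i}. d i * Rm i) \<le> M * ((\<Sum>i<m. rho i) + (\<Sum>i<m. ends i))" .
  have "(\<Sum>i<m. u i) + (\<Sum>l\<in>L - {l1}. \<Sum>i<m. ha l i) + (\<Sum>i<m. rho i) + (\<Sum>i<m. ends i)
      = (\<Sum>i<m. u i + (\<Sum>l\<in>L - {l1}. ha l i) + rho i + ends i)"
    unfolding sum.distrib sum.swap[of _ "L - {l1}" "{..<m}"] by simp
  also have "\<dots> \<le> (\<Sum>i<m. er f i)" using u by (intro sum_mono pointwise[OF multi]) auto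
  finally have "M * ((\<Sum>i<m. u i) + (\<Sum>l\<in>L - {l1}. \<Sum>i<m. ha l i) + (\<Sum>i<m. rho i) + (\<Sum>i<m. ends i)) \<le> M * (\<Sum>i<m. er f i)"
    using M by (rule mult_left_mono)
  then have "dual_pairing f (xs d) \<le> K * dual_pairing g (zs d) + M * (\<Sum>i<m. er f i)"
    using r g(3) unfolding main_sum_split by (simp add: distrib_left)
  then show ?thesis using g by blast
qed

end

section \<open>Domination of all functionals and of the norm\<close>

context domination
begin

lemma avg_rep_restr: "avg_rep n l \<alpha> R g \<Longrightarrow> avg_rep n l (restr B \<alpha>) R (\<lambda>r. restr B (g r))"
  by (auto simp: avg_rep_def restr_scaleR restr_sum before_restr restr_W0)

text \<open>The claim is proved for all right tails at once, since a sum needs it for the tails of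
  its averages. A tail of an average is the average of the tails of its parts, so the hypothesis on
  the parts suffices.\<close>

theorem all_dominated: "f \<in> W0 n \<Longrightarrow> \<forall>v. restr {v..} f \<noteq> 0 \<longrightarrow> dominated (restr {v..} f)"
proof (induction rule: W0_induct)
  case (unit i)
  have W: "restr {v..} (Poly_Mapping.single i 1) \<in> W0 n" for v
  proof -
    have "Poly_Mapping.single i 1 \<in> norming_level n 0" using unit by auto
    then have "Poly_Mapping.single i 1 \<in> W0 n" unfolding W0_def norming_set_def by blast
    then show ?thesis by (rule restr_W0)
  qed
  show ?case
  proof (intro allI impI)
    fix v assume nz: "restr {v..} (Poly_Mapping.single i (1::real)) \<noteq> 0"
    then have "supp (restr {v..} (Poly_Mapping.single i (1::real))) = {i}" by (simp add: restr_single split: if_splits)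
    then show "dominated (restr {v..} (Poly_Mapping.single i 1))" by (intro single_dominated[OF W nz]) simp
  qed
next
  case (neg_unit i)
  have W: "restr {v..} (- Poly_Mapping.single i 1) \<in> W0 n" for v
  proof -
    have "- Poly_Mapping.single i 1 \<in> norming_level n 0" using neg_unit by auto
    then have "- Poly_Mapping.single i 1 \<in> W0 n" unfolding W0_def norming_set_def by blast
    then show ?thesis by (rule restr_W0)
  qed
  show ?case
  proof (intro allI impI)
    fix v assume nz: "restr {v..} (- Poly_Mapping.single i (1::real)) \<noteq> 0"
    then have "supp (restr {v..} (- Poly_Mapping.single i (1::real))) = {i}" by (simp add: restr_uminus restr_single split: if_splits)
    then show "dominated (restr {v..} (- Poly_Mapping.single i 1))" by (intro single_dominated[OF W nz]) simp
  qed
next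
  case (average l R g \<alpha>)
  show ?case
  proof (intro allI impI)
    fix v assume nz: "restr {v..} \<alpha> \<noteq> 0"
    have "dominated_avg l (restr {v..} \<alpha>)"
      by (rule average_dominated[OF avg_rep_restr[OF average(1)] nz]) (use average(4) in blast)
    then show "dominated (restr {v..} \<alpha>)" by (rule dominated_avg_imp_dominated)
  qed
next
  case (sum L \<alpha>)
  show ?case
  proof (intro allI impI)
    fix v assume nz: "restr {v..} (\<Sum>l\<in>L. \<alpha> l) \<noteq> 0"
    define \<alpha>' where "\<alpha>' l = restr {v..} (\<alpha> l)" for l
    define L' where "L' = {l\<in>L. \<alpha>' l \<noteq> 0}"
    have f: "restr {v..} (\<Sum>l\<in>L. \<alpha> l) = (\<Sum>l\<in>L'. \<alpha>' l)"
      unfolding restr_sum \<alpha>'_def[symmetric] using famD(1)[OF sum(1)] by (intro sum.mono_neutral_right) (auto simp: L'_def)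
    have fam': "fam n n L' \<alpha>'"
      unfolding \<alpha>'_def by (rule fam_subset[OF fam_restr[OF sum(1)]]) (auto simp: L'_def)
    have hyp: "dominated_avg l (restr {v'..} (\<alpha>' l))" if l: "l \<in> L'" "restr {v'..} (\<alpha>' l) \<noteq> 0" for l v'
    proof -
      have eq: "restr {v'..} (\<alpha>' l) = restr {max v v'..} (\<alpha> l)"
      proof -
        have "{v'..} \<inter> {v..} = {max v v'..}" by auto
        then show ?thesis by (simp add: \<alpha>'_def restr_restr)
      qed
      obtain R g where R: "avg_rep n l (\<alpha> l) R g" "\<forall>r\<in>R. g r \<noteq> 0 \<and> (\<forall>v. restr {v..} (g r) \<noteq> 0 \<longrightarrow> dominated (restr {v..} (g r)))"
        using sum(4)[of l] l(1) by (auto simp: L'_def)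
      show ?thesis unfolding eq
        by (rule average_dominated[OF avg_rep_restr[OF R(1)]]) (use R(2) l(2) eq in auto)
    qed
    have ne: "L' \<noteq> {}" using nz f by auto
    show "dominated (restr {v..} (\<Sum>l\<in>L. \<alpha> l))"
    proof (cases "fi (\<Sum>l\<in>L'. \<alpha>' l) = la (\<Sum>l\<in>L'. \<alpha>' l)")
      case True
      have "(\<Sum>l\<in>L'. \<alpha>' l) \<in> W0 n" by (rule fam_sum_W0[OF fam'])
      then show ?thesis using single_dominated[OF _ _ True] nz unfolding f by blast
    next
      case False
      have "(\<Sum>l\<in>L'. \<alpha>' l) \<noteq> 0" using nz f by simp
      then have "fi (\<Sum>l\<in>L'. \<alpha>' l) \<le> la (\<Sum>l\<in>L'. \<alpha>' l)" using lo_hi(4)[OF lo_hi(1)] by (blast intro: ix_mono)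
      then have multi: "fi (\<Sum>l\<in>L'. \<alpha>' l) < la (\<Sum>l\<in>L'. \<alpha>' l)" using False by simp
      show ?thesis unfolding f dominated_def
      proof (intro allI impI)
        fix d :: "nat \<Rightarrow> real" assume d: "\<forall>i. \<bar>d i\<bar> \<le> M"
        interpret sum_node n n' a b x y C \<delta> A s F c \<epsilon> p e m M L' \<alpha>' d
          by unfold_locales (use fam' ne hyp d in \<open>auto simp: L'_def\<close>)
        show "\<exists>g\<in>W0 n. supp g \<subseteq> {lo (\<Sum>l\<in>L'. \<alpha>' l)..hi (\<Sum>l\<in>L'. \<alpha>' l)} \<and>
           dual_pairing (\<Sum>l\<in>L'. \<alpha>' l) (xs d) \<le> K * dual_pairing g (zs d) + M * (\<Sum>i<m. er (\<Sum>l\<in>L'. \<alpha>' l) i)"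
          using multi_block_dominated multi unfolding f_def by blast
      qed
    qed
  qed
qed simp

theorem norm_dominated:
  assumes d: "\<And>i. \<bar>d i\<bar> \<le> M"
  shows "norm01 n (xs d) \<le> K * norm01 n (zs d) + M * (\<Sum>i<m. e i)"
proof (rule norm01_le)
  fix f assume f: "f \<in> W0 n"
  have K0: "0 \<le> K" using C0 \<delta> by (simp add: K_def)
  have r0: "restr {0..} f = f" by (rule restr_id) auto
  show "dual_pairing f (xs d) \<le> K * norm01 n (zs d) + M * (\<Sum>i<m. e i)"
  proof (cases "f = 0")
    case True
    then show ?thesis using K0 M e_nonneg norm01_nonneg[of n "zs d"] by (simp add: sum_nonneg)
  next
    case False
    then have "dominated f" using all_dominated[OF f] r0 by metis
    then obtain g where g: "g \<in> W0 n" "dual_pairing f (xs d) \<le> K * dual_pairing g (zs d) + M * (\<Sum>i<m. er f i)"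
      using d unfolding dominated_def by blast
    have "dual_pairing g (zs d) \<le> norm01 n (zs d)" using W0_le_norm01[OF g(1), of "zs d"] by linarith
    then have "K * dual_pairing g (zs d) \<le> K * norm01 n (zs d)" using K0 by (rule mult_left_mono)
    moreover have "M * (\<Sum>i<m. er f i) \<le> M * (\<Sum>i<m. e i)"
      using M e_nonneg by (intro mult_left_mono sum_mono) (auto simp: er_def)
    ultimately show ?thesis using g(2) by linarith
  qed
qed

text \<open>The averages \<open>A k\<close> over the whole of \<open>F i\<close>, with a common
  sign, form an admissible family because the support of the convex combination is admissible. So
  the coefficients, and with them the error term containing \<open>M\<close>, are controlled by the
  norm on the \<open>y\<close> side.\<close>

lemma coeff_le:
  assumes "i < m" shows "\<delta> * \<bar>d i\<bar> \<le> norm01 n (zs d)"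
proof -
  define g where "g = (\<Sum>l\<in>s ` F i. sg (d i) *\<^sub>R AA l)"
  have "g \<in> W0 n" unfolding g_def by (intro fam_sum_W0 sg_fam units_fam[OF subset_refl F(1)])
  then have "dual_pairing g (zs d) \<le> norm01 n (zs d)" using W0_le_norm01[of g n "zs d"] by linarith
  moreover have "dual_pairing g (zs d) = \<bar>d i\<bar> * (\<Sum>k\<in>F i. c i k * dual_pairing (A k) (y k))"
    using units_pairing[where d = d, OF subset_refl F(1) assms]
    by (simp add: g_def dual_pairing_sum_left dual_pairing_scaleR_left sg_def flip: sum_distrib_left)
      (simp add: sum_negf)?
  moreover have "(\<Sum>k\<in>F i. c i k * dual_pairing (A k) (y k)) \<ge> \<delta>"
  proof -
    have "(\<Sum>k\<in>F i. c i k * dual_pairing (A k) (y k)) \<ge> (\<Sum>k\<in>F i. c i k * \<delta>)"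
      using A(3) F(3) by (intro sum_mono mult_left_mono)
    then show ?thesis using F(4)[of i] by (simp flip: sum_distrib_right)
  qed
  then have "\<bar>d i\<bar> * \<delta> \<le> \<bar>d i\<bar> * (\<Sum>k\<in>F i. c i k * dual_pairing (A k) (y k))" by (rule mult_left_mono) simp
  ultimately show ?thesis by (simp add: mult.commute)
qed

end

section \<open>An isomorphic restriction\<close>

text \<open>Inside \<open>{..<b}\<close> at most \<open>b\<close> successive parts can be nonzero.
  An average of larger size can therefore be read as one of size \<open>b\<close> after
  multiplication by \<open>l / b\<close>, which does not decrease positive values.\<close>

lemma avg_resize:
  assumes avg: "avg n l \<alpha>" and sup: "supp \<alpha> \<subseteq> {..<b}" and b: "2 \<le> b" "b \<le> l"
  shows "avg n b ((real l / real b) *\<^sub>R \<alpha>)"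
proof -
  obtain R g where R: "avg_rep n l \<alpha> R g" using avg by (auto simp: avg_def)
  have fin: "finite R" and bef: "\<And>r s. r \<in> R \<Longrightarrow> s \<in> R \<Longrightarrow> r < s \<Longrightarrow> before (g r) (g s)"
    and \<alpha>: "\<alpha> = (1 / real l) *\<^sub>R (\<Sum>r\<in>R. g r)" using R by (auto simp: avg_rep_def)
  define R' where "R' = {r\<in>R. g r \<noteq> 0}"
  have sup': "supp (\<Sum>r\<in>R. g r) \<subseteq> {..<b}" using sup b by (simp add: \<alpha> supp_scaleR)
  have sub: "supp (g r) \<subseteq> {..<b}" if "r \<in> R" for r
    using supp_sum_successive[where R = R and g = g and r = r, OF fin bef that] sup' by blast
  have "card R' \<le> card {..<b}"
  proof (rule card_inj_on_le[of "\<lambda>r. lo (g r)"])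
    show "inj_on (\<lambda>r. lo (g r)) R'"
    proof (rule inj_onI)
      have less: "lo (g r) < lo (g s)" if "r \<in> R'" "s \<in> R'" "r < s" for r s
        using before_Max_Min(2)[OF bef] that by (auto simp: R'_def)
      fix r s assume "r \<in> R'" "s \<in> R'" "lo (g r) = lo (g s)"
      then show "r = s" using less[of r s] less[of s r] by (cases r s rule: linorder_cases) auto
    qed
    show "(\<lambda>r. lo (g r)) ` R' \<subseteq> {..<b}" using sub lo_hi(1) by (force simp: R'_def)
  qed simp
  moreover have "(real l / real b) *\<^sub>R \<alpha> = (1 / real b) *\<^sub>R (\<Sum>r\<in>R'. g r)"
  proof -
    have "(\<Sum>r\<in>R. g r) = (\<Sum>r\<in>R'. g r)" using fin by (intro sum.mono_neutral_right) (auto simp: R'_def)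
    then show ?thesis using b by (simp add: \<alpha>)
  qed
  ultimately have "avg_rep n b ((real l / real b) *\<^sub>R \<alpha>) R' g"
    using R b unfolding avg_rep_def by (auto simp: R'_def)
  then show ?thesis by (auto simp: avg_def)
qed

lemma subspace_c00: "subspace c00"
  by (auto simp: subspace_def c00_def in_keys_iff lookup_add lookup_scaleR)

lemma c00_sum: "(\<And>i. i \<in> I \<Longrightarrow> x i \<in> c00) \<Longrightarrow> (\<Sum>i\<in>I. d i *\<^sub>R x i) \<in> c00"
  using subspace_c00 by (intro subspace_sum subspace_scale) auto

lemma infinite_dim_span:
  fixes W :: "nat \<Rightarrow> 'a::real_vector"
  assumes "\<And>m d. (\<Sum>i<m. d i *\<^sub>R W i) = 0 \<Longrightarrow> (\<forall>i<m. d i = 0)"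
  shows "infinite_dim (span (range W))"
proof -
  have inj: "inj W"
  proof (rule injI, rule ccontr)
    fix i j assume ij: "W i = W j" "i \<noteq> j"
    define d where "d k = (if k = i then 1 else if k = j then - 1 else (0::real))" for k
    have "(\<Sum>k<Suc (max i j). d k *\<^sub>R W k) = (\<Sum>k\<in>{i, j}. d k *\<^sub>R W k)"
      by (intro sum.mono_neutral_right) (auto simp: d_def)
    also have "\<dots> = 0" using ij by (simp add: d_def)
    finally have "\<forall>k<Suc (max i j). d k = 0" by (rule assms)
    then have "d i = 0" using max.cobounded1[of i j] le_imp_less_Suc by blast
    then show False by (simp add: d_def)
  qed
  have "independent (range W)"
  proof
    assume "dependent (range W)"
    then obtain t u where t: "finite t" "t \<subseteq> range W" "(\<Sum>v\<in>t. u v *\<^sub>R v) = 0" "\<exists>v\<in>t. u v \<noteq> 0"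
      unfolding dependent_explicit by blast
    define T where "T = W -` t"
    have finT: "finite T" unfolding T_def using t(1) inj by (simp add: finite_vimageI)
    have tT: "t = W ` T" using t(2) by (auto simp: T_def)
    obtain m where m: "T \<subseteq> {..<m}" using finite_nat_iff_bounded finT by blast
    have "(\<Sum>i<m. (if i \<in> T then u (W i) else 0) *\<^sub>R W i) = (\<Sum>i\<in>T. u (W i) *\<^sub>R W i)"
      using m by (intro sum.mono_neutral_cong_right) auto
    also have "\<dots> = (\<Sum>v\<in>t. u v *\<^sub>R v)" unfolding tT using inj by (simp add: sum.reindex inj_on_subset)
    finally have "(\<Sum>i<m. (if i \<in> T then u (W i) else 0) *\<^sub>R W i) = 0" using t(3) by simp
    then have "\<forall>i<m. (if i \<in> T then u (W i) else 0) = 0"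
      by (rule assms[where d = "\<lambda>i. if i \<in> T then u (W i) else 0"])
    then show False using t(4) m unfolding tT by auto
  qed
  moreover have "infinite (range W)" using inj by (simp add: finite_image_iff)
  ultimately have "\<not> (\<exists>B. finite B \<and> span (range W) \<subseteq> span B)"
    using independent_span_bound[of _ "range W"] span_superset[of "range W"] by blast
  then show ?thesis by (simp add: infinite_dim_def)
qed

lemma span_range_eq:
  fixes W :: "nat \<Rightarrow> 'a::real_vector"
  assumes "v \<in> span (range W)" shows "\<exists>m d. v = (\<Sum>i<m. d i *\<^sub>R W i) \<and> (\<forall>i\<ge>m. d i = 0)"
  using assms
proof (induction rule: span_induct_alt)
  case base
  show ?case by (intro exI[of _ 0] exI[of _ "\<lambda>_. 0"]) simp
next
  case (step c x y)
  then obtain j m d where j: "x = W j" and y: "y = (\<Sum>i<m. d i *\<^sub>R W i)" "\<forall>i\<ge>m. d i = 0" by blast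
  define m' where "m' = max m (Suc j)"
  have "y = (\<Sum>i<m'. d i *\<^sub>R W i)"
    unfolding y(1) using y(2) by (intro sum.mono_neutral_left) (auto simp: m'_def)
  moreover have "c *\<^sub>R x = (\<Sum>i<m'. (if i = j then c else 0) *\<^sub>R W i)"
  proof -
    have "(\<Sum>i<m'. (if i = j then c else 0) *\<^sub>R W i) = (\<Sum>i\<in>{j}. (if i = j then c else 0) *\<^sub>R W i)"
      by (intro sum.mono_neutral_right) (auto simp: m'_def)
    then show ?thesis by (simp add: j)
  qed
  ultimately have "c *\<^sub>R x + y = (\<Sum>i<m'. ((if i = j then c else 0) + d i) *\<^sub>R W i)"
    by (simp add: scaleR_add_left sum.distrib)
  then show ?case using y(2)
    by (intro exI[of _ m'] exI[of _ "\<lambda>i. (if i = j then c else 0) + d i"]) (auto simp: m'_def)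
qed

section \<open>Choice of averages and blocks, and the isomorphism\<close>

context operator_on_X01
begin

lemma S_diff:
  assumes uv: "u \<in> Y" "v \<in> Y" shows "S (u - v) = S u - S v"
proof -
  have "u - v \<in> Y" using Y uv by (simp add: subspace_diff)
  then have "S ((u - v) + v) = S (u - v) + S v" using S uv(2) unfolding bounded_operator_on_def by blast
  then show ?thesis by (simp only: diff_add_cancel eq_diff_eq)
qed

lemma bounded_below_homeomorphism:
  assumes V: "V \<subseteq> Y" "subspace V" and D: "\<And>v. v \<in> V \<Longrightarrow> norm v \<le> D * norm (S v)"
  shows "\<exists>g. homeomorphism V (S ` V) S g"
proof -
  obtain B where B: "\<And>v. v \<in> Y \<Longrightarrow> norm (S v) \<le> B * norm v" using S unfolding bounded_operator_on_def by blast
  have dV: "u - v \<in> V" if "u \<in> V" "v \<in> V" for u v using V(2) that by (rule subspace_diff)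
  have SV: "S (u - v) = S u - S v" if "u \<in> V" "v \<in> V" for u v
    using S_diff subsetD[OF V(1)] that by blast
  have low: "norm (u - v) \<le> D * norm (S u - S v)" if "u \<in> V" "v \<in> V" for u v
    using D[OF dV[OF that]] unfolding SV[OF that] .
  have up: "norm (S u - S v) \<le> B * norm (u - v)" if "u \<in> V" "v \<in> V" for u v
    using B[OF subsetD[OF V(1) dV[OF that]]] unfolding SV[OF that] .
  have inj: "inj_on S V"
  proof (rule inj_onI)
    fix u v assume "u \<in> V" "v \<in> V" "S u = S v"
    then show "u = v" using low[of u v] by simp
  qed
  have lip: "continuous_on A f" if "\<And>u v. u \<in> A \<Longrightarrow> v \<in> A \<Longrightarrow> norm (f u - f v) \<le> L * norm (u - v)" for A L and f :: "'a \<Rightarrow> 'a"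
  proof (rule lipschitz_on_continuous_on)
    show "\<bar>L\<bar>-lipschitz_on A f"
    proof (rule lipschitz_onI)
      fix u v assume "u \<in> A" "v \<in> A"
      then have "norm (f u - f v) \<le> L * norm (u - v)" by (rule that)
      also have "\<dots> \<le> \<bar>L\<bar> * norm (u - v)" by (intro mult_right_mono) auto
      finally show "dist (f u) (f v) \<le> \<bar>L\<bar> * dist u v" by (simp add: dist_norm)
    qed simp
  qed
  have c1: "continuous_on V S" by (rule lip[of V S B]) (rule up)
  have inv: "inv_into V S (S v) = v" if "v \<in> V" for v using inj that by simp
  have c2: "continuous_on (S ` V) (inv_into V S)"
  proof (rule lip[of _ _ D])
    fix u v assume "u \<in> S ` V" "v \<in> S ` V"
    then obtain u' v' where "u = S u'" "v = S v'" "u' \<in> V" "v' \<in> V" by blast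
    then show "norm (inv_into V S u - inv_into V S v) \<le> D * norm (u - v)" using low inv by simp
  qed
  have "homeomorphism V (S ` V) S (inv_into V S)"
    unfolding homeomorphism_def using c1 c2 inv by (force simp: image_iff)
  then show ?thesis by blast
qed

text \<open>Failure of nullness of order 0 supplies single averages of arbitrarily large size with
  value at least \<delta>. Sizes beyond the right end of the block are cut down by
  \<open>avg_resize\<close>; growth and spacing are secured by choosing each block and size beyond
  twice the previous right end.\<close>

lemma unit_selection:
  assumes app: "approx a b x y X" and nn: "\<not> null n 0 y"
  obtains \<delta> s ls A where "0 < \<delta>" "strict_mono s" "\<forall>k. avg n (ls k) (A k) \<and> supp (A k) \<subseteq> {a (s k)..<b (s k)} \<and>
      \<delta> \<le> dual_pairing (A k) (y (s k)) \<and> ls k \<le> b (s k) \<and> err x y X (s k) \<le> \<delta> / 2 ^ (k + 2)"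
    "\<forall>k. b (s k) < ls (Suc k) \<and> 2 * b (s k) \<le> a (s (Suc k))"
proof -
  have bs: "block_seq a b" and by': "blocks a b y" using app by (auto simp: approx_def)
  obtain \<delta> where \<delta>: "0 < \<delta>" and freq: "\<forall>j i. \<exists>i'\<ge>i. \<exists>L \<alpha>. fam n 0 L \<alpha> \<and> (\<forall>l\<in>L. j \<le> l) \<and>
     \<delta> \<le> (\<Sum>l\<in>L. dual_pairing (\<alpha> l) (y i'))" using nn unfolding not_null_iff by blast
  define P where "P k = (\<lambda>(i, l, \<alpha>). avg n l \<alpha> \<and> supp \<alpha> \<subseteq> {a i..<b i} \<and> \<delta> \<le> dual_pairing \<alpha> (y i) \<and> l \<le> b i \<and> err x y X i \<le> \<delta> / 2 ^ (k + 2))" for k :: nat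
  define Q where "Q = (\<lambda>(i, l :: nat, \<alpha> :: nat \<Rightarrow>\<^sub>0 real) (i', l', \<alpha>' :: nat \<Rightarrow>\<^sub>0 real). i < i' \<and> b i < l' \<and> 2 * b i \<le> a i')"
  have ex: "\<exists>i l \<alpha>. P k (i, l, \<alpha>) \<and> B < i \<and> B < l \<and> B \<le> a i" for k B
  proof -
    have "0 < \<delta> / 2 ^ (k + 2)" using \<delta> by simp
    then obtain i0 where i0: "\<forall>i\<ge>i0. err x y X i \<le> \<delta> / 2 ^ (k + 2)" using approx_err_small[OF app] by blast
    obtain i L \<alpha> where i: "i \<ge> max i0 (B + 2)" "fam n 0 L \<alpha>" "\<forall>l\<in>L. B + 2 \<le> l" "\<delta> \<le> (\<Sum>l\<in>L. dual_pairing (\<alpha> l) (y i))"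
      using freq by blast
    obtain l where l: "l \<in> L" "\<delta> \<le> dual_pairing (\<alpha> l) (y i)"
      using fam_0_eq_single[OF i(2), of "y i"] i(4) \<delta> by fastforce
    define \<beta> where "\<beta> = restr {a i..<b i} (\<alpha> l)"
    have \<beta>: "avg n l \<beta>" "supp \<beta> \<subseteq> {a i..<b i}" "\<delta> \<le> dual_pairing \<beta> (y i)"
    proof -
      show "avg n l \<beta>" unfolding \<beta>_def using famD(2)[OF i(2) l(1)] by (rule avg_restr)
      show "supp \<beta> \<subseteq> {a i..<b i}" by (auto simp: \<beta>_def supp_restr)
      show "\<delta> \<le> dual_pairing \<beta> (y i)" unfolding \<beta>_def using by' l(2) by (simp add: dual_pairing_restr_left blocks_def)
    qed
    have bi: "B + 2 < b i" "B < a i" using block_seqD(2,6)[OF bs, of i] i(1) by auto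
    show ?thesis
    proof (cases "l \<le> b i")
      case True
      then have "P k (i, l, \<beta>)" using \<beta> i0 i(1) by (auto simp: P_def)
      then show ?thesis using i l(1) bi by (intro exI[of _ i] exI[of _ l] exI[of _ \<beta>]) auto
    next
      case False
      have "avg n (b i) ((real l / real (b i)) *\<^sub>R \<beta>)"
        using \<beta>(2) bi False by (intro avg_resize[OF \<beta>(1)]) auto
      moreover have "supp ((real l / real (b i)) *\<^sub>R \<beta>) \<subseteq> {a i..<b i}"
        using keys_scaleR_subset \<beta>(2) by (rule order_trans)
      moreover have "\<delta> \<le> dual_pairing ((real l / real (b i)) *\<^sub>R \<beta>) (y i)"
      proof -
        have "\<delta> \<le> 1 * dual_pairing \<beta> (y i)" using \<beta>(3) by simp
        also have "\<dots> \<le> (real l / real (b i)) * dual_pairing \<beta> (y i)"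
          using False bi \<beta>(3) \<delta> by (intro mult_right_mono) auto
        finally show ?thesis by (simp add: dual_pairing_scaleR_left)
      qed
      ultimately have "P k (i, b i, (real l / real (b i)) *\<^sub>R \<beta>)" using i0 i(1) by (auto simp: P_def)
      then show ?thesis using i(1) bi by (intro exI[of _ i] exI[of _ "b i"] exI) auto
    qed
  qed
  have "\<exists>f. \<forall>k. P k (f k) \<and> Q (f k) (f (Suc k))"
  proof (rule dependent_nat_choice)
    show "\<exists>q. P 0 q" using ex[of 0 0] by blast
    fix q k assume "P k q"
    obtain i l \<alpha> where q: "q = (i, l, \<alpha>)" by (cases q) auto
    obtain i' l' \<alpha>' where "P (Suc k) (i', l', \<alpha>')" "max i (2 * b i) < i'" "max i (2 * b i) < l'" "max i (2 * b i) \<le> a i'"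
      using ex[of "Suc k" "max i (2 * b i)"] by blast
    then show "\<exists>q'. P (Suc k) q' \<and> Q q q'" unfolding q Q_def by (intro exI[of _ "(i', l', \<alpha>')"]) auto
  qed
  then obtain f where f: "\<forall>k. P k (f k) \<and> Q (f k) (f (Suc k))" by blast
  show thesis
  proof (rule that[OF \<delta>, of "\<lambda>k. fst (f k)" "\<lambda>k. fst (snd (f k))" "\<lambda>k. snd (snd (f k))"])
    have Pk: "P k (f k)" and Qk: "Q (f k) (f (Suc k))" for k using f by blast+
    show "strict_mono (\<lambda>k. fst (f k))" unfolding strict_mono_Suc_iff using Qk by (auto simp: Q_def case_prod_unfold)
    show "\<forall>k. avg n (fst (snd (f k))) (snd (snd (f k))) \<and> supp (snd (snd (f k))) \<subseteq> {a (fst (f k))..<b (fst (f k))} \<and>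
      \<delta> \<le> dual_pairing (snd (snd (f k))) (y (fst (f k))) \<and> fst (snd (f k)) \<le> b (fst (f k)) \<and> err x y X (fst (f k)) \<le> \<delta> / 2 ^ (k + 2)"
      using Pk by (auto simp: P_def case_prod_unfold)
    show "\<forall>k. b (fst (f k)) < fst (snd (f (Suc k))) \<and> 2 * b (fst (f k)) \<le> a (fst (f (Suc k)))"
      using Qk by (auto simp: Q_def case_prod_unfold)
  qed
qed

text \<open>The coefficient bound 1/(2 p 2^i) turns the error term
  \<open>2 * C * p * \<epsilon>\<close> into C/2^i. The other one, C/p, is no larger because
  \<open>F i\<close> starts beyond 2^(i+1), which forces p \<ge> 2^i at every step.\<close>

lemma block_selection:
  assumes bs: "block_seq a b"
  obtains F c p where "\<forall>i. scc n a b (1 / (2 * real (p i) * 2 ^ i)) (F i) (c i) \<and> F i \<subseteq> {2 ^ (i + 1)..} \<and> 2 ^ i \<le> p i"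
    "\<forall>i. Max (F i) < Min (F (Suc i)) \<and> p (Suc i) = b (Max (F i))" "p 0 = (1::nat)"
proof -
  define P where "P i = (\<lambda>(F, c, p). scc n a b (1 / (2 * real p * 2 ^ i)) F c \<and> F \<subseteq> {2 ^ (i + 1)..} \<and> 2 ^ i \<le> p \<and> (i = 0 \<longrightarrow> p = 1))" for i :: nat
  define Q where "Q = (\<lambda>(F, c :: nat \<Rightarrow> real, p :: nat) (F', c' :: nat \<Rightarrow> real, p'). Max F < Min F' \<and> p' = b (Max F))"
  have "\<exists>f. \<forall>i. P i (f i) \<and> Q (f i) (f (Suc i))"
  proof (rule dependent_nat_choice)
    obtain F c where "scc n a b (1 / 2) F c" "F \<subseteq> {2..}" using scc_exists[OF bs, of "1 / 2" n 2] by auto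
    then show "\<exists>q. P 0 q" unfolding P_def by (intro exI[of _ "(F, c, 1)"]) auto
  next
    fix q i assume q: "P i q"
    obtain F c p where qe: "q = (F, c, p)" by (cases q) auto
    have F: "finite F" "F \<noteq> {}" "F \<subseteq> {2 ^ (i + 1)..}" using q unfolding qe P_def scc_def by auto
    then have "Max F \<in> {2 ^ (i + 1)..}" using Max_in by blast
    then have p': "2 ^ Suc i \<le> b (Max F)" using block_seqD(2,6)[OF bs, of "Max F"] by simp
    define p' where "p' = b (Max F)"
    have "0 < p'" using p' unfolding p'_def by (meson less_le_trans zero_less_numeral zero_less_power)
    then have "0 < 1 / (2 * real p' * 2 ^ Suc i)" by simp
    then obtain F' c' where F': "scc n a b (1 / (2 * real p' * 2 ^ Suc i)) F' c'" "F' \<subseteq> {max (Suc (Max F)) (2 ^ (Suc i + 1))..}"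
      using scc_exists[OF bs, where m = n and t = "max (Suc (Max F)) (2 ^ (Suc i + 1))"] by blast
    have "finite F'" "F' \<noteq> {}" using F' by (auto simp: scc_def)
    then have "Max F < Min F'" using F'(2) by (auto simp: Suc_le_eq)
    then show "\<exists>q'. P (Suc i) q' \<and> Q q q'" unfolding qe P_def Q_def
      using F' p' by (intro exI[of _ "(F', c', p')"]) (auto simp: p'_def)
  qed
  then obtain f where f: "\<forall>i. P i (f i) \<and> Q (f i) (f (Suc i))" by blast
  then have Pk: "P k (f k)" and Qk: "Q (f k) (f (Suc k))" for k by blast+
  show thesis
  proof (rule that[of "\<lambda>i. snd (snd (f i))" "\<lambda>i. fst (f i)" "\<lambda>i. fst (snd (f i))"])
    show "\<forall>i. scc n a b (1 / (2 * real (snd (snd (f i))) * 2 ^ i)) (fst (f i)) (fst (snd (f i))) \<and> fst (f i) \<subseteq> {2 ^ (i + 1)..} \<and> 2 ^ i \<le> snd (snd (f i))"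
      using Pk by (auto simp: P_def case_prod_unfold)
    show "\<forall>i. Max (fst (f i)) < Min (fst (f (Suc i))) \<and> snd (snd (f (Suc i))) = b (Max (fst (f i)))"
      using Qk by (auto simp: Q_def case_prod_unfold)
    show "snd (snd (f 0)) = 1" using Pk[of 0] by (auto simp: P_def case_prod_unfold)
  qed
qed

lemma sum_geometric_le: "(\<Sum>i<m. 1 / 2 ^ i) \<le> (2::real)" for m :: nat
proof -
  have "(\<Sum>i<m. 1 / 2 ^ i) = 2 - 2 / (2::real) ^ m"
    by (induction m) (auto simp: field_simps)
  then show ?thesis by simp
qed

lemma c00_blocks: "block_seq a b \<Longrightarrow> blocks a b x \<Longrightarrow> x k \<in> c00"
  using block_seqD(1)[of a b k] unfolding blocks_def c00_def by fastforce

text \<open>Let \<open>M\<close> be the largest modulus of a coefficient of a vector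
  \<open>v\<close>. By \<open>coeff_le\<close>, the norm on the \<open>y\<close> side is at least
  \<delta> M, while replacing blocks by the actual vectors costs at most M \<delta>/2, half of that
  norm. So this norm and \<open>M\<close> are both bounded by multiples of
  \<open>norm (S v)\<close>, and \<open>norm_dominated\<close> then bounds
  \<open>norm v\<close>.\<close>

theorem isomorphic_on_subspace:
  assumes app: "approx a b x y X" and C: "\<And>k. norm01 n (x k) \<le> C" and nn: "\<not> null n 0 y"
  shows "\<exists>V g. subspace V \<and> V \<subseteq> Y \<and> infinite_dim V \<and> homeomorphism V (S ` V) S g"
proof -
  have C0: "0 \<le> C" using C[of 0] norm01_nonneg[of n "x 0"] by linarith
  obtain \<delta> s ls A where sel: "0 < \<delta>" "strict_mono s" "\<forall>k. avg n (ls k) (A k) \<and> supp (A k) \<subseteq> {a (s k)..<b (s k)} \<and>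
      \<delta> \<le> dual_pairing (A k) (y (s k)) \<and> ls k \<le> b (s k) \<and> err x y X (s k) \<le> \<delta> / 2 ^ (k + 2)"
    "\<forall>k. b (s k) < ls (Suc k) \<and> 2 * b (s k) \<le> a (s (Suc k))"
    by (rule unit_selection[OF app nn])
  define a1 b1 x1 y1 X1 where defs: "a1 = a \<circ> s" "b1 = b \<circ> s" "x1 = x \<circ> s" "y1 = y \<circ> s" "X1 = X \<circ> s"
  have app1: "approx a1 b1 x1 y1 X1" unfolding defs using approx_subseq[OF app sel(2)] .
  then have bs1: "block_seq a1 b1" "blocks a1 b1 x1" "blocks a1 b1 y1" and XY: "\<And>k. X1 k \<in> Y" by (auto simp: approx_def)
  obtain F c p where blk: "\<forall>i. scc n a1 b1 (1 / (2 * real (p i) * 2 ^ i)) (F i) (c i) \<and> F i \<subseteq> {2 ^ (i + 1)..} \<and> 2 ^ i \<le> p i"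
    "\<forall>i. Max (F i) < Min (F (Suc i)) \<and> p (Suc i) = b1 (Max (F i))" "p 0 = (1::nat)"
    by (rule block_selection[OF bs1(1)])
  obtain n' where n': "n = Suc n'" using n by (cases n) auto
  \<comment> \<open>Both error terms of the domination are at most C/2^i, hence at most e i/16, and
    all \<open>e i\<close> together sum to at most 32 (C + 1).\<close>
  define e where "e i = 16 * (C + 1) / 2 ^ i" for i :: nat
  have gap: "b1 j < ls k \<and> 2 * b1 j \<le> a1 k" if jk: "j < k" for j k
  proof -
    define k' where "k' = k - 1"
    have k': "k = Suc k'" "j \<le> k'" using jk by (auto simp: k'_def)
    have "b1 j \<le> b1 k'" using block_seqD(5)[OF bs1(1) k'(2)] .
    moreover have "b1 k' < ls k \<and> 2 * b1 k' \<le> a1 k" using sel(4) k'(1) by (simp add: defs)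
    ultimately show ?thesis by linarith
  qed
  have p1: "2 ^ i \<le> real (p i)" for i
  proof -
    have "real (2 ^ i) \<le> real (p i)" using blk(1) of_nat_le_iff by blast
    then show ?thesis by simp
  qed
  have Ce: "C / 2 ^ i \<le> e i / 16" for i
  proof -
    have "C / 2 ^ i \<le> (C + 1) / 2 ^ i" by (rule divide_right_mono) auto
    then show ?thesis by (simp add: e_def field_simps)
  qed
  have dom: "domination n n' a1 b1 x1 y1 C \<delta> A ls F c (\<lambda>i. 1 / (2 * real (p i) * 2 ^ i)) p e M" if "0 \<le> M" for M
  proof
    show "C / real (p i) \<le> e i / 16" for i
    proof -
      have "C / real (p i) \<le> C / 2 ^ i" using C0 p1[of i] by (intro divide_left_mono) (auto intro!: mult_pos_pos less_le_trans[OF _ p1])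
      also have "\<dots> \<le> e i / 16" by (rule Ce)
      finally show ?thesis .
    qed
    show "2 * C * real (p i) * (1 / (2 * real (p i) * 2 ^ i)) \<le> e i / 16" for i
    proof -
      have "0 < real (p i)" using p1[of i] by (meson less_le_trans zero_less_numeral zero_less_power)
      then have "2 * C * real (p i) * (1 / (2 * real (p i) * 2 ^ i)) = C / 2 ^ i" by (simp add: field_simps)
      then show ?thesis using Ce[of i] by simp
    qed
  qed (use n' bs1 C sel blk gap that in \<open>auto simp: defs\<close>)
  define W where "W i = (\<Sum>k\<in>F i. c i k *\<^sub>R X1 k)" for i
  have WY: "W i \<in> Y" for i unfolding W_def using XY Y by (intro subspace_sum subspace_scale) auto
  \<comment> \<open>The first summand comes from the domination constant C/\<delta>, with the norm
    on the \<open>y\<close> side at most twice \<open>norm (S v)\<close>. The second is the bound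
    2/\<delta> for \<open>M\<close> times the total of the domination errors and the perturbation
    \<delta>/2.\<close>
  define D where "D = 2 * (C / \<delta>) + (2 / \<delta>) * (32 * (C + 1) + \<delta> / 2)"
  define \<eta> where "\<eta> i = (\<delta> / 4) * (1 / 2 ^ i)" for i :: nat
  have key: "norm v \<le> D * norm (S v) \<and> (\<forall>i<m. \<delta> * \<bar>d i\<bar> \<le> 2 * norm (S v))" if v: "v = (\<Sum>i<m. d i *\<^sub>R W i)" for m d v
  proof (cases "m = 0")
    case True
    then show ?thesis using v S_sum[of "{}" W d] by simp
  next
    case False
    define d' where "d' i = (if i < m then d i else 0)" for i
    define M where "M = Max ((\<lambda>i. \<bar>d i\<bar>) ` {..<m})"
    have Mi: "\<bar>d i\<bar> \<le> M" if "i < m" for i unfolding M_def using that by (intro Max_ge) auto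
    have "M \<in> (\<lambda>i. \<bar>d i\<bar>) ` {..<m}" unfolding M_def using False by (intro Max_in) auto
    then obtain i0 where i0: "i0 < m" "M = \<bar>d i0\<bar>" by blast
    have M0: "0 \<le> M" using i0 by simp
    interpret dm: domination n n' a1 b1 x1 y1 C \<delta> A ls F c "\<lambda>i. 1 / (2 * real (p i) * 2 ^ i)" p e m M by (rule dom[OF M0])
    have d'M: "\<bar>d' i\<bar> \<le> M" for i using Mi M0 by (simp add: d'_def)
    have xs: "dm.xs d' = (\<Sum>i<m. d i *\<^sub>R dm.w i)" and zs: "dm.zs d' = (\<Sum>i<m. d i *\<^sub>R dm.z i)"
      unfolding dm.xs_def dm.zs_def d'_def by auto
    have wc: "dm.w i \<in> c00" "dm.z i \<in> c00" for i
      unfolding dm.w_def dm.z_def using c00_blocks[OF bs1(1)] bs1(2,3) by (auto intro!: c00_sum)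
    have Jxs: "norm (J (dm.xs d')) = norm01 n (dm.xs d')" and Jzs: "norm (J (dm.zs d')) = norm01 n (dm.zs d')"
      unfolding xs zs using wc by (auto intro!: norm_J c00_sum)
    have errW: "norm (W i - J (dm.w i)) + norm (S (W i) - J (dm.z i)) \<le> \<eta> i" for i
    proof -
      have "norm (W i - J (dm.w i)) + norm (S (W i) - J (dm.z i)) \<le> (\<Sum>k\<in>F i. \<bar>c i k\<bar> * err x1 y1 X1 k)"
        unfolding W_def dm.w_def dm.z_def using XY by (intro err_combine_le)
      also have "\<dots> \<le> (\<Sum>k\<in>F i. c i k * \<eta> i)"
      proof (rule sum_mono)
        fix k assume k: "k \<in> F i"
        have "2 ^ (i + 1) \<le> k" using blk(1) k by fastforce
        moreover have "i < 2 ^ (i + 1)" using less_exp[of i] trans_less_add1[of i "2 ^ i" "2 ^ i"] by (simp add: power_add mult_2)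
        ultimately have ik: "i \<le> k" by linarith
        have "err x1 y1 X1 k = err x y X (s k)" by (simp add: err_def defs)
        also have "\<dots> \<le> \<delta> / 2 ^ (k + 2)" using sel(3) by blast
        also have "\<dots> \<le> \<delta> / 2 ^ (i + 2)" using ik sel(1) by (intro divide_left_mono power_increasing) auto
        also have "\<dots> = \<eta> i" by (simp add: \<eta>_def)
        finally show "\<bar>c i k\<bar> * err x1 y1 X1 k \<le> c i k * \<eta> i"
          using dm.F(3)[of i k] by (simp add: mult_left_mono)
      qed
      also have "\<dots> = (\<Sum>k\<in>F i. c i k) * \<eta> i" by (rule sum_distrib_right[symmetric])
      also have "\<dots> = \<eta> i" using dm.F(4)[of i] by simp
      finally show ?thesis .
    qed
    have er: "(\<Sum>i<m. \<bar>d i\<bar> * \<eta> i) \<le> M * (\<delta> / 2)"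
    proof -
      have "(\<Sum>i<m. \<bar>d i\<bar> * \<eta> i) \<le> (\<Sum>i<m. M * \<eta> i)"
        using Mi sel(1) unfolding \<eta>_def mult.assoc by (intro sum_mono mult_right_mono) auto
      also have "\<dots> = M * (\<delta> / 4) * (\<Sum>i<m. 1 / 2 ^ i)" unfolding \<eta>_def sum_distrib_left mult.assoc ..
      also have "\<dots> \<le> M * (\<delta> / 4) * 2" using M0 sel(1) by (intro mult_left_mono sum_geometric_le) auto
      finally show ?thesis by simp
    qed
    have nv: "norm (v - J (dm.xs d')) \<le> M * (\<delta> / 2)"
    proof -
      have "norm (v - J (dm.xs d')) \<le> (\<Sum>i<m. \<bar>d i\<bar> * norm (W i - J (dm.w i)))"
        unfolding v xs by (rule norm_sum_diff_J_le)
      also have "\<dots> \<le> (\<Sum>i<m. \<bar>d i\<bar> * \<eta> i)"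
      proof (intro sum_mono mult_left_mono)
        fix i show "norm (W i - J (dm.w i)) \<le> \<eta> i"
          using errW[of i] norm_ge_zero[of "S (W i) - J (dm.z i)"] by linarith
      qed simp
      finally show ?thesis using er by linarith
    qed
    have nSv: "norm (S v - J (dm.zs d')) \<le> M * (\<delta> / 2)"
    proof -
      have "S v = (\<Sum>i<m. d i *\<^sub>R S (W i))" unfolding v using WY by (intro S_sum)
      then have "norm (S v - J (dm.zs d')) \<le> (\<Sum>i<m. \<bar>d i\<bar> * norm (S (W i) - J (dm.z i)))"
        unfolding zs using norm_sum_diff_J_le[of d "\<lambda>i. S (W i)" "{..<m}" dm.z] by simp
      also have "\<dots> \<le> (\<Sum>i<m. \<bar>d i\<bar> * \<eta> i)"
      proof (intro sum_mono mult_left_mono)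
        fix i show "norm (S (W i) - J (dm.z i)) \<le> \<eta> i"
          using errW[of i] norm_ge_zero[of "W i - J (dm.w i)"] by linarith
      qed simp
      finally show ?thesis using er by linarith
    qed
    have \<delta>M: "\<delta> * M \<le> norm01 n (dm.zs d')" using dm.coeff_le[OF i0(1), of d'] i0 by (simp add: d'_def)
    have "norm01 n (dm.zs d') \<le> norm (S v) + M * (\<delta> / 2)"
      using nSv norm_triangle_sub[of "J (dm.zs d')" "S v"] Jzs by (simp add: norm_minus_commute)
    then have z2: "norm01 n (dm.zs d') \<le> 2 * norm (S v)" using \<delta>M by (simp add: mult.commute)
    have Mle: "M \<le> (2 / \<delta>) * norm (S v)" using \<delta>M z2 sel(1) by (simp add: field_simps)
    have E: "(\<Sum>i<m. e i) \<le> 32 * (C + 1)"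
    proof -
      have "(\<Sum>i<m. e i) = 16 * (C + 1) * (\<Sum>i<m. 1 / 2 ^ i)" by (simp add: e_def sum_distrib_left)
      also have "\<dots> \<le> 16 * (C + 1) * 2" using C0 by (intro mult_left_mono sum_geometric_le) auto
      finally show ?thesis by simp
    qed
    have "norm v \<le> norm01 n (dm.xs d') + M * (\<delta> / 2)"
      using nv norm_triangle_sub[of v "J (dm.xs d')"] Jxs by simp
    also have "norm01 n (dm.xs d') \<le> dm.K * norm01 n (dm.zs d') + M * (\<Sum>i<m. e i)"
      by (rule dm.norm_dominated[OF d'M])
    also have "dm.K * norm01 n (dm.zs d') \<le> (C / \<delta>) * (2 * norm (S v))"
      unfolding dm.K_def using z2 C0 sel(1) by (intro mult_left_mono) auto
    also have "M * (\<Sum>i<m. e i) \<le> M * (32 * (C + 1))" using E M0 by (rule mult_left_mono)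
    finally have "norm v \<le> (C / \<delta>) * (2 * norm (S v)) + M * (32 * (C + 1) + \<delta> / 2)" by (simp add: distrib_left)
    also have "M * (32 * (C + 1) + \<delta> / 2) \<le> (2 / \<delta>) * norm (S v) * (32 * (C + 1) + \<delta> / 2)"
      using Mle C0 sel(1) by (intro mult_right_mono) auto
    also have "(C / \<delta>) * (2 * norm (S v)) + (2 / \<delta>) * norm (S v) * (32 * (C + 1) + \<delta> / 2) = D * norm (S v)"
      by (simp add: D_def algebra_simps)
    finally have "norm v \<le> D * norm (S v)" by simp
    moreover have "\<delta> * \<bar>d i\<bar> \<le> 2 * norm (S v)" if "i < m" for i
    proof -
      have "\<delta> * \<bar>d i\<bar> \<le> \<delta> * M" using Mi[OF that] sel(1) by (intro mult_left_mono) auto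
      then show ?thesis using \<delta>M z2 by linarith
    qed
    ultimately show ?thesis by blast
  qed
  define V where "V = span (range W)"
  have VY: "V \<subseteq> Y" unfolding V_def using WY Y by (intro span_minimal) auto
  have "norm v \<le> D * norm (S v)" if "v \<in> V" for v
    using span_range_eq[of v W] that key unfolding V_def by blast
  then have "\<exists>g. homeomorphism V (S ` V) S g"
    using VY by (intro bounded_below_homeomorphism) (auto simp: V_def)
  moreover have "infinite_dim V"
    unfolding V_def
  proof (rule infinite_dim_span)
    fix m d assume 0: "(\<Sum>i<m. d i *\<^sub>R W i) = 0"
    have "S 0 = 0" using S_sum[of "{}" W d] by simp
    then show "\<forall>i<m. d i = 0" using key[where d = d and m = m, OF refl] 0 sel(1)
      by (auto simp: mult_le_0_iff)
  qed
  ultimately show ?thesis using VY unfolding V_def by blast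
qed

end

section \<open>Schauder's fixed point theorem\<close>

lemma diagonal_convergent:
  fixes \<Phi> :: "nat \<Rightarrow> nat \<Rightarrow> real"
  assumes "\<And>k m. \<bar>\<Phi> k m\<bar> \<le> D m"
  shows "\<exists>r. strict_mono r \<and> (\<forall>m. convergent (\<lambda>k. \<Phi> (r k) m))"
proof -
  interpret subseqs "\<lambda>m s. convergent (\<lambda>k. \<Phi> (s k) m)"
  proof
    fix m and s :: "nat \<Rightarrow> nat"
    have "bounded (range (\<lambda>k. \<Phi> (s k) m))" using assms by (auto simp: bounded_iff)
    then obtain l r where "strict_mono r" "((\<lambda>k. \<Phi> (s k) m) \<circ> r) \<longlonglongrightarrow> l"
      using bounded_imp_convergent_subsequence by blast
    then show "\<exists>r. strict_mono r \<and> convergent (\<lambda>k. \<Phi> ((s \<circ> r) k) m)"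
      by (intro exI[of _ r]) (auto simp: convergent_def o_def)
  qed
  have "convergent (\<lambda>k. \<Phi> (diagseq k) m)" for m
  proof -
    have "convergent (\<lambda>k. \<Phi> ((diagseq \<circ> (+) (Suc m)) k) m)"
    proof (rule diagseq_holds)
      fix r s :: "nat \<Rightarrow> nat" and i assume "strict_mono r" "convergent (\<lambda>k. \<Phi> (s k) i)"
      then show "convergent (\<lambda>k. \<Phi> ((s \<circ> r) k) i)"
        using convergent_subseq_convergent[of "\<lambda>k. \<Phi> (s k) i" r] by (simp add: o_def)
    qed
    then obtain l where "(\<lambda>k. \<Phi> (diagseq (k + Suc m)) m) \<longlonglongrightarrow> l" by (auto simp: o_def add.commute convergent_def)
    then have "(\<lambda>k. \<Phi> (diagseq k) m) \<longlonglongrightarrow> l" by (rule LIMSEQ_offset)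
    then show ?thesis by (auto simp: convergent_def)
  qed
  then show ?thesis using subseq_diagseq by blast
qed

text \<open>The dimension has to be a term and not a type here, hence the detour through Kuhn's lemma.\<close>

lemma brouwer_nat_cube:
  fixes g :: "(nat \<Rightarrow> real) \<Rightarrow> nat \<Rightarrow> real"
  assumes cube: "\<And>s. \<forall>i<k. 0 \<le> s i \<and> s i \<le> 1 \<Longrightarrow> \<forall>i<k. 0 \<le> g s i \<and> g s i \<le> 1"
    and cont: "\<And>\<sigma> s i. \<forall>p. \<forall>i<k. 0 \<le> \<sigma> p i \<and> \<sigma> p i \<le> 1 \<Longrightarrow> \<forall>i<k. (\<lambda>p. \<sigma> p i) \<longlonglongrightarrow> s i \<Longrightarrow> i < k \<Longrightarrow> (\<lambda>p. g (\<sigma> p) i) \<longlonglongrightarrow> g s i"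
  shows "\<exists>s. (\<forall>i<k. 0 \<le> s i \<and> s i \<le> 1) \<and> (\<forall>i<k. g s i = s i)"
proof -
  define P where "P s \<longleftrightarrow> (\<forall>i<k. 0 \<le> s i \<and> s i \<le> 1)" for s :: "nat \<Rightarrow> real"
  have Pg: "\<forall>s. P s \<longrightarrow> P (g s)" using cube by (auto simp: P_def)
  obtain l where l: "\<forall>x i. l x i \<le> (1::nat)" "\<forall>x i. P x \<and> i < k \<and> x i = 0 \<longrightarrow> l x i = 0"
    "\<forall>x i. P x \<and> i < k \<and> x i = 1 \<longrightarrow> l x i = 1" "\<forall>x i. P x \<and> i < k \<and> l x i = 0 \<longrightarrow> x i \<le> g x i"
    "\<forall>x i. P x \<and> i < k \<and> l x i = 1 \<longrightarrow> g x i \<le> x i"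
    using kuhn_labelling_lemma'[where P = P and f = g and Q = "\<lambda>i. i < k", OF Pg] unfolding P_def by blast
  define pt where "pt p x i = real (x i) / real (Suc p)" for p and x :: "nat \<Rightarrow> nat" and i :: nat
  have Ppt: "P (pt p x)" if "\<forall>i<k. x i \<le> Suc p" for p x
    using that by (auto simp: P_def pt_def divide_le_eq_1 simp del: of_nat_Suc)
  \<comment> \<open>A cube of the grid with mesh 1/(p+1) whose vertices carry both labels in every
    direction.\<close>
  define R where "R p q \<longleftrightarrow> (\<forall>i<k. q i < Suc p) \<and> (\<forall>i<k. \<exists>r s. (\<forall>j<k. q j \<le> r j \<and> r j \<le> q j + 1) \<and>
      (\<forall>j<k. q j \<le> s j \<and> s j \<le> q j + 1) \<and> l (pt p r) i \<noteq> l (pt p s) i)" for p q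
  have "\<exists>q. R p q" for p
  proof (rule kuhn_lemma[of "Suc p" k "\<lambda>x. l (pt p x)"])
    show "\<forall>x. (\<forall>i<k. x i \<le> Suc p) \<longrightarrow> (\<forall>i<k. l (pt p x) i = 0 \<or> l (pt p x) i = 1)"
      using l(1) by (metis le_Suc_eq le_zero_eq One_nat_def)
    show "\<forall>x. (\<forall>i<k. x i \<le> Suc p) \<longrightarrow> (\<forall>i<k. x i = 0 \<longrightarrow> l (pt p x) i = 0)"
      using l(2) Ppt by (simp add: pt_def)
    show "\<forall>x. (\<forall>i<k. x i \<le> Suc p) \<longrightarrow> (\<forall>i<k. x i = Suc p \<longrightarrow> l (pt p x) i = 1)"
    proof (intro allI impI)
      fix x i assume x: "\<forall>i<k. x i \<le> Suc p" "i < k" "x i = Suc p"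
      then have "pt p x i = 1" by (simp add: pt_def del: of_nat_Suc)
      then show "l (pt p x) i = 1" using l(3) Ppt[OF x(1)] x(2) by blast
    qed
  next
    fix q assume "\<forall>i<k. q i < Suc p" "\<forall>i<k. \<exists>r s. (\<forall>j<k. q j \<le> r j \<and> r j \<le> q j + 1) \<and>
      (\<forall>j<k. q j \<le> s j \<and> s j \<le> q j + 1) \<and> l (pt p r) i \<noteq> l (pt p s) i"
    then show "\<exists>q. R p q" unfolding R_def by (intro exI[of _ q] conjI)
  qed simp
  then obtain q where "\<forall>p. R p (q p)" by metis
  then have q: "i < k \<Longrightarrow> q p i < Suc p" and labels: "i < k \<Longrightarrow> \<exists>r s. (\<forall>j<k. q p j \<le> r j \<and> r j \<le> q p j + 1) \<and>
      (\<forall>j<k. q p j \<le> s j \<and> s j \<le> q p j + 1) \<and> l (pt p r) i \<noteq> l (pt p s) i" for p i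
    unfolding R_def by blast+
  define s where "s p i = (if i < k then pt p (q p) i else 0)" for p i
  have "\<bar>s p i\<bar> \<le> 1" for p i
    using Ppt[of "q p" p] q by (auto simp: s_def P_def less_imp_le)
  then obtain \<rho> where \<rho>: "strict_mono \<rho>" "\<forall>i. convergent (\<lambda>p. s (\<rho> p) i)"
    using diagonal_convergent[of s "\<lambda>_. 1"] by blast
  then obtain t where t: "\<And>i. (\<lambda>p. s (\<rho> p) i) \<longlonglongrightarrow> t i" unfolding convergent_def by metis
  have inv: "(\<lambda>p. inverse (real (Suc (\<rho> p)))) \<longlonglongrightarrow> 0"
    using LIMSEQ_subseq_LIMSEQ[OF LIMSEQ_inverse_real_of_nat \<rho>(1)] by (simp add: o_def)
  \<comment> \<open>The cubes shrink, so along the subsequence vertices converge to \<open>t\<close>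
    however they are chosen.\<close>
  have near: "(\<lambda>p. pt (\<rho> p) (x p) i) \<longlonglongrightarrow> t i"
    if "\<And>p. \<forall>j<k. q (\<rho> p) j \<le> x p j \<and> x p j \<le> q (\<rho> p) j + 1" "i < k" for x i
  proof (rule tendsto_sandwich[OF _ _ t[of i]])
    show "\<forall>\<^sub>F p in sequentially. s (\<rho> p) i \<le> pt (\<rho> p) (x p) i"
      using that by (simp add: s_def pt_def divide_right_mono)
    show "\<forall>\<^sub>F p in sequentially. pt (\<rho> p) (x p) i \<le> s (\<rho> p) i + inverse (real (Suc (\<rho> p)))"
    proof (intro always_eventually allI)
      fix p
      have "real (x p i) \<le> real (q (\<rho> p) i) + 1" using that by (metis of_nat_1 of_nat_add of_nat_le_iff)
      then have "real (x p i) / real (Suc (\<rho> p)) \<le> (real (q (\<rho> p) i) + 1) / real (Suc (\<rho> p))" by (rule divide_right_mono) simp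
      then show "pt (\<rho> p) (x p) i \<le> s (\<rho> p) i + inverse (real (Suc (\<rho> p)))"
        using that(2) by (simp add: s_def pt_def add_divide_distrib inverse_eq_divide)
    qed
    show "(\<lambda>p. s (\<rho> p) i + inverse (real (Suc (\<rho> p)))) \<longlonglongrightarrow> t i" using tendsto_add[OF t[of i] inv] by simp
  qed
  have "g t i = t i" if i: "i < k" for i
  proof -
    \<comment> \<open>In every direction there is a vertex with label 0, where \<open>g\<close> does
      not decrease the coordinate, and one with label 1, where \<open>g\<close> does not increase
      it. In the limit both inequalities hold at \<open>t\<close>.\<close>
    have ex: "\<exists>x. (\<forall>j<k. q p j \<le> x j \<and> x j \<le> q p j + 1) \<and> l (pt p x) i = c" if c: "c = 0 \<or> c = 1" for p c
    proof -
      obtain r s where rs: "\<forall>j<k. q p j \<le> r j \<and> r j \<le> q p j + 1" "\<forall>j<k. q p j \<le> s j \<and> s j \<le> q p j + 1"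
        "l (pt p r) i \<noteq> l (pt p s) i" using labels[OF i, of p] by blast
      have "l (pt p r) i \<le> 1" "l (pt p s) i \<le> 1" using l(1) by blast+
      then have "l (pt p r) i = c \<or> l (pt p s) i = c" using c rs(3) by linarith
      then show ?thesis using rs by blast
    qed
    have lim: "\<exists>x. (\<forall>p. P (pt (\<rho> p) (x p)) \<and> l (pt (\<rho> p) (x p)) i = c) \<and> (\<lambda>p. pt (\<rho> p) (x p) i) \<longlonglongrightarrow> t i \<and> (\<lambda>p. g (pt (\<rho> p) (x p)) i) \<longlonglongrightarrow> g t i" if c: "c = 0 \<or> c = 1" for c
    proof -
      have "\<forall>p. \<exists>x. (\<forall>j<k. q (\<rho> p) j \<le> x j \<and> x j \<le> q (\<rho> p) j + 1) \<and> l (pt (\<rho> p) x) i = c" using ex[OF c] by blast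
      then obtain x where x: "\<And>p. \<forall>j<k. q (\<rho> p) j \<le> x p j \<and> x p j \<le> q (\<rho> p) j + 1" "\<And>p. l (pt (\<rho> p) (x p)) i = c" by metis
      have xP: "P (pt (\<rho> p) (x p))" for p
      proof (rule Ppt, intro allI impI)
        fix j assume "j < k"
        then have "x p j \<le> q (\<rho> p) j + 1" "q (\<rho> p) j < Suc (\<rho> p)" using x(1)[of p] q[of j "\<rho> p"] by blast+
        then show "x p j \<le> Suc (\<rho> p)" by simp
      qed
      have "(\<lambda>p. g (pt (\<rho> p) (x p)) i) \<longlonglongrightarrow> g t i"
        using xP near[OF x(1)] by (intro cont[OF _ _ i]) (auto simp: P_def)
      then show ?thesis using x(2) xP near[OF x(1) i] by blast
    qed
    obtain x where x: "\<forall>p. P (pt (\<rho> p) (x p)) \<and> l (pt (\<rho> p) (x p)) i = 0" "(\<lambda>p. pt (\<rho> p) (x p) i) \<longlonglongrightarrow> t i" "(\<lambda>p. g (pt (\<rho> p) (x p)) i) \<longlonglongrightarrow> g t i"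
      using lim[of 0] by blast
    have "\<forall>p. pt (\<rho> p) (x p) i \<le> g (pt (\<rho> p) (x p)) i" using l(4) x(1) i by blast
    then have "t i \<le> g t i" using LIMSEQ_le[OF x(2,3)] by blast
    obtain z where z: "\<forall>p. P (pt (\<rho> p) (z p)) \<and> l (pt (\<rho> p) (z p)) i = 1" "(\<lambda>p. pt (\<rho> p) (z p) i) \<longlonglongrightarrow> t i" "(\<lambda>p. g (pt (\<rho> p) (z p)) i) \<longlonglongrightarrow> g t i"
      using lim[of 1] by blast
    have "\<forall>p. g (pt (\<rho> p) (z p)) i \<le> pt (\<rho> p) (z p) i" using l(5) z(1) i by blast
    then have "g t i \<le> t i" using LIMSEQ_le[OF z(3,2)] by blast
    then show ?thesis using \<open>t i \<le> g t i\<close> by simp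
  qed
  moreover have "0 \<le> t i \<and> t i \<le> 1" if i: "i < k" for i
  proof -
    have "P (s p)" for p using Ppt[of "q p" p] q by (auto simp: s_def P_def less_imp_le)
    then have "\<forall>p. 0 \<le> s (\<rho> p) i \<and> s (\<rho> p) i \<le> 1" using i by (auto simp: P_def)
    then show ?thesis using LIMSEQ_le_const[OF t[of i], of 0] LIMSEQ_le_const2[OF t[of i], of 1] by blast
  qed
  ultimately show ?thesis by blast
qed

text \<open>The image is pushed into the hull of a finite \<epsilon>-net of \<open>C\<close> by a
  partition of unity, and the cube version of Brouwer's theorem is applied to the coefficients. The
  resulting approximate fixed points converge along a subsequence, because their images lie in the
  compact set \<open>C\<close>.\<close>

theorem schauder_fixpoint:
  fixes F :: "'a::real_normed_vector \<Rightarrow> 'a"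
  assumes U: "convex U" "U \<noteq> {}" and C: "compact C" "C \<subseteq> U" and F: "continuous_on U F" "F ` U \<subseteq> C"
  shows "\<exists>x\<in>U. F x = x"
proof -
  have approx: "\<exists>x\<in>U. dist x (F x) \<le> \<epsilon>" if \<epsilon>: "0 < \<epsilon>" for \<epsilon>
  proof -
    obtain A where A: "finite A" "A \<subseteq> C" "C \<subseteq> (\<Union>c\<in>A. ball c \<epsilon>)"
    proof (rule compactE_image[OF C(1), of C "\<lambda>c. ball c \<epsilon>"])
      show "C \<subseteq> (\<Union>c\<in>C. ball c \<epsilon>)" using \<epsilon> by force
    qed (auto intro: that)
    obtain k and c :: "nat \<Rightarrow> 'a" where c: "A = c ` {i. i < k}" using finite_imp_nat_seg_image_inj_on[OF A(1)] by blast
    have cC: "c i \<in> C" if "i < k" for i using A(2) c that by blast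
    obtain c0 where c0: "c0 \<in> U" using U(2) by blast
    define w where "w y i = max 0 (\<epsilon> - dist y (c i))" for y i
    define W where "W y = (\<Sum>i<k. w y i)" for y
    have w0: "0 \<le> w y i" for y i by (simp add: w_def)
    have W0: "0 < W y" if y: "y \<in> C" for y
    proof -
      obtain i where i: "i < k" "dist (c i) y < \<epsilon>" using subsetD[OF A(3) y] unfolding c by auto
      have "0 < w y i" using i(2) by (simp add: w_def dist_commute)
      also have "\<dots> \<le> W y" unfolding W_def using i(1) w0 by (intro member_le_sum) auto
      finally show ?thesis .
    qed
    \<comment> \<open>The coefficients range over a cube and not over a simplex. They are scaled
      down when their sum exceeds 1, and \<open>c0\<close> takes up the mass missing to 1; at the
      fixed point the sum is exactly 1.\<close>
    define \<tau> where "\<tau> s i = s i / max 1 (\<Sum>j<k. s j)" for s :: "nat \<Rightarrow> real" and i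
    define x where "x s = (1 - (\<Sum>i<k. \<tau> s i)) *\<^sub>R c0 + (\<Sum>i<k. \<tau> s i *\<^sub>R c i)" for s
    have xU: "x s \<in> U" if s: "\<forall>i<k. 0 \<le> s i \<and> s i \<le> 1" for s
    proof -
      have \<tau>0: "0 \<le> \<tau> s i" if "i < k" for i using s that by (auto simp: \<tau>_def intro!: divide_nonneg_nonneg)
      have \<tau>1: "(\<Sum>i<k. \<tau> s i) \<le> 1"
        unfolding \<tau>_def sum_divide_distrib[symmetric] by (simp add: divide_le_eq_1 less_max_iff_disj)
      define u where "u i = (case i of 0 \<Rightarrow> 1 - (\<Sum>i<k. \<tau> s i) | Suc i \<Rightarrow> \<tau> s i)" for i
      define v where "v i = (case i of 0 \<Rightarrow> c0 | Suc i \<Rightarrow> c i)" for i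
      have "(\<Sum>i<Suc k. u i *\<^sub>R v i) \<in> U"
      proof (rule convex_sum[OF _ U(1)])
        show "sum u {..<Suc k} = 1" by (simp add: sum.lessThan_Suc_shift u_def del: sum.lessThan_Suc)
        fix i assume "i \<in> {..<Suc k}"
        then show "0 \<le> u i" "v i \<in> U"
          using \<tau>0 \<tau>1 cC C(2) c0 by (auto simp: u_def v_def split: nat.splits)
      qed simp
      then show ?thesis by (simp add: sum.lessThan_Suc_shift u_def v_def x_def del: sum.lessThan_Suc)
    qed
    define g where "g s i = w (F (x s)) i / W (F (x s))" for s i
    have FC: "F (x s) \<in> C" if s: "\<forall>i<k. 0 \<le> s i \<and> s i \<le> 1" for s using F(2) xU[OF s] by blast
    have "\<exists>s. (\<forall>i<k. 0 \<le> s i \<and> s i \<le> 1) \<and> (\<forall>i<k. g s i = s i)"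
    proof (rule brouwer_nat_cube)
      fix s :: "nat \<Rightarrow> real" assume s: "\<forall>i<k. 0 \<le> s i \<and> s i \<le> 1"
      show "\<forall>i<k. 0 \<le> g s i \<and> g s i \<le> 1"
      proof (intro allI impI conjI)
        fix i assume i: "i < k"
        have "w (F (x s)) i \<le> W (F (x s))" unfolding W_def using i w0 by (intro member_le_sum) auto
        then show "0 \<le> g s i" "g s i \<le> 1" using W0[OF FC[OF s]] w0 by (auto simp: g_def divide_le_eq_1)
      qed
    next
      fix \<sigma> :: "nat \<Rightarrow> nat \<Rightarrow> real" and s i
      assume \<sigma>: "\<forall>p. \<forall>i<k. 0 \<le> \<sigma> p i \<and> \<sigma> p i \<le> 1" "\<forall>i<k. (\<lambda>p. \<sigma> p i) \<longlonglongrightarrow> s i" "i < k"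
      have s: "\<forall>i<k. 0 \<le> s i \<and> s i \<le> 1"
      proof (intro allI impI)
        fix j assume j: "j < k"
        show "0 \<le> s j \<and> s j \<le> 1" using \<sigma>(1) j LIMSEQ_le_const[of "\<lambda>p. \<sigma> p j" "s j" 0] LIMSEQ_le_const2[of "\<lambda>p. \<sigma> p j" "s j" 1] \<sigma>(2) by blast
      qed
      have sums: "(\<lambda>p. \<Sum>j<k. \<sigma> p j) \<longlonglongrightarrow> (\<Sum>j<k. s j)" using \<sigma>(2) by (intro tendsto_sum) auto
      have \<tau>: "(\<lambda>p. \<tau> (\<sigma> p) j) \<longlonglongrightarrow> \<tau> s j" if "j < k" for j
        unfolding \<tau>_def using \<sigma>(2) that sums by (intro tendsto_divide tendsto_max tendsto_const) auto
      have "(\<lambda>p. x (\<sigma> p)) \<longlonglongrightarrow> x s"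
        unfolding x_def using \<tau> by (intro tendsto_add tendsto_scaleR tendsto_diff tendsto_sum tendsto_const) auto
      then have Fx: "(\<lambda>p. F (x (\<sigma> p))) \<longlonglongrightarrow> F (x s)"
        using xU \<sigma>(1) s by (intro continuous_on_tendsto_compose[OF F(1)]) auto
      have w: "(\<lambda>p. w (F (x (\<sigma> p))) j) \<longlonglongrightarrow> w (F (x s)) j" for j
        unfolding w_def by (intro tendsto_max tendsto_diff tendsto_const tendsto_dist Fx)
      then have "(\<lambda>p. W (F (x (\<sigma> p)))) \<longlonglongrightarrow> W (F (x s))" unfolding W_def by (intro tendsto_sum)
      then show "(\<lambda>p. g (\<sigma> p) i) \<longlonglongrightarrow> g s i" unfolding g_def using w W0[OF FC[OF s]] by (intro tendsto_divide) auto
    qed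
    then obtain s where s: "\<forall>i<k. 0 \<le> s i \<and> s i \<le> 1" and fix_: "\<And>i. i < k \<Longrightarrow> g s i = s i" by blast
    define y where "y = F (x s)"
    have Wy: "0 < W y" unfolding y_def by (rule W0[OF FC[OF s]])
    have sy: "s i = w y i / W y" if "i < k" for i using fix_[OF that] by (simp add: g_def y_def)
    have sum1: "(\<Sum>i<k. s i) = 1"
      using Wy by (simp add: sy W_def flip: sum_divide_distrib)
    then have "x s = (\<Sum>i<k. s i *\<^sub>R c i)" by (simp add: x_def \<tau>_def)
    then have "x s - y = (\<Sum>i<k. s i *\<^sub>R (c i - y))"
      using sum1 by (simp add: scaleR_diff_right sum_subtractf flip: scaleR_left.sum)
    then have "norm (x s - y) \<le> (\<Sum>i<k. s i * \<epsilon>)"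
    proof (simp only:, intro sum_norm_le)
      fix i assume "i \<in> {..<k}"
      then have i: "i < k" by simp
      have "norm (c i - y) \<le> \<epsilon> \<or> s i = 0" using sy[OF i] by (auto simp: w_def dist_norm norm_minus_commute max_def)
      then show "norm (s i *\<^sub>R (c i - y)) \<le> s i * \<epsilon>" using s i by (auto intro: mult_left_mono)
    qed
    also have "\<dots> = \<epsilon>" using sum1 by (simp flip: sum_distrib_right)
    finally show ?thesis using xU[OF s] by (auto simp: y_def dist_norm)
  qed
  have "\<forall>p. \<exists>x\<in>U. dist x (F x) \<le> inverse (real (Suc p))" using approx by simp
  then obtain x where x: "\<And>p. x p \<in> U" "\<And>p. dist (x p) (F (x p)) \<le> inverse (real (Suc p))" by metis
  obtain l r where l: "l \<in> C" "strict_mono r" "((\<lambda>p. F (x p)) \<circ> r) \<longlonglongrightarrow> l"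
    using C(1) x(1) F(2) unfolding compact_def by (metis image_subset_iff)
  have "(\<lambda>p. dist (x (r p)) (F (x (r p)))) \<longlonglongrightarrow> 0"
  proof (rule tendsto_sandwich[OF _ _ tendsto_const])
    show "\<forall>\<^sub>F p in sequentially. dist (x (r p)) (F (x (r p))) \<le> inverse (real (Suc (r p)))" using x(2) by simp
    show "(\<lambda>p. inverse (real (Suc (r p)))) \<longlonglongrightarrow> 0"
      using LIMSEQ_subseq_LIMSEQ[OF LIMSEQ_inverse_real_of_nat l(2)] by (simp add: o_def)
  qed simp
  then have "(\<lambda>p. F (x (r p)) + (x (r p) - F (x (r p)))) \<longlonglongrightarrow> l + 0"
    using l(3) by (intro tendsto_add) (auto simp: o_def dist_norm tendsto_norm_zero_iff)
  then have xl: "(\<lambda>p. x (r p)) \<longlonglongrightarrow> l" by simp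
  have lU: "l \<in> U" using l(1) C(2) by blast
  have "(\<lambda>p. F (x (r p))) \<longlonglongrightarrow> F l"
    using x(1) by (intro continuous_on_tendsto_compose[OF F(1) xl lU]) simp
  then have "F l = l" using l(3) LIMSEQ_unique by (auto simp: o_def)
  then show ?thesis using lU by blast
qed

section \<open>Compactness by Cauchy subsequences and finite dimension\<close>

lemma compact_closure_if_Cauchy_subseq:
  fixes A :: "'a::banach set"
  assumes "\<And>u. \<forall>k. u k \<in> A \<Longrightarrow> \<exists>r. strict_mono (r :: nat \<Rightarrow> nat) \<and> Cauchy (u \<circ> r)"
  shows "compact (closure A)"
  unfolding compact_def
proof (intro allI impI)
  fix f :: "nat \<Rightarrow> 'a" assume f: "\<forall>n. f n \<in> closure A"
  have "\<forall>n. \<exists>y\<in>A. dist y (f n) < inverse (real (Suc n))" using f by (simp add: closure_approachable)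
  then obtain u where u: "\<And>n. u n \<in> A" "\<And>n. dist (u n) (f n) < inverse (real (Suc n))" by metis
  obtain r where r: "strict_mono r" "Cauchy (u \<circ> r)" using assms[of u] u(1) by blast
  then obtain l where l: "(u \<circ> r) \<longlonglongrightarrow> l" using Cauchy_convergent_iff convergent_def by blast
  have "(\<lambda>n. dist (u (r n)) (f (r n))) \<longlonglongrightarrow> 0"
  proof (rule tendsto_sandwich[OF _ _ tendsto_const])
    show "\<forall>\<^sub>F n in sequentially. dist (u (r n)) (f (r n)) \<le> inverse (real (Suc (r n)))" using u(2) by (simp add: less_imp_le)
    show "(\<lambda>p. inverse (real (Suc (r p)))) \<longlonglongrightarrow> 0"
      using LIMSEQ_subseq_LIMSEQ[OF LIMSEQ_inverse_real_of_nat r(1)] by (simp add: o_def)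
  qed simp
  then have "(\<lambda>n. u (r n) - (u (r n) - f (r n))) \<longlonglongrightarrow> l - 0"
    using l by (intro tendsto_diff) (auto simp: o_def dist_norm tendsto_norm_zero_iff)
  then have lim: "(f \<circ> r) \<longlonglongrightarrow> l" by (simp add: o_def)
  moreover have "l \<in> closure A" using closed_sequentially[OF closed_closure, of "f \<circ> r"] f lim by auto
  ultimately show "\<exists>l\<in>closure A. \<exists>r. strict_mono r \<and> (f \<circ> r) \<longlonglongrightarrow> l" using r(1) by blast
qed

text \<open>A vector of norm at most 1 is a series \<open>\<Sum> f\<^sub>i / 2\<^sup>i\<close> with all \<open>f\<^sub>i\<close> in a finite \<open>1/2\<close>-net; collecting
  equal terms shows that it lies in the span of the net.\<close>

lemma finite_dim_if_Cauchy_subseq: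
  fixes N :: "'a::banach set"
  assumes N: "subspace N" and comp: "\<And>u. \<forall>k. u k \<in> N \<and> norm (u k) \<le> 1 \<Longrightarrow> \<exists>r. strict_mono (r :: nat \<Rightarrow> nat) \<and> Cauchy (u \<circ> r)"
  shows "\<not> infinite_dim N"
proof -
  define A where "A = {x \<in> N. norm x \<le> 1}"
  have "compact (closure A)"
    by (rule compact_closure_if_Cauchy_subseq) (use comp in \<open>auto simp: A_def\<close>)
  then obtain B where B: "finite B" "B \<subseteq> A" "closure A \<subseteq> (\<Union>c\<in>B. ball c (1 / 2))"
  proof (rule compactE_image[of _ A "\<lambda>c. ball c (1 / 2)"])
    show "closure A \<subseteq> (\<Union>c\<in>A. ball c (1 / 2))"
    proof
      fix x assume "x \<in> closure A"
      then have "\<exists>y\<in>A. dist y x < 1 / 2" unfolding closure_approachable using half_gt_zero[OF zero_less_one] by blast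
      then show "x \<in> (\<Union>c\<in>A. ball c (1 / 2))" by simp
    qed
  qed (auto intro: that)
  have "\<forall>x\<in>A. \<exists>c\<in>B. dist c x < 1 / 2" using B(3) closure_subset[of A] by fastforce
  then obtain c where c: "\<And>x. x \<in> A \<Longrightarrow> c x \<in> B" "\<And>x. x \<in> A \<Longrightarrow> dist (c x) x < 1 / 2" by metis
  have in_span: "x \<in> span B" if x: "x \<in> A" for x
  proof -
    \<comment> \<open>The remainder after subtracting a near point of the net, doubled so that it
      has norm at most 1 again.\<close>
    define z where "z i = ((\<lambda>x. 2 *\<^sub>R (x - c x)) ^^ i) x" for i
    have z: "z i \<in> A" for i
    proof (induction i)
      case (Suc i)
      have "z i - c (z i) \<in> N" using Suc c(1)[OF Suc] B(2) N by (auto simp: A_def subspace_diff)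
      moreover have "norm (z i - c (z i)) < 1 / 2" using c(2)[OF Suc] by (simp add: dist_norm norm_minus_commute)
      ultimately show ?case using N by (simp add: z_def A_def subspace_scale)
    qed (simp add: z_def x)
    have part: "x = (\<Sum>i<n. (1 / 2 ^ i) *\<^sub>R c (z i)) + (1 / 2 ^ n) *\<^sub>R z n" for n
    proof (induction n)
      case (Suc n)
      have "z (Suc n) = 2 *\<^sub>R (z n - c (z n))" by (simp add: z_def)
      then have "(1 / 2 ^ Suc n) *\<^sub>R z (Suc n) = (1 / 2 ^ n) *\<^sub>R z n - (1 / 2 ^ n) *\<^sub>R c (z n)"
        by (simp add: scaleR_diff_right)
      then show ?case using Suc by simp
    qed (simp add: z_def)
    define \<alpha> where "\<alpha> b i = (if c (z i) = b then (1 / 2) ^ i else (0::real))" for b i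
    have sm: "summable (\<alpha> b)" for b
      by (rule summable_comparison_test'[OF complete_algebra_summable_geometric[of "1 / 2 :: real"], of 0]) (auto simp: \<alpha>_def)
    have eq: "(\<Sum>i<n. (1 / 2 ^ i) *\<^sub>R c (z i)) = (\<Sum>b\<in>B. (\<Sum>i<n. \<alpha> b i) *\<^sub>R b)" for n
    proof -
      have "(\<Sum>b\<in>B. \<alpha> b i *\<^sub>R b) = (1 / 2 ^ i) *\<^sub>R c (z i)" for i
      proof -
        have "(\<Sum>b\<in>B. \<alpha> b i *\<^sub>R b) = (\<Sum>b\<in>{c (z i)}. \<alpha> b i *\<^sub>R b)"
          using B(1) c(1)[OF z] by (intro sum.mono_neutral_right) (auto simp: \<alpha>_def)
        then show ?thesis by (simp add: \<alpha>_def power_divide)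
      qed
      then have "(\<Sum>i<n. (1 / 2 ^ i) *\<^sub>R c (z i)) = (\<Sum>i<n. \<Sum>b\<in>B. \<alpha> b i *\<^sub>R b)" by simp
      also have "\<dots> = (\<Sum>b\<in>B. (\<Sum>i<n. \<alpha> b i) *\<^sub>R b)" unfolding scaleR_left.sum by (rule sum.swap)
      finally show ?thesis .
    qed
    have "(\<lambda>n. \<Sum>i<n. (1 / 2 ^ i) *\<^sub>R c (z i)) \<longlonglongrightarrow> (\<Sum>b\<in>B. suminf (\<alpha> b) *\<^sub>R b)"
      unfolding eq by (intro tendsto_sum tendsto_scaleR tendsto_const summable_LIMSEQ sm)
    moreover have "(\<lambda>n. \<Sum>i<n. (1 / 2 ^ i) *\<^sub>R c (z i)) \<longlonglongrightarrow> x"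
    proof -
      have "(\<lambda>n. (1 / 2 ^ n) *\<^sub>R z n) \<longlonglongrightarrow> 0"
      proof (rule Lim_null_comparison[of _ "\<lambda>n. (1 / 2) ^ n"])
        show "\<forall>\<^sub>F n in sequentially. norm ((1 / 2 ^ n) *\<^sub>R z n) \<le> (1 / 2) ^ n"
          using z by (simp add: A_def power_divide divide_right_mono)
      qed (simp add: LIMSEQ_power_zero)
      then have "(\<lambda>n. x - (1 / 2 ^ n) *\<^sub>R z n) \<longlonglongrightarrow> x - 0" by (intro tendsto_diff tendsto_const)
      moreover have "x - (1 / 2 ^ n) *\<^sub>R z n = (\<Sum>i<n. (1 / 2 ^ i) *\<^sub>R c (z i))" for n
        using part[of n] by (metis add_diff_cancel_right')
      ultimately show ?thesis by simp
    qed
    ultimately have "x = (\<Sum>b\<in>B. suminf (\<alpha> b) *\<^sub>R b)" using LIMSEQ_unique by blast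
    then show ?thesis using span_sum[of B "\<lambda>b. suminf (\<alpha> b) *\<^sub>R b" B] span_scale[OF span_base] by metis
  qed
  then have sp: "x \<in> span B" if x: "x \<in> N" for x
  proof (cases "x = 0")
    case False
    have "(1 / norm x) *\<^sub>R x \<in> A" using N x False by (simp add: A_def subspace_scale)
    then have "norm x *\<^sub>R ((1 / norm x) *\<^sub>R x) \<in> span B" by (intro span_scale in_span)
    then show ?thesis using False by simp
  qed (simp add: span_zero)
  then show ?thesis unfolding infinite_dim_def using B(1) by blast
qed

section \<open>Compactness of powers\<close>

lemma lookup_le_norm01:
  assumes "x \<in> c00" shows "\<bar>Poly_Mapping.lookup x i\<bar> \<le> norm01 n x"
proof (cases "i = 0")
  case True
  then show ?thesis using assms norm01_nonneg[of n x] by (simp add: c00_def in_keys_iff)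
next
  case False
  have "Poly_Mapping.single i 1 \<in> norming_level n 0" using False by auto
  then have "Poly_Mapping.single i 1 \<in> norming_set n" unfolding norming_set_def by blast
  moreover have "dual_pairing (Poly_Mapping.single i 1) x = Poly_Mapping.lookup x i"
  proof -
    have "dual_pairing (Poly_Mapping.single i 1) x = (\<Sum>k\<in>insert i (supp x). Poly_Mapping.lookup (Poly_Mapping.single i 1) k * Poly_Mapping.lookup x k)"
      by (rule dual_pairing_superset) auto
    also have "\<dots> = (\<Sum>k\<in>{i}. Poly_Mapping.lookup (Poly_Mapping.single i 1) k * Poly_Mapping.lookup x k)"
      by (intro sum.mono_neutral_right) (auto simp: lookup_single when_def)
    finally show ?thesis by simp
  qed
  ultimately show ?thesis using abs_dual_pairing_le_norm01[of "Poly_Mapping.single i 1" n x] by simp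
qed

lemma dual_pairing_restr_swap: "dual_pairing f (restr A x) = dual_pairing (restr A f) x"
proof -
  have "dual_pairing f (restr A x) = (\<Sum>i\<in>supp x. Poly_Mapping.lookup f i * Poly_Mapping.lookup (restr A x) i)"
    by (rule dual_pairing_superset) (auto simp: supp_restr)
  then show ?thesis unfolding dual_pairing_def by (auto simp: lookup_restr intro!: sum.cong)
qed

lemma norm01_restr_le: "norm01 n (restr A x) \<le> norm01 n x"
proof (rule norm01_le)
  fix f assume "f \<in> W0 n"
  then show "dual_pairing f (restr A x) \<le> norm01 n x"
    using W0_le_norm01[OF restr_W0, of f n A x] by (simp add: dual_pairing_restr_swap)
qed

lemma norm01_le_sum:
  assumes "finite B" "supp x \<subseteq> B" shows "norm01 n x \<le> (\<Sum>i\<in>B. \<bar>Poly_Mapping.lookup x i\<bar>)"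
proof (rule norm01_le)
  fix f assume f: "f \<in> W0 n"
  have f1: "\<bar>Poly_Mapping.lookup f i\<bar> \<le> 1" for i using f norming_set_le_1 by (auto simp: W0_def)
  have "dual_pairing f x = (\<Sum>i\<in>B. Poly_Mapping.lookup f i * Poly_Mapping.lookup x i)"
    using assms by (rule dual_pairing_superset)
  also have "\<dots> \<le> (\<Sum>i\<in>B. \<bar>Poly_Mapping.lookup x i\<bar>)"
  proof (rule sum_mono)
    fix i
    have "Poly_Mapping.lookup f i * Poly_Mapping.lookup x i \<le> \<bar>Poly_Mapping.lookup f i\<bar> * \<bar>Poly_Mapping.lookup x i\<bar>"
      by (metis abs_ge_self abs_mult)
    also have "\<dots> \<le> 1 * \<bar>Poly_Mapping.lookup x i\<bar>" using f1 by (intro mult_right_mono) auto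
    finally show "Poly_Mapping.lookup f i * Poly_Mapping.lookup x i \<le> \<bar>Poly_Mapping.lookup x i\<bar>" by simp
  qed
  finally show "dual_pairing f x \<le> (\<Sum>i\<in>B. \<bar>Poly_Mapping.lookup x i\<bar>)" .
qed

text \<open>Families of order \<open>n\<close> sum to norming functionals, so a lower bound for them
  is one for the norm.\<close>

lemma not_null_norm01:
  assumes "\<not> null n n y" shows "\<exists>\<delta>>0. \<forall>j. \<exists>i\<ge>j. \<delta> \<le> norm01 n (y i)"
proof -
  obtain \<delta> where \<delta>: "0 < \<delta>" and freq: "\<forall>j i. \<exists>i'\<ge>i. \<exists>L \<alpha>. fam n n L \<alpha> \<and> (\<forall>l\<in>L. j \<le> l) \<and>
     \<delta> \<le> (\<Sum>l\<in>L. dual_pairing (\<alpha> l) (y i'))"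
    using assms[unfolded not_null_iff] by (elim exE conjE) (rule that)
  have "\<exists>i\<ge>j. \<delta> \<le> norm01 n (y i)" for j
  proof -
    obtain i L \<alpha> where i: "i \<ge> j" and fam: "fam n n L \<alpha>" and "\<forall>l\<in>L. 0 \<le> l" and le: "\<delta> \<le> (\<Sum>l\<in>L. dual_pairing (\<alpha> l) (y i))"
      using freq[THEN spec[of _ 0], THEN spec[of _ j]] by (elim exE conjE) (rule that)
    have "\<delta> \<le> norm01 n (y i)" using fam_sum_le[OF fam order_refl, of "y i"] le by linarith
    then show ?thesis using i by blast
  qed
  then show ?thesis using \<delta> by blast
qed

section \<open>Strictly singular operators gain one order of nullness per application\<close>

locale strictly_singular_on_X01 = operator_on_X01 +
  assumes ss: "strictly_singular_on Y S" and X: "Y \<subseteq> closure (J ` c00)"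
begin

text \<open>Otherwise \<open>S\<close> would be an isomorphism on an infinite dimensional
  subspace.\<close>

lemma null_image:
  assumes "approx a b x y Z" "\<And>k. norm01 n (x k) \<le> C" shows "null n 0 y"
proof (rule ccontr)
  assume "\<not> null n 0 y"
  then obtain V g where "subspace V" "V \<subseteq> Y" "infinite_dim V" "homeomorphism V (S ` V) S g"
    using isomorphic_on_subspace[OF assms] by blast
  then show False using ss unfolding strictly_singular_on_def by blast
qed

text \<open>Otherwise window sums would be a bounded sequence whose image is not null of order
  0.\<close>

lemma norm01_image_vanishes:
  assumes "approx a b x y Z" "\<And>k. norm01 n (x k) \<le> C" "null n K x" "n = Suc K"
  shows "\<not> (\<exists>\<delta>>0. \<forall>j. \<exists>i\<ge>j. \<delta> \<le> norm01 n (y i))"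
proof
  assume "\<exists>\<delta>>0. \<forall>j. \<exists>i\<ge>j. \<delta> \<le> norm01 n (y i)"
  then obtain \<delta> where \<delta>: "0 < \<delta>" "\<forall>j. \<exists>i\<ge>j. \<delta> \<le> norm01 n (y i)" by blast
  show False
    by (rule step_sums[OF assms \<delta>]) (use null_image in blast)
qed

text \<open>Induction on the distance of \<open>Suc K\<close> from \<open>n\<close>. If the image
  failed to be null, \<open>step_up\<close> would produce a pair with the same failure one order
  higher; at order \<open>n\<close> the failure means that the norms do not tend to zero.\<close>

lemma null_Suc_image:
  "approx a b x y Z \<Longrightarrow> (\<And>k. norm01 n (x k) \<le> C) \<Longrightarrow> null n K x \<Longrightarrow> Suc K \<le> n \<Longrightarrow> null n (Suc K) y"
proof (induction "n - Suc K" arbitrary: K a b x y Z)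
  case 0
  then show ?case using norm01_image_vanishes[of a b x y Z C K] not_null_norm01[of n y] by (metis diff_is_0_eq le_antisym)
next
  case (Suc d)
  show ?case
  proof (rule ccontr)
    assume nn: "\<not> null n (Suc K) y"
    show False
    proof (rule step_up[OF Suc.prems(1,2,3) nn Suc.prems(4)])
      fix a' b' x' y' Z'
      assume "approx a' b' x' y' Z'" "\<And>k. norm01 n (x' k) \<le> C" "null n (Suc K) x'" "\<not> null n (Suc (Suc K)) y'"
      moreover have "d = n - Suc (Suc K)" "Suc (Suc K) \<le> n" using Suc.hyps(2) by linarith+
      ultimately show False using Suc.hyps(1)[of "Suc K" a' b' x' y' Z'] by blast
    qed
  qed
qed

lemma funpow_in: "v \<in> Y \<Longrightarrow> (S ^^ j) v \<in> Y"
  by (induction j) (auto intro: S_in)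

text \<open>Here the exponent \<open>n + 1\<close> arises: boundedness gives order 0 after one
  application of \<open>S\<close>, each of the next \<open>n - 1\<close> applications raises the
  order by one, up to \<open>n - 1\<close>, and the last one makes the norms tend to zero.\<close>

lemma chain_vanishes:
  assumes bs: "block_seq a b" and x: "\<And>j. j \<le> Suc n \<Longrightarrow> blocks a b (x j)" "\<And>j k. j \<le> Suc n \<Longrightarrow> norm01 n (x j k) \<le> C"
    and Z: "\<And>k. Z k \<in> Y" "\<And>j. j \<le> Suc n \<Longrightarrow> (\<lambda>k. norm ((S ^^ j) (Z k) - J (x j k))) \<longlonglongrightarrow> 0"
  shows "\<not> (\<exists>\<delta>>0. \<forall>j. \<exists>i\<ge>j. \<delta> \<le> norm01 n (x (Suc n) i))"
proof -
  have app: "approx a b (x j) (x (Suc j)) (\<lambda>k. (S ^^ j) (Z k))" if j: "j \<le> n" for j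
  proof -
    have "err (x j) (x (Suc j)) (\<lambda>k. (S ^^ j) (Z k)) = (\<lambda>k. norm ((S ^^ j) (Z k) - J (x j k)) + norm ((S ^^ Suc j) (Z k) - J (x (Suc j) k)))"
      by (auto simp: err_def)
    moreover have "\<dots> \<longlonglongrightarrow> 0" using j by (intro tendsto_add_zero Z(2)) auto
    ultimately show ?thesis unfolding approx_def using bs x(1) j funpow_in Z(1) by simp
  qed
  have null: "null n j (x (Suc j))" if "j < n" for j
    using that
  proof (induction j)
    case 0
    show ?case by (rule null_image[OF app[of 0]]) (use x(2) in auto)
  next
    case (Suc j)
    show ?case
    proof (rule null_Suc_image[OF app[of "Suc j"], of C])
      show "null n j (x (Suc j))" using Suc by simp
    qed (use x(2) Suc.prems in auto)
  qed
  obtain K where K: "n = Suc K" using n by (cases n) auto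
  show ?thesis
    using null[of K] K x(2)[of n] by (intro norm01_image_vanishes[OF app[of n], of C K]) auto
qed

lemma funpow_diff: "u \<in> Y \<Longrightarrow> v \<in> Y \<Longrightarrow> (S ^^ j) (u - v) = (S ^^ j) u - (S ^^ j) v"
  by (induction j) (auto simp: S_diff funpow_in)

lemma funpow_bound: "\<exists>L\<ge>1. \<forall>j. \<forall>v\<in>Y. norm ((S ^^ j) v) \<le> L ^ j * norm v"
proof -
  obtain L where L: "\<And>v. v \<in> Y \<Longrightarrow> norm (S v) \<le> L * norm v" using S unfolding bounded_operator_on_def by blast
  have "norm ((S ^^ j) v) \<le> (max 1 L) ^ j * norm v" if v: "v \<in> Y" for j v
  proof (induction j)
    case (Suc j)
    have "norm (S ((S ^^ j) v)) \<le> L * norm ((S ^^ j) v)" using L funpow_in[OF v] .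
    also have "\<dots> \<le> max 1 L * norm ((S ^^ j) v)" by (intro mult_right_mono) auto
    also have "\<dots> \<le> max 1 L * (max 1 L ^ j * norm v)" using Suc by (intro mult_left_mono) auto
    finally show ?case by (simp add: mult.assoc)
  qed simp
  then show ?thesis by (intro exI[of _ "max 1 L"]) auto
qed

text \<open>One choice of indices and cut points serves all sequences \<open>g j\<close> with j
  \<le> m, because they are finitely many. Coordinatewise convergence is enough, as only finitely
  many coordinates lie below a cut point.\<close>

lemma sliding_hump:
  fixes g :: "nat \<Rightarrow> nat \<Rightarrow> nat \<Rightarrow>\<^sub>0 real"
  assumes coord: "\<And>j i. j \<le> m \<Longrightarrow> (\<lambda>N. Poly_Mapping.lookup (g j N) i) \<longlonglongrightarrow> 0"
  shows "\<exists>N p. \<forall>k. k \<le> N k \<and> 1 \<le> p k \<and> p k < p (Suc k) \<and> (\<forall>j\<le>m. supp (g j (N k)) \<subseteq> {..<p (Suc k)} \<and>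
    (\<Sum>i<p k. \<bar>Poly_Mapping.lookup (g j (N k)) i\<bar>) \<le> inverse (real (Suc k)))"
proof -
  define P where "P k = (\<lambda>(N, p). k \<le> N \<and> 1 \<le> p \<and> (\<forall>j\<le>m. (\<Sum>i<p. \<bar>Poly_Mapping.lookup (g j N) i\<bar>) \<le> inverse (real (Suc k))))" for k :: nat
  define Q where "Q = (\<lambda>(N, p) (N' :: nat, p'). p < p' \<and> (\<forall>j\<le>m. supp (g j N) \<subseteq> {..<p'}))"
  have ex: "\<exists>N. P k (N, p)" if p: "1 \<le> p" for k p
  proof -
    have "\<forall>\<^sub>F N in sequentially. \<forall>j\<in>{..m}. (\<Sum>i<p. \<bar>Poly_Mapping.lookup (g j N) i\<bar>) < inverse (real (Suc k))"
    proof (intro eventually_ball_finite ballI)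
      fix j assume "j \<in> {..m}"
      then have "(\<lambda>N. \<Sum>i<p. \<bar>Poly_Mapping.lookup (g j N) i\<bar>) \<longlonglongrightarrow> 0"
        using coord by (intro tendsto_null_sum tendsto_rabs_zero) auto
      then show "\<forall>\<^sub>F N in sequentially. (\<Sum>i<p. \<bar>Poly_Mapping.lookup (g j N) i\<bar>) < inverse (real (Suc k))"
        by (rule order_tendstoD(2)) simp
    qed simp
    then obtain N0 where "\<forall>N\<ge>N0. \<forall>j\<in>{..m}. (\<Sum>i<p. \<bar>Poly_Mapping.lookup (g j N) i\<bar>) < inverse (real (Suc k))"
      unfolding eventually_sequentially by blast
    then have "P k (max N0 k, p)" using p by (auto simp: P_def less_imp_le)
    then show ?thesis by blast
  qed
  have "\<exists>f. \<forall>k. P k (f k) \<and> Q (f k) (f (Suc k))"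
  proof (rule dependent_nat_choice)
    show "\<exists>q. P 0 q" using ex[of 1 0] by auto
    fix q k assume "P k q"
    obtain N p where q: "q = (N, p)" by (cases q) auto
    have "finite (\<Union>j\<le>m. supp (g j N))" by simp
    then obtain p1 where p1: "(\<Union>j\<le>m. supp (g j N)) \<subseteq> {..<p1}" using finite_nat_iff_bounded by blast
    define p' where "p' = max p1 (Suc p)"
    have "1 \<le> p'" by (simp add: p'_def)
    then obtain N' where "P (Suc k) (N', p')" using ex[of p' "Suc k"] by blast
    moreover have "Q q (N', p')" using p1 by (fastforce simp: Q_def q p'_def)
    ultimately show "\<exists>q'. P (Suc k) q' \<and> Q q q'" by blast
  qed
  then obtain f where f: "\<forall>k. P k (f k) \<and> Q (f k) (f (Suc k))" by blast
  show ?thesis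
    by (rule exI[of _ "\<lambda>k. fst (f k)"], rule exI[of _ "\<lambda>k. snd (f k)"]) (use f in \<open>auto simp: P_def Q_def case_prod_unfold\<close>)
qed

text \<open>The images of the \<open>u k\<close> under the powers of \<open>S\<close> are
  approximated by finitely supported vectors, and a subsequence is chosen along which all
  coordinates converge for the powers up to \<open>n + 1\<close>. If the last power were not Cauchy
  along it, differences of suitable pairs would be coordinatewise null, and the humps cut out of
  them would contradict \<open>chain_vanishes\<close>.\<close>

theorem power_compact:
  fixes u :: "nat \<Rightarrow> 'a"
  assumes u: "\<And>k. u k \<in> Y" "\<And>k. norm (u k) \<le> B"
  shows "\<exists>r. strict_mono r \<and> Cauchy (\<lambda>k. (S ^^ Suc n) (u (r k)))"
proof -
  obtain L where L: "1 \<le> L" "\<And>j v. v \<in> Y \<Longrightarrow> norm ((S ^^ j) v) \<le> L ^ j * norm v" using funpow_bound by blast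
  define D where "D = L ^ Suc n * B + 1"
  have "\<exists>h\<in>c00. norm ((S ^^ j) (u k) - J h) < inverse (real (Suc k))" for j k
  proof -
    have "(S ^^ j) (u k) \<in> closure (J ` c00)" using funpow_in[OF u(1)] X by blast
    then have "\<exists>y\<in>J ` c00. dist y ((S ^^ j) (u k)) < inverse (real (Suc k))"
      unfolding closure_approachable by simp
    then show ?thesis by (auto simp: dist_norm norm_minus_commute)
  qed
  then obtain h where h: "\<And>j k. h j k \<in> c00" "\<And>j k. norm ((S ^^ j) (u k) - J (h j k)) < inverse (real (Suc k))" by metis
  have hD: "norm01 n (h j k) \<le> D" if j: "j \<le> Suc n" for j k
  proof -
    have "norm (J (h j k)) \<le> norm ((S ^^ j) (u k)) + norm ((S ^^ j) (u k) - J (h j k))"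
      using norm_triangle_sub[of "J (h j k)" "(S ^^ j) (u k)"] by (simp add: norm_minus_commute)
    also have "norm ((S ^^ j) (u k)) \<le> L ^ Suc n * B"
    proof -
      have "norm ((S ^^ j) (u k)) \<le> L ^ j * norm (u k)" using L(2) u(1) .
      also have "\<dots> \<le> L ^ Suc n * B" using L(1) j u(2)[of k] by (intro mult_mono power_increasing) auto
      finally show ?thesis .
    qed
    also have "norm ((S ^^ j) (u k) - J (h j k)) \<le> 1"
    proof -
      have "inverse (real (Suc k)) \<le> 1" by (simp add: inverse_le_1_iff)
      then show ?thesis using h(2)[of j k] by linarith
    qed
    finally show ?thesis by (simp add: norm_J h(1) D_def)
  qed
  \<comment> \<open>Power and coordinate are coded in one number, so that a single diagonal sequence
    serves all of them.\<close>
  define \<Phi> where "\<Phi> k m = (case prod_decode m of (j, i) \<Rightarrow> if j \<le> Suc n then Poly_Mapping.lookup (h j k) i else 0)" for k m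
  have D0: "0 \<le> D" using hD[of 0 0] norm01_nonneg[of n "h 0 0"] by linarith
  have "\<bar>\<Phi> k m\<bar> \<le> D" for k m
    using D0 order_trans[OF lookup_le_norm01[OF h(1)] hD] by (auto simp: \<Phi>_def split: prod.split)
  then obtain r where r: "strict_mono r" "\<And>m. convergent (\<lambda>k. \<Phi> (r k) m)"
    using diagonal_convergent[of \<Phi> "\<lambda>_. D"] by blast
  have conv: "convergent (\<lambda>k. Poly_Mapping.lookup (h j (r k)) i)" if "j \<le> Suc n" for j i
    using r(2)[of "prod_encode (j, i)"] that by (simp add: \<Phi>_def)
  have "Cauchy (\<lambda>k. (S ^^ Suc n) (u (r k)))"
  proof (rule ccontr)
    assume "\<not> Cauchy (\<lambda>k. (S ^^ Suc n) (u (r k)))"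
    then obtain \<delta> where \<delta>: "0 < \<delta>" "\<forall>N. \<exists>k\<ge>N. \<exists>l\<ge>N. \<delta> \<le> norm ((S ^^ Suc n) (u (r k)) - (S ^^ Suc n) (u (r l)))"
      unfolding Cauchy_def dist_norm not_all not_ex not_imp not_less by (metis (no_types, lifting))
    then obtain kk ll where kl: "\<And>N. N \<le> kk N" "\<And>N. N \<le> ll N"
      "\<And>N. \<delta> \<le> norm ((S ^^ Suc n) (u (r (kk N))) - (S ^^ Suc n) (u (r (ll N))))" by metis
    \<comment> \<open>Limits of coordinates cancel in differences, so convergence of the coordinates
      alone makes these vectors coordinatewise null.\<close>
    define z where "z N = u (r (kk N)) - u (r (ll N))" for N
    define g where "g j N = h j (r (kk N)) - h j (r (ll N))" for j N
    have zY: "z N \<in> Y" for N unfolding z_def using u(1) Y by (intro subspace_diff)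
    have gc: "g j N \<in> c00" for j N unfolding g_def using h(1) subspace_c00 by (intro subspace_diff)
    have Jg: "J (g j N) = J (h j (r (kk N))) - J (h j (r (ll N)))" for j N unfolding g_def using J by (rule linear_diff)
    have inv: "inverse (real (Suc (r k))) \<le> inverse (real (Suc N))" if "N \<le> k" for k N
      using seq_suble[OF r(1), of k] that by (intro le_imp_inverse_le) auto
    have near: "norm ((S ^^ j) (z N) - J (g j N)) \<le> 2 * inverse (real (Suc N))" for j N
    proof -
      have "(S ^^ j) (z N) - J (g j N) = ((S ^^ j) (u (r (kk N))) - J (h j (r (kk N)))) - ((S ^^ j) (u (r (ll N))) - J (h j (r (ll N))))"
        unfolding z_def Jg funpow_diff[OF u(1) u(1)] by simp
      also have "norm \<dots> \<le> norm ((S ^^ j) (u (r (kk N))) - J (h j (r (kk N)))) + norm ((S ^^ j) (u (r (ll N))) - J (h j (r (ll N))))"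
        by (rule norm_triangle_ineq4)
      finally show ?thesis
        using h(2)[of j "r (kk N)"] h(2)[of j "r (ll N)"] inv[OF kl(1)[of N]] inv[OF kl(2)[of N]] by linarith
    qed
    have g2D: "norm01 n (g j N) \<le> 2 * D" if j: "j \<le> Suc n" for j N
    proof -
      have "norm01 n (g j N) \<le> norm01 n (h j (r (kk N))) + norm01 n (h j (r (ll N)))"
        using norm_triangle_ineq4[of "J (h j (r (kk N)))" "J (h j (r (ll N)))"]
        unfolding Jg[symmetric] norm_J[OF h(1)] norm_J[OF gc] .
      then show ?thesis using hD[OF j, of "r (kk N)"] hD[OF j, of "r (ll N)"] by linarith
    qed
    have coord: "(\<lambda>N. Poly_Mapping.lookup (g j N) i) \<longlonglongrightarrow> 0" if j: "j \<le> Suc n" for j i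
    proof -
      obtain c where c: "(\<lambda>k. Poly_Mapping.lookup (h j (r k)) i) \<longlonglongrightarrow> c" using conv[OF j] by (auto simp: convergent_def)
      have "filterlim kk at_top sequentially" "filterlim ll at_top sequentially"
        using kl(1,2) by (auto intro!: filterlim_at_top_mono[OF filterlim_ident])
      then have "(\<lambda>N. Poly_Mapping.lookup (h j (r (kk N))) i - Poly_Mapping.lookup (h j (r (ll N))) i) \<longlonglongrightarrow> c - c"
        by (intro tendsto_diff filterlim_compose[OF c])
      then show ?thesis by (simp add: g_def lookup_minus)
    qed
    obtain N p where Np: "\<forall>k. k \<le> N k \<and> 1 \<le> p k \<and> p k < p (Suc k) \<and> (\<forall>j\<le>Suc n. supp (g j (N k)) \<subseteq> {..<p (Suc k)} \<and>
        (\<Sum>i<p k. \<bar>Poly_Mapping.lookup (g j (N k)) i\<bar>) \<le> inverse (real (Suc k)))"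
      using sliding_hump[of "Suc n" g, OF coord] by blast
    define x where "x j k = restr {p k..} (g j (N k))" for j k
    have bs: "block_seq p (\<lambda>k. p (Suc k))" using Np by (simp add: block_seq_def)
    have xblocks: "blocks p (\<lambda>k. p (Suc k)) (x j)" if j: "j \<le> Suc n" for j
      using Np j unfolding blocks_def x_def supp_restr by fastforce
    have x2D: "norm01 n (x j k) \<le> 2 * D" if j: "j \<le> Suc n" for j k
      unfolding x_def using norm01_restr_le g2D[OF j] by (rule order_trans)
    have xc: "x j k \<in> c00" if j: "j \<le> Suc n" for j k
      using c00_blocks[OF bs xblocks[OF j]] .
    have close: "norm ((S ^^ j) (z (N k)) - J (x j k)) \<le> 3 * inverse (real (Suc k))" if j: "j \<le> Suc n" for j k
    proof -
      have split: "g j (N k) = x j k + restr {..<p k} (g j (N k))"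
        unfolding x_def by (auto intro!: poly_mapping_eqI simp: lookup_restr lookup_add)
      have rc: "restr {..<p k} (g j (N k)) \<in> c00" using gc[of j "N k"] by (auto simp: c00_def supp_restr)
      have "norm (J (restr {..<p k} (g j (N k)))) \<le> (\<Sum>i<p k. \<bar>Poly_Mapping.lookup (restr {..<p k} (g j (N k))) i\<bar>)"
        unfolding norm_J[OF rc] by (rule norm01_le_sum) (auto simp: supp_restr)
      also have "\<dots> = (\<Sum>i<p k. \<bar>Poly_Mapping.lookup (g j (N k)) i\<bar>)" by (simp add: lookup_restr)
      also have "\<dots> \<le> inverse (real (Suc k))" using Np j by blast
      finally have 1: "norm (J (restr {..<p k} (g j (N k)))) \<le> inverse (real (Suc k))" .
      have "J (g j (N k)) = J (x j k) + J (restr {..<p k} (g j (N k)))"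
        using linear_add[OF J, of "x j k" "restr {..<p k} (g j (N k))"] split by simp
      then have eq: "(S ^^ j) (z (N k)) - J (x j k) = ((S ^^ j) (z (N k)) - J (g j (N k))) + J (restr {..<p k} (g j (N k)))"
        by simp
      have "norm ((S ^^ j) (z (N k)) - J (x j k)) \<le> norm ((S ^^ j) (z (N k)) - J (g j (N k))) + norm (J (restr {..<p k} (g j (N k))))"
        unfolding eq by (rule norm_triangle_ineq)
      moreover have "inverse (real (Suc (N k))) \<le> inverse (real (Suc k))" using Np by (intro le_imp_inverse_le) auto
      ultimately show ?thesis using near[of j "N k"] 1 by linarith
    qed
    have null3: "(\<lambda>k. 3 * inverse (real (Suc k))) \<longlonglongrightarrow> 0"
      using tendsto_mult_right_zero[OF LIMSEQ_inverse_real_of_nat, of 3] .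
    have "\<not> (\<exists>\<delta>>0. \<forall>j. \<exists>i\<ge>j. \<delta> \<le> norm01 n (x (Suc n) i))"
    proof (rule chain_vanishes[OF bs xblocks x2D zY])
      fix j assume j: "j \<le> Suc n"
      show "(\<lambda>k. norm ((S ^^ j) (z (N k)) - J (x j k))) \<longlonglongrightarrow> 0"
        by (rule Lim_null_comparison[OF _ null3]) (use close[OF j] in simp)
    qed
    moreover have "\<exists>\<delta>>0. \<forall>j. \<exists>i\<ge>j. \<delta> \<le> norm01 n (x (Suc n) i)"
    proof (intro exI[of _ "\<delta> / 2"] conjI allI)
      fix j
      have "\<forall>\<^sub>F k in sequentially. 3 * inverse (real (Suc k)) < \<delta> / 2"
        by (rule order_tendstoD(2)[OF null3]) (use \<delta>(1) in simp)
      then obtain k0 where k0: "\<forall>k\<ge>k0. 3 * inverse (real (Suc k)) < \<delta> / 2" unfolding eventually_sequentially by blast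
      define k where "k = max j k0"
      have "(S ^^ Suc n) (z (N k)) = (S ^^ Suc n) (u (r (kk (N k)))) - (S ^^ Suc n) (u (r (ll (N k))))"
        unfolding z_def by (rule funpow_diff[OF u(1) u(1)])
      then have "\<delta> \<le> norm ((S ^^ Suc n) (z (N k)))" using kl(3)[of "N k"] by simp
      also have "\<dots> \<le> norm (J (x (Suc n) k)) + norm ((S ^^ Suc n) (z (N k)) - J (x (Suc n) k))"
        by (rule norm_triangle_sub)
      finally have "\<delta> \<le> norm01 n (x (Suc n) k) + 3 * inverse (real (Suc k))"
        using close[of "Suc n" k] norm_J[OF xc[of "Suc n" k]] by linarith
      moreover have "3 * inverse (real (Suc k)) < \<delta> / 2" using k0 by (simp add: k_def)
      ultimately have "\<delta> / 2 \<le> norm01 n (x (Suc n) k)" by linarith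
      then show "\<exists>i\<ge>j. \<delta> / 2 \<le> norm01 n (x (Suc n) i)" by (intro exI[of _ k]) (simp add: k_def)
    qed (use \<delta>(1) in simp)
    ultimately show False by blast
  qed
  then show ?thesis using r(1) by blast
qed

end

section \<open>Lomonosov's theorem\<close>

lemma bounded_operator_on_funpow: "bounded_operator_on Y T \<Longrightarrow> v \<in> Y \<Longrightarrow> (T ^^ j) v \<in> Y"
  by (induction j) (auto simp: bounded_operator_on_def)

lemma subspace_closure:
  fixes A :: "'a::real_normed_vector set"
  assumes "subspace A" shows "subspace (closure A)"
proof (rule subspaceI)
  show "0 \<in> closure A" using subspace_0[OF assms] closure_subset by blast
next
  fix x y assume "x \<in> closure A" "y \<in> closure A"
  then obtain u v where "\<forall>n. u n \<in> A" "u \<longlonglongrightarrow> x" "\<forall>n. v n \<in> A" "v \<longlonglongrightarrow> y" unfolding closure_sequential by blast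
  then show "x + y \<in> closure A" unfolding closure_sequential
    using assms by (intro exI[of _ "\<lambda>n. u n + v n"]) (auto intro: subspace_add tendsto_add)
next
  fix c x assume "x \<in> closure A"
  then obtain u where "\<forall>n. u n \<in> A" "u \<longlonglongrightarrow> x" unfolding closure_sequential by blast
  then show "c *\<^sub>R x \<in> closure A" unfolding closure_sequential
    using assms by (intro exI[of _ "\<lambda>n. c *\<^sub>R u n"]) (auto intro: subspace_scale tendsto_scaleR)
qed

locale closed_subspace =
  fixes Y :: "'a::banach set"
  assumes Y: "subspace Y" "closed Y"
begin

abbreviation "bop \<equiv> bounded_operator_on Y"

lemma bopD:
  assumes "bop T"
  shows "x \<in> Y \<Longrightarrow> T x \<in> Y" "x \<in> Y \<Longrightarrow> y \<in> Y \<Longrightarrow> T (x + y) = T x + T y" "x \<in> Y \<Longrightarrow> T (c *\<^sub>R x) = c *\<^sub>R T x"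
    "T 0 = 0" "x \<in> Y \<Longrightarrow> y \<in> Y \<Longrightarrow> T (x - y) = T x - T y"
proof -
  have 1: "\<And>x. x \<in> Y \<Longrightarrow> T x \<in> Y" and 2: "\<And>x y. x \<in> Y \<Longrightarrow> y \<in> Y \<Longrightarrow> T (x + y) = T x + T y"
    and 3: "\<And>c x. x \<in> Y \<Longrightarrow> T (c *\<^sub>R x) = c *\<^sub>R T x"
    using assms unfolding bounded_operator_on_def by blast+
  show "x \<in> Y \<Longrightarrow> T x \<in> Y" "x \<in> Y \<Longrightarrow> y \<in> Y \<Longrightarrow> T (x + y) = T x + T y" "x \<in> Y \<Longrightarrow> T (c *\<^sub>R x) = c *\<^sub>R T x"
    using 1 2 3 by blast+
  show "T 0 = 0" using 3[of 0 0] subspace_0[OF Y(1)] by simp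
  assume xy: "x \<in> Y" "y \<in> Y"
  have "T ((x - y) + y) = T (x - y) + T y" using xy Y(1) by (intro 2 subspace_diff)
  then show "T (x - y) = T x - T y" by (simp only: diff_add_cancel eq_diff_eq)
qed

lemma bop_bound:
  assumes "bop T" obtains M where "0 \<le> M" "\<And>x. x \<in> Y \<Longrightarrow> norm (T x) \<le> M * norm x"
proof -
  obtain M where M: "\<And>x. x \<in> Y \<Longrightarrow> norm (T x) \<le> M * norm x" using assms unfolding bounded_operator_on_def by blast
  have "norm (T x) \<le> \<bar>M\<bar> * norm x" if "x \<in> Y" for x
    using M[OF that] mult_right_mono[OF abs_ge_self norm_ge_zero, of M x] by linarith
  then show thesis using that[of "\<bar>M\<bar>"] by simp
qed

lemma bopI:
  assumes "\<And>x. x \<in> Y \<Longrightarrow> T x \<in> Y" "\<And>x y. x \<in> Y \<Longrightarrow> y \<in> Y \<Longrightarrow> T (x + y) = T x + T y"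
    "\<And>c x. x \<in> Y \<Longrightarrow> T (c *\<^sub>R x) = c *\<^sub>R T x" "\<And>x. x \<in> Y \<Longrightarrow> norm (T x) \<le> M * norm x"
  shows "bop T"
  using assms unfolding bounded_operator_on_def by blast

lemma bop_sum_arg:
  assumes T: "bop T" and x: "\<And>i. i \<in> I \<Longrightarrow> x i \<in> Y"
  shows "T (\<Sum>i\<in>I. c i *\<^sub>R x i) = (\<Sum>i\<in>I. c i *\<^sub>R T (x i))"
  using x
proof (induction I rule: infinite_finite_induct)
  case (insert i I)
  have "c i *\<^sub>R x i \<in> Y" "(\<Sum>i\<in>I. c i *\<^sub>R x i) \<in> Y" using insert.prems Y(1) by (auto intro!: subspace_sum subspace_scale)
  then show ?case using insert bopD(2,3)[OF T] by simp
qed (use bopD(4)[OF T] in simp_all)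

lemma bop_continuous: "bop T \<Longrightarrow> continuous_on Y T"
proof -
  assume T: "bop T"
  obtain M where M: "0 \<le> M" "\<And>x. x \<in> Y \<Longrightarrow> norm (T x) \<le> M * norm x" using bop_bound[OF T] by blast
  have "M-lipschitz_on Y T"
  proof (rule lipschitz_onI)
    fix x y assume "x \<in> Y" "y \<in> Y"
    then show "dist (T x) (T y) \<le> M * dist x y"
      using M(2)[of "x - y"] bopD(5)[OF T, of x y] Y(1) by (simp add: dist_norm subspace_diff)
  qed (rule M(1))
  then show ?thesis by (rule lipschitz_on_continuous_on)
qed

lemma bop_Cauchy:
  assumes T: "bop T" and u: "\<And>k. u k \<in> Y" "Cauchy u" shows "Cauchy (\<lambda>k. T (u k))"
proof -
  obtain l where l: "u \<longlonglongrightarrow> l" using u(2) Cauchy_convergent_iff convergent_def by blast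
  have "l \<in> Y" using closed_sequentially[OF Y(2) _ l] u(1) by blast
  then have "(\<lambda>k. T (u k)) \<longlonglongrightarrow> T l" using u(1) by (intro continuous_on_tendsto_compose[OF bop_continuous[OF T] l]) auto
  then show ?thesis by (rule LIMSEQ_imp_Cauchy)
qed

definition compact_operator :: "('a \<Rightarrow> 'a) \<Rightarrow> bool" where
  "compact_operator K \<longleftrightarrow> (\<forall>u B. (\<forall>k. u k \<in> Y \<and> norm (u k) \<le> B) \<longrightarrow>
     (\<exists>r. strict_mono (r :: nat \<Rightarrow> nat) \<and> Cauchy (\<lambda>k. K (u (r k)))))"

lemma compact_operatorD:
  assumes "compact_operator K" "\<And>k. u k \<in> Y" "\<And>k. norm (u k) \<le> B"
  shows "\<exists>r. strict_mono (r :: nat \<Rightarrow> nat) \<and> Cauchy (\<lambda>k. K (u (r k)))"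
  using assms(1)[unfolded compact_operator_def, rule_format, of u B] assms(2,3) by blast

text \<open>Operators are functions on the whole type with arbitrary values off \<open>Y\<close>, so
  commuting is demanded on \<open>Y\<close> only.\<close>

definition commutant :: "('a \<Rightarrow> 'a) set \<Rightarrow> ('a \<Rightarrow> 'a) set" where
  "commutant F = {T. bop T \<and> (\<forall>S\<in>F. \<forall>x\<in>Y. T (S x) = S (T x))}"

lemma commutantD: "T \<in> commutant F \<Longrightarrow> bop T" "T \<in> commutant F \<Longrightarrow> S \<in> F \<Longrightarrow> x \<in> Y \<Longrightarrow> T (S x) = S (T x)"
  by (auto simp: commutant_def)

lemma commutant_id: "(\<lambda>x. x) \<in> commutant F"
  by (auto simp: commutant_def intro!: bopI[where M = 1])

lemma commutant_comp:
  assumes F: "\<And>S. S \<in> F \<Longrightarrow> bop S" and T: "T \<in> commutant F" "R \<in> commutant F" shows "(\<lambda>x. T (R x)) \<in> commutant F"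
proof -
  note D = bopD[OF commutantD(1)[OF T(1)]] bopD[OF commutantD(1)[OF T(2)]]
  obtain M1 where M1: "0 \<le> M1" "\<And>x. x \<in> Y \<Longrightarrow> norm (T x) \<le> M1 * norm x" using bop_bound[OF commutantD(1)[OF T(1)]] by blast
  obtain M2 where M2: "0 \<le> M2" "\<And>x. x \<in> Y \<Longrightarrow> norm (R x) \<le> M2 * norm x" using bop_bound[OF commutantD(1)[OF T(2)]] by blast
  have "bop (\<lambda>x. T (R x))"
  proof (rule bopI)
    fix x assume x: "x \<in> Y"
    have "norm (T (R x)) \<le> M1 * norm (R x)" using M1(2) D(6) x by simp
    also have "\<dots> \<le> M1 * (M2 * norm x)" using M1(1) M2(2)[OF x] by (rule mult_left_mono[rotated])
    finally show "norm (T (R x)) \<le> (M1 * M2) * norm x" by (simp add: mult.assoc)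
  qed (simp_all add: D)
  moreover have "T (R (S x)) = S (T (R x))" if "S \<in> F" "x \<in> Y" for S x
    using commutantD(2)[OF T(2) that] commutantD(2)[OF T(1) that(1) D(6)[OF that(2)]] by simp
  ultimately show ?thesis by (simp add: commutant_def)
qed

lemma commutant_sum:
  assumes F: "\<And>S. S \<in> F \<Longrightarrow> bop S" and T: "\<And>i. i \<in> I \<Longrightarrow> T i \<in> commutant F"
  shows "(\<lambda>x. \<Sum>i\<in>I. c i *\<^sub>R T i x) \<in> commutant F"
proof -
  have D: "bop (T i)" if "i \<in> I" for i using commutantD(1)[OF T[OF that]] .
  have "\<forall>i. \<exists>M. i \<in> I \<longrightarrow> (\<forall>x\<in>Y. norm (T i x) \<le> M * norm x)" using D bop_bound by metis
  then obtain M where M: "\<And>i x. i \<in> I \<Longrightarrow> x \<in> Y \<Longrightarrow> norm (T i x) \<le> M i * norm x" by metis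
  have "bop (\<lambda>x. \<Sum>i\<in>I. c i *\<^sub>R T i x)"
  proof (rule bopI)
    fix x y and t :: real assume x: "x \<in> Y"
    show "(\<Sum>i\<in>I. c i *\<^sub>R T i x) \<in> Y" using bopD(1)[OF D x] Y(1) by (intro subspace_sum subspace_scale)
    show "(\<Sum>i\<in>I. c i *\<^sub>R T i (t *\<^sub>R x)) = t *\<^sub>R (\<Sum>i\<in>I. c i *\<^sub>R T i x)"
      unfolding scaleR_sum_right by (rule sum.cong) (simp_all add: bopD(3)[OF D x] mult.commute)
    have "norm (\<Sum>i\<in>I. c i *\<^sub>R T i x) \<le> (\<Sum>i\<in>I. \<bar>c i\<bar> * (M i * norm x))"
      using M x by (intro sum_norm_le) (simp add: mult_left_mono)
    then show "norm (\<Sum>i\<in>I. c i *\<^sub>R T i x) \<le> (\<Sum>i\<in>I. \<bar>c i\<bar> * M i) * norm x" by (simp add: sum_distrib_right mult.assoc)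
    assume y: "y \<in> Y"
    show "(\<Sum>i\<in>I. c i *\<^sub>R T i (x + y)) = (\<Sum>i\<in>I. c i *\<^sub>R T i x) + (\<Sum>i\<in>I. c i *\<^sub>R T i y)"
      unfolding sum.distrib[symmetric] by (rule sum.cong) (simp_all add: bopD(2)[OF D x y] scaleR_add_right)
  qed
  moreover have "(\<Sum>i\<in>I. c i *\<^sub>R T i (S x)) = S (\<Sum>i\<in>I. c i *\<^sub>R T i x)" if S: "S \<in> F" "x \<in> Y" for S x
  proof -
    have "S (\<Sum>i\<in>I. c i *\<^sub>R T i x) = (\<Sum>i\<in>I. c i *\<^sub>R S (T i x))"
      using bopD(1)[OF D S(2)] by (rule bop_sum_arg[OF F[OF S(1)]])
    also have "\<dots> = (\<Sum>i\<in>I. c i *\<^sub>R T i (S x))" using commutantD(2)[OF T S] by (intro sum.cong) auto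
    finally show ?thesis by simp
  qed
  ultimately show ?thesis by (simp add: commutant_def)
qed

lemma commutant_funpow:
  assumes "\<And>S. S \<in> F \<Longrightarrow> bop S" "T \<in> commutant F" shows "(T ^^ i) \<in> commutant F"
proof (induction i)
  case 0
  show ?case using commutant_id[of F] by (simp add: id_def)
next
  case (Suc i)
  show ?case using commutant_comp[OF assms Suc] by (simp add: comp_def)
qed

end

section \<open>Consequences of the absence of hyperinvariant subspaces\<close>

locale no_hyperinvariant_subspace = closed_subspace +
  fixes S :: "'a \<Rightarrow> 'a"
  assumes dim: "infinite_dim Y" and S: "bop S"
    and none: "\<And>Z. subspace Z \<Longrightarrow> closed Z \<Longrightarrow> Z \<noteq> {0} \<Longrightarrow> Z \<subseteq> Y \<Longrightarrow> hyperinvariant_on Y S Z \<Longrightarrow> Z = Y"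
begin

abbreviation "comm \<equiv> commutant {S}"
abbreviation "bicomm \<equiv> commutant comm"

lemma S_bop: "T \<in> {S} \<Longrightarrow> bop T" and comm_bop: "T \<in> comm \<Longrightarrow> bop T"
  using S commutantD(1) by auto

lemma S_bicomm: "S \<in> bicomm"
  using S commutantD(2)[of _ "{S}" S] by (auto simp: commutant_def[of comm])

lemma hyperinvariantI: "(\<And>T z. T \<in> comm \<Longrightarrow> z \<in> Z \<Longrightarrow> T z \<in> Z) \<Longrightarrow> hyperinvariant_on Y S Z"
  unfolding hyperinvariant_on_def commutant_def by auto

text \<open>The kernel of an operator in the bicommutant is closed and hyperinvariant, so if it is
  nonzero it is all of \<open>Y\<close>.\<close>

lemma bicomm_injective:
  assumes R: "R \<in> bicomm" and x: "x \<in> Y" "x \<noteq> 0" "R x = 0" and z: "z \<in> Y" shows "R z = 0"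
proof -
  note D = bopD[OF commutantD(1)[OF R]]
  define Z where "Z = {z\<in>Y. R z = 0}"
  have "Z = Y"
  proof (rule none)
    show "subspace Z" using D Y(1) by (auto simp: Z_def subspace_def)
    show "closed Z" unfolding Z_def using bop_continuous[OF commutantD(1)[OF R]] Y(2) by (rule continuous_closed_preimage_constant)
    show "Z \<noteq> {0}" "Z \<subseteq> Y" using x by (auto simp: Z_def)
    show "hyperinvariant_on Y S Z"
    proof (rule hyperinvariantI)
      fix T z assume T: "T \<in> comm" and z: "z \<in> Z"
      then have "R (T z) = T (R z)" using commutantD(2)[OF R T] by (simp add: Z_def)
      then show "T z \<in> Z" using z bopD(1,4)[OF comm_bop[OF T]] by (simp add: Z_def)
    qed
  qed
  then show ?thesis using z by (auto simp: Z_def)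
qed

text \<open>The closure of the orbit of \<open>y\<close> under the commutant is a hyperinvariant
  subspace, and it contains \<open>y\<close> because the identity commutes with
  \<open>S\<close>.\<close>

lemma orbit_dense:
  assumes y: "y \<in> Y" "y \<noteq> 0" and w: "w \<in> Y" and e: "0 < e"
  shows "\<exists>T\<in>comm. norm (T y - w) < e"
proof -
  define O' where "O' = (\<lambda>T. T y) ` comm"
  have OY: "O' \<subseteq> Y" using bopD(1)[OF comm_bop y(1)] by (auto simp: O'_def)
  have sub: "subspace O'"
  proof (rule subspaceI)
    have "(\<lambda>x. \<Sum>i\<in>({}::nat set). 0 *\<^sub>R x) \<in> comm" by (rule commutant_sum) (use S in auto)
    then show "0 \<in> O'" unfolding O'_def by (force simp: image_iff)
  next
    fix a b assume "a \<in> O'" "b \<in> O'"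
    then obtain T R where TR: "T \<in> comm" "R \<in> comm" "a = T y" "b = R y" by (auto simp: O'_def)
    have "(\<lambda>x. \<Sum>i\<in>{True, False}. 1 *\<^sub>R (if i then T else R) x) \<in> comm" by (rule commutant_sum) (use S TR in auto)
    then have "(\<lambda>x. T x + R x) \<in> comm" by simp
    then show "a + b \<in> O'" unfolding O'_def TR(3,4) by (rule rev_image_eqI) simp
  next
    fix c a assume "a \<in> O'"
    then obtain T where T: "T \<in> comm" "a = T y" by (auto simp: O'_def)
    have "(\<lambda>x. \<Sum>i\<in>{()}. c *\<^sub>R T x) \<in> comm" by (rule commutant_sum) (use S T in auto)
    then have "(\<lambda>x. c *\<^sub>R T x) \<in> comm" by simp
    then show "c *\<^sub>R a \<in> O'" unfolding O'_def T(2) by (rule rev_image_eqI) simp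
  qed
  have cY: "closure O' \<subseteq> Y" using OY Y(2) by (rule closure_minimal)
  have "closure O' = Y"
  proof (rule none)
    show "subspace (closure O')" using sub by (rule subspace_closure)
    have "y \<in> O'" unfolding O'_def using commutant_id by (rule rev_image_eqI) simp
    then show "closure O' \<noteq> {0}" using y(2) closure_subset[of O'] by auto
    show "hyperinvariant_on Y S (closure O')"
    proof (rule hyperinvariantI)
      fix T z assume T: "T \<in> comm" and z: "z \<in> closure O'"
      have "T ` O' \<subseteq> O'"
      proof
        fix v assume "v \<in> T ` O'"
        then obtain R where "R \<in> comm" "v = T (R y)" by (auto simp: O'_def)
        then show "v \<in> O'" unfolding O'_def using commutant_comp[OF S_bop T] by (auto intro!: rev_image_eqI)
      qed
      then have "T ` closure O' \<subseteq> closure O'"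
        using continuous_on_subset[OF bop_continuous[OF comm_bop[OF T]] cY] closure_subset[of O']
        by (intro image_closure_subset) auto
      then show "T z \<in> closure O'" using z by blast
    qed
  qed (simp_all add: cY)
  then have "\<exists>v\<in>O'. dist v w < e" using w e unfolding closure_approachable[symmetric] by (metis closure_approachable)
  then show ?thesis by (auto simp: O'_def dist_norm)
qed

text \<open>Lomonosov's construction: the weights of a partition of unity, frozen at the fixed point, turn a nonlinear map
  into an operator in the commutant.\<close>

lemma commutant_fixed_vector:
  assumes K: "bop K" and comp: "compact_operator K"
    and x1: "x1 \<in> Y" "K x1 \<noteq> 0"
  shows "\<exists>T\<in>comm. \<exists>x\<in>Y. x \<noteq> 0 \<and> T (K x) = x"
proof -
  note D = bopD[OF K]
  obtain M where M: "0 \<le> M" "\<And>x. x \<in> Y \<Longrightarrow> norm (K x) \<le> M * norm x" using bop_bound[OF K] by blast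
  \<comment> \<open>Scaled so that \<open>norm (K x0) = M + 1\<close>. Then \<open>K\<close> maps
    the unit ball around \<open>x0\<close> to vectors of norm at least 1, so the compact set
    \<open>L\<close> below avoids zero and every point of it has a dense orbit.\<close>
  define x0 where "x0 = ((M + 1) / norm (K x1)) *\<^sub>R x1"
  have x0: "x0 \<in> Y" unfolding x0_def using x1(1) Y(1) by (rule subspace_scale[rotated])
  have "norm (K x0) = M + 1" unfolding x0_def D(3)[OF x1(1)] using x1(2) M(1) by simp
  define U where "U = cball x0 1 \<inter> Y"
  have KU: "1 \<le> norm (K x)" if x: "x \<in> U" for x
  proof -
    have xY: "x \<in> Y" and "norm (x0 - x) \<le> 1" using x by (auto simp: U_def dist_norm)
    have "norm (K (x0 - x)) \<le> M * norm (x0 - x)" using xY x0 Y(1) by (intro M(2) subspace_diff)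
    also have "\<dots> \<le> M * 1" using \<open>norm (x0 - x) \<le> 1\<close> M(1) by (rule mult_left_mono)
    finally have "norm (K x0 - K x) \<le> M" using D(5)[OF x0 xY] by simp
    then show ?thesis using norm_triangle_sub[of "K x0" "K x"] \<open>norm (K x0) = M + 1\<close> by linarith
  qed
  define L where "L = closure (K ` U)"
  have LY: "L \<subseteq> Y" unfolding L_def using D(1) Y(2) by (intro closure_minimal) (auto simp: U_def)
  have L1: "1 \<le> norm y" if "y \<in> L" for y
  proof -
    have "closed {y::'a. 1 \<le> norm y}" by (intro closed_Collect_le continuous_intros)
    then have "L \<subseteq> {y. 1 \<le> norm y}" unfolding L_def using KU by (intro closure_minimal) auto
    then show ?thesis using that by blast
  qed
  have Lc: "compact L"
    unfolding L_def
  proof (rule compact_closure_if_Cauchy_subseq)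
    fix u :: "nat \<Rightarrow> 'a" assume "\<forall>k. u k \<in> K ` U"
    then obtain v where v: "\<And>k. v k \<in> U" "\<And>k. u k = K (v k)" unfolding image_iff by metis
    have "norm (v k) \<le> norm x0 + 1" for k
      using v(1)[of k] norm_triangle_sub[of "v k" x0] by (simp add: U_def dist_norm norm_minus_commute)
    then show "\<exists>r. strict_mono r \<and> Cauchy (u \<circ> r)" using compact_operatorD[OF comp, of v "norm x0 + 1"] v by (auto simp: U_def o_def)
  qed
  have "\<forall>y\<in>L. \<exists>T\<in>comm. norm (T y - x0) < 1"
    using orbit_dense[OF _ _ x0, of _ 1] LY L1 by fastforce
  then obtain \<tau> where \<tau>: "\<And>y. y \<in> L \<Longrightarrow> \<tau> y \<in> comm" "\<And>y. y \<in> L \<Longrightarrow> norm (\<tau> y y - x0) < 1" by metis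
  have \<tau>c: "continuous_on L (\<tau> y)" if "y \<in> L" for y
    using bop_continuous[OF comm_bop[OF \<tau>(1)[OF that]]] LY by (rule continuous_on_subset)
  have "\<exists>e>0. \<forall>y'\<in>L. dist y' y < e \<longrightarrow> norm (\<tau> y y' - x0) < 1" if y: "y \<in> L" for y
  proof -
    have "0 < 1 - norm (\<tau> y y - x0)" using \<tau>(2)[OF y] by simp
    then obtain e where e: "0 < e" "\<forall>y'\<in>L. dist y' y < e \<longrightarrow> dist (\<tau> y y') (\<tau> y y) < 1 - norm (\<tau> y y - x0)"
      using \<tau>c[OF y] y unfolding continuous_on_iff by meson
    have "norm (\<tau> y y' - x0) < 1" if "y' \<in> L" "dist y' y < e" for y'
    proof -
      have "norm (\<tau> y y' - \<tau> y y) < 1 - norm (\<tau> y y - x0)" using e(2) that by (simp add: dist_norm)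
      then show ?thesis using norm_triangle_ineq[of "\<tau> y y' - \<tau> y y" "\<tau> y y - x0"] by simp
    qed
    then show ?thesis using e(1) by blast
  qed
  then obtain e where e: "\<And>y. y \<in> L \<Longrightarrow> 0 < e y" "\<And>y y'. y \<in> L \<Longrightarrow> y' \<in> L \<Longrightarrow> dist y' y < e y \<Longrightarrow> norm (\<tau> y y' - x0) < 1" by metis
  obtain A where A: "A \<subseteq> L" "finite A" "L \<subseteq> (\<Union>y\<in>A. ball y (e y))"
  proof (rule compactE_image[OF Lc, of L "\<lambda>y. ball y (e y)"])
    show "L \<subseteq> (\<Union>y\<in>L. ball y (e y))" using e(1) by force
  qed (auto intro: that)
  \<comment> \<open>Positive exactly where \<open>\<tau> i y\<close> lies in the open unit ball
    around \<open>x0\<close>, so every weighted mean lands in \<open>U\<close>.\<close>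
  define w where "w i y = max 0 (1 - norm (\<tau> i y - x0))" for i y
  define W where "W y = (\<Sum>i\<in>A. w i y)" for y
  have w0: "0 \<le> w i y" for i y by (simp add: w_def)
  have W0: "0 < W y" if y: "y \<in> L" for y
  proof -
    obtain i where i: "i \<in> A" "dist y i < e i" using subsetD[OF A(3) y] by (auto simp: dist_commute)
    have "0 < w i y" using e(2)[OF subsetD[OF A(1) i(1)] y i(2)] by (simp add: w_def)
    also have "\<dots> \<le> W y" unfolding W_def using i(1) w0 A(2) by (intro member_le_sum) auto
    finally show ?thesis .
  qed
  define \<Psi> where "\<Psi> y = (\<Sum>i\<in>A. (w i y / W y) *\<^sub>R \<tau> i y)" for y
  have wc: "continuous_on L (w i)" if "i \<in> A" for i
    unfolding w_def using \<tau>c A(1) that by (intro continuous_on_max continuous_on_diff continuous_on_norm continuous_on_const) auto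
  have Wc: "continuous_on L W" unfolding W_def using wc by (intro continuous_on_sum)
  have \<Psi>c: "continuous_on L \<Psi>"
    unfolding \<Psi>_def using wc Wc \<tau>c A(1) W0
    by (intro continuous_on_sum continuous_on_scaleR continuous_on_divide) (auto simp: less_imp_neq[symmetric])
  have \<Psi>U: "\<Psi> y \<in> U" if y: "y \<in> L" for y
  proof -
    have sum1: "(\<Sum>i\<in>A. w i y / W y) = 1" using W0[OF y] by (simp add: W_def flip: sum_divide_distrib)
    have "\<Psi> y - x0 = (\<Sum>i\<in>A. (w i y / W y) *\<^sub>R (\<tau> i y - x0))"
      using sum1 by (simp add: \<Psi>_def scaleR_diff_right sum_subtractf flip: scaleR_left.sum)
    also have "norm \<dots> \<le> (\<Sum>i\<in>A. w i y / W y)"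
    proof (rule sum_norm_le)
      fix i
      have "w i y = 0 \<or> norm (\<tau> i y - x0) \<le> 1" by (auto simp: w_def)
      then have "w i y * norm (\<tau> i y - x0) \<le> w i y" using w0 mult_left_le by fastforce
      then have "w i y * norm (\<tau> i y - x0) / W y \<le> w i y / W y" using W0[OF y] by (intro divide_right_mono) auto
      then show "norm ((w i y / W y) *\<^sub>R (\<tau> i y - x0)) \<le> w i y / W y" using W0[OF y] w0[of i y] by simp
    qed
    finally have "norm (\<Psi> y - x0) \<le> 1" using sum1 by simp
    moreover have "\<Psi> y \<in> Y"
      unfolding \<Psi>_def using A(1) y LY Y(1) bopD(1)[OF comm_bop[OF \<tau>(1)]] by (intro subspace_sum subspace_scale) blast+
    ultimately show ?thesis by (simp add: U_def dist_norm norm_minus_commute)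
  qed
  have "\<exists>x\<in>U. \<Psi> (K x) = x"
  proof (rule schauder_fixpoint)
    show "convex U" unfolding U_def using Y(1) by (intro convex_Int convex_cball subspace_imp_convex)
    have "x0 \<in> U" using x0 by (simp add: U_def)
    then show "U \<noteq> {}" by blast
    show "compact (\<Psi> ` L)" using \<Psi>c Lc by (rule compact_continuous_image)
    show "\<Psi> ` L \<subseteq> U" using \<Psi>U by blast
    have KL: "K ` U \<subseteq> L" unfolding L_def by (rule closure_subset)
    then show "(\<lambda>x. \<Psi> (K x)) ` U \<subseteq> \<Psi> ` L" by blast
    have "continuous_on U K" using bop_continuous[OF K] by (rule continuous_on_subset) (simp add: U_def)
    then show "continuous_on U (\<lambda>x. \<Psi> (K x))" using KL by (intro continuous_on_compose2[OF \<Psi>c])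
  qed
  then obtain x where x: "x \<in> U" "\<Psi> (K x) = x" by blast
  have "(\<lambda>z. \<Sum>i\<in>A. (w i (K x) / W (K x)) *\<^sub>R \<tau> i z) \<in> comm"
    using \<tau>(1) A(1) by (intro commutant_sum[OF S_bop]) auto
  moreover have "x \<noteq> 0" "x \<in> Y" using KU[OF x(1)] D(4) x(1) by (auto simp: U_def)
  moreover have "(\<Sum>i\<in>A. (w i (K x) / W (K x)) *\<^sub>R \<tau> i (K x)) = x" using x(2) by (simp only: \<Psi>_def)
  ultimately show ?thesis by (intro bexI[of _ "\<lambda>z. \<Sum>i\<in>A. (w i (K x) / W (K x)) *\<^sub>R \<tau> i z"] bexI[of _ x] conjI)
qed

text \<open>Let \<open>N\<close> be the fixed space of the operator \<open>T\<close> after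
  \<open>K\<close>. Compactness makes it finite dimensional, and \<open>K\<close> is injective on it
  because \<open>T\<close> undoes \<open>K\<close> there. A linear relation between the vectors
  obtained from \<open>x\<close> by powers of \<open>K\<close> can therefore be divided by its
  lowest power, which leaves a polynomial in \<open>K\<close> with nonzero constant term that
  annihilates \<open>x\<close>.\<close>

theorem lomonosov:
  assumes K: "K \<in> bicomm" and comp: "compact_operator K"
    and x1: "x1 \<in> Y" "K x1 \<noteq> 0"
  shows False
proof -
  have Kb: "bop K" using commutantD(1)[OF K] .
  note D = bopD[OF Kb]
  obtain T x where T: "T \<in> comm" and x: "x \<in> Y" "x \<noteq> 0" "T (K x) = x"
    using commutant_fixed_vector[OF Kb comp x1] by blast
  have Tb: "bop T" using comm_bop[OF T] .
  define N where "N = {z\<in>Y. T (K z) = z}"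
  have NY: "N \<subseteq> Y" and xN: "x \<in> N" using x by (auto simp: N_def)
  have N: "subspace N"
    using Y(1) D(1-4) bopD(1-4)[OF Tb] by (auto simp: N_def subspace_def)
  have KN: "(K ^^ i) z \<in> N" if z: "z \<in> N" for i z
  proof (induction i)
    case (Suc i)
    then have "(K ^^ i) z \<in> Y" "T (K ((K ^^ i) z)) = (K ^^ i) z" by (auto simp: N_def)
    then have "T (K (K ((K ^^ i) z))) = K ((K ^^ i) z)" using commutantD(2)[OF K T, of "K ((K ^^ i) z)"] D(1) by simp
    then show ?case using \<open>(K ^^ i) z \<in> Y\<close> D(1) by (simp add: N_def)
  qed (simp add: z)
  have K_inj: "z = 0" if z: "z \<in> N" "(K ^^ j) z = 0" for j z
    using z(2)
  proof (induction j)
    case (Suc j)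
    have "(K ^^ j) z = T (K ((K ^^ j) z))" using KN[OF z(1), of j] by (simp add: N_def)
    also have "\<dots> = 0" using Suc.prems bopD(4)[OF Tb] by simp
    finally show ?case by (rule Suc.IH)
  qed simp
  have "\<not> infinite_dim N"
  proof (rule finite_dim_if_Cauchy_subseq[OF N])
    fix u :: "nat \<Rightarrow> 'a" assume u: "\<forall>k. u k \<in> N \<and> norm (u k) \<le> 1"
    then obtain r where r: "strict_mono (r :: nat \<Rightarrow> nat)" "Cauchy (\<lambda>k. K (u (r k)))" using compact_operatorD[OF comp, of u 1] NY by blast
    have "Cauchy (\<lambda>k. T (K (u (r k))))" using u NY D(1) by (intro bop_Cauchy[OF Tb _ r(2)]) blast
    moreover have "(\<lambda>k. T (K (u (r k)))) = u \<circ> r" using u by (auto simp: N_def)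
    ultimately show "\<exists>r. strict_mono r \<and> Cauchy (u \<circ> r)" using r(1) by auto
  qed
  moreover have "span (range (\<lambda>i. (K ^^ i) x)) \<subseteq> N" using KN[OF xN] N by (intro span_minimal) auto
  ultimately have "\<not> infinite_dim (span (range (\<lambda>i. (K ^^ i) x)))" unfolding infinite_dim_def by (meson order_trans)
  then obtain m d where md: "(\<Sum>i<m. d i *\<^sub>R (K ^^ i) x) = 0" "\<exists>i<m. d i \<noteq> 0"
    using infinite_dim_span[of "\<lambda>i. (K ^^ i) x"] by blast
  \<comment> \<open>The lowest power in the relation. Injectivity of \<open>K\<close> on
    \<open>N\<close> removes it, so that \<open>R\<close> has the constant coefficient
    \<open>d j\<close>, which is nonzero.\<close>
  define j where "j = (LEAST i. d i \<noteq> 0)"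
  have j: "d j \<noteq> 0" "j < m" "\<And>i. i < j \<Longrightarrow> d i = 0"
  proof -
    obtain i where i: "i < m" "d i \<noteq> 0" using md(2) by blast
    show "d j \<noteq> 0" unfolding j_def using i(2) by (rule LeastI)
    show "j < m" using Least_le[of "\<lambda>i. d i \<noteq> 0", OF i(2)] i(1) by (simp add: j_def)
    show "\<And>i. i < j \<Longrightarrow> d i = 0" unfolding j_def using not_less_Least by blast
  qed
  define R where "R z = (\<Sum>i<m - j. d (i + j) *\<^sub>R (K ^^ i) z)" for z
  have Kpow: "(K ^^ i) \<in> bicomm" for i by (rule commutant_funpow[OF comm_bop K])
  have Rb: "R \<in> bicomm" unfolding R_def[abs_def] using Kpow by (intro commutant_sum[OF comm_bop]) auto
  have "R x = 0"
  proof (rule K_inj)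
    show "R x \<in> N" unfolding R_def using KN[OF xN] N by (intro subspace_sum subspace_scale)
    have "(K ^^ j) (R x) = (\<Sum>i<m - j. d (i + j) *\<^sub>R (K ^^ j) ((K ^^ i) x))"
      unfolding R_def using KN[OF xN] NY by (intro bop_sum_arg[OF commutantD(1)[OF Kpow]]) blast
    also have "\<dots> = (\<Sum>i\<in>{0..<m - j}. d (i + j) *\<^sub>R (K ^^ (i + j)) x)"
    proof -
      have "(K ^^ j) ((K ^^ i) x) = (K ^^ (i + j)) x" for i by (simp only: add.commute[of i] funpow_add comp_apply)
      then show ?thesis by (simp add: lessThan_atLeast0)
    qed
    also have "\<dots> = (\<Sum>i\<in>{0 + j..<m - j + j}. d i *\<^sub>R (K ^^ i) x)"
      by (rule sum.shift_bounds_nat_ivl[symmetric])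
    also have "\<dots> = (\<Sum>i<m. d i *\<^sub>R (K ^^ i) x)"
      using j(2,3) by (intro sum.mono_neutral_left) auto
    finally show "(K ^^ j) (R x) = 0" using md(1) by simp
  qed
  then have R0: "R z = 0" if "z \<in> Y" for z using bicomm_injective[OF Rb x(1,2)] that by blast
  obtain m' where m': "m - j = Suc m'" using j(2) by (metis Suc_diff_Suc)
  \<comment> \<open>Solving R = 0 for its constant term exhibits a right inverse of \<open>K\<close>
    as a polynomial in \<open>K\<close>.\<close>
  define Q where "Q z = (\<Sum>i<m'. (- d (Suc i + j) / d j) *\<^sub>R (K ^^ i) z)" for z
  have "Q \<in> bicomm" unfolding Q_def[abs_def] using Kpow by (intro commutant_sum[OF comm_bop]) auto
  then have Qb: "bop Q" by (rule commutantD(1))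
  have KQ: "K (Q z) = z" if z: "z \<in> Y" for z
  proof -
    have "K (Q z) = (\<Sum>i<m'. (- d (Suc i + j) / d j) *\<^sub>R K ((K ^^ i) z))"
      unfolding Q_def using bounded_operator_on_funpow[OF Kb z] by (rule bop_sum_arg[OF Kb])
    also have "\<dots> = (- 1 / d j) *\<^sub>R (\<Sum>i<m'. d (Suc i + j) *\<^sub>R K ((K ^^ i) z))"
      by (simp add: scaleR_sum_right)
    also have "(\<Sum>i<m'. d (Suc i + j) *\<^sub>R K ((K ^^ i) z)) = R z - d j *\<^sub>R z"
      unfolding R_def m' by (simp add: sum.lessThan_Suc_shift del: sum.lessThan_Suc)
    also have "(- 1 / d j) *\<^sub>R (R z - d j *\<^sub>R z) = z" using R0[OF z] j(1) by simp
    finally show ?thesis .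
  qed
  obtain M where M: "0 \<le> M" "\<And>z. z \<in> Y \<Longrightarrow> norm (Q z) \<le> M * norm z" using bop_bound[OF Qb] by blast
  \<comment> \<open>On \<open>Y\<close> the identity is \<open>K\<close> after the bounded operator
    \<open>Q\<close>, hence compact.\<close>
  have "\<not> infinite_dim Y"
  proof (rule finite_dim_if_Cauchy_subseq[OF Y(1)])
    fix u :: "nat \<Rightarrow> 'a" assume u: "\<forall>k. u k \<in> Y \<and> norm (u k) \<le> 1"
    have "norm (Q (u k)) \<le> M" for k
      using M(2)[of "u k"] u mult_left_mono[of "norm (u k)" 1 M] M(1) by force
    then obtain r where "strict_mono (r :: nat \<Rightarrow> nat)" "Cauchy (\<lambda>k. K (Q (u (r k))))"
      using compact_operatorD[OF comp, of "\<lambda>k. Q (u k)" M] u bopD(1)[OF Qb] by blast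
    then show "\<exists>r. strict_mono r \<and> Cauchy (u \<circ> r)" using KQ u by (auto simp: o_def)
  qed
  then show False using dim by blast
qed

end

theorem corollary5p6:
  fixes n :: nat
    and J :: "(nat \<Rightarrow>\<^sub>0 real) \<Rightarrow> 'a::banach"
    and X Y :: "'a set"
    and S :: "'a \<Rightarrow> 'a"
  assumes "n \<ge> 1"
    and "is_X01 n J X"
    and "subspace Y" and "closed Y" and "Y \<subseteq> X" and "infinite_dim Y"
    and "strictly_singular_on Y S"
    and "\<exists>x\<in>Y. S x \<noteq> 0"
  shows "\<exists>Z. subspace Z \<and> closed Z \<and> Z \<noteq> {0} \<and> Z \<subset> Y \<and> hyperinvariant_on Y S Z"
proof (rule ccontr)
  assume none: "\<not> ?thesis"
  have S: "bounded_operator_on Y S" using assms(7) by (simp add: strictly_singular_on_def)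
  interpret no_hyperinvariant_subspace Y S
    by unfold_locales (use assms none S in blast)+
  interpret X01: strictly_singular_on_X01 n J Y S
    by (intro strictly_singular_on_X01.intro operator_on_X01.intro strictly_singular_on_X01_axioms.intro)
      (use assms S in \<open>auto simp: is_X01_def\<close>)
  define K where "K = S ^^ Suc n"
  have K: "K \<in> bicomm" unfolding K_def by (rule commutant_funpow[OF comm_bop S_bicomm])
  have "\<exists>x\<in>Y. K x \<noteq> 0"
  proof (rule ccontr)
    assume "\<not> (\<exists>x\<in>Y. K x \<noteq> 0)"
    then have K0: "(S ^^ Suc n) x = 0" if "x \<in> Y" for x using that by (simp add: K_def)
    \<comment> \<open>A nonzero kernel vector of \<open>S\<close> would force \<open>S\<close> to
      vanish on \<open>Y\<close>, against the hypothesis. So \<open>S\<close> is injective on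
      \<open>Y\<close>, and no power of it kills a nonzero vector.\<close>
    have "x = 0" if x: "x \<in> Y" "(S ^^ m) x = 0" for x m
      using x(2)
    proof (induction m)
      case (Suc m)
      have "(S ^^ m) x = 0"
        using bicomm_injective[OF S_bicomm, of "(S ^^ m) x"] Suc.prems X01.funpow_in[OF x(1)] assms(8) by auto
      then show ?case by (rule Suc.IH)
    qed simp
    then show False using K0 assms(8) S_bicomm X01.S_in by (metis bopD(4) S)
  qed
  then obtain x1 where "x1 \<in> Y" "K x1 \<noteq> 0" by blast
  moreover have "compact_operator K"
    unfolding compact_operator_def K_def using X01.power_compact by blast
  ultimately show False using lomonosov[OF K] by blast
qed

end
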